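(* Let $(M^8,\Phi)$ be a manifold with a torsion-free $\mathrm{Spin}(7)$-structure. For each degree $k$ and irreducible types $p,q$ write $D^{k}_{p,q}:=\pi_q\circ d|_{\Omega^k_p}:\Omega^k_p\to\Omega^{k+1}_q$. Then the following second-order identities hold. On $\Omega^0$: $D^1_{8,7}D^0_{1,8}=0$ and $D^1_{8,21}D^0_{1,8}=0$. On $\Omega^1_8$: $D^2_{7,8}D^1_{8,7}+D^2_{21,8}D^1_{8,21}=0$ and $D^2_{7,48}D^1_{8,7}+D^2_{21,48}D^1_{8,21}=0$. On $\Omega^2_7$: $D^3_{8,1}D^2_{7,8}=0$; $D^3_{8,7}D^2_{7,8}+D^3_{48,7}D^2_{7,48}=0$; $D^3_{48,27}D^2_{7,48}=0$; $D^3_{8,35}D^2_{7,8}+D^3_{48,35}D^2_{7,48}=0$. On $\Omega^2_{21}$: $D^3_{8,1}D^2_{21,8}=0$; $D^3_{8,7}D^2_{21,8}+D^3_{48,7}D^2_{21,48}=0$; $D^3_{48,27}D^2_{21,48}=0$; $D^3_{8,35}D^2_{21,8}+D^3_{48,35}D^2_{21,48}=0$. On $\Omega^3_8$: $D^4_{1,8}D^3_{8,1}+D^4_{7,8}D^3_{8,7}+D^4_{35,8}D^3_{8,35}=0$ and $D^4_{7,48}D^3_{8,7}+D^4_{35,48}D^3_{8,35}=0$. On $\Omega^3_{48}$: $D^4_{7,8}D^3_{48,7}+D^4_{35,8}D^3_{48,35}=0$ and $D^4_{7,48}D^3_{48,7}+D^4_{27,48}D^3_{48,27}+D^4_{35,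48}D^3_{48,35}=0$.
   Context: A $\mathrm{Spin}(7)$-structure on a smooth 8-manifold $M$ is a smooth 4-form $\Phi$ that is admissible: at each $x\in M$ there is a linear isomorphism $T_xM\cong\mathbb R^8$ taking $\Phi_x$ to the standard Cayley form $\Phi_0=e^{1234}+e^{1256}+e^{1278}+e^{1357}-e^{1368}-e^{1458}-e^{1467}-e^{2358}-e^{2367}-e^{2457}+e^{2468}+e^{3456}+e^{3478}+e^{5678}$. It induces a Riemannian metric $g$ and an orientation, hence a Hodge star $*$ with $*\Phi=\Phi$. It is torsion-free if $\nabla\Phi=0$ for the Levi-Civita connection $\nabla$ of $g$, equivalently $d\Phi=0$. Forms decompose pointwise orthogonally into irreducible $\mathrm{Spin}(7)$-types (the subscript is the pointwise dimension): $\Omega^0=\Omega^0_1$, $\Omega^1=\Omega^1_8$, $\Omega^2=\Omega^2_7\oplus\Omega^2_{21}$, $\Omega^3=\Omega^3_8\oplus\Omega^3_{48}$, $\Omega^4=\Omega^4_1\oplus\Omega^4_7\oplus\Omega^4_{27}\oplus\Omega^4_{35}$, $\Omega^5=\Omega^5_8\oplus\Omega^5_{48}$, where $\Omega^2_7=\{\beta:*(\Phi\wedge\beta)=3\beta\}$, $\Omega^2_{21}=\{\beta:*(\Phi\wedge\beta)=-\beta\}$, $\Omega^3_8=\{X\lrcorner\Phi: X\in\Gamma(TM)\}$, $\Omega^3_{48}=\{\gamma:\gamma\wedge\Phi=0\}$, $\Omega^4_1=\{h\Phi\}$, $\Omega^4_7=\{\beta\diamond\Phi:\beta\in\Omega^2_7\}$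 with $(\beta\diamond\Phi)_{ijkl}=\beta_i{}^p\Phi_{pjkl}+\beta_j{}^p\Phi_{ipkl}+\beta_k{}^p\Phi_{ijpl}+\beta_l{}^p\Phi_{ijkp}$, $\Omega^4_{35}$ the anti-self-dual 4-forms, $\Omega^4_{27}$ the orthogonal complement of $\Omega^4_1\oplus\Omega^4_7$ in the self-dual 4-forms, and $\Omega^5_j=*\Omega^3_j$. $\pi_q$ denotes the orthogonal projection onto the type-$q$ summand in the relevant degree. *)

theory Defs
  imports "HOL-Analysis.Analysis" "HOL-Combinatorics.Permutations" "HOL-Library.Function_Algebras"
begin

section \<open>Linear algebra of forms on \<open>\<real>\<^sup>8\<close>\<close>

text \<open>
  A form is a function on lists of vectors. A \<open>k\<close>-form vanishes on lists of length other than \<open>k\<close>,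
  so that equality of \<open>k\<close>-forms is equality of functions. The linear structure on forms is the
  pointwise one from \<^theory>\<open>HOL-Library.Function_Algebras\<close>. In the index type \<open>8\<close> the numeral
  \<open>8\<close> denotes the same element as \<open>0\<close>, so \<open>1, \<dots>, 8\<close> enumerate the type.
\<close>

type_synonym vec8 = "real^8"
type_synonym form8 = "vec8 list \<Rightarrow> real"
type_synonym bilin8 = "vec8 \<Rightarrow> vec8 \<Rightarrow> real"

definition alt_forms :: "nat \<Rightarrow> form8 set" where
  "alt_forms k = {\<alpha>.
     (\<forall>vs. length vs \<noteq> k \<longrightarrow> \<alpha> vs = 0) \<and>
     (\<forall>vs i. length vs = k \<and> i < k \<longrightarrow> linear (\<lambda>v. \<alpha> (vs[i := v]))) \<and>
     (\<forall>vs i j. length vs = k \<and> i < j \<and> j < k \<and> vs ! i = vs ! j \<longrightarrow> \<alpha> vs = 0)}"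

definition pullback :: "(vec8 \<Rightarrow> vec8) \<Rightarrow> form8 \<Rightarrow> form8" where
  "pullback A \<alpha> = (\<lambda>vs. \<alpha> (map A vs))"

definition interior_product :: "vec8 \<Rightarrow> form8 \<Rightarrow> form8" where
  "interior_product X \<alpha> = (\<lambda>vs. \<alpha> (X # vs))"

definition wedge :: "nat \<Rightarrow> nat \<Rightarrow> form8 \<Rightarrow> form8 \<Rightarrow> form8" where
  "wedge k l \<alpha> \<beta> = (\<lambda>vs. if length vs = k + l
     then (\<Sum>\<sigma> | \<sigma> permutes {..<k + l}. of_int (sign \<sigma>)
             * \<alpha> (map (\<lambda>i. vs ! \<sigma> i) [0..<k]) * \<beta> (map (\<lambda>i. vs ! \<sigma> i) [k..<k + l]))
          / (fact k * fact l)
     else 0)"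

text \<open>The monomial \<open>e\<^sup>I = e\<^bsup>i\<^sub>1\<^esup> \<and> \<dots> \<and> e\<^bsup>i\<^sub>k\<^esup>\<close>, as the determinant of the entries \<open>e\<^bsup>i\<^sub>a\<^esup>(v\<^sub>b)\<close>.\<close>

definition ecov :: "8 list \<Rightarrow> form8" where
  "ecov I = (\<lambda>vs. if length vs = length I
     then (\<Sum>\<sigma> | \<sigma> permutes {..<length I}. of_int (sign \<sigma>) * (\<Prod>a<length I. (vs ! \<sigma> a) $ (I ! a)))
     else 0)"

definition cayley_form :: form8 where
  "cayley_form =
     ecov [1,2,3,4] + ecov [1,2,5,6] + ecov [1,2,7,8] + ecov [1,3,5,7] - ecov [1,3,6,8]
     - ecov [1,4,5,8] - ecov [1,4,6,7] - ecov [2,3,5,8] - ecov [2,3,6,7] - ecov [2,4,5,7]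
     + ecov [2,4,6,8] + ecov [3,4,5,6] + ecov [3,4,7,8] + ecov [5,6,7,8]"

subsection \<open>Metric contractions\<close>

definition inverse_metric :: "bilin8 \<Rightarrow> 8 \<Rightarrow> 8 \<Rightarrow> real" where
  "inverse_metric g i j = matrix_inv (\<chi> a b. g (axis a 1) (axis b 1)) $ i $ j"

definition form_inner :: "bilin8 \<Rightarrow> nat \<Rightarrow> form8 \<Rightarrow> form8 \<Rightarrow> real" where
  "form_inner g k \<alpha> \<beta> =
     (\<Sum>I | length I = k. \<Sum>J | length J = k.
        (\<Prod>a<k. inverse_metric g (I ! a) (J ! a))
        * \<alpha> (map (\<lambda>i. axis i 1) I) * \<beta> (map (\<lambda>j. axis j 1) J)) / fact k"

text \<open>The Hodge star of a \<open>k\<close>-form, normalised by \<open>\<alpha> \<and> *\<beta> = \<langle>\<alpha>, \<beta>\<rangle> vol\<close>.\<close>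

definition hodge :: "bilin8 \<Rightarrow> form8 \<Rightarrow> nat \<Rightarrow> form8 \<Rightarrow> form8" where
  "hodge g vol k \<beta> = (\<lambda>vs.
     (\<Sum>I | length I = k. \<Sum>J | length J = k.
        (\<Prod>a<k. inverse_metric g (I ! a) (J ! a))
        * \<beta> (map (\<lambda>i. axis i 1) I) * vol (map (\<lambda>j. axis j 1) J @ vs)) / fact k)"

text \<open>The endomorphism \<open>\<beta>\<^sub>i\<^sup>p\<close> obtained from a 2-form by raising its second index.\<close>

definition raise_second :: "bilin8 \<Rightarrow> form8 \<Rightarrow> vec8 \<Rightarrow> vec8" where
  "raise_second g \<beta> v = (\<chi> p. \<Sum>q\<in>UNIV. \<beta> [v, axis q 1] * inverse_metric g q p)"

definition diamond :: "bilin8 \<Rightarrow> form8 \<Rightarrow> form8 \<Rightarrow> form8" where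
  "diamond g \<beta> \<omega> = (\<lambda>vs. \<Sum>j<length vs. \<omega> (vs[j := raise_second g \<beta> (vs ! j)]))"

definition orth_proj :: "bilin8 \<Rightarrow> nat \<Rightarrow> form8 set \<Rightarrow> form8 \<Rightarrow> form8" where
  "orth_proj g k W \<alpha> = (THE \<beta>. \<beta> \<in> W \<and> (\<forall>\<gamma>\<in>W. form_inner g k (\<alpha> - \<beta>) \<gamma> = 0))"

subsection \<open>Admissible 4-forms and the type decomposition of a fibre\<close>

definition spin7_frame :: "form8 \<Rightarrow> (vec8 \<Rightarrow> vec8) \<Rightarrow> bool" where
  "spin7_frame \<omega> A \<longleftrightarrow> linear A \<and> bij A \<and> pullback A cayley_form = \<omega>"

definition admissible :: "form8 \<Rightarrow> bool" where
  "admissible \<omega> \<longleftrightarrow> (\<exists>A. spin7_frame \<omega> A)"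

text \<open>
  The metric and the volume form (hence orientation) are transported from \<open>\<real>\<^sup>8\<close> along a frame. The
  choice of frame is immaterial, the stabiliser \<open>Spin(7)\<close> of the Cayley form being contained in
  \<open>SO(8)\<close>.
\<close>

definition induced_metric :: "form8 \<Rightarrow> bilin8" where
  "induced_metric \<omega> = (let A = (SOME A. spin7_frame \<omega> A) in (\<lambda>u v. A u \<bullet> A v))"

definition induced_vol :: "form8 \<Rightarrow> form8" where
  "induced_vol \<omega> = (let A = (SOME A. spin7_frame \<omega> A) in pullback A (ecov [1,2,3,4,5,6,7,8]))"

abbreviation spin7_star :: "form8 \<Rightarrow> nat \<Rightarrow> form8 \<Rightarrow> form8" where
  "spin7_star \<omega> \<equiv> hodge (induced_metric \<omega>) (induced_vol \<omega>)"

abbreviation spin7_inner :: "form8 \<Rightarrow> nat \<Rightarrow> form8 \<Rightarrow> form8 \<Rightarrow> real" where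
  "spin7_inner \<omega> \<equiv> form_inner (induced_metric \<omega>)"

definition L2_7 :: "form8 \<Rightarrow> form8 set" where
  "L2_7 \<omega> = {\<beta> \<in> alt_forms 2. spin7_star \<omega> 6 (wedge 4 2 \<omega> \<beta>) = (\<lambda>vs. 3 * \<beta> vs)}"

definition L2_21 :: "form8 \<Rightarrow> form8 set" where
  "L2_21 \<omega> = {\<beta> \<in> alt_forms 2. spin7_star \<omega> 6 (wedge 4 2 \<omega> \<beta>) = - \<beta>}"

definition L3_8 :: "form8 \<Rightarrow> form8 set" where
  "L3_8 \<omega> = range (\<lambda>X. interior_product X \<omega>)"

definition L3_48 :: "form8 \<Rightarrow> form8 set" where
  "L3_48 \<omega> = {\<gamma> \<in> alt_forms 3. wedge 3 4 \<gamma> \<omega> = 0}"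

definition L4_1 :: "form8 \<Rightarrow> form8 set" where
  "L4_1 \<omega> = range (\<lambda>h::real. \<lambda>vs. h * \<omega> vs)"

definition L4_7 :: "form8 \<Rightarrow> form8 set" where
  "L4_7 \<omega> = (\<lambda>\<beta>. diamond (induced_metric \<omega>) \<beta> \<omega>) ` L2_7 \<omega>"

definition L4_27 :: "form8 \<Rightarrow> form8 set" where
  "L4_27 \<omega> = {\<eta> \<in> alt_forms 4. spin7_star \<omega> 4 \<eta> = \<eta> \<and>
     (\<forall>\<zeta>\<in>L4_1 \<omega>. \<forall>\<xi>\<in>L4_7 \<omega>. spin7_inner \<omega> 4 \<eta> (\<zeta> + \<xi>) = 0)}"

definition L4_35 :: "form8 \<Rightarrow> form8 set" where
  "L4_35 \<omega> = {\<eta> \<in> alt_forms 4. spin7_star \<omega> 4 \<eta> = - \<eta>}"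

definition type_space :: "form8 \<Rightarrow> nat \<Rightarrow> nat \<Rightarrow> form8 set" where
  "type_space \<omega> k q =
     (if (k, q) = (0, 1) then alt_forms 0
      else if (k, q) = (1, 8) then alt_forms 1
      else if (k, q) = (2, 7) then L2_7 \<omega>
      else if (k, q) = (2, 21) then L2_21 \<omega>
      else if (k, q) = (3, 8) then L3_8 \<omega>
      else if (k, q) = (3, 48) then L3_48 \<omega>
      else if (k, q) = (4, 1) then L4_1 \<omega>
      else if (k, q) = (4, 7) then L4_7 \<omega>
      else if (k, q) = (4, 27) then L4_27 \<omega>
      else if (k, q) = (4, 35) then L4_35 \<omega>
      else if (k, q) = (5, 8) then spin7_star \<omega> 3 ` L3_8 \<omega>
      else if (k, q) = (5, 48) then spin7_star \<omega> 3 ` L3_48 \<omega>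
      else {0})"


section \<open>Smooth 8-manifolds\<close>

primrec Ck_on :: "nat \<Rightarrow> vec8 set \<Rightarrow> (vec8 \<Rightarrow> 'b::real_normed_vector) \<Rightarrow> bool" where
  "Ck_on 0 S f \<longleftrightarrow> continuous_on S f"
| "Ck_on (Suc k) S f \<longleftrightarrow> (\<forall>x\<in>S. f differentiable (at x)) \<and>
     (\<forall>v. Ck_on k S (\<lambda>x. frechet_derivative f (at x) v))"

text \<open>Only used for open \<open>S\<close>.\<close>

definition smooth_on :: "vec8 set \<Rightarrow> (vec8 \<Rightarrow> 'b::real_normed_vector) \<Rightarrow> bool" where
  "smooth_on S f \<longleftrightarrow> (\<forall>k. Ck_on k S f)"

type_synonym 'a chart = "'a set \<times> ('a \<Rightarrow> vec8)"

definition chart_image :: "'a chart \<Rightarrow> vec8 set" where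
  "chart_image c = snd c ` fst c"

definition transition :: "'a chart \<Rightarrow> 'a chart \<Rightarrow> vec8 \<Rightarrow> vec8" where
  "transition c c' = snd c' \<circ> inv_into (fst c) (snd c)"

definition smooth_manifold8 :: "'a topology \<Rightarrow> 'a chart set \<Rightarrow> bool" where
  "smooth_manifold8 M \<A> \<longleftrightarrow>
     Hausdorff_space M \<and> second_countable M \<and>
     (\<Union>c\<in>\<A>. fst c) = topspace M \<and>
     (\<forall>c\<in>\<A>. openin M (fst c) \<and> open (chart_image c) \<and>
        homeomorphic_map (subtopology M (fst c)) (top_of_set (chart_image c)) (snd c)) \<and>
     (\<forall>c\<in>\<A>. \<forall>c'\<in>\<A>. smooth_on (snd c ` (fst c \<inter> fst c')) (transition c c'))"

subsection \<open>Differential forms\<close>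

text \<open>
  A field of forms is the family of its local expressions: \<open>\<alpha> c y\<close> is the value at the point with
  coordinates \<open>y\<close> in the chart \<open>c\<close>, the tangent space being identified with \<open>\<real>\<^sup>8\<close> by the coordinate
  frame. Expressions are extended by \<open>0\<close> off the coordinate domains, so that equality of fields is
  equality of functions.
\<close>

type_synonym 'a form_field = "'a chart \<Rightarrow> vec8 \<Rightarrow> form8"

definition on_charts :: "'a chart set \<Rightarrow> 'a form_field \<Rightarrow> 'a form_field" where
  "on_charts \<A> F = (\<lambda>c y. if c \<in> \<A> \<and> y \<in> chart_image c then F c y else 0)"

definition smooth_forms :: "'a chart set \<Rightarrow> nat \<Rightarrow> 'a form_field set" where
  "smooth_forms \<A> k = {\<alpha>.
     on_charts \<A> \<alpha> = \<alpha> \<and>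
     (\<forall>c\<in>\<A>. \<forall>y\<in>chart_image c. \<alpha> c y \<in> alt_forms k) \<and>
     (\<forall>c\<in>\<A>. \<forall>vs. smooth_on (chart_image c) (\<lambda>y. \<alpha> c y vs)) \<and>
     (\<forall>c\<in>\<A>. \<forall>c'\<in>\<A>. \<forall>p\<in>fst c \<inter> fst c'.
        \<alpha> c (snd c p) =
          pullback (frechet_derivative (transition c c') (at (snd c p))) (\<alpha> c' (snd c' p)))}"

text \<open>
  \<open>d\<alpha>(v\<^sub>0, \<dots>, v\<^sub>k) = \<Sum>\<^sub>i (-1)\<^sup>i \<partial>\<^bsub>v\<^sub>i\<^esub> (\<alpha>(v\<^sub>0, \<dots>, v\<^sub>k without v\<^sub>i))\<close> for constant coordinate fields \<open>v\<^sub>i\<close>,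
  whose Lie brackets vanish.
\<close>

definition ext_deriv :: "'a chart set \<Rightarrow> 'a form_field \<Rightarrow> 'a form_field" where
  "ext_deriv \<A> \<alpha> = on_charts \<A> (\<lambda>c y vs. \<Sum>i<length vs.
     (-1) ^ i * frechet_derivative (\<lambda>z. \<alpha> c z (take i vs @ drop (Suc i) vs)) (at y) (vs ! i))"

subsection \<open>Levi-Civita connection\<close>

text \<open>The coordinate expression \<open>\<Gamma>(u, v)\<close> of \<open>\<nabla>\<^sub>u v\<close> for constant coordinate fields \<open>u\<close>, \<open>v\<close>.\<close>

definition christoffel :: "(vec8 \<Rightarrow> bilin8) \<Rightarrow> vec8 \<Rightarrow> vec8 \<Rightarrow> vec8 \<Rightarrow> vec8" where
  "christoffel g y u v = (\<chi> m. (\<Sum>l\<in>UNIV. inverse_metric (g y) m l *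
     (frechet_derivative (\<lambda>z. g z v (axis l 1)) (at y) u
      + frechet_derivative (\<lambda>z. g z u (axis l 1)) (at y) v
      - frechet_derivative (\<lambda>z. g z u v) (at y) (axis l 1))) / 2)"

definition cov_deriv :: "(vec8 \<Rightarrow> bilin8) \<Rightarrow> (vec8 \<Rightarrow> form8) \<Rightarrow> vec8 \<Rightarrow> vec8 \<Rightarrow> form8" where
  "cov_deriv g \<alpha> y u = (\<lambda>vs. frechet_derivative (\<lambda>z. \<alpha> z vs) (at y) u
     - (\<Sum>j<length vs. \<alpha> y (vs[j := christoffel g y u (vs ! j)])))"


section \<open>\<open>Spin(7)\<close>-structures\<close>

definition spin7_structure :: "'a chart set \<Rightarrow> 'a form_field \<Rightarrow> bool" where
  "spin7_structure \<A> \<Phi> \<longleftrightarrow>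
     \<Phi> \<in> smooth_forms \<A> 4 \<and> (\<forall>c\<in>\<A>. \<forall>y\<in>chart_image c. admissible (\<Phi> c y))"

definition torsion_free :: "'a chart set \<Rightarrow> 'a form_field \<Rightarrow> bool" where
  "torsion_free \<A> \<Phi> \<longleftrightarrow> (\<forall>c\<in>\<A>. \<forall>y\<in>chart_image c. \<forall>u.
     cov_deriv (\<lambda>z. induced_metric (\<Phi> c z)) (\<Phi> c) y u = 0)"

definition Omega :: "'a chart set \<Rightarrow> 'a form_field \<Rightarrow> nat \<Rightarrow> nat \<Rightarrow> 'a form_field set" where
  "Omega \<A> \<Phi> k p = {\<alpha> \<in> smooth_forms \<A> k.
     \<forall>c\<in>\<A>. \<forall>y\<in>chart_image c. \<alpha> c y \<in> type_space (\<Phi> c y) k p}"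

definition type_proj ::
  "'a chart set \<Rightarrow> 'a form_field \<Rightarrow> nat \<Rightarrow> nat \<Rightarrow> 'a form_field \<Rightarrow> 'a form_field" where
  "type_proj \<A> \<Phi> k q \<alpha> = on_charts \<A> (\<lambda>c y.
     orth_proj (induced_metric (\<Phi> c y)) k (type_space (\<Phi> c y) k q) (\<alpha> c y))"

text \<open>
  The operator \<open>D\<^sup>k\<^sub>p\<^sub>,\<^sub>q\<close> is \<open>D \<A> \<Phi> k q\<close> applied to elements of \<open>Omega \<A> \<Phi> k p\<close>: functions being
  total, the source type \<open>p\<close> is that of the argument.
\<close>

definition D :: "'a chart set \<Rightarrow> 'a form_field \<Rightarrow> nat \<Rightarrow> nat \<Rightarrow> 'a form_field \<Rightarrow> 'a form_field" where
  "D \<A> \<Phi> k q \<alpha> = type_proj \<A> \<Phi> (Suc k) q (ext_deriv \<A> \<alpha>)"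

end

(*
  Idea. Since the Levi-Civita connection is torsion free, d is the skew-symmetrisation of the covariant
  derivative, and since the 4-form is parallel the covariant derivative preserves types. Hence d of a form of
  type p only has components in those types that occur in the skew-symmetrisation of R^8 tensor (type p);
  explicit frame computations show that d has no component from 48 to 1 and from 8 to 27 (degree 3), nor
  from 1 to 48 and from 27 to 8 (degree 4). Splitting d alpha into types and projecting d (d alpha) = 0
  gives all identities.

  The metric enters the definition of the types only through a choice of frame, so its differentiability
  needs an argument: contracting bivectors with the Cayley form is an endomorphism with minimal polynomial
  (x - 3)(x + 1), which lets one write the induced inner product on bivectors, and then the metric itself,
  in terms of wedge products of the 4-form.
*)

theory Submission imports Defs begin

section \<open>Alternating multilinear algebra on \<real>^8, independent of the Cayley form\<close>

section \<open>Alternating forms\<close>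

text \<open>No representation theory is used. The key algebraic fact is that \<Lambda>^4_27 is
  orthogonal to b.\<Phi> for every b in gl(8): spin(7) annihilates \<Phi>, so skew b only reach type
  7; symmetric traceless b give anti-self-dual forms; the identity gives a multiple of \<Phi>.
  Pairing a skew-symmetrised X-contraction of \<Phi> with a form of type 27 is such a pairing, hence
  d has no component from 8 to 27; from 27 to 8 it is the adjoint statement.

  Invariance of types under the covariant derivative comes from the Leibniz rule, applied to an
  equation satisfied by the type, such as \<gamma> \<and> \<Phi> = 0, or to a parametrisation, such
  as the contraction of \<Phi> with a vector field.

  The development is shaped by the fact that the composites differentiate a projected form. Each
  inner projection must therefore be expressed by the metric, the volume form and \<Phi> alone: the
  adapted frame is chosen point by point and need not vary continuously. The outer projection is not
  differentiated, so in degree 5 its existence and additivity suffice.\<close>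

definition multilin :: "nat \<Rightarrow> form8 \<Rightarrow> bool" where
  "multilin k \<alpha> \<longleftrightarrow> (\<forall>X Y. length X + Suc (length Y) = k \<longrightarrow> linear (\<lambda>v. \<alpha> (X @ v # Y)))"

lemma multilinD: "multilin k \<alpha> \<Longrightarrow> length X + Suc (length Y) = k \<Longrightarrow> linear (\<lambda>v. \<alpha> (X @ v # Y))"
  by (simp add: multilin_def)

lemma multilin_Cons: "multilin (Suc k) \<alpha> \<Longrightarrow> multilin k (\<lambda>vs. \<alpha> (v # vs))"
  unfolding multilin_def
proof (intro allI impI)
  fix X Y :: "vec8 list"
  assume "\<forall>X Y. length X + Suc (length Y) = Suc k \<longrightarrow> linear (\<lambda>v. \<alpha> (X @ v # Y))"
    and "length X + Suc (length Y) = k"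
  then have "linear (\<lambda>w. \<alpha> ((v # X) @ w # Y))" by (metis add_Suc length_Cons)
  then show "linear (\<lambda>w. \<alpha> (v # X @ w # Y))" by simp
qed

lemma multilin_append:
  assumes "multilin (length us + k) \<alpha>" shows "multilin k (\<lambda>vs. \<alpha> (us @ vs))"
  unfolding multilin_def
proof (intro allI impI)
  fix X Y :: "vec8 list" assume "length X + Suc (length Y) = k"
  then show "linear (\<lambda>v. \<alpha> (us @ X @ v # Y))"
    using multilinD[OF assms, of "us @ X" Y] by simp
qed

lemma multilin_append_right:
  assumes "multilin (k + length us) \<alpha>" shows "multilin k (\<lambda>vs. \<alpha> (vs @ us))"
  unfolding multilin_def
proof (intro allI impI)
  fix X Y :: "vec8 list" assume "length X + Suc (length Y) = k"
  then show "linear (\<lambda>v. \<alpha> ((X @ v # Y) @ us))"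
    using multilinD[OF assms, of X "Y @ us"] by simp
qed

lemma multilin_hd: "multilin (Suc k) \<alpha> \<Longrightarrow> length Y = k \<Longrightarrow> linear (\<lambda>v. \<alpha> (v # Y))"
  using multilinD[of "Suc k" \<alpha> "[]" Y] by simp

lemma alternating_swap:
  assumes ml: "multilin k \<alpha>" and z: "\<And>X v Y. length X + Suc (Suc (length Y)) = k \<Longrightarrow> \<alpha> (X @ v # v # Y) = 0"
    and len: "length X + Suc (Suc (length Y)) = k"
  shows "\<alpha> (X @ u # v # Y) = - \<alpha> (X @ v # u # Y)"
proof -
  have l1: "linear (\<lambda>u. \<alpha> (X @ u # w # Y))" for w
    using multilinD[OF ml, of X "w # Y"] len by simp
  have l2: "linear (\<lambda>u. \<alpha> (X @ w # u # Y))" for w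
    using multilinD[OF ml, of "X @ [w]" Y] len by simp
  have "\<alpha> (X @ (u + v) # (u + v) # Y) = 0" using z len by blast
  then show ?thesis
    using z[OF len, of u] z[OF len, of v]
    by (simp add: linear_add[OF l1] linear_add[OF l2])
qed

lemma alternating_move:
  assumes ml: "multilin k \<alpha>" and z: "\<And>X v Y. length X + Suc (Suc (length Y)) = k \<Longrightarrow> \<alpha> (X @ v # v # Y) = 0"
    and len: "length X + length Y + Suc (length Z) = k"
  shows "\<alpha> (X @ Y @ v # Z) = (-1) ^ length Y * \<alpha> (X @ v # Y @ Z)"
  using len
proof (induction Y arbitrary: Z rule: rev_induct)
  case (snoc y Y)
  have "\<alpha> (X @ (Y @ [y]) @ v # Z) = - \<alpha> (X @ Y @ v # y # Z)"
    using alternating_swap[OF ml z, of "X @ Y" Z y v] snoc.prems by simp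
  also have "\<dots> = - ((-1) ^ length Y * \<alpha> (X @ v # Y @ y # Z))"
    using snoc.IH[of "y # Z"] snoc.prems by simp
  finally show ?case by simp
qed simp

lemma alt_forms_length: "\<alpha> \<in> alt_forms k \<Longrightarrow> length vs \<noteq> k \<Longrightarrow> \<alpha> vs = 0"
  by (simp add: alt_forms_def)

lemma alt_forms_multilin:
  assumes "\<alpha> \<in> alt_forms k" shows "multilin k \<alpha>"
  unfolding multilin_def
proof (intro allI impI)
  fix X Y :: "vec8 list" assume l: "length X + Suc (length Y) = k"
  have "linear (\<lambda>v. \<alpha> ((X @ 0 # Y)[length X := v]))"
    using assms l unfolding alt_forms_def by (auto simp del: list_update_length)
  then show "linear (\<lambda>v. \<alpha> (X @ v # Y))" by simp
qed

lemma alt_forms_repeat: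
  assumes "\<alpha> \<in> alt_forms k" shows "\<alpha> (X @ v # Y @ v # Z) = 0"
proof (cases "length (X @ v # Y @ v # Z) = k")
  case True
  let ?j = "Suc (length X + length Y)"
  have "(X @ v # Y @ v # Z) ! length X = (X @ v # Y @ v # Z) ! ?j" by (simp add: nth_append)
  moreover have "length X < ?j" "?j < k" using True by auto
  ultimately show ?thesis using assms True unfolding alt_forms_def by blast
qed (use assms alt_forms_length in blast)

lemma alt_forms_repeat_adj: "\<alpha> \<in> alt_forms k \<Longrightarrow> \<alpha> (X @ v # v # Z) = 0"
  using alt_forms_repeat[of \<alpha> k X v "[]" Z] by simp

lemma list_update_two:
  assumes "a < b" "b < length ws"
  shows "ws[a := u, b := v] = take a ws @ u # take (b - Suc a) (drop (Suc a) ws) @ v # drop (Suc b) ws"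
proof -
  let ?n = "b - Suc a"
  have 1: "drop (Suc a) ws ! ?n = ws ! b" "drop (Suc ?n) (drop (Suc a) ws) = drop (Suc b) ws"
    using assms by simp_all
  have d: "drop (Suc a) ws = take ?n (drop (Suc a) ws) @ ws ! b # drop (Suc b) ws"
    by (rule id_take_nth_drop[of ?n "drop (Suc a) ws", unfolded 1]) (use assms in simp)
  have ws: "ws = take a ws @ ws ! a # take ?n (drop (Suc a) ws) @ ws ! b # drop (Suc b) ws"
    by (subst d[symmetric]) (rule id_take_nth_drop, use assms in simp)
  have upd: "(X @ x # Y @ y # Z)[length X := u, Suc (length X + length Y) := v] = X @ u # Y @ v # Z"
    for X Y Z and x y
    by (simp add: list_update_append)
  have len: "length (take a ws) = a" "Suc (a + length (take (b - Suc a) (drop (Suc a) ws))) = b"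
    using assms by auto
  have "ws[a := u, b := v] = (take a ws @ ws ! a # take (b - Suc a) (drop (Suc a) ws) @ ws ! b # drop (Suc b) ws)[a := u, b := v]"
    by (rule arg_cong[OF ws])
  also have "\<dots> = take a ws @ u # take (b - Suc a) (drop (Suc a) ws) @ v # drop (Suc b) ws"
    using upd[of "take a ws" "ws ! a" "take (b - Suc a) (drop (Suc a) ws)" "ws ! b" "drop (Suc b) ws"]
    unfolding len .
  finally show ?thesis .
qed

text \<open>Equal neighbours are enough: an equal argument further right can be moved next to the
  first one, which only costs a sign.\<close>

lemma alt_formsI:
  assumes len: "\<And>vs. length vs \<noteq> k \<Longrightarrow> \<alpha> vs = 0"
    and ml: "multilin k \<alpha>"
    and z: "\<And>X v Y. length X + Suc (Suc (length Y)) = k \<Longrightarrow> \<alpha> (X @ v # v # Y) = 0"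
  shows "\<alpha> \<in> alt_forms k"
  unfolding alt_forms_def
proof (intro CollectI conjI allI impI; (elim conjE)?)
  fix vs :: "vec8 list" and i
  assume l: "length vs = k" and i: "i < k"
  have "vs[i := v] = take i vs @ v # drop (Suc i) vs" for v
    using l i by (simp add: upd_conv_take_nth_drop)
  moreover have "linear (\<lambda>v. \<alpha> (take i vs @ v # drop (Suc i) vs))"
    using multilinD[OF ml, of "take i vs" "drop (Suc i) vs"] l i by simp
  ultimately show "linear (\<lambda>v. \<alpha> (vs[i := v]))" by simp
next
  fix vs :: "vec8 list" and i j
  assume l: "length vs = k" and ij: "i < j" "j < k" "vs ! i = vs ! j"
  let ?X = "take i vs" and ?Y = "take (j - Suc i) (drop (Suc i) vs)" and ?Z = "drop (Suc j) vs"
  have vs: "?X @ vs ! j # ?Y @ vs ! j # ?Z = vs"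
    using list_update_two[of i j vs "vs ! j" "vs ! j"] ij l by (metis list_update_id)
  have "\<alpha> (?X @ vs ! j # ?Y @ vs ! j # ?Z) = (-1) ^ length ?Y * \<alpha> (?X @ vs ! j # vs ! j # ?Y @ ?Z)"
    using alternating_move[OF ml z, of "?X @ [vs ! j]" ?Y ?Z "vs ! j"] l ij by simp
  also have "\<dots> = 0" using z[of ?X "?Y @ ?Z" "vs ! j"] l ij by simp
  finally show "\<alpha> vs = 0" using vs by simp
next
  fix vs :: "vec8 list" assume "length vs \<noteq> k" then show "\<alpha> vs = 0" by (rule len)
qed

lemma alt_forms_swap:
  assumes "\<alpha> \<in> alt_forms k" shows "\<alpha> (X @ u # v # Y) = - \<alpha> (X @ v # u # Y)"
proof (cases "length X + Suc (Suc (length Y)) = k")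
  case True then show ?thesis
    using alternating_swap[OF alt_forms_multilin[OF assms] alt_forms_repeat_adj[OF assms]] by blast
next
  case False then show ?thesis using alt_forms_length[OF assms] by simp
qed

lemma alt_forms_move:
  assumes "\<alpha> \<in> alt_forms k"
  shows "\<alpha> (X @ Y @ v # Z) = (-1) ^ length Y * \<alpha> (X @ v # Y @ Z)"
proof (cases "length X + length Y + Suc (length Z) = k")
  case True then show ?thesis
    using alternating_move[OF alt_forms_multilin[OF assms] alt_forms_repeat_adj[OF assms]] by blast
next
  case False then show ?thesis using alt_forms_length[OF assms] by simp
qed

lemma alt_forms_move_block:
  assumes "\<alpha> \<in> alt_forms k"
  shows "\<alpha> (X @ Y @ W @ Z) = (-1) ^ (length Y * length W) * \<alpha> (X @ W @ Y @ Z)"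
proof (induction W arbitrary: X)
  case (Cons w W)
  have "\<alpha> (X @ Y @ (w # W) @ Z) = (-1) ^ length Y * \<alpha> ((X @ [w]) @ Y @ W @ Z)"
    using alt_forms_move[OF assms, of X Y w "W @ Z"] by simp
  also have "\<dots> = (-1) ^ length Y * ((-1) ^ (length Y * length W) * \<alpha> ((X @ [w]) @ W @ Y @ Z))"
    by (simp only: Cons.IH[of "X @ [w]"])
  finally show ?case by (simp add: power_add)
qed simp

lemma alt_forms_swap_far:
  assumes "\<alpha> \<in> alt_forms k" shows "\<alpha> (X @ u # Y @ v # Z) = - \<alpha> (X @ v # Y @ u # Z)"
proof -
  have "\<alpha> (X @ u # Y @ v # Z) = (-1) ^ length Y * \<alpha> (X @ u # v # Y @ Z)"
    using alt_forms_move[OF assms, of "X @ [u]" Y v Z] by simp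
  moreover have "\<alpha> (X @ v # Y @ u # Z) = (-1) ^ length Y * \<alpha> (X @ v # u # Y @ Z)"
    using alt_forms_move[OF assms, of "X @ [v]" Y u Z] by simp
  ultimately show ?thesis using alt_forms_swap[OF assms, of X u v "Y @ Z"] by simp
qed

lemma alt_forms_transpose:
  assumes "\<alpha> \<in> alt_forms k" "a < length ws" "b < length ws" "a \<noteq> b"
  shows "\<alpha> (ws[a := ws ! b, b := ws ! a]) = - \<alpha> ws"
proof -
  have *: "\<alpha> (ws[a := ws ! b, b := ws ! a]) = - \<alpha> ws" if "a < b" "b < length ws" for a b
  proof -
    have "\<alpha> (ws[a := ws ! a, b := ws ! b]) = - \<alpha> (ws[a := ws ! b, b := ws ! a])"
      unfolding list_update_two[OF that] using alt_forms_swap_far[OF assms(1)] .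
    then show ?thesis by simp
  qed
  show ?thesis
  proof (cases "a < b")
    case False
    then have "ws[a := ws ! b, b := ws ! a] = ws[b := ws ! a, a := ws ! b]"
      by (intro list_update_swap assms(4))
    moreover have "b < a" using False assms(4) by simp
    ultimately show ?thesis using *[OF _ assms(2), of b] by metis
  next
    case True then show ?thesis using *[OF _ assms(3)] by blast
  qed
qed

lemma alt_forms_permute:
  assumes al: "\<alpha> \<in> alt_forms k" and p: "\<sigma> permutes {..<length vs}"
  shows "\<alpha> (map (\<lambda>i. vs ! \<sigma> i) [0..<length vs]) = of_int (sign \<sigma>) * \<alpha> vs"
  using finite_lessThan p
proof (induction rule: permutes_rev_induct)
  case id
  then show ?case by (simp add: map_nth)
next
  case (swap a b p)
  let ?ws = "map (\<lambda>i. vs ! p i) [0..<length vs]"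
  have ab: "a < length ?ws" "b < length ?ws" using swap by auto
  have "map (\<lambda>i. vs ! (p \<circ> Transposition.transpose a b) i) [0..<length vs] = ?ws[a := ?ws ! b, b := ?ws ! a]"
    using ab by (intro nth_equalityI) (auto simp: nth_list_update Transposition.transpose_def)
  then have "\<alpha> (map (\<lambda>i. vs ! (p \<circ> Transposition.transpose a b) i) [0..<length vs]) = - \<alpha> ?ws"
    using alt_forms_transpose[OF al ab swap(3)] by simp
  moreover have "sign (p \<circ> Transposition.transpose a b) = - sign p"
    using swap by (subst sign_compose)
      (auto simp: sign_swap_id permutation_swap_id intro: permutes_imp_permutation[of "{..<length vs}"])
  ultimately show ?case using swap by (simp add: comp_def)
qed

subsection \<open>Linear structure\<close>

lemma linear_scale_real: "linear f \<Longrightarrow> linear (\<lambda>v. c * f v :: real)"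
  using linear_compose_scale_right[of f c] by simp

lemma multilin_add: "multilin k \<alpha> \<Longrightarrow> multilin k \<beta> \<Longrightarrow> multilin k (\<alpha> + \<beta>)"
  by (simp add: multilin_def linear_compose_add)

lemma multilin_scale: "multilin k \<alpha> \<Longrightarrow> multilin k (\<lambda>vs. c * \<alpha> vs)"
  unfolding multilin_def by (intro allI impI linear_scale_real) blast

lemma multilin_sum: "(\<And>i. i \<in> S \<Longrightarrow> multilin k (\<alpha> i)) \<Longrightarrow> multilin k (\<lambda>vs. \<Sum>i\<in>S. \<alpha> i vs)"
  unfolding multilin_def by (intro allI impI linear_compose_sum) blast

lemma alt_forms_zero: "0 \<in> alt_forms k"
  by (rule alt_formsI) (simp_all add: multilin_def linear_iff)

lemma alt_forms_add: "\<alpha> \<in> alt_forms k \<Longrightarrow> \<beta> \<in> alt_forms k \<Longrightarrow> \<alpha> + \<beta> \<in> alt_forms k"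
  by (rule alt_formsI)
    (simp_all add: alt_forms_length multilin_add alt_forms_multilin alt_forms_repeat_adj)

lemma alt_forms_scale: "\<alpha> \<in> alt_forms k \<Longrightarrow> (\<lambda>vs. c * \<alpha> vs) \<in> alt_forms k"
  by (rule alt_formsI)
    (simp_all add: alt_forms_length multilin_scale alt_forms_multilin alt_forms_repeat_adj)

lemma alt_forms_sum:
  assumes "\<And>i. i \<in> S \<Longrightarrow> \<alpha> i \<in> alt_forms k" shows "(\<lambda>vs. \<Sum>i\<in>S. \<alpha> i vs) \<in> alt_forms k"
proof (rule alt_formsI)
  show "multilin k (\<lambda>vs. \<Sum>i\<in>S. \<alpha> i vs)"
    by (intro multilin_sum alt_forms_multilin assms)
qed (use alt_forms_length[OF assms] alt_forms_repeat_adj[OF assms] in \<open>auto intro!: sum.neutral\<close>)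

lemma alt_forms_uminus: "\<alpha> \<in> alt_forms k \<Longrightarrow> - \<alpha> \<in> alt_forms k"
  using alt_forms_scale[of \<alpha> k "-1"] by (simp add: fun_Compl_def)

lemma alt_forms_diff: "\<alpha> \<in> alt_forms k \<Longrightarrow> \<beta> \<in> alt_forms k \<Longrightarrow> \<alpha> - \<beta> \<in> alt_forms k"
  using alt_forms_add[OF _ alt_forms_uminus] by (simp add: fun_diff_def plus_fun_def fun_Compl_def)

lemma interior_alt_forms: "\<alpha> \<in> alt_forms (Suc k) \<Longrightarrow> interior_product X \<alpha> \<in> alt_forms k"
  unfolding interior_product_def
  apply (rule alt_formsI)
    apply (simp add: alt_forms_length)
   apply (simp add: alt_forms_multilin multilin_Cons)
  using alt_forms_repeat_adj[of \<alpha> "Suc k" "X # _"] by simp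

subsection \<open>Sums over index lists\<close>

lemma finite_lists_len [simp]: "finite {I::8 list. length I = n}"
  using finite_lists_length_eq[of "UNIV :: 8 set" n] by simp

lemma sum_lists_Suc:
  "(\<Sum>I::8 list | length I = Suc n. F I) = (\<Sum>a\<in>UNIV. \<Sum>I | length I = n. F (a # I))"
proof -
  have "{I::8 list. length I = Suc n} = (\<lambda>(a, I). a # I) ` (UNIV \<times> {I. length I = n})"
    by (auto simp: length_Suc_conv image_iff)
  moreover have "inj_on (\<lambda>(a, I). a # I) (UNIV \<times> {I::8 list. length I = n})" by (auto simp: inj_on_def)
  ultimately show ?thesis
    by (simp only: sum.reindex sum.cartesian_product) (simp add: case_prod_beta)
qed

lemma sum_lists_add:
  "(\<Sum>K::8 list | length K = m + n. F K) = (\<Sum>I | length I = m. \<Sum>J | length J = n. F (I @ J))"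
  by (induction m arbitrary: F) (simp_all add: sum_lists_Suc)

lemma sum_lists_permute:
  assumes "\<sigma> permutes {..<n}"
  shows "(\<Sum>I::8 list | length I = n. F (map (\<lambda>i. I ! \<sigma> i) [0..<n])) = (\<Sum>I | length I = n. F I)"
proof (rule sum.reindex_bij_witness[where i="\<lambda>I. map (\<lambda>i. I ! inv \<sigma> i) [0..<n]"
      and j="\<lambda>I. map (\<lambda>i. I ! \<sigma> i) [0..<n]"])
  fix I :: "8 list" assume I: "I \<in> {I. length I = n}"
  have inv: "inv \<sigma> i < n" if "i < n" for i using permutes_in_image[OF permutes_inv[OF assms], of i] that by simp
  have s: "\<sigma> i < n" if "i < n" for i using permutes_in_image[OF assms, of i] that by simp
  show "map (\<lambda>i. (map (\<lambda>i. I ! inv \<sigma> i) [0..<n]) ! \<sigma> i) [0..<n] = I"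
    using I s permutes_inverses[OF assms] by (intro nth_equalityI) auto
  show "map (\<lambda>i. (map (\<lambda>i. I ! \<sigma> i) [0..<n]) ! inv \<sigma> i) [0..<n] = I"
    using I inv permutes_inverses[OF assms] by (intro nth_equalityI) auto
qed simp_all

text \<open>Frame vectors replace the arguments one at a time, starting from the right:
  \<open>X\<close> holds the arguments that are still arbitrary, \<open>I\<close> the indices of
  those already in the frame. The spanning family is general because the frames adapted to a 4-form
  differ from the coordinate basis.\<close>

lemma multilin_ext:
  assumes sp: "span (range f) = UNIV" and "multilin k \<alpha>" "multilin k \<beta>"
    and eq: "\<And>I. length I = k \<Longrightarrow> \<alpha> (map f I) = \<beta> (map f (I::8 list))"
    and "length vs = k"
  shows "\<alpha> vs = \<beta> vs"
proof -
  have "length X + length I = k \<Longrightarrow> \<alpha> (X @ map f I) = \<beta> (X @ map f I)" for X I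
  proof (induction X arbitrary: I rule: rev_induct)
    case (snoc v X)
    have "linear (\<lambda>v. \<alpha> (X @ v # map f I))" "linear (\<lambda>v. \<beta> (X @ v # map f I))"
      using multilinD assms(2,3) snoc.prems by simp_all
    moreover have "\<alpha> (X @ v # map f I) = \<beta> (X @ v # map f I)" if "v \<in> range f" for v
      using that snoc.IH[of "a # I" for a] snoc.prems by auto
    ultimately have "\<alpha> (X @ v # map f I) = \<beta> (X @ v # map f I)"
      using linear_eq_on_span[of "\<lambda>v. \<alpha> (X @ v # map f I)" "\<lambda>v. \<beta> (X @ v # map f I)" "range f" v] sp by blast
    then show ?case by simp
  qed (use eq in simp)
  from this[of vs "[]"] show ?thesis using assms(5) by simp
qed

lemma alt_forms_ext:
  assumes sp: "span (range f) = UNIV" and "\<alpha> \<in> alt_forms k" "\<beta> \<in> alt_forms k"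
    and eq: "\<And>I. length I = k \<Longrightarrow> \<alpha> (map f I) = \<beta> (map f (I::8 list))"
  shows "\<alpha> = \<beta>"
proof
  fix vs show "\<alpha> vs = \<beta> vs"
    by (cases "length vs = k")
      (use multilin_ext[OF sp alt_forms_multilin[OF assms(2)] alt_forms_multilin[OF assms(3)] eq]
        alt_forms_length[OF assms(2)] alt_forms_length[OF assms(3)] in auto)
qed

text \<open>The hypothesis says that h^ij e_i e_j and the sum of the f_k f_k are the same 2-tensor.
  Used slot by slot, it turns a contraction with the inverse metric over the coordinate basis into a
  plain sum over an orthonormal frame.\<close>

lemma multilin_contract:
  fixes e f :: "8 \<Rightarrow> vec8"
  assumes h: "\<And>F G. linear F \<Longrightarrow> linear G \<Longrightarrow>
      (\<Sum>i\<in>UNIV. \<Sum>j\<in>UNIV. h i j * F (e i) * G (e j)) = (\<Sum>k\<in>UNIV. F (f k) * (G (f k) :: real))"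
    and "multilin k \<alpha>" "multilin k \<beta>"
  shows "(\<Sum>I | length I = k. \<Sum>J | length J = k. (\<Prod>a<k. h (I ! a) (J ! a)) * \<alpha> (map e I) * \<beta> (map e J))
     = (\<Sum>K | length K = k. \<alpha> (map f K) * \<beta> (map f (K::8 list)))"
  using assms(2,3)
proof (induction k arbitrary: \<alpha> \<beta>)
  case (Suc k)
  have "(\<Sum>I | length I = Suc k. \<Sum>J | length J = Suc k. (\<Prod>a<Suc k. h (I ! a) (J ! a)) * \<alpha> (map e I) * \<beta> (map e J))
    = (\<Sum>i\<in>UNIV. \<Sum>I | length I = k. \<Sum>j\<in>UNIV. \<Sum>J | length J = k.
        h i j * ((\<Prod>a<k. h (I ! a) (J ! a)) * \<alpha> (e i # map e I) * \<beta> (e j # map e J)))"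
    unfolding sum_lists_Suc prod.lessThan_Suc_shift by (simp add: mult.assoc del: prod.lessThan_Suc)
  also have "\<dots> = (\<Sum>i\<in>UNIV. \<Sum>j\<in>UNIV. h i j * (\<Sum>I | length I = k. \<Sum>J | length J = k.
        ((\<Prod>a<k. h (I ! a) (J ! a)) * \<alpha> (e i # map e I) * \<beta> (e j # map e J))))"
    by (intro sum.cong refl, subst sum.swap) (simp add: sum_distrib_left)
  also have "\<dots> = (\<Sum>i\<in>UNIV. \<Sum>j\<in>UNIV. h i j * (\<Sum>K | length K = k. \<alpha> (e i # map f K) * \<beta> (e j # map f K)))"
    using Suc.IH[OF multilin_Cons[OF Suc.prems(1)] multilin_Cons[OF Suc.prems(2)]] by (simp add: mult.assoc)
  also have "\<dots> = (\<Sum>K | length K = k. \<Sum>i\<in>UNIV. \<Sum>j\<in>UNIV. h i j * \<alpha> (e i # map f K) * \<beta> (e j # map f K))"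
  proof -
    have "(\<Sum>i\<in>UNIV. \<Sum>j\<in>UNIV. \<Sum>K\<in>S. G i j K) = (\<Sum>K\<in>S. \<Sum>i\<in>UNIV. \<Sum>j\<in>UNIV. G i j K)"
      for G :: "8 \<Rightarrow> 8 \<Rightarrow> 8 list \<Rightarrow> real" and S
      by (subst sum.swap[of _ UNIV S]) (rule sum.cong[OF refl], rule sum.swap)
    then show ?thesis by (simp add: sum_distrib_left mult.assoc)
  qed
  also have "\<dots> = (\<Sum>K | length K = k. \<Sum>i\<in>UNIV. \<alpha> (f i # map f K) * \<beta> (f i # map f K))"
    by (rule sum.cong[OF refl], rule h)
      (auto intro: multilin_hd[OF Suc.prems(1)] multilin_hd[OF Suc.prems(2)])
  also have "\<dots> = (\<Sum>i\<in>UNIV. \<Sum>K | length K = k. \<alpha> (f i # map f K) * \<beta> (f i # map f K))"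
    by (rule sum.swap)
  finally show ?case unfolding sum_lists_Suc by simp
qed simp

lemma alt_forms_append:
  assumes "\<alpha> \<in> alt_forms (length us + k)" shows "(\<lambda>vs. \<alpha> (us @ vs)) \<in> alt_forms k"
proof (rule alt_formsI)
  show "multilin k (\<lambda>vs. \<alpha> (us @ vs))" by (rule multilin_append[OF alt_forms_multilin[OF assms]])
  show "\<alpha> (us @ X @ v # v # Y) = 0" for X v Y
    using alt_forms_repeat_adj[OF assms, of "us @ X" v Y] by simp
qed (use alt_forms_length[OF assms] in simp)

lemma alt_forms_append_right:
  assumes "\<alpha> \<in> alt_forms (k + length us)" shows "(\<lambda>vs. \<alpha> (vs @ us)) \<in> alt_forms k"
proof (rule alt_formsI)
  show "multilin k (\<lambda>vs. \<alpha> (vs @ us))" by (rule multilin_append_right[OF alt_forms_multilin[OF assms]])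
  show "\<alpha> ((X @ v # v # Y) @ us) = 0" for X v Y
    using alt_forms_repeat_adj[OF assms, of X v "Y @ us"] by simp
qed (use alt_forms_length[OF assms] in simp)

text \<open>One permutation serves every form \<beta> at once. Two forms evaluated on the same
  rearrangement thus change by the same sign, and these signs cancel in products.\<close>

lemma alt_forms_mset:
  assumes "\<alpha> \<in> alt_forms (length J)" "mset I = mset J"
  obtains \<sigma> where "\<sigma> permutes {..<length J}"
    "\<And>\<beta>. \<beta> \<in> alt_forms (length J) \<Longrightarrow> \<beta> (map f I) = of_int (sign \<sigma>) * \<beta> (map f J)"
proof -
  obtain \<sigma> where s: "\<sigma> permutes {..<length J}" "permute_list \<sigma> J = I"
    using mset_eq_permutation[OF assms(2)] by blast
  then have I: "I = map (\<lambda>i. J ! \<sigma> i) [0..<length J]" by (simp add: permute_list_def)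
  have "map f I = map (\<lambda>i. map f J ! \<sigma> i) [0..<length J]"
    using I permutes_in_image[OF s(1)] by auto
  then have "\<beta> (map f I) = of_int (sign \<sigma>) * \<beta> (map f J)" if "\<beta> \<in> alt_forms (length J)" for \<beta>
    using alt_forms_permute[OF that, of \<sigma> "map f J"] s(1) by simp
  then show ?thesis using that s(1) by blast
qed

lemma alt_forms_not_distinct:
  assumes "\<alpha> \<in> alt_forms k" "\<not> distinct I" shows "\<alpha> (map f I) = 0"
proof -
  obtain X y Y Z where "I = X @ [y] @ Y @ [y] @ Z" using not_distinct_decomp[OF assms(2)] by blast
  then show ?thesis using alt_forms_repeat[OF assms(1), of "map f X" "f y" "map f Y" "map f Z"] by simp
qed

lemma alt_forms_top_zero:
  assumes sp: "span (range f) = UNIV" and T: "T \<in> alt_forms (length K)"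
    and K: "distinct K" "set K = (UNIV :: 8 set)" and z: "T (map f K) = 0"
  shows "T = 0"
proof (rule alt_forms_ext[OF sp T alt_forms_zero])
  fix I :: "8 list" assume I: "length I = length K"
  show "T (map f I) = 0 (map f I)"
  proof (cases "distinct I")
    case True
    then have "set I = UNIV"
      using K I distinct_card[of I] distinct_card[of K] by (intro card_subset_eq) auto
    then have "mset I = mset K" using True K by (simp add: set_eq_iff_mset_eq_distinct[symmetric])
    then show ?thesis
    proof (rule alt_forms_mset[OF T, where f = f])
      fix \<sigma> assume "\<And>\<beta>. \<beta> \<in> alt_forms (length K) \<Longrightarrow> \<beta> (map f I) = of_int (sign \<sigma>) * \<beta> (map f K)"
      from this[OF T] show ?thesis using z by simp
    qed
  next
    case False then show ?thesis using alt_forms_not_distinct[OF T] by simp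
  qed
qed

text \<open>Nondegeneracy of the contraction with a volume form. If \<open>T\<close> is nonzero on
  the frame vectors of \<open>I0\<close>, take for \<open>L\<close> the complementary indices. Only
  rearrangements of \<open>I0\<close> are disjoint from \<open>L\<close>, and for each of them
  \<open>T\<close> and \<open>V\<close> change by the same sign, so the sum is a positive multiple
  of a nonzero number.\<close>

lemma alt_forms_complement_zero:
  assumes sp: "span (range f) = UNIV" and T: "T \<in> alt_forms k" and V: "V \<in> alt_forms (length K)"
    and K: "distinct K" "set K = (UNIV :: 8 set)" and nz: "V (map f K) \<noteq> 0"
    and z: "\<And>L. k + length L = length K \<Longrightarrow> (\<Sum>I | length I = k. T (map f I) * V (map f (I @ L))) = 0"
  shows "T = 0"
proof (rule alt_forms_ext[OF sp T alt_forms_zero], rule ccontr)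
  fix I0 :: "8 list" assume I0: "length I0 = k" "T (map f I0) \<noteq> 0 (map f I0)"
  then have T0: "T (map f I0) \<noteq> 0" by simp
  then have d0: "distinct I0" using alt_forms_not_distinct[OF T] by blast
  obtain L where L: "distinct L" "set L = UNIV - set I0"
    using finite_distinct_list[of "UNIV - set I0"] by auto
  have "length K = card (UNIV :: 8 set)" using distinct_card[OF K(1)] K(2) by simp
  moreover have "card (UNIV - set I0) = card (UNIV :: 8 set) - card (set I0)"
    by (rule card_Diff_subset) auto
  moreover have "card (set I0) \<le> card (UNIV :: 8 set)" by (rule card_mono) auto
  ultimately have len: "k + length L = length K"
    using distinct_card[OF d0] distinct_card[OF L(1)] L(2) I0 by simp
  have IL: "mset (I0 @ L) = mset K"
    by (rule iffD1[OF set_eq_iff_mset_eq_distinct]) (use d0 L K in auto)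
  have V0: "V (map f (I0 @ L)) \<noteq> 0"
  proof (rule alt_forms_mset[OF V IL, where f = f])
    fix \<sigma> assume "\<And>\<beta>. \<beta> \<in> alt_forms (length K) \<Longrightarrow> \<beta> (map f (I0 @ L)) = of_int (sign \<sigma>) * \<beta> (map f K)"
    from this[OF V] show ?thesis using nz by (simp add: sign_def)
  qed
  let ?V = "\<lambda>vs. V (vs @ map f L)"
  have V': "?V \<in> alt_forms k"
    by (rule alt_forms_append_right) (use V len in simp)
  have *: "T (map f I) * V (map f (I @ L)) = (if mset I = mset I0 then T (map f I0) * V (map f (I0 @ L)) else 0)"
    if I: "length I = k" for I
  proof (cases "mset I = mset I0")
    case True
    have T': "T \<in> alt_forms (length I0)" and V'': "?V \<in> alt_forms (length I0)" using T V' I0 by auto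
    show ?thesis
    proof (rule alt_forms_mset[OF T' True, where f = f])
      fix \<sigma> assume "\<And>\<beta>. \<beta> \<in> alt_forms (length I0) \<Longrightarrow> \<beta> (map f I) = of_int (sign \<sigma>) * \<beta> (map f I0)"
      from this[OF T'] this[OF V''] show ?thesis using True by (simp add: sign_def)
    qed
  next
    case False
    have "\<not> distinct (I @ L)"
    proof
      assume d: "distinct (I @ L)"
      then have "set (I @ L) = UNIV"
        using I len K \<open>length K = card UNIV\<close>
        by (intro card_subset_eq) (simp_all only: distinct_card length_append subset_UNIV finite_class.finite_UNIV)
      then have "set I = set I0" using d L by auto
      then show False using False d d0 set_eq_iff_mset_eq_distinct[of I I0] by auto
    qed
    then have "V (map f (I @ L)) = 0" by (rule alt_forms_not_distinct[OF V])
    then show ?thesis using False by (simp del: map_append)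
  qed
  have "(\<Sum>I | length I = k. T (map f I) * V (map f (I @ L)))
      = (\<Sum>I | length I = k. if mset I = mset I0 then T (map f I0) * V (map f (I0 @ L)) else 0)"
    by (rule sum.cong) (use * in auto)
  also have "\<dots> = of_nat (card {I. length I = k \<and> mset I = mset I0}) * (T (map f I0) * V (map f (I0 @ L)))"
    by (simp add: sum.If_cases Collect_conj_eq[symmetric] Int_def)
  finally have "card {I. length I = k \<and> mset I = mset I0} = 0"
    using z[OF len] T0 V0 by simp
  moreover have "finite {I. length I = k \<and> mset I = mset I0}"
    by (rule finite_subset[OF _ finite_lists_len[of k]]) auto
  ultimately show False using I0 by (simp add: card_eq_0_iff) blast
qed

subsection \<open>Wedge products\<close>

lemma nth_split: "(X @ v # Y) ! i = (if i = length X then v else (X @ u # Y) ! i)"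
  by (auto simp: nth_append nth_Cons split: nat.splits)

lemma linear_slot:
  assumes \<alpha>: "multilin (n - m) \<alpha>" and \<sigma>: "inj \<sigma>" and p: "\<sigma> p = length X" "m \<le> p" "p < n"
  shows "linear (\<lambda>v. \<alpha> (map (\<lambda>i. (X @ v # Y) ! \<sigma> i) [m..<n]))"
proof -
  let ?h = "\<lambda>i. (X @ 0 # Y) ! \<sigma> i"
  have "map (\<lambda>i. (X @ v # Y) ! \<sigma> i) [m..<n] = map ?h [m..<p] @ v # map ?h [Suc p..<n]" for v
  proof -
    have "[m..<n] = [m..<p] @ p # [Suc p..<n]"
      using p by (metis less_or_eq_imp_le upt_add_eq_append upt_conv_Cons le_add_diff_inverse)
    moreover have "(X @ v # Y) ! \<sigma> i = ?h i" if "i \<noteq> p" for i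
      using nth_split[of X v Y "\<sigma> i" 0] that p(1) \<sigma> by (metis inj_eq)
    ultimately show ?thesis using p by (auto intro!: map_cong)
  qed
  then show ?thesis using multilinD[OF \<alpha>, of "map ?h [m..<p]" "map ?h [Suc p..<n]"] p by simp
qed

lemma const_slot:
  assumes \<sigma>: "inj \<sigma>" and p: "\<sigma> p = length X" "p \<notin> {m..<n}"
  shows "map (\<lambda>i. (X @ v # Y) ! \<sigma> i) [m..<n] = map (\<lambda>i. (X @ 0 # Y) ! \<sigma> i) [m..<n]"
proof -
  have "(X @ v # Y) ! \<sigma> i = (X @ 0 # Y) ! \<sigma> i" if "i \<noteq> p" for i
    using nth_split[of X v Y "\<sigma> i" 0] that p(1) \<sigma> by (metis inj_eq)
  then show ?thesis using p by (auto intro!: map_cong)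
qed

text \<open>For each permutation exactly one position \<open>p\<close> reads the slot
  \<open>length X\<close>. According to whether \<open>p < k\<close>, the varying vector enters the
  first or the second factor, and the other factor is constant.\<close>

lemma wedge_multilin:
  assumes \<alpha>: "multilin k \<alpha>" and \<beta>: "multilin l \<beta>" shows "multilin (k + l) (wedge k l \<alpha> \<beta>)"
  unfolding multilin_def
proof (intro allI impI)
  fix X Y :: "vec8 list" assume len: "length X + Suc (length Y) = k + l"
  have *: "linear (\<lambda>v. of_int (sign \<sigma>) * \<alpha> (map (\<lambda>i. (X @ v # Y) ! \<sigma> i) [0..<k])
             * \<beta> (map (\<lambda>i. (X @ v # Y) ! \<sigma> i) [k..<k + l]))" if s: "\<sigma> permutes {..<k + l}" for \<sigma>
  proof -
    obtain p where p: "\<sigma> p = length X" using permutes_surj[OF s] by (metis surjD)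
    have pn: "p < k + l" using permutes_in_image[OF s, of p] p len by auto
    have inj: "inj \<sigma>" using permutes_inj[OF s] .
    show ?thesis
    proof (cases "p < k")
      case True
      define c where "c = \<beta> (map (\<lambda>i. (X @ 0 # Y) ! \<sigma> i) [k..<k + l])"
      have c: "\<beta> (map (\<lambda>i. (X @ v # Y) ! \<sigma> i) [k..<k + l]) = c" for v
        unfolding c_def by (rule arg_cong[OF const_slot[OF inj p]]) (use True in auto)
      have "linear (\<lambda>v. \<alpha> (map (\<lambda>i. (X @ v # Y) ! \<sigma> i) [0..<k]))"
        by (rule linear_slot[OF _ inj p]) (use \<alpha> True in auto)
      from linear_scale_real[OF this, of "of_int (sign \<sigma>) * c"]
      show ?thesis unfolding c by (simp only: mult_ac)
    next
      case False
      define c where "c = \<alpha> (map (\<lambda>i. (X @ 0 # Y) ! \<sigma> i) [0..<k])"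
      have c: "\<alpha> (map (\<lambda>i. (X @ v # Y) ! \<sigma> i) [0..<k]) = c" for v
        unfolding c_def by (rule arg_cong[OF const_slot[OF inj p]]) (use False in auto)
      have "linear (\<lambda>v. \<beta> (map (\<lambda>i. (X @ v # Y) ! \<sigma> i) [k..<k + l]))"
        by (rule linear_slot[OF _ inj p]) (use \<beta> False pn in auto)
      then show ?thesis unfolding c by (rule linear_scale_real)
    qed
  qed
  have "linear (\<lambda>v. inverse (fact k * fact l) * (\<Sum>\<sigma> | \<sigma> permutes {..<k + l}. of_int (sign \<sigma>)
             * \<alpha> (map (\<lambda>i. (X @ v # Y) ! \<sigma> i) [0..<k]) * \<beta> (map (\<lambda>i. (X @ v # Y) ! \<sigma> i) [k..<k + l])))"
    by (intro linear_scale_real linear_compose_sum) (use * in auto)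
  then show "linear (\<lambda>v. wedge k l \<alpha> \<beta> (X @ v # Y))"
    using len by (simp add: wedge_def divide_inverse mult.commute)
qed

text \<open>Composing all permutations with the transposition of the two equal slots permutes the
  summands and reverses every sign, so the sum equals its own negative.\<close>

lemma wedge_alt_forms:
  assumes \<alpha>: "multilin k \<alpha>" and \<beta>: "multilin l \<beta>" shows "wedge k l \<alpha> \<beta> \<in> alt_forms (k + l)"
proof (rule alt_formsI)
  show "multilin (k + l) (wedge k l \<alpha> \<beta>)" by (rule wedge_multilin[OF assms])
  show "wedge k l \<alpha> \<beta> vs = 0" if "length vs \<noteq> k + l" for vs using that by (simp add: wedge_def)
  fix X Y :: "vec8 list" and v assume len: "length X + Suc (Suc (length Y)) = k + l"
  let ?vs = "X @ v # v # Y" and ?\<tau> = "Transposition.transpose (length X) (Suc (length X))"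
  let ?S = "\<Sum>\<sigma> | \<sigma> permutes {..<k + l}. of_int (sign \<sigma>)
             * \<alpha> (map (\<lambda>i. ?vs ! \<sigma> i) [0..<k]) * \<beta> (map (\<lambda>i. ?vs ! \<sigma> i) [k..<k + l])"
  have t: "?\<tau> permutes {..<k + l}" using len by (intro permutes_swap_id) auto
  have nt: "?vs ! ?\<tau> i = ?vs ! i" for i
    by (auto simp: Transposition.transpose_def nth_append)
  have "?S = (\<Sum>\<sigma> | \<sigma> permutes {..<k + l}. of_int (sign (?\<tau> \<circ> \<sigma>))
             * \<alpha> (map (\<lambda>i. ?vs ! (?\<tau> \<circ> \<sigma>) i) [0..<k]) * \<beta> (map (\<lambda>i. ?vs ! (?\<tau> \<circ> \<sigma>) i) [k..<k + l]))"
    by (rule setum_permutations_compose_left[OF t])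
  also have "\<dots> = (\<Sum>\<sigma> | \<sigma> permutes {..<k + l}. - (of_int (sign \<sigma>)
             * \<alpha> (map (\<lambda>i. ?vs ! \<sigma> i) [0..<k]) * \<beta> (map (\<lambda>i. ?vs ! \<sigma> i) [k..<k + l])))"
  proof (rule sum.cong[OF refl])
    fix \<sigma> assume "\<sigma> \<in> {\<sigma>. \<sigma> permutes {..<k + l}}"
    then have "sign (?\<tau> \<circ> \<sigma>) = - sign \<sigma>"
      by (subst sign_compose)
        (auto simp: sign_swap_id permutation_swap_id intro: permutes_imp_permutation[of "{..<k + l}"])
    then show "of_int (sign (?\<tau> \<circ> \<sigma>))
             * \<alpha> (map (\<lambda>i. ?vs ! (?\<tau> \<circ> \<sigma>) i) [0..<k]) * \<beta> (map (\<lambda>i. ?vs ! (?\<tau> \<circ> \<sigma>) i) [k..<k + l])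
       = - (of_int (sign \<sigma>) * \<alpha> (map (\<lambda>i. ?vs ! \<sigma> i) [0..<k]) * \<beta> (map (\<lambda>i. ?vs ! \<sigma> i) [k..<k + l]))"
      by (simp only: comp_apply nt)
  qed
  also have "\<dots> = - ?S" by (rule sum_negf)
  finally have "?S = 0" by simp
  then show "wedge k l \<alpha> \<beta> ?vs = 0" by (simp add: wedge_def)
qed

text \<open>Reindexing the lists by \<sigma> moves the permutation onto \<open>E\<close>, where its
  sign cancels the sign in the wedge product; the (k + l)! permutations then contribute equally.
  \<open>E\<close> is a function of index lists so that it can be a volume form with its last
  arguments fixed.\<close>

lemma wedge_contract:
  fixes E :: "8 list \<Rightarrow> real"
  assumes E: "\<And>\<sigma> I. \<sigma> permutes {..<k + l} \<Longrightarrow> length I = k + l \<Longrightarrow>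
      E (map (\<lambda>i. I ! \<sigma> i) [0..<k + l]) = of_int (sign \<sigma>) * E I"
  shows "(\<Sum>K | length K = k + l. wedge k l \<alpha> \<beta> (map f K) * E K)
     = fact (k + l) / (fact k * fact l)
       * (\<Sum>I | length I = k. \<Sum>J | length J = l. \<alpha> (map f I) * \<beta> (map f J) * E (I @ J))"
proof -
  define G where "G L = \<alpha> (map f (take k L)) * \<beta> (map f (drop k L)) * E L" for L
  have *: "wedge k l \<alpha> \<beta> (map f K) * E K
      = (\<Sum>\<sigma> | \<sigma> permutes {..<k + l}. G (map (\<lambda>i. K ! \<sigma> i) [0..<k + l])) / (fact k * fact l)"
    if K: "length K = k + l" for K
  proof -
    have "of_int (sign \<sigma>) * \<alpha> (map (\<lambda>i. map f K ! \<sigma> i) [0..<k]) * \<beta> (map (\<lambda>i. map f K ! \<sigma> i) [k..<k + l]) * E K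
        = G (map (\<lambda>i. K ! \<sigma> i) [0..<k + l])" if s: "\<sigma> permutes {..<k + l}" for \<sigma>
    proof -
      have lt: "\<sigma> i < length K" if "i < k + l" for i
        using permutes_in_image[OF s, of i] that K by auto
      have "map f (take k (map (\<lambda>i. K ! \<sigma> i) [0..<k + l])) = map (\<lambda>i. map f K ! \<sigma> i) [0..<k]"
        "map f (drop k (map (\<lambda>i. K ! \<sigma> i) [0..<k + l])) = map (\<lambda>i. map f K ! \<sigma> i) [k..<k + l]"
        using lt by (simp_all add: take_map drop_map)
      then show ?thesis unfolding G_def E[OF s K] by simp
    qed
    then show ?thesis using K unfolding wedge_def
      by (simp add: sum_distrib_right sum_divide_distrib)
  qed
  have "(\<Sum>K | length K = k + l. wedge k l \<alpha> \<beta> (map f K) * E K)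
     = (\<Sum>K | length K = k + l. \<Sum>\<sigma> | \<sigma> permutes {..<k + l}. G (map (\<lambda>i. K ! \<sigma> i) [0..<k + l])) / (fact k * fact l)"
    using * by (simp add: sum_divide_distrib)
  also have "(\<Sum>K | length K = k + l. \<Sum>\<sigma> | \<sigma> permutes {..<k + l}. G (map (\<lambda>i. K ! \<sigma> i) [0..<k + l]))
     = (\<Sum>\<sigma> | \<sigma> permutes {..<k + l}. \<Sum>K | length K = k + l. G (map (\<lambda>i. K ! \<sigma> i) [0..<k + l]))"
    by (rule sum.swap)
  also have "\<dots> = (\<Sum>\<sigma> | \<sigma> permutes {..<k + l}. \<Sum>K | length K = k + l. G K)"
    by (intro sum.cong refl sum_lists_permute) simp
  also have "\<dots> = fact (k + l) * (\<Sum>K | length K = k + l. G K)"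
    by (simp add: card_permutations[of "{..<k + l}"])
  also have "(\<Sum>K | length K = k + l. G K) = (\<Sum>I | length I = k. \<Sum>J | length J = l. G (I @ J))"
    by (rule sum_lists_add)
  also have "\<dots> = (\<Sum>I | length I = k. \<Sum>J | length J = l. \<alpha> (map f I) * \<beta> (map f J) * E (I @ J))"
    by (intro sum.cong refl) (simp add: G_def)
  finally show ?thesis by simp
qed

subsection \<open>The derivation action of endomorphisms\<close>

text \<open>The derivative at t = 0 of the pullback of \<alpha> along exp(t B), that is, the
  infinitesimal action of gl(8) on forms. It covers both the \<open>diamond\<close> operation and
  the connection terms of a covariant derivative.\<close>

definition act :: "(vec8 \<Rightarrow> vec8) \<Rightarrow> form8 \<Rightarrow> form8" where
  "act B \<alpha> = (\<lambda>vs. \<Sum>j<length vs. \<alpha> (vs[j := B (vs ! j)]))"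

lemma sum_lessThan_add: "(\<Sum>j<m + n. h j) = (\<Sum>j<m. h j) + (\<Sum>j<n. h (m + j) :: real)" for m n :: nat
  by (induction n) (simp_all add: add.assoc)

lemma act_append:
  "act B \<alpha> (X @ Y) = act B (\<lambda>vs. \<alpha> (vs @ Y)) X + act B (\<lambda>vs. \<alpha> (X @ vs)) Y"
proof -
  have "act B \<alpha> (X @ Y) = (\<Sum>j<length X. \<alpha> ((X @ Y)[j := B ((X @ Y) ! j)]))
      + (\<Sum>j<length Y. \<alpha> ((X @ Y)[length X + j := B ((X @ Y) ! (length X + j))]))"
    unfolding act_def by (simp add: sum_lessThan_add)
  then show ?thesis by (simp add: act_def list_update_append nth_append)
qed

lemma act_Cons: "act B \<alpha> (v # Y) = \<alpha> (B v # Y) + act B (\<lambda>vs. \<alpha> (v # vs)) Y"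
  using act_append[of B \<alpha> "[v]" Y] by (simp add: act_def)

lemma act_multilin:
  assumes B: "linear B" and \<alpha>: "multilin k \<alpha>" shows "multilin k (act B \<alpha>)"
  unfolding multilin_def
proof (intro allI impI)
  fix X Y :: "vec8 list" assume len: "length X + Suc (length Y) = k"
  have "linear (\<lambda>v. \<Sum>j<length X. \<alpha> (X[j := B (X ! j)] @ v # Y))"
    by (intro linear_compose_sum ballI multilinD[OF \<alpha>]) (use len in simp)
  moreover have "linear (\<lambda>v. \<Sum>j<length Y. \<alpha> (X @ v # Y[j := B (Y ! j)]))"
    by (intro linear_compose_sum ballI multilinD[OF \<alpha>]) (use len in simp)
  moreover have "linear (\<lambda>v. \<alpha> (X @ B v # Y))"
    using linear_compose[OF B multilinD[OF \<alpha> len]] by (simp add: comp_def)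
  ultimately have "linear (\<lambda>v. (\<Sum>j<length X. \<alpha> (X[j := B (X ! j)] @ v # Y))
      + (\<alpha> (X @ B v # Y) + (\<Sum>j<length Y. \<alpha> (X @ v # Y[j := B (Y ! j)]))))"
    by (intro linear_compose_add)
  then show "linear (\<lambda>v. act B \<alpha> (X @ v # Y))"
    unfolding act_append act_Cons by (simp add: act_def)
qed

lemma act_alt_forms:
  assumes B: "linear B" and \<alpha>: "\<alpha> \<in> alt_forms k" shows "act B \<alpha> \<in> alt_forms k"
proof (rule alt_formsI)
  show "multilin k (act B \<alpha>)" by (rule act_multilin[OF B alt_forms_multilin[OF \<alpha>]])
  show "act B \<alpha> vs = 0" if "length vs \<noteq> k" for vs
    unfolding act_def using that alt_forms_length[OF \<alpha>] by simp
  show "act B \<alpha> (X @ v # v # Y) = 0" for X v Y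
  proof -
    have z: "\<alpha> (Z @ v # v # W) = 0" for Z W using alt_forms_repeat_adj[OF \<alpha>] .
    have z': "\<alpha> (X @ v # v # W) = 0" for W using alt_forms_repeat_adj[OF \<alpha>] .
    show ?thesis unfolding act_append act_Cons
      using alt_forms_swap[OF \<alpha>, of X "B v" v Y] by (simp add: act_def z)
  qed
qed

text \<open>For a fixed permutation every slot j is \<sigma> m for exactly one position m. Summing
  over m instead of j separates the terms in which \<open>B\<close> acts inside the first factor
  from those in which it acts inside the second.\<close>

lemma wedge_act:
  "act B (wedge k l \<alpha> \<beta>) = wedge k l (act B \<alpha>) \<beta> + wedge k l \<alpha> (act B \<beta>)"
proof
  fix vs :: "vec8 list"
  show "act B (wedge k l \<alpha> \<beta>) vs = (wedge k l (act B \<alpha>) \<beta> + wedge k l \<alpha> (act B \<beta>)) vs"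
  proof (cases "length vs = k + l")
    case False then show ?thesis by (simp add: act_def wedge_def)
  next
    case len: True
    let ?A = "\<lambda>\<sigma> vs. map (\<lambda>i. vs ! \<sigma> i) [0..<k]" and ?B = "\<lambda>\<sigma> vs. map (\<lambda>i. vs ! \<sigma> i) [k..<k + l]"
    have *: "(\<Sum>j<k + l. \<alpha> (?A \<sigma> (vs[j := B (vs ! j)])) * \<beta> (?B \<sigma> (vs[j := B (vs ! j)])))
       = act B \<alpha> (?A \<sigma> vs) * \<beta> (?B \<sigma> vs) + \<alpha> (?A \<sigma> vs) * act B \<beta> (?B \<sigma> vs)" if s: "\<sigma> permutes {..<k + l}" for \<sigma>
    proof -
      let ?F = "\<lambda>j. \<alpha> (?A \<sigma> (vs[j := B (vs ! j)])) * \<beta> (?B \<sigma> (vs[j := B (vs ! j)]))"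
      have lt: "\<sigma> i < length vs" if "i < k + l" for i
        using permutes_in_image[OF s, of i] that len by auto
      have nth: "vs[\<sigma> m := B (vs ! \<sigma> m)] ! \<sigma> i = (if i = m then B (vs ! \<sigma> m) else vs ! \<sigma> i)"
        if "i < k + l" "m < k + l" for i m
        using lt[OF that(1)] lt[OF that(2)] permutes_inj[OF s] by (auto simp: nth_list_update inj_eq)
      have 1: "?F (\<sigma> m) = \<alpha> ((?A \<sigma> vs)[m := B (?A \<sigma> vs ! m)]) * \<beta> (?B \<sigma> vs)" if m: "m < k" for m
      proof -
        have "?A \<sigma> (vs[\<sigma> m := B (vs ! \<sigma> m)]) = (?A \<sigma> vs)[m := B (?A \<sigma> vs ! m)]"
          by (rule nth_equalityI) (use m nth in \<open>auto simp: nth_list_update\<close>)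
        moreover have "?B \<sigma> (vs[\<sigma> m := B (vs ! \<sigma> m)]) = ?B \<sigma> vs"
          using m nth by (intro map_cong) auto
        ultimately show ?thesis by (simp only:)
      qed
      have 2: "?F (\<sigma> (k + m)) = \<alpha> (?A \<sigma> vs) * \<beta> ((?B \<sigma> vs)[m := B (?B \<sigma> vs ! m)])" if m: "m < l" for m
      proof -
        have "?B \<sigma> (vs[\<sigma> (k + m) := B (vs ! \<sigma> (k + m))]) = (?B \<sigma> vs)[m := B (?B \<sigma> vs ! m)]"
          by (rule nth_equalityI) (use m nth in \<open>auto simp: nth_list_update\<close>)
        moreover have "?A \<sigma> (vs[\<sigma> (k + m) := B (vs ! \<sigma> (k + m))]) = ?A \<sigma> vs"
          using m nth by (intro map_cong) auto
        ultimately show ?thesis by (simp only:)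
      qed
      have "(\<Sum>j<k + l. ?F j) = (\<Sum>m<k + l. ?F (\<sigma> m))"
        using sum.permute[OF s, of ?F] by (simp add: comp_def)
      also have "\<dots> = (\<Sum>m<k. ?F (\<sigma> m)) + (\<Sum>m<l. ?F (\<sigma> (k + m)))"
        by (rule sum_lessThan_add)
      also have "\<dots> = act B \<alpha> (?A \<sigma> vs) * \<beta> (?B \<sigma> vs) + \<alpha> (?A \<sigma> vs) * act B \<beta> (?B \<sigma> vs)"
        unfolding act_def sum_distrib_left sum_distrib_right using 1 2 by (intro arg_cong2[where f="(+)"] sum.cong) simp_all
      finally show ?thesis .
    qed
    have "act B (wedge k l \<alpha> \<beta>) vs = (\<Sum>\<sigma> | \<sigma> permutes {..<k + l}. of_int (sign \<sigma>) *
       (\<Sum>j<k + l. \<alpha> (?A \<sigma> (vs[j := B (vs ! j)])) * \<beta> (?B \<sigma> (vs[j := B (vs ! j)])))) / (fact k * fact l)"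
      unfolding act_def wedge_def using len
      by (simp add: sum_distrib_left mult.assoc sum_divide_distrib sum.swap[of _ "{..<k + l}" "{\<sigma>. \<sigma> permutes {..<k + l}}"])
    also have "\<dots> = (\<Sum>\<sigma> | \<sigma> permutes {..<k + l}. of_int (sign \<sigma>) *
       (act B \<alpha> (?A \<sigma> vs) * \<beta> (?B \<sigma> vs) + \<alpha> (?A \<sigma> vs) * act B \<beta> (?B \<sigma> vs))) / (fact k * fact l)"
      using * by (intro arg_cong2[where f="(/)"] sum.cong refl) simp
    also have "\<dots> = (wedge k l (act B \<alpha>) \<beta> + wedge k l \<alpha> (act B \<beta>)) vs"
      unfolding wedge_def using len
      by (simp add: sum.distrib algebra_simps add_divide_distrib)
    finally show ?thesis .
  qed
qed

subsection \<open>Skew-symmetrisation in an additional argument\<close>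

definition del :: "nat \<Rightarrow> 'b list \<Rightarrow> 'b list" where
  "del i vs = take i vs @ drop (Suc i) vs"

text \<open>For \<open>F u\<close> the derivative of a form in direction u this is the coordinate
  formula of the exterior derivative, with no normalising factor.\<close>

definition skew :: "(vec8 \<Rightarrow> form8) \<Rightarrow> form8" where
  "skew F = (\<lambda>vs. \<Sum>i<length vs. (-1) ^ i * F (vs ! i) (del i vs))"

lemma length_del: "i < length vs \<Longrightarrow> length (del i vs) = length vs - 1"
  by (simp add: del_def)

lemma nth_del: "i < length vs \<Longrightarrow> j < length vs - 1 \<Longrightarrow> del i vs ! j = (if j < i then vs ! j else vs ! Suc j)"
  by (auto simp: del_def nth_append)

lemma del_append: "del i (X @ Y) = (if i < length X then del i X @ Y else X @ del (i - length X) Y)"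
  by (simp add: del_def Suc_diff_le)

lemma del_del:
  assumes "i \<le> j" "Suc j < length vs" shows "del j (del i vs) = del i (del (Suc j) vs)"
  by (rule nth_equalityI) (use assms in \<open>auto simp: length_del nth_del\<close>)

text \<open>The term (i, j) with i \<le> j cancels the term (j + 1, i), and these pairs exhaust the
  range. This is the combinatorial half of d d = 0.\<close>

lemma sum_skew_cancel:
  fixes T :: "nat \<Rightarrow> nat \<Rightarrow> real"
  assumes "\<And>i j. i \<le> j \<Longrightarrow> j < m \<Longrightarrow> T (Suc j) i = - T i j"
  shows "(\<Sum>i<Suc m. \<Sum>j<m. T i j) = 0"
  using assms
proof (induction m)
  case (Suc m)
  have "(\<Sum>i<Suc (Suc m). \<Sum>j<Suc m. T i j)
     = (\<Sum>i<Suc m. \<Sum>j<m. T i j) + (\<Sum>i<Suc m. T i m + T (Suc m) i)"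
    by (simp add: sum.distrib)
  also have "(\<Sum>i<Suc m. T i m + T (Suc m) i) = 0"
    using Suc.prems[of _ m] by (intro sum.neutral) auto
  finally show ?case using Suc.IH Suc.prems by simp
qed simp

text \<open>It serves twice: with second partial derivatives it is d d = 0, and with \<alpha>(C u v,
  ...) it removes a symmetric connection from d.\<close>

lemma skew_skew_zero:
  assumes "\<And>u v ws. S u v ws = S v u ws"
  shows "skew (\<lambda>u. skew (S u)) = 0"
proof
  fix vs
  show "skew (\<lambda>u. skew (S u)) vs = 0 vs"
  proof (cases "length vs")
    case (Suc m)
    define T where "T i j = (-1) ^ i * ((-1) ^ j * S (vs ! i) (del i vs ! j) (del j (del i vs)))" for i j
    have "skew (\<lambda>u. skew (S u)) vs = (\<Sum>i<Suc m. \<Sum>j<m. T i j)"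
      unfolding skew_def T_def using Suc by (simp add: length_del sum_distrib_left del: sum.lessThan_Suc)
    also have "\<dots> = 0"
      by (rule sum_skew_cancel) (use Suc assms in \<open>auto simp: T_def nth_del del_del\<close>)
    finally show ?thesis by simp
  qed (simp add: skew_def)
qed

lemma alt_forms_list_update:
  assumes "\<alpha> \<in> alt_forms k" "j < length W"
  shows "\<alpha> (W[j := x]) = (-1) ^ j * \<alpha> (x # del j W)"
  using alt_forms_move[OF assms(1), of "[]" "take j W" x "drop (Suc j) W"] assms(2)
  by (simp add: upd_conv_take_nth_drop del_def)

text \<open>Moving the modified argument to the front shows that the action of \<open>C u\<close> is
  itself a skew-symmetrisation, in v, of \<alpha>(C u v, ...). The double skew-symmetrisation
  vanishes by the symmetry of \<open>C\<close>.\<close>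

lemma skew_act_zero:
  assumes \<alpha>: "\<alpha> \<in> alt_forms k" and C: "\<And>u v. C u v = C v u"
  shows "skew (\<lambda>u. act (C u) \<alpha>) = 0"
proof -
  have "act (C u) \<alpha> = skew (\<lambda>v ws. \<alpha> (C u v # ws))" for u
    unfolding act_def skew_def using alt_forms_list_update[OF \<alpha>] by (intro ext sum.cong) auto
  then show ?thesis using skew_skew_zero[of "\<lambda>u v ws. \<alpha> (C u v # ws)"] C by simp
qed

lemma skew_alt_forms:
  assumes lin: "\<And>ws. linear (\<lambda>u. F u ws)" and alt: "\<And>u. F u \<in> alt_forms k"
  shows "skew F \<in> alt_forms (Suc k)"
proof (rule alt_formsI)
  show "skew F vs = 0" if "length vs \<noteq> Suc k" for vs
    unfolding skew_def using that alt_forms_length[OF alt]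
    by (intro sum.neutral) (auto simp: length_del)
  show "multilin (Suc k) (skew F)" unfolding multilin_def
  proof (intro allI impI)
    fix X Y :: "vec8 list" assume len: "length X + Suc (length Y) = Suc k"
    have "linear (\<lambda>v. (-1) ^ i * F ((X @ v # Y) ! i) (del i (X @ v # Y)))" if i: "i < Suc k" for i
    proof (rule linear_scale_real)
      consider "i < length X" | "i = length X" | j where "i = Suc (length X + j)"
        by (metis add_Suc_right less_imp_Suc_add linorder_less_linear)
      then show "linear (\<lambda>v. F ((X @ v # Y) ! i) (del i (X @ v # Y)))"
      proof cases
        case 1
        then show ?thesis using multilinD[OF alt_forms_multilin[OF alt], of "del i X" Y] len
          by (simp add: nth_append del_append length_del)
      next
        case 2 then show ?thesis using lin by (simp add: del_def)
      next
        case 3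
        then have "(X @ v # Y) ! i = Y ! j" "del i (X @ v # Y) = X @ v # del j Y" for v
          by (simp_all add: nth_append del_def)
        then show ?thesis using multilinD[OF alt_forms_multilin[OF alt], of X "del j Y"] len i 3
          by (simp add: length_del)
      qed
    qed
    then have "linear (\<lambda>v. \<Sum>i<Suc k. (-1) ^ i * F ((X @ v # Y) ! i) (del i (X @ v # Y)))"
      by (intro linear_compose_sum) auto
    then show "linear (\<lambda>v. skew F (X @ v # Y))"
      unfolding skew_def using len by (simp del: sum.lessThan_Suc)
  qed
  show "skew F (X @ v # v # Y) = 0" if len: "length X + Suc (Suc (length Y)) = Suc k" for X v Y
  proof -
    let ?T = "\<lambda>i. (-1) ^ i * F ((X @ v # v # Y) ! i) (del i (X @ v # v # Y))"
    have 1: "?T i = 0" if "i < length X" for i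
      using that alt_forms_repeat_adj[OF alt] by (simp add: del_append)
    have 2: "?T (length X + Suc (Suc j)) = 0" for j
      using alt_forms_repeat_adj[OF alt] by (simp add: del_def)
    have "length (X @ v # v # Y) = length X + Suc (Suc (length Y))" by simp
    then have "skew F (X @ v # v # Y) = (\<Sum>i<length X. ?T i) + (\<Sum>j<Suc (Suc (length Y)). ?T (length X + j))"
      unfolding skew_def by (simp only: sum_lessThan_add)
    also have "(\<Sum>i<length X. ?T i) = 0" using 1 by simp
    also have "(\<Sum>j<Suc (Suc (length Y)). ?T (length X + j)) = ?T (length X + 0) + (?T (length X + Suc 0)
        + (\<Sum>j<length Y. ?T (length X + Suc (Suc j))))"
      by (simp only: sum.lessThan_Suc_shift)
    also have "(\<Sum>j<length Y. ?T (length X + Suc (Suc j))) = 0" using 2 by simp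
    also have "?T (length X + 0) + (?T (length X + Suc 0) + 0) = 0"
      by (simp add: nth_append del_def)
    finally show ?thesis by simp
  qed
qed

lemma sum_lists_insert:
  assumes "i \<le> k"
  shows "(\<Sum>L::8 list | length L = Suc k. H L) = (\<Sum>a\<in>UNIV. \<Sum>I | length I = k. H (take i I @ a # drop i I))"
proof -
  have "(\<Sum>L::8 list | length L = Suc k. H L) = (\<Sum>L::8 list | length L = i + Suc (k - i). H L)"
    using assms by simp
  also have "\<dots> = (\<Sum>I | length I = i. \<Sum>a\<in>UNIV. \<Sum>J | length J = k - i. H (I @ a # J))"
    unfolding sum_lists_add sum_lists_Suc by simp
  also have "\<dots> = (\<Sum>a\<in>UNIV. \<Sum>I | length I = i. \<Sum>J | length J = k - i. H (I @ a # J))"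
    by (rule sum.swap)
  also have "\<dots> = (\<Sum>a\<in>UNIV. \<Sum>I | length I = i. \<Sum>J | length J = k - i. H (take i (I @ J) @ a # drop i (I @ J)))"
    by (intro sum.cong refl) simp
  also have "\<dots> = (\<Sum>a\<in>UNIV. \<Sum>I | length I = i + (k - i). H (take i I @ a # drop i I))"
    unfolding sum_lists_add by simp
  finally show ?thesis using assms by simp
qed

text \<open>Bringing the i-th argument of \<beta> to the front costs (-1)^i, which cancels the sign
  in \<open>skew\<close>; so all k + 1 summands agree. Components of an exterior derivative are
  thereby read off from contractions of \<beta> with single frame vectors.\<close>

lemma skew_contract:
  assumes \<beta>: "\<beta> \<in> alt_forms (Suc k)"
  shows "(\<Sum>L | length L = Suc k. skew F (map f L) * \<beta> (map f L))
    = of_nat (Suc k) * (\<Sum>a\<in>UNIV. \<Sum>I::8 list | length I = k. F (f a) (map f I) * \<beta> (f a # map f I))"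
proof -
  let ?R = "\<Sum>a\<in>UNIV. \<Sum>I::8 list | length I = k. F (f a) (map f I) * \<beta> (f a # map f I)"
  have *: "(\<Sum>L::8 list | length L = Suc k. (-1) ^ i * F (map f L ! i) (del i (map f L)) * \<beta> (map f L)) = ?R"
    if i: "i < Suc k" for i
  proof -
    have "(-1) ^ i * F (map f (take i I @ a # drop i I) ! i) (del i (map f (take i I @ a # drop i I)))
        * \<beta> (map f (take i I @ a # drop i I)) = F (f a) (map f I) * \<beta> (f a # map f I)"
      if I: "length I = k" for I :: "8 list" and a
    proof -
      have "\<beta> (map f (take i I @ a # drop i I)) = (-1) ^ i * \<beta> (f a # map f (take i I) @ map f (drop i I))"
        using alt_forms_move[OF \<beta>, of "[]" "map f (take i I)" "f a" "map f (drop i I)"] I i by simp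
      also have "map f (take i I) @ map f (drop i I) = map f I" by (metis append_take_drop_id map_append)
      finally show ?thesis using I i by (simp add: nth_append del_def take_map drop_map flip: map_append)
    qed
    then show ?thesis unfolding sum_lists_insert[OF less_Suc_eq_le[THEN iffD1, OF i]]
      by (intro sum.cong refl) simp
  qed
  have "(\<Sum>L | length L = Suc k. skew F (map f L) * \<beta> (map f L))
    = (\<Sum>L::8 list | length L = Suc k. \<Sum>i<Suc k. (-1) ^ i * F (map f L ! i) (del i (map f L)) * \<beta> (map f L))"
    by (intro sum.cong refl) (simp add: skew_def sum_distrib_right del: sum.lessThan_Suc)
  also have "\<dots> = (\<Sum>i<Suc k. ?R)"
    by (subst sum.swap) (intro sum.cong refl *, simp)
  finally show ?thesis by simp
qed

section \<open>The Cayley form: self-duality, its operator on 2-forms, and contraction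
  identities\<close>

section \<open>The Cayley form in coordinates\<close>

abbreviation e8 :: "8 \<Rightarrow> vec8" where "e8 i \<equiv> axis i 1"

lemma axis_nth_if: "axis i (1::real) $ j = (if i = j then 1 else 0)"
  by (simp add: axis_def)

lemma span_e8: "span (range e8) = UNIV"
proof -
  have "(Basis :: vec8 set) = range e8" by (auto simp: Basis_vec_def)
  then show ?thesis using span_Basis by metis
qed

lemma ecov_alt_forms: "ecov I \<in> alt_forms (length I)"
proof (rule alt_formsI)
  let ?n = "length I"
  show "ecov I vs = 0" if "length vs \<noteq> ?n" for vs using that by (simp add: ecov_def)
  show "multilin ?n (ecov I)" unfolding multilin_def
  proof (intro allI impI)
    fix X Y :: "vec8 list" assume len: "length X + Suc (length Y) = ?n"
    have "linear (\<lambda>v. \<Prod>a<?n. ((X @ v # Y) ! \<sigma> a) $ (I ! a))" if s: "\<sigma> permutes {..<?n}" for \<sigma>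
    proof -
      obtain p where p: "\<sigma> p = length X" using permutes_surj[OF s] by (metis surjD)
      have pn: "p < ?n" using permutes_in_image[OF s, of p] p len by auto
      define c where "c = (\<Prod>a\<in>{..<?n} - {p}. ((X @ 0 # Y) ! \<sigma> a) $ (I ! a))"
      have c: "(\<Prod>a<?n. ((X @ v # Y) ! \<sigma> a) $ (I ! a)) = c * v $ (I ! p)" for v
      proof -
        have "(X @ v # Y) ! \<sigma> a = (X @ 0 # Y) ! \<sigma> a" if "a \<noteq> p" for a
          using nth_split[of X v Y "\<sigma> a" 0] that p permutes_inj[OF s] by (metis inj_eq)
        then have "(\<Prod>a\<in>{..<?n} - {p}. ((X @ v # Y) ! \<sigma> a) $ (I ! a)) = c"
          unfolding c_def by (intro prod.cong refl) auto
        then show ?thesis using pn p by (simp add: prod.remove[of _ p] mult.commute)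
      qed
      show ?thesis unfolding c by (intro linear_scale_real) (simp add: linear_iff)
    qed
    then have "linear (\<lambda>v. \<Sum>\<sigma> | \<sigma> permutes {..<?n}. of_int (sign \<sigma>) * (\<Prod>a<?n. ((X @ v # Y) ! \<sigma> a) $ (I ! a)))"
      by (intro linear_compose_sum ballI linear_scale_real) simp
    then show "linear (\<lambda>v. ecov I (X @ v # Y))" using len by (simp add: ecov_def)
  qed
  fix X Y :: "vec8 list" and v assume len: "length X + Suc (Suc (length Y)) = ?n"
  let ?vs = "X @ v # v # Y" and ?\<tau> = "Transposition.transpose (length X) (Suc (length X))"
  let ?S = "\<Sum>\<sigma> | \<sigma> permutes {..<?n}. of_int (sign \<sigma>) * (\<Prod>a<?n. (?vs ! \<sigma> a) $ (I ! a))"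
  have t: "?\<tau> permutes {..<?n}" using len by (intro permutes_swap_id) auto
  have nt: "?vs ! ?\<tau> i = ?vs ! i" for i
    by (auto simp: Transposition.transpose_def nth_append)
  have "?S = (\<Sum>\<sigma> | \<sigma> permutes {..<?n}. of_int (sign (?\<tau> \<circ> \<sigma>)) * (\<Prod>a<?n. (?vs ! (?\<tau> \<circ> \<sigma>) a) $ (I ! a)))"
    by (rule setum_permutations_compose_left[OF t])
  also have "\<dots> = (\<Sum>\<sigma> | \<sigma> permutes {..<?n}. - (of_int (sign \<sigma>) * (\<Prod>a<?n. (?vs ! \<sigma> a) $ (I ! a))))"
  proof (rule sum.cong[OF refl])
    fix \<sigma> assume "\<sigma> \<in> {\<sigma>. \<sigma> permutes {..<?n}}"
    then have "sign (?\<tau> \<circ> \<sigma>) = - sign \<sigma>"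
      by (subst sign_compose)
        (auto simp: sign_swap_id permutation_swap_id intro: permutes_imp_permutation[of "{..<?n}"])
    then show "of_int (sign (?\<tau> \<circ> \<sigma>)) * (\<Prod>a<?n. (?vs ! (?\<tau> \<circ> \<sigma>) a) $ (I ! a))
       = - (of_int (sign \<sigma>) * (\<Prod>a<?n. (?vs ! \<sigma> a) $ (I ! a)))"
      by (simp only: comp_apply nt)
  qed
  also have "\<dots> = - ?S" by (rule sum_negf)
  finally have "?S = 0" by simp
  then show "ecov I ?vs = 0" by (simp add: ecov_def)
qed

lemma prod_delta_list:
  assumes "\<sigma> permutes {..<length J}" "length I = length J"
  shows "(\<Prod>a<length J. (map e8 I ! \<sigma> a) $ (J ! a)) = (if map (\<lambda>i. I ! \<sigma> i) [0..<length J] = J then 1 else 0)"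
proof -
  have "(\<Prod>a<length J. (map e8 I ! \<sigma> a) $ (J ! a)) = (\<Prod>a<length J. if I ! \<sigma> a = J ! a then 1 else 0)"
    using assms permutes_in_image[OF assms(1)] by (intro prod.cong refl) (auto simp: axis_nth_if)
  also have "\<dots> = (if \<forall>a<length J. I ! \<sigma> a = J ! a then 1 else 0)"
    by (auto simp: prod_zero_iff)
  also have "(\<forall>a<length J. I ! \<sigma> a = J ! a) \<longleftrightarrow> map (\<lambda>i. I ! \<sigma> i) [0..<length J] = J"
    by (subst list_eq_iff_nth_eq) simp
  finally show ?thesis .
qed

text \<open>Each permutation in the determinant selects a single index list, and the sign of
  \<open>F\<close> on that list cancels the sign of the permutation. This leaves one copy of
  \<open>F J\<close> per permutation.\<close>

lemma ecov_contract:
  fixes F :: "8 list \<Rightarrow> real"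
  assumes F: "\<And>\<sigma> I. \<sigma> permutes {..<length J} \<Longrightarrow> length I = length J \<Longrightarrow>
      F (map (\<lambda>i. I ! \<sigma> i) [0..<length J]) = of_int (sign \<sigma>) * F I"
  shows "(\<Sum>I | length I = length J. ecov J (map e8 I) * F I) = fact (length J) * F J"
proof -
  let ?n = "length J"
  let ?p = "\<lambda>\<sigma> I. map (\<lambda>i. I ! \<sigma> i) [0..<?n]"
  have "(\<Sum>I | length I = ?n. ecov J (map e8 I) * F I)
     = (\<Sum>I | length I = ?n. \<Sum>\<sigma> | \<sigma> permutes {..<?n}. if ?p \<sigma> I = J then F (?p \<sigma> I) else 0)"
  proof (rule sum.cong[OF refl])
    fix I :: "8 list" assume "I \<in> {I. length I = ?n}"
    then have I: "length I = ?n" by simp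
    have "ecov J (map e8 I) * F I = (\<Sum>\<sigma> | \<sigma> permutes {..<?n}.
        of_int (sign \<sigma>) * (\<Prod>a<?n. (map e8 I ! \<sigma> a) $ (J ! a)) * F I)"
      using I by (simp add: ecov_def sum_distrib_right)
    also have "\<dots> = (\<Sum>\<sigma> | \<sigma> permutes {..<?n}. if ?p \<sigma> I = J then F (?p \<sigma> I) else 0)"
    proof (rule sum.cong[OF refl])
      fix \<sigma> assume "\<sigma> \<in> {\<sigma>. \<sigma> permutes {..<?n}}"
      then have s: "\<sigma> permutes {..<?n}" by simp
      show "of_int (sign \<sigma>) * (\<Prod>a<?n. (map e8 I ! \<sigma> a) $ (J ! a)) * F I = (if ?p \<sigma> I = J then F (?p \<sigma> I) else 0)"
        unfolding prod_delta_list[OF s I] F[OF s I] by simp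
    qed
    finally show "ecov J (map e8 I) * F I
       = (\<Sum>\<sigma> | \<sigma> permutes {..<?n}. if ?p \<sigma> I = J then F (?p \<sigma> I) else 0)" .
  qed
  also have "\<dots> = (\<Sum>\<sigma> | \<sigma> permutes {..<?n}. \<Sum>I | length I = ?n. if ?p \<sigma> I = J then F (?p \<sigma> I) else 0)"
    by (rule sum.swap)
  also have "\<dots> = (\<Sum>\<sigma> | \<sigma> permutes {..<?n}. \<Sum>I | length I = ?n. if I = J then F I else 0)"
    by (intro sum.cong refl sum_lists_permute[of _ _ "\<lambda>I. if I = J then F I else 0"]) simp
  also have "\<dots> = fact ?n * F J"
    by (simp add: card_permutations[of "{..<?n}"])
  finally show ?thesis .
qed

lemma alt_forms_permute_map:
  assumes "\<alpha> \<in> alt_forms k" "\<sigma> permutes {..<length I}"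
  shows "\<alpha> (map f (map (\<lambda>i. I ! \<sigma> i) [0..<length I])) = of_int (sign \<sigma>) * \<alpha> (map f I)"
proof -
  have *: "map f (map (\<lambda>i. I ! \<sigma> i) [0..<length I]) = map (\<lambda>i. map f I ! \<sigma> i) [0..<length (map f I)]"
    using permutes_in_image[OF assms(2)] by auto
  show ?thesis unfolding * by (rule alt_forms_permute[OF assms(1)]) (use assms(2) in simp)
qed

lemma ecov_self: assumes "distinct J" shows "ecov J (map e8 J) = 1"
proof -
  have "of_int (sign \<sigma>) * (\<Prod>a<length J. (map e8 J ! \<sigma> a) $ (J ! a)) = (if \<sigma> = id then 1 else 0)"
    if s: "\<sigma> permutes {..<length J}" for \<sigma>
  proof -
    have "map (\<lambda>i. J ! \<sigma> i) [0..<length J] = J \<longleftrightarrow> (\<forall>i<length J. \<sigma> i = i)"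
      using assms permutes_in_image[OF s] by (subst list_eq_iff_nth_eq) (simp add: nth_eq_iff_index_eq)
    also have "\<dots> \<longleftrightarrow> \<sigma> = id" using s unfolding permutes_def by (metis id_apply lessThan_iff ext)
    finally show ?thesis unfolding prod_delta_list[OF s refl] by simp
  qed
  then have "ecov J (map e8 J) = (\<Sum>\<sigma> | \<sigma> permutes {..<length J}. if \<sigma> = id then 1 else 0)"
    unfolding ecov_def by simp
  also have "\<dots> = 1" by (simp add: finite_permutations permutes_id)
  finally show ?thesis .
qed

lemma ecov_mset: assumes "mset I \<noteq> mset J" shows "ecov J (map e8 I) = 0"
proof (cases "length I = length J")
  case True
  have *: "of_int (sign \<sigma>) * (\<Prod>a<length J. (map e8 I ! \<sigma> a) $ (J ! a)) = 0"
    if s: "\<sigma> permutes {..<length J}" for \<sigma>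
  proof -
    have "mset (permute_list \<sigma> I) = mset I" using s True by (intro mset_permute_list) simp
    then have "permute_list \<sigma> I \<noteq> J" using assms by auto
    then have "map (\<lambda>i. I ! \<sigma> i) [0..<length J] \<noteq> J" using True by (simp add: permute_list_def)
    then show ?thesis unfolding prod_delta_list[OF s True] by simp
  qed
  have "(\<Sum>\<sigma> | \<sigma> permutes {..<length J}. of_int (sign \<sigma>) * (\<Prod>a<length J. (map e8 I ! \<sigma> a) $ (J ! a))) = 0"
    by (rule sum.neutral) (use * in blast)
  then show ?thesis unfolding ecov_def by (simp only: if_cancel)
qed (simp add: ecov_def)

lemma alt_forms_insort:
  assumes "\<alpha> \<in> alt_forms k" "sorted ys"
  shows "\<alpha> (X @ h x # map h ys) = (-1) ^ length (filter (\<lambda>y. y < x) ys) * \<alpha> (X @ map h (insort x ys))"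
  using assms(2)
proof (induction ys arbitrary: X)
  case (Cons y ys)
  show ?case
  proof (cases "x \<le> y")
    case True
    then have "filter (\<lambda>y. y < x) (y # ys) = []" using Cons.prems by (auto simp: filter_empty_conv)
    then show ?thesis using True by simp
  next
    case False
    have "\<alpha> (X @ h x # map h (y # ys)) = - \<alpha> ((X @ [h y]) @ h x # map h ys)"
      using alt_forms_swap[OF assms(1), of X "h x" "h y" "map h ys"] by simp
    also have "\<dots> = - ((-1) ^ length (filter (\<lambda>y. y < x) ys) * \<alpha> ((X @ [h y]) @ map h (insort x ys)))"
      using Cons.IH[of "X @ [h y]"] Cons.prems by simp
    finally show ?thesis using False by simp
  qed
qed simp

text \<open>The parity of the number of inversions, in a form that the simplifier can evaluate. It
  works on naturals because their order is that of the labels 1, ..., 8, whereas in the index type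
  \<open>8\<close> is \<open>0\<close>.\<close>

fun sort_sign :: "nat list \<Rightarrow> real" where
  "sort_sign [] = 1"
| "sort_sign (x # xs) = (-1) ^ length (filter (\<lambda>y. y < x) xs) * sort_sign xs"

lemma alt_forms_sort:
  assumes "\<alpha> \<in> alt_forms k"
  shows "\<alpha> (X @ map h xs) = sort_sign xs * \<alpha> (X @ map h (sort xs))"
proof (induction xs arbitrary: X)
  case (Cons x xs)
  have "length (filter (\<lambda>y. y < x) (sort xs)) = length (filter (\<lambda>y. y < x) xs)"
    by (metis filter_sort length_sort)
  then show ?case
    using Cons.IH[of "X @ [h x]"] alt_forms_insort[OF assms sorted_sort, of X h x xs] by simp
qed simp

abbreviation top8 :: "8 list" where "top8 \<equiv> [1,2,3,4,5,6,7,8]"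

lemma exhaust_8: "(x::8) = 1 \<or> x = 2 \<or> x = 3 \<or> x = 4 \<or> x = 5 \<or> x = 6 \<or> x = 7 \<or> x = 8"
proof (induct x)
  case (of_int z)
  then have "z = 0 \<or> z = 1 \<or> z = 2 \<or> z = 3 \<or> z = 4 \<or> z = 5 \<or> z = 6 \<or> z = 7" by fastforce
  then show ?case by auto
qed

lemma UNIV_8: "(UNIV::8 set) = {1,2,3,4,5,6,7,8}"
  using exhaust_8 by auto

lemma top8: "distinct top8" "set top8 = UNIV" "length top8 = 8"
  unfolding UNIV_8 by simp_all

lemma ecov_top_alt_forms: "ecov top8 \<in> alt_forms 8"
  using ecov_alt_forms[of top8] by (simp only: top8(3))

text \<open>Both sides vanish unless \<open>L\<close> rearranges \<open>K\<close>, and under such a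
  rearrangement both change by the same sign.\<close>

lemma ecov_top_complement:
  assumes J: "length J = 4" and K: "length K = 4" and d: "distinct (J @ K)" and L: "length L = 4"
  shows "ecov top8 (map e8 (J @ L)) = ecov top8 (map e8 (J @ K)) * ecov K (map e8 L)"
proof (cases "mset L = mset K")
  case True
  let ?V = "\<lambda>vs. ecov top8 (map e8 J @ vs)"
  have 1: "?V \<in> alt_forms (length K)" "ecov K \<in> alt_forms (length K)"
    by (rule alt_forms_append, use ecov_top_alt_forms J K in simp) (rule ecov_alt_forms)
  show ?thesis
  proof (rule alt_forms_mset[OF 1(1) True, where f = e8])
    fix \<sigma> assume "\<And>\<beta>. \<beta> \<in> alt_forms (length K) \<Longrightarrow> \<beta> (map e8 L) = of_int (sign \<sigma>) * \<beta> (map e8 K)"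
    from this[OF 1(1)] this[OF 1(2)] ecov_self[of K] d show ?thesis by simp
  qed
next
  case False
  have "\<not> distinct (J @ L)"
  proof
    assume d': "distinct (J @ L)"
    have "set (J @ L) = UNIV" "set (J @ K) = UNIV"
      using distinct_card[OF d'] distinct_card[OF d] J K L
      by (intro card_subset_eq; simp)+
    then have "set L = set K" using d d' by auto
    then show False using False d d' set_eq_iff_mset_eq_distinct[of L K] by simp
  qed
  then have "ecov top8 (map e8 (J @ L)) = 0" by (rule alt_forms_not_distinct[OF ecov_alt_forms])
  then show ?thesis using ecov_mset[OF False] by simp
qed

lemma ecov_top_sign:
  assumes "sort xs = [1,2,3,4,5,6,7,8]"
  shows "ecov top8 (map e8 (map of_nat xs)) = sort_sign xs"
proof -
  have "ecov top8 (map (\<lambda>n. e8 (of_nat n)) xs) = sort_sign xs * ecov top8 (map (\<lambda>n. e8 (of_nat n)) (sort xs))"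
    using alt_forms_sort[OF ecov_top_alt_forms, of "[]" "\<lambda>n. e8 (of_nat n)" xs] by simp
  also have "map (\<lambda>n. e8 (of_nat n)) (sort xs) = map e8 top8" unfolding assms by simp
  also have "ecov top8 (map e8 top8) = 1" by (rule ecov_self) (rule top8)
  finally show ?thesis by (simp add: comp_def)
qed

lemma ecov4_alt_forms: "ecov [p,q,r,s] \<in> alt_forms 4"
  using ecov_alt_forms[of "[p,q,r,s]"] by (simp add: eval_nat_numeral)

lemma cayley_alt_forms: "cayley_form \<in> alt_forms 4"
  unfolding cayley_form_def
  by (intro alt_forms_add alt_forms_diff) (simp_all add: ecov4_alt_forms)

text \<open>The 14 monomials form seven complementary pairs with equal coefficients, and in each
  pair J followed by K is an even permutation of 1, ..., 8. The factor 24 = 4! counts the orderings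
  of an index set.\<close>

lemma cayley_self_dual:
  assumes L: "length L = 4"
  shows "(\<Sum>I | length I = 4. cayley_form (map e8 I) * ecov top8 (map e8 (I @ L))) = 24 * cayley_form (map e8 L)"
proof -
  have c: "(\<Sum>I | length I = 4. ecov (map of_nat J) (map e8 I) * ecov top8 (map e8 (I @ L)))
     = 24 * ecov (map of_nat K) (map e8 L)"
    if s: "sort (J @ K) = [1,2,3,4,5,6,7,8]" "sort_sign (J @ K) = 1" "length J = 4" "length K = 4" for J K
  proof -
    let ?J = "map of_nat J :: 8 list" and ?K = "map of_nat K :: 8 list"
    have V: "(\<lambda>vs. ecov top8 (vs @ map e8 L)) \<in> alt_forms 4"
      by (rule alt_forms_append_right) (use ecov_top_alt_forms L in simp)
    have e: "ecov top8 (map e8 (?J @ ?K)) = 1" using ecov_top_sign[OF s(1)] s(2) by simp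
    have d: "distinct (?J @ ?K)"
    proof (rule ccontr)
      assume "\<not> distinct (?J @ ?K)"
      from alt_forms_not_distinct[OF ecov_top_alt_forms this, of e8] show False using e by simp
    qed
    have "(\<Sum>I | length I = length ?J. ecov ?J (map e8 I) * ecov top8 (map e8 (I @ L)))
        = fact (length ?J) * ecov top8 (map e8 (?J @ L))"
    proof (rule ecov_contract)
      fix \<sigma> and I :: "8 list" assume "\<sigma> permutes {..<length ?J}" "length I = length ?J"
      then show "ecov top8 (map e8 (map (\<lambda>i. I ! \<sigma> i) [0..<length ?J] @ L)) = of_int (sign \<sigma>) * ecov top8 (map e8 (I @ L))"
        using alt_forms_permute_map[OF V, of \<sigma> I e8] by simp
    qed
    then show ?thesis using ecov_top_complement[OF _ _ d L] e s by (simp add: fact_numeral)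
  qed
  let ?S = "\<lambda>J. \<Sum>I | length I = 4. ecov J (map e8 I) * ecov top8 (map e8 (I @ L))"
  have q1: "?S [1,2,3,4] = 24 * ecov [5,6,7,8] (map e8 L)"
    using c[of "[1,2,3,4]" "[5,6,7,8]"] by simp
  have q2: "?S [5,6,7,8] = 24 * ecov [1,2,3,4] (map e8 L)"
    using c[of "[5,6,7,8]" "[1,2,3,4]"] by simp
  have q3: "?S [1,2,5,6] = 24 * ecov [3,4,7,8] (map e8 L)"
    using c[of "[1,2,5,6]" "[3,4,7,8]"] by simp
  have q4: "?S [3,4,7,8] = 24 * ecov [1,2,5,6] (map e8 L)"
    using c[of "[3,4,7,8]" "[1,2,5,6]"] by simp
  have q5: "?S [1,2,7,8] = 24 * ecov [3,4,5,6] (map e8 L)"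
    using c[of "[1,2,7,8]" "[3,4,5,6]"] by simp
  have q6: "?S [3,4,5,6] = 24 * ecov [1,2,7,8] (map e8 L)"
    using c[of "[3,4,5,6]" "[1,2,7,8]"] by simp
  have q7: "?S [1,3,5,7] = 24 * ecov [2,4,6,8] (map e8 L)"
    using c[of "[1,3,5,7]" "[2,4,6,8]"] by simp
  have q8: "?S [2,4,6,8] = 24 * ecov [1,3,5,7] (map e8 L)"
    using c[of "[2,4,6,8]" "[1,3,5,7]"] by simp
  have q9: "?S [1,3,6,8] = 24 * ecov [2,4,5,7] (map e8 L)"
    using c[of "[1,3,6,8]" "[2,4,5,7]"] by simp
  have q10: "?S [2,4,5,7] = 24 * ecov [1,3,6,8] (map e8 L)"
    using c[of "[2,4,5,7]" "[1,3,6,8]"] by simp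
  have q11: "?S [1,4,5,8] = 24 * ecov [2,3,6,7] (map e8 L)"
    using c[of "[1,4,5,8]" "[2,3,6,7]"] by simp
  have q12: "?S [2,3,6,7] = 24 * ecov [1,4,5,8] (map e8 L)"
    using c[of "[2,3,6,7]" "[1,4,5,8]"] by simp
  have q13: "?S [1,4,6,7] = 24 * ecov [2,3,5,8] (map e8 L)"
    using c[of "[1,4,6,7]" "[2,3,5,8]"] by simp
  have q14: "?S [2,3,5,8] = 24 * ecov [1,4,6,7] (map e8 L)"
    using c[of "[2,3,5,8]" "[1,4,6,7]"] by simp
  have "(\<Sum>I | length I = 4. cayley_form (map e8 I) * ecov top8 (map e8 (I @ L)))
     = ?S [1,2,3,4] + ?S [1,2,5,6] + ?S [1,2,7,8] + ?S [1,3,5,7] - ?S [1,3,6,8]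
     - ?S [1,4,5,8] - ?S [1,4,6,7] - ?S [2,3,5,8] - ?S [2,3,6,7] - ?S [2,4,5,7]
     + ?S [2,4,6,8] + ?S [3,4,5,6] + ?S [3,4,7,8] + ?S [5,6,7,8]"
    by (simp only: cayley_form_def plus_fun_def fun_diff_def distrib_right left_diff_distrib sum.distrib sum_subtractf)
  also have "\<dots> = 24 * cayley_form (map e8 L)"
    unfolding q1 q2 q3 q4 q5 q6 q7 q8 q9 q10 q11 q12 q13 q14 by (simp add: cayley_form_def)
  finally show ?thesis .
qed

lemma ecov_4:
  "ecov [p,q,r,s] [u,v,w,x] =
     u $ p * (v $ q * (w $ r * x $ s - w $ s * x $ r) - v $ r * (w $ q * x $ s - w $ s * x $ q) + v $ s * (w $ q * x $ r - w $ r * x $ q))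
   - u $ q * (v $ p * (w $ r * x $ s - w $ s * x $ r) - v $ r * (w $ p * x $ s - w $ s * x $ p) + v $ s * (w $ p * x $ r - w $ r * x $ p))
   + u $ r * (v $ p * (w $ q * x $ s - w $ s * x $ q) - v $ q * (w $ p * x $ s - w $ s * x $ p) + v $ s * (w $ p * x $ q - w $ q * x $ p))
   - u $ s * (v $ p * (w $ q * x $ r - w $ r * x $ q) - v $ q * (w $ p * x $ r - w $ r * x $ p) + v $ r * (w $ p * x $ q - w $ q * x $ p))"
proof -
  have S: "{..<4::nat} = insert 0 (insert 1 (insert 2 (insert 3 {})))" by auto
  have P: "permutation (Transposition.transpose a b)" for a b :: nat by (rule permutation_swap_id)
  have l: "{..<length [p,q,r,s]} = {..<4}" by (simp add: eval_nat_numeral)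
  have pr: "(\<Prod>a<length [p,q,r,s]. h a) = h 0 * h 1 * h 2 * h 3" for h :: "nat \<Rightarrow> real"
    by (simp add: eval_nat_numeral)
  show ?thesis
    unfolding ecov_def pr l S
    apply (simp add: sum_over_permutations_insert permutes_sing del: permutes_insert)
    apply (simp add: sign_swap_id sign_compose permutation_compose P sign_id Transposition.transpose_def algebra_simps)
    done
qed

definition cay :: "8 \<Rightarrow> 8 \<Rightarrow> 8 \<Rightarrow> 8 \<Rightarrow> real" where
  "cay i j k l = cayley_form [e8 i, e8 j, e8 k, e8 l]"

text \<open>The operator that sends \<beta> to the star of \<Phi> \<and> \<beta>, in an adapted
  frame; see \<open>P2_f\<close>. The division by 2 accounts for summing over ordered pairs.\<close>

definition cay2 :: "(8 \<Rightarrow> 8 \<Rightarrow> real) \<Rightarrow> 8 \<Rightarrow> 8 \<Rightarrow> real" where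
  "cay2 b i j = (\<Sum>k\<in>UNIV. \<Sum>l\<in>UNIV. cay i j k l * b k l) / 2"

definition dl2 :: "8 \<Rightarrow> 8 \<Rightarrow> 8 \<Rightarrow> 8 \<Rightarrow> real" where
  "dl2 i j p q = (if i = p \<and> j = q then 1 else 0) - (if i = q \<and> j = p then 1 else 0)"

lemma dl2_delta: "(if i = p then 1 else 0) * (if j = q then 1 else 0) - (if i = q then 1 else 0) * (if j = p then 1 else 0) = dl2 i j p q"
  unfolding dl2_def
  by (cases "i = p"; cases "j = q"; cases "i = q"; cases "j = p";
      simp only: if_True if_False simp_thms mult_1_left mult_zero_left mult_1_right mult_zero_right)

lemma sum_delta_2:
  "(\<Sum>k\<in>(UNIV::8 set). \<Sum>l\<in>(UNIV::8 set). (if r = k then 1 else 0) * (if s = l then 1 else 0) * b k l) = (b r s :: real)"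
proof -
  have "(\<Sum>k\<in>(UNIV::8 set). \<Sum>l\<in>(UNIV::8 set). (if r = k then 1 else 0) * (if s = l then 1 else 0) * b k l)
     = (\<Sum>k\<in>UNIV. \<Sum>l\<in>UNIV. if k = r then (if l = s then b k l else 0) else 0)"
    by (intro sum.cong refl) auto
  also have "\<dots> = (\<Sum>k\<in>UNIV. if k = r then (\<Sum>l\<in>UNIV. if l = s then b k l else 0) else 0)"
    by (intro sum.cong refl) (simp split: if_split)
  also have "\<dots> = b r s" by (simp only: sum.delta finite_class.finite_UNIV UNIV_I if_True)
  finally show ?thesis .
qed

text \<open>Laplace expansion that separates the first two arguments from the last two, which is the
  shape needed to contract the last two with a skew matrix.\<close>

lemma ecov_4_blocks:
  "ecov [p,q,r,s] [u,v,w,x] =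
     (u $ p * v $ q - u $ q * v $ p) * (w $ r * x $ s - w $ s * x $ r)
   - (u $ p * v $ r - u $ r * v $ p) * (w $ q * x $ s - w $ s * x $ q)
   + (u $ p * v $ s - u $ s * v $ p) * (w $ q * x $ r - w $ r * x $ q)
   + (u $ q * v $ r - u $ r * v $ q) * (w $ p * x $ s - w $ s * x $ p)
   - (u $ q * v $ s - u $ s * v $ q) * (w $ p * x $ r - w $ r * x $ p)
   + (u $ r * v $ s - u $ s * v $ r) * (w $ p * x $ q - w $ q * x $ p)"
  unfolding ecov_4 by (simp add: algebra_simps)

lemma ecov_4_contract:
  assumes b: "\<And>k l. b l k = - b k l"
  shows "(\<Sum>k\<in>UNIV. \<Sum>l\<in>UNIV. ecov [p,q,r,s] [e8 i, e8 j, e8 k, e8 l] * b k l)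
    = 2 * (dl2 i j p q * b r s - dl2 i j p r * b q s + dl2 i j p s * b q r
         + dl2 i j q r * b p s - dl2 i j q s * b p r + dl2 i j r s * b p q)"
proof -
  define d where "d r k = (if k = r then 1 else 0 :: real)" for r k :: 8
  have S: "(\<Sum>k\<in>UNIV. \<Sum>l\<in>UNIV. d r k * d s l * b k l) = b r s" for r s
    using sum_delta_2[of r s b] unfolding d_def by (simp add: eq_commute)
  have S2: "(\<Sum>k\<in>UNIV. \<Sum>l\<in>UNIV. (d r k * d s l - d s k * d r l) * b k l) = b r s - b s r" for r s
    unfolding left_diff_distrib sum_subtractf S ..
  have D: "d p i * d q j - d q i * d p j = dl2 i j p q" for p q
    unfolding d_def by (rule dl2_delta)
  have pt: "ecov [p,q,r,s] [e8 i, e8 j, e8 k, e8 l] =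
        dl2 i j p q * (d r k * d s l - d s k * d r l) - dl2 i j p r * (d q k * d s l - d s k * d q l)
        + dl2 i j p s * (d q k * d r l - d r k * d q l) + dl2 i j q r * (d p k * d s l - d s k * d p l)
        - dl2 i j q s * (d p k * d r l - d r k * d p l) + dl2 i j r s * (d p k * d q l - d q k * d p l)" for k l
    by (simp only: ecov_4_blocks axis_nth_if D[symmetric] d_def)
  have "(\<Sum>k\<in>UNIV. \<Sum>l\<in>UNIV. ecov [p,q,r,s] [e8 i, e8 j, e8 k, e8 l] * b k l)
    = (\<Sum>k\<in>UNIV. \<Sum>l\<in>UNIV.
        dl2 i j p q * ((d r k * d s l - d s k * d r l) * b k l) - dl2 i j p r * ((d q k * d s l - d s k * d q l) * b k l)
        + dl2 i j p s * ((d q k * d r l - d r k * d q l) * b k l) + dl2 i j q r * ((d p k * d s l - d s k * d p l) * b k l)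
        - dl2 i j q s * ((d p k * d r l - d r k * d p l) * b k l) + dl2 i j r s * ((d p k * d q l - d q k * d p l) * b k l))"
    by (simp only: pt mult.assoc[of "dl2 _ _ _ _"] left_diff_distrib[of _ _ "b _ _"] distrib_right[of _ _ "b _ _"])
  also have "\<dots> = dl2 i j p q * (b r s - b s r) - dl2 i j p r * (b q s - b s q) + dl2 i j p s * (b q r - b r q)
         + dl2 i j q r * (b p s - b s p) - dl2 i j q s * (b p r - b r p) + dl2 i j r s * (b p q - b q p)"
    unfolding sum.distrib sum_subtractf sum_distrib_left[symmetric] S2 ..
  also have "\<dots> = 2 * (dl2 i j p q * b r s - dl2 i j p r * b q s + dl2 i j p s * b q r
         + dl2 i j q r * b p s - dl2 i j q s * b p r + dl2 i j r s * b p q)"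
    using b[of s r] b[of s q] b[of r q] b[of s p] b[of r p] b[of q p] by (simp add: algebra_simps)
  finally show ?thesis .
qed

definition ec2 :: "(8 \<Rightarrow> 8 \<Rightarrow> real) \<Rightarrow> 8 \<Rightarrow> 8 \<Rightarrow> 8 \<Rightarrow> 8 \<Rightarrow> 8 \<Rightarrow> 8 \<Rightarrow> real" where
  "ec2 b i j p q r s = dl2 i j p q * b r s - dl2 i j p r * b q s + dl2 i j p s * b q r
         + dl2 i j q r * b p s - dl2 i j q s * b p r + dl2 i j r s * b p q"

lemma cay2_eq:
  assumes b: "\<And>k l. b l k = - b k l"
  shows "cay2 b i j = ec2 b i j 1 2 3 4 + ec2 b i j 1 2 5 6 + ec2 b i j 1 2 7 8 + ec2 b i j 1 3 5 7 - ec2 b i j 1 3 6 8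
     - ec2 b i j 1 4 5 8 - ec2 b i j 1 4 6 7 - ec2 b i j 2 3 5 8 - ec2 b i j 2 3 6 7 - ec2 b i j 2 4 5 7
     + ec2 b i j 2 4 6 8 + ec2 b i j 3 4 5 6 + ec2 b i j 3 4 7 8 + ec2 b i j 5 6 7 8"
  unfolding cay2_def cay_def cayley_form_def plus_fun_def fun_diff_def distrib_right left_diff_distrib sum.distrib sum_subtractf
    ecov_4_contract[of b, OF b] ec2_def by simp

lemma cay2_alt:
  assumes b: "\<And>k l. b l k = - b k l" shows "cay2 b j i = - cay2 b i j"
proof -
  have "dl2 j i p q = - dl2 i j p q" for p q by (simp add: dl2_def conj_commute)
  then show ?thesis unfolding cay2_eq[of b, OF b] ec2_def by simp
qed

lemma cay2_table:
  assumes b: "\<And>k l. b l k = - b k l"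
  shows
    "cay2 b 1 2 = b 3 4 + b 5 6 + b 7 8"
    "cay2 b 1 3 = - b 2 4 + b 5 7 - b 6 8"
    "cay2 b 1 4 = b 2 3 - b 5 8 - b 6 7"
    "cay2 b 1 5 = - b 2 6 - b 3 7 + b 4 8"
    "cay2 b 1 6 = b 2 5 + b 3 8 + b 4 7"
    "cay2 b 1 7 = - b 2 8 + b 3 5 - b 4 6"
    "cay2 b 1 8 = b 2 7 - b 3 6 - b 4 5"
    "cay2 b 2 3 = b 1 4 - b 5 8 - b 6 7"
    "cay2 b 2 4 = - b 1 3 - b 5 7 + b 6 8"
    "cay2 b 2 5 = b 1 6 + b 3 8 + b 4 7"
    "cay2 b 2 6 = - b 1 5 + b 3 7 - b 4 8"
    "cay2 b 2 7 = b 1 8 - b 3 6 - b 4 5"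
    "cay2 b 2 8 = - b 1 7 - b 3 5 + b 4 6"
    "cay2 b 3 4 = b 1 2 + b 5 6 + b 7 8"
    "cay2 b 3 5 = b 1 7 - b 2 8 - b 4 6"
    "cay2 b 3 6 = - b 1 8 - b 2 7 + b 4 5"
    "cay2 b 3 7 = - b 1 5 + b 2 6 - b 4 8"
    "cay2 b 3 8 = b 1 6 + b 2 5 + b 4 7"
    "cay2 b 4 5 = - b 1 8 - b 2 7 + b 3 6"
    "cay2 b 4 6 = - b 1 7 + b 2 8 - b 3 5"
    "cay2 b 4 7 = b 1 6 + b 2 5 + b 3 8"
    "cay2 b 4 8 = b 1 5 - b 2 6 - b 3 7"
    "cay2 b 5 6 = b 1 2 + b 3 4 + b 7 8"
    "cay2 b 5 7 = b 1 3 - b 2 4 - b 6 8"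
    "cay2 b 5 8 = - b 1 4 - b 2 3 + b 6 7"
    "cay2 b 6 7 = - b 1 4 - b 2 3 + b 5 8"
    "cay2 b 6 8 = - b 1 3 + b 2 4 - b 5 7"
    "cay2 b 7 8 = b 1 2 + b 3 4 + b 5 6"
  unfolding cay2_eq[of b, OF b] ec2_def dl2_def by simp_all

text \<open>By \<open>cay2_table\<close> the 28 index pairs fall into seven blocks of four, such as
  12, 34, 56, 78. Up to signs of the basis elements, each entry of a block is mapped to the sum of
  the other three. The all-ones matrix of size 4 minus the identity has eigenvalue 3 once and -1
  three times, whence the quadratic relation and the dimensions 7 and 21.\<close>

lemma cay2_cay2:
  assumes b: "\<And>k l. b l k = - b k l"
  shows "cay2 (cay2 b) i j = 2 * cay2 b i j + 3 * b i j"
proof -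
  note t = cay2_table[of b, OF b] and t2 = cay2_table[of "cay2 b", OF cay2_alt[of b, OF b]]
  define Q where "Q i j \<longleftrightarrow> cay2 (cay2 b) i j = 2 * cay2 b i j + 3 * b i j" for i j
  have sym: "Q j i" if "Q i j" for i j
    using that b[of i j] cay2_alt[of b i j, OF b] cay2_alt[of "cay2 b" i j, OF cay2_alt[of b, OF b]]
    unfolding Q_def by simp
  have diag: "Q i i" for i
    using b[of i i] cay2_alt[of b i i, OF b] cay2_alt[of "cay2 b" i i, OF cay2_alt[of b, OF b]]
    unfolding Q_def by simp
  have up: "Q 1 2" "Q 1 3" "Q 1 4" "Q 1 5" "Q 1 6" "Q 1 7" "Q 1 8" "Q 2 3" "Q 2 4" "Q 2 5" "Q 2 6" "Q 2 7" "Q 2 8" "Q 3 4" "Q 3 5" "Q 3 6" "Q 3 7" "Q 3 8" "Q 4 5" "Q 4 6" "Q 4 7" "Q 4 8" "Q 5 6" "Q 5 7" "Q 5 8" "Q 6 7" "Q 6 8" "Q 7 8"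
    unfolding Q_def t2 unfolding t by simp_all
  show ?thesis
    using exhaust_8[of i] exhaust_8[of j] unfolding Q_def[symmetric]
    by (elim disjE; simp only: up up[THEN sym] diag)
qed

lemma sum_lists_2: "(\<Sum>I::8 list | length I = 2. F I) = (\<Sum>a\<in>UNIV. \<Sum>b\<in>UNIV. F [a,b])"
  by (simp add: numeral_2_eq_2 sum_lists_Suc)

lemma sum_lists_3: "(\<Sum>I::8 list | length I = 3. F I) = (\<Sum>a\<in>UNIV. \<Sum>b\<in>UNIV. \<Sum>c\<in>UNIV. F [a,b,c])"
  by (simp add: numeral_3_eq_3 sum_lists_Suc)

lemma cay_swap: "cay j i k l = - cay i j k l" "cay i k j l = - cay i j k l" "cay i j l k = - cay i j k l"
  unfolding cay_def
  using alt_forms_swap[OF cayley_alt_forms, of "[]" "e8 j" "e8 i" "[e8 k, e8 l]"]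
    alt_forms_swap[OF cayley_alt_forms, of "[e8 i]" "e8 k" "e8 j" "[e8 l]"]
    alt_forms_swap[OF cayley_alt_forms, of "[e8 i, e8 j]" "e8 l" "e8 k" "[]"] by simp_all

lemma cay_pairs: "cay k l i j = cay i j k l"
  using alt_forms_move_block[OF cayley_alt_forms, of "[]" "[e8 k, e8 l]" "[e8 i, e8 j]" "[]"]
  by (simp add: cay_def)

text \<open>This is \<open>cay2_cay2\<close> for the elementary skew matrix in positions a, b, whose
  image under \<open>cay2\<close> is \<Phi>_xyab; both numerical factors double because the
  contraction runs over ordered pairs.\<close>

lemma cay_cay:
  "(\<Sum>k\<in>UNIV. \<Sum>l\<in>UNIV. cay i j k l * cay a b k l) = 4 * cay i j a b + 6 * dl2 i j a b"
proof -
  define c where "c k l = dl2 k l a b" for k l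
  have c: "c l k = - c k l" for k l by (simp add: c_def dl2_def conj_commute)
  have 1: "cay2 c x y = cay x y a b" for x y
  proof -
    have "(\<Sum>k\<in>UNIV. \<Sum>l\<in>UNIV. cay x y k l * c k l) =
        (\<Sum>k\<in>UNIV. \<Sum>l\<in>UNIV. (if a = k then 1 else 0) * (if b = l then 1 else 0) * cay x y k l)
        - (\<Sum>k\<in>UNIV. \<Sum>l\<in>UNIV. (if b = k then 1 else 0) * (if a = l then 1 else 0) * cay x y k l)"
      unfolding sum_subtractf[symmetric] c_def dl2_delta[symmetric] eq_commute[of a] eq_commute[of b]
      by (intro sum.cong refl) (simp only: left_diff_distrib mult_ac right_diff_distrib)
    then show ?thesis unfolding cay2_def sum_delta_2 using cay_swap(3)[of x y a b] by simp
  qed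
  have "(\<Sum>k\<in>UNIV. \<Sum>l\<in>UNIV. cay i j k l * cay a b k l) = 2 * cay2 (cay2 c) i j"
    unfolding cay2_def[of "cay2 c"] 1 using cay_pairs[of _ _ a b] by simp
  also have "\<dots> = 4 * cay2 c i j + 6 * c i j" using cay2_cay2[of c i j, OF c] by simp
  finally show ?thesis by (simp add: 1 c_def)
qed

text \<open>A trace of \<open>cay_cay\<close>: the term \<Phi>_ajbj vanishes, and the sum of
  \<open>dl2 a j b j\<close> over j is 7 if a = b and 0 otherwise, so the constant is 6 * 7.\<close>

lemma cay_cay3:
  "(\<Sum>j\<in>UNIV. \<Sum>k\<in>UNIV. \<Sum>l\<in>UNIV. cay a j k l * cay b j k l) = (if a = b then 42 else 0)"
proof -
  have z: "cay a j b j = 0" for j using alt_forms_repeat[OF cayley_alt_forms, of "[e8 a]" "e8 j" "[e8 b]" "[]"]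
    by (simp add: cay_def)
  have "(\<Sum>j\<in>UNIV. \<Sum>k\<in>UNIV. \<Sum>l\<in>UNIV. cay a j k l * cay b j k l) = (\<Sum>j\<in>UNIV. 6 * dl2 a j b j)"
    unfolding cay_cay z by simp
  also have "\<dots> = 6 * (\<Sum>j\<in>(UNIV::8 set). (if a = b then 1 else 0) - (if j = a then if a = b then 1 else 0 else 0))"
    unfolding sum_distrib_left by (intro sum.cong refl) (auto simp: dl2_def)
  also have "\<dots> = (if a = b then 42 else 0)"
    unfolding sum_subtractf by simp
  finally show ?thesis .
qed

lemma cay_cay4: "(\<Sum>i\<in>UNIV. \<Sum>j\<in>UNIV. \<Sum>k\<in>UNIV. \<Sum>l\<in>UNIV. cay i j k l * cay i j k l) = 336"
  unfolding cay_cay3 by simp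

text \<open>With \<open>K\<close> complementary to \<open>L\<close>, only rearrangements of
  \<open>K\<close> contribute for \<open>J\<close>, and the square of the remaining sign is 1.
  Exchanging two blocks of length four costs no sign, which is why star squared is +1 in this
  degree.\<close>

lemma eps_eps:
  assumes L: "length L = 4" "distinct L" and I: "length I = 4"
  shows "(\<Sum>J | length J = 4. ecov top8 (map e8 (I @ J)) * ecov top8 (map e8 (J @ L))) = 24 * ecov L (map e8 I)"
proof -
  let ?\<epsilon> = "\<lambda>I. ecov top8 (map e8 I)"
  obtain K where K: "distinct K" "set K = UNIV - set L" using finite_distinct_list[of "UNIV - set L"] by auto
  have "length K = card (UNIV - set L)" using distinct_card[OF K(1)] K(2) by simp
  also have "\<dots> = 4" using distinct_card[OF L(2)] L(1) by (subst card_Diff_subset) auto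
  finally have K4: "length K = 4" .
  have d: "distinct (L @ K)" "distinct (K @ L)" using K L by auto
  have comm: "?\<epsilon> (A @ B) = ?\<epsilon> (B @ A)" if "length A = 4" "length B = 4" for A B
    using alt_forms_move_block[OF ecov_top_alt_forms, of "[]" "map e8 A" "map e8 B" "[]"] that by simp
  have sq: "?\<epsilon> (K @ L) * ?\<epsilon> (K @ L) = 1"
  proof -
    have "mset (K @ L) = mset top8"
      by (rule iffD1[OF set_eq_iff_mset_eq_distinct]) (use d top8 K in auto)
    moreover have "ecov top8 \<in> alt_forms (length top8)" by (rule ecov_alt_forms)
    ultimately show ?thesis
    proof (rule_tac alt_forms_mset[where f = e8])
      fix \<sigma> assume a: "\<And>\<beta>. \<beta> \<in> alt_forms (length top8) \<Longrightarrow> \<beta> (map e8 (K @ L)) = of_int (sign \<sigma>) * \<beta> (map e8 top8)"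
      have "?\<epsilon> (K @ L) = of_int (sign \<sigma>)"
        using a[OF ecov_alt_forms] ecov_self[OF top8(1)] by simp
      then show "?\<epsilon> (K @ L) * ?\<epsilon> (K @ L) = 1" by (simp add: sign_def)
    qed
  qed
  have "(\<Sum>J | length J = 4. ?\<epsilon> (I @ J) * ?\<epsilon> (J @ L)) = (\<Sum>J | length J = 4. ecov K (map e8 J) * (?\<epsilon> (J @ I) * ?\<epsilon> (L @ K)))"
  proof (rule sum.cong[OF refl])
    fix J :: "8 list" assume "J \<in> {J. length J = 4}"
    then have J: "length J = 4" by simp
    show "?\<epsilon> (I @ J) * ?\<epsilon> (J @ L) = ecov K (map e8 J) * (?\<epsilon> (J @ I) * ?\<epsilon> (L @ K))"
      unfolding comm[OF I J] comm[OF J L(1)] ecov_top_complement[OF L(1) K4 d(1) J] by simp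
  qed
  also have "\<dots> = fact (length K) * (?\<epsilon> (K @ I) * ?\<epsilon> (L @ K))"
    unfolding K4[symmetric]
  proof (rule ecov_contract)
    fix \<sigma> and J :: "8 list" assume s: "\<sigma> permutes {..<length K}" "length J = length K"
    have "(\<lambda>vs. ecov top8 (vs @ map e8 I)) \<in> alt_forms 4"
      by (rule alt_forms_append_right) (use ecov_top_alt_forms I in simp)
    from alt_forms_permute_map[OF this, of \<sigma> J e8] s
    show "?\<epsilon> (map (\<lambda>i. J ! \<sigma> i) [0..<length K] @ I) * ?\<epsilon> (L @ K) = of_int (sign \<sigma>) * (?\<epsilon> (J @ I) * ?\<epsilon> (L @ K))"
      by simp
  qed
  also have "\<dots> = 24 * ((?\<epsilon> (K @ L) * ?\<epsilon> (K @ L)) * ecov L (map e8 I))"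
    unfolding ecov_top_complement[OF K4 L(1) d(2) I] comm[OF L(1) K4] K4 by (simp add: fact_numeral)
  finally show ?thesis unfolding sq by simp
qed

section \<open>Linear algebra of one tangent space in an adapted orthonormal frame\<close>

section \<open>A fibre with an admissible 4-form\<close>

text \<open>A frame \<open>f\<close> in which \<open>w\<close> is the Cayley form, \<open>g\<close>
  the Euclidean metric and \<open>V\<close> the standard volume. The first two assumptions keep
  \<open>g\<close> and \<open>V\<close> tied to the choice made in their definitions, so that the
  types of \<open>w\<close> refer to them; everything else is stated through the frame.
  \<open>contract\<close> says that the inverse metric is the sum of the f_k f_k.\<close>

locale spin7_fibre =
  fixes f :: "8 \<Rightarrow> vec8" and g :: bilin8 and V w :: form8
  assumes g_eq: "g = induced_metric w" and V_eq: "V = induced_vol w"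
    and span_f: "span (range f) = UNIV"
    and contract: "\<And>F G. linear F \<Longrightarrow> linear G \<Longrightarrow>
      (\<Sum>i\<in>UNIV. \<Sum>j\<in>UNIV. inverse_metric g i j * F (e8 i) * G (e8 j)) = (\<Sum>k\<in>UNIV. F (f k) * (G (f k) :: real))"
    and V_alt: "V \<in> alt_forms 8" and V_f: "\<And>I. V (map f I) = ecov top8 (map e8 I)"
    and w_alt: "w \<in> alt_forms 4" and w_f: "\<And>I. w (map f I) = cayley_form (map e8 I)"
    and g_lin: "\<And>u. linear (g u)" and g_sym: "\<And>u v. g u v = g v u"
    and g_f: "\<And>i j. g (f i) (f j) = (if i = j then 1 else 0)"

lemma pullback_alt_forms:
  assumes "linear A" "\<alpha> \<in> alt_forms k" shows "pullback A \<alpha> \<in> alt_forms k"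
  unfolding pullback_def
proof (rule alt_formsI)
  show "multilin k (\<lambda>vs. \<alpha> (map A vs))" unfolding multilin_def
  proof (intro allI impI)
    fix X Y :: "vec8 list" assume "length X + Suc (length Y) = k"
    then have "linear (\<lambda>v. \<alpha> (map A X @ v # map A Y))"
      using multilinD[OF alt_forms_multilin[OF assms(2)], of "map A X" "map A Y"] by simp
    from linear_compose[OF assms(1) this] show "linear (\<lambda>v. \<alpha> (map A (X @ v # Y)))" by (simp add: comp_def)
  qed
qed (use alt_forms_length[OF assms(2)] alt_forms_repeat_adj[OF assms(2)] in auto)

lemma matrix_inv_unique':
  fixes G H :: "real^'n^'n" assumes "H ** G = mat 1" "G ** H = mat 1" shows "matrix_inv G = H"
  unfolding matrix_inv_def
proof (rule some_equality)
  fix X assume "G ** X = mat 1 \<and> X ** G = mat 1"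
  then show "X = H" using assms by (metis matrix_mul_assoc matrix_mul_lid matrix_mul_rid)
qed (use assms in simp)

text \<open>The product with the Gram matrix is computed directly: the sum of f_k^m g(e_m, e_b) over
  m is the k-th coordinate of A e_b, and the inverse of \<open>A\<close> turns these coordinates
  back into e_b.\<close>

lemma inverse_metric_frame:
  assumes A: "linear A" and bij: "bij A" and g: "g = (\<lambda>u v. A u \<bullet> A v)" and f: "f = (\<lambda>i. inv A (e8 i))"
  shows "inverse_metric g i j = (\<Sum>k\<in>UNIV. f k $ i * f k $ j)"
proof -
  have iA: "linear (inv A)" using A bij by (metis bij_is_inj bij_is_surj inj_linear_imp_inv_linear)
  let ?G = "\<chi> a b. g (e8 a) (e8 b)" and ?H = "\<chi> a b. \<Sum>k\<in>UNIV. f k $ a * f k $ b"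
  have "?H ** ?G = mat 1"
  proof -
    have "(\<Sum>m\<in>UNIV. (\<Sum>k\<in>UNIV. f k $ a * f k $ m) * g (e8 m) (e8 b)) = (if a = b then 1 else 0)" for a b
    proof -
      have Ak: "(\<Sum>m\<in>UNIV. f k $ m * g (e8 m) (e8 b)) = A (f k) \<bullet> A (e8 b)" for k
      proof -
        have "f k = (\<Sum>m\<in>UNIV. f k $ m *\<^sub>R e8 m)" by (simp add: basis_expansion scalar_mult_eq_scaleR[symmetric])
        then have "A (f k) = (\<Sum>m\<in>UNIV. f k $ m *\<^sub>R A (e8 m))"
          by (metis (no_types, lifting) linear_sum[OF A] linear_cmul[OF A] sum.cong)
        then show ?thesis by (simp add: inner_sum_left g)
      qed
      have "(\<Sum>m\<in>UNIV. (\<Sum>k\<in>UNIV. f k $ a * f k $ m) * g (e8 m) (e8 b))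
        = (\<Sum>k\<in>UNIV. f k $ a * (\<Sum>m\<in>UNIV. f k $ m * g (e8 m) (e8 b)))"
        unfolding sum_distrib_right sum_distrib_left by (subst sum.swap) (simp add: mult_ac)
      also have "\<dots> = (\<Sum>k\<in>UNIV. f k $ a * (A (f k) \<bullet> A (e8 b)))" unfolding Ak ..
      also have "(\<Sum>k\<in>UNIV. f k $ a * (A (f k) \<bullet> A (e8 b))) = (\<Sum>k\<in>UNIV. A (e8 b) $ k *\<^sub>R f k) $ a"
        using bij by (simp add: f bij_is_surj surj_f_inv_f inner_axis' mult.commute)
      also have "(\<Sum>k\<in>UNIV. A (e8 b) $ k *\<^sub>R f k) = inv A (\<Sum>k\<in>UNIV. A (e8 b) $ k *\<^sub>R e8 k)"
        by (simp add: f linear_sum[OF iA] linear_cmul[OF iA])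
      also have "(\<Sum>k\<in>UNIV. A (e8 b) $ k *\<^sub>R e8 k) = A (e8 b)"
        by (simp add: basis_expansion scalar_mult_eq_scaleR[symmetric])
      also have "inv A (A (e8 b)) $ a = (if a = b then 1 else 0)"
        using bij by (simp add: bij_is_inj axis_nth_if eq_commute)
      finally show ?thesis .
    qed
    then show ?thesis by (simp add: matrix_matrix_mult_def mat_def vec_eq_iff)
  qed
  moreover from this have "?G ** ?H = mat 1" using matrix_left_right_inverse by blast
  ultimately have "matrix_inv ?G = ?H" by (intro matrix_inv_unique')
  then show ?thesis by (simp add: inverse_metric_def)
qed

text \<open>The frame is the preimage of the standard basis under the very map that the choice
  operator selects. Metric, volume and 4-form are thus normalised by one frame, and the stabiliser
  of the Cayley form need not be known.\<close>

lemma admissible_fibre: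
  assumes "admissible w" shows "\<exists>f. spin7_fibre f (induced_metric w) (induced_vol w) w"
proof -
  define A where "A = (SOME A. spin7_frame w A)"
  have "spin7_frame w A" using assms unfolding admissible_def A_def by (rule someI_ex)
  then have A: "linear A" "bij A" "pullback A cayley_form = w" by (auto simp: spin7_frame_def)
  have g: "induced_metric w = (\<lambda>u v. A u \<bullet> A v)" by (simp add: induced_metric_def A_def[symmetric] Let_def)
  have V: "induced_vol w = pullback A (ecov top8)" by (simp add: induced_vol_def A_def[symmetric] Let_def)
  define f where "f = (\<lambda>i. inv A (e8 i))"
  have Af: "A (f i) = e8 i" for i using A(2) by (simp add: f_def bij_is_surj surj_f_inv_f)
  have iA: "linear (inv A)" using A by (metis bij_is_inj bij_is_surj inj_linear_imp_inv_linear)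
  have mapf: "map A (map f I) = map e8 I" for I by (simp add: comp_def Af)
  have "spin7_fibre f (induced_metric w) (induced_vol w) w"
  proof (rule spin7_fibre.intro)
    have "range f = inv A ` range e8" by (auto simp: f_def)
    then have "span (range f) = inv A ` UNIV" using span_e8 linear_span_image[OF iA, of "range e8"] by simp
    then show "span (range f) = UNIV" using A(2) by (simp add: bij_is_inj inj_imp_surj_inv)
    show "induced_vol w \<in> alt_forms 8" unfolding V by (rule pullback_alt_forms[OF A(1) ecov_top_alt_forms])
    show "w \<in> alt_forms 4" using pullback_alt_forms[OF A(1) cayley_alt_forms] A(3) by simp
    show "induced_vol w (map f I) = ecov top8 (map e8 I)" for I unfolding V pullback_def mapf ..
    show "w (map f I) = cayley_form (map e8 I)" for I unfolding A(3)[symmetric] pullback_def mapf ..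
    show "linear (induced_metric w u)" for u unfolding g
      using linear_compose[OF A(1) bounded_linear.linear[OF bounded_linear_inner_right], of "A u"] by (simp add: comp_def)
    show "induced_metric w u v = induced_metric w v u" for u v unfolding g by (rule inner_commute)
    show "induced_metric w (f i) (f j) = (if i = j then 1 else 0)" for i j
      unfolding g Af by (simp add: inner_axis_axis)
    fix F G :: "vec8 \<Rightarrow> real" assume F: "linear F" and G: "linear G"
    have exp: "L (f k) = (\<Sum>i\<in>UNIV. f k $ i * L (e8 i))" if L: "linear L" for L :: "vec8 \<Rightarrow> real" and k
    proof -
      have "f k = (\<Sum>m\<in>UNIV. f k $ m *\<^sub>R e8 m)" by (simp add: basis_expansion scalar_mult_eq_scaleR[symmetric])
      then have "L (f k) = L (\<Sum>m\<in>UNIV. f k $ m *\<^sub>R e8 m)" by (rule arg_cong)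
      then show ?thesis by (simp add: linear_sum[OF L] linear_cmul[OF L])
    qed
    have "(\<Sum>i\<in>UNIV. \<Sum>j\<in>UNIV. inverse_metric (induced_metric w) i j * F (e8 i) * G (e8 j))
       = (\<Sum>i\<in>UNIV. \<Sum>j\<in>UNIV. \<Sum>k\<in>UNIV. (f k $ i * F (e8 i)) * (f k $ j * G (e8 j)))"
      unfolding inverse_metric_frame[OF A(1,2) g f_def] sum_distrib_right by (simp add: mult_ac)
    also have "\<dots> = (\<Sum>i\<in>UNIV. \<Sum>k\<in>UNIV. \<Sum>j\<in>UNIV. (f k $ i * F (e8 i)) * (f k $ j * G (e8 j)))"
      by (intro sum.cong refl sum.swap)
    also have "\<dots> = (\<Sum>k\<in>UNIV. \<Sum>i\<in>UNIV. \<Sum>j\<in>UNIV. (f k $ i * F (e8 i)) * (f k $ j * G (e8 j)))"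
      by (rule sum.swap)
    also have "\<dots> = (\<Sum>k\<in>UNIV. F (f k) * G (f k))"
      unfolding exp[OF F] exp[OF G] sum_product ..
    finally show "(\<Sum>i\<in>UNIV. \<Sum>j\<in>UNIV. inverse_metric (induced_metric w) i j * F (e8 i) * G (e8 j))
       = (\<Sum>k\<in>UNIV. F (f k) * G (f k))" .
  qed auto
  then show ?thesis by blast
qed

lemma sum_swap_pairs:
  fixes F :: "8 \<Rightarrow> 8 \<Rightarrow> 8 \<Rightarrow> 8 \<Rightarrow> real"
  shows "(\<Sum>i\<in>UNIV. \<Sum>j\<in>UNIV. \<Sum>k\<in>UNIV. \<Sum>l\<in>UNIV. F i j k l) = (\<Sum>k\<in>UNIV. \<Sum>l\<in>UNIV. \<Sum>i\<in>UNIV. \<Sum>j\<in>UNIV. F i j k l)"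
proof -
  have "(\<Sum>i\<in>UNIV. \<Sum>j\<in>UNIV. \<Sum>k\<in>UNIV. \<Sum>l\<in>UNIV. F i j k l) = (\<Sum>i\<in>UNIV. \<Sum>k\<in>UNIV. \<Sum>l\<in>UNIV. \<Sum>j\<in>UNIV. F i j k l)"
    by (rule sum.cong[OF refl], subst sum.swap, rule sum.cong[OF refl], rule sum.swap)
  also have "\<dots> = (\<Sum>k\<in>UNIV. \<Sum>i\<in>UNIV. \<Sum>l\<in>UNIV. \<Sum>j\<in>UNIV. F i j k l)" by (rule sum.swap)
  also have "\<dots> = (\<Sum>k\<in>UNIV. \<Sum>l\<in>UNIV. \<Sum>i\<in>UNIV. \<Sum>j\<in>UNIV. F i j k l)"
    by (rule sum.cong[OF refl], rule sum.swap)
  finally show ?thesis .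
qed

lemma cay2_add: "cay2 (\<lambda>k l. a k l + b k l) i j = cay2 a i j + cay2 b i j"
  by (simp add: cay2_def distrib_left sum.distrib add_divide_distrib)

lemma cay2_scale: "cay2 (\<lambda>k l. c * a k l) i j = c * cay2 a i j"
  by (simp add: cay2_def sum_distrib_left mult_ac)

lemma cay2_adjoint:
  "(\<Sum>i\<in>UNIV. \<Sum>j\<in>UNIV. cay2 a i j * b i j) = (\<Sum>i\<in>UNIV. \<Sum>j\<in>UNIV. a i j * cay2 b i j)"
proof -
  have "(\<Sum>i\<in>UNIV. \<Sum>j\<in>UNIV. cay2 a i j * b i j)
      = (\<Sum>i\<in>UNIV. \<Sum>j\<in>UNIV. \<Sum>k\<in>UNIV. \<Sum>l\<in>UNIV. cay i j k l * a k l * b i j / 2)"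
    by (simp add: cay2_def sum_distrib_right sum_divide_distrib)
  also have "\<dots> = (\<Sum>k\<in>UNIV. \<Sum>l\<in>UNIV. \<Sum>i\<in>UNIV. \<Sum>j\<in>UNIV. cay i j k l * a k l * b i j / 2)"
    by (rule sum_swap_pairs)
  also have "\<dots> = (\<Sum>k\<in>UNIV. \<Sum>l\<in>UNIV. a k l * cay2 b k l)"
    unfolding cay2_def sum_distrib_left sum_divide_distrib
    by (intro sum.cong refl) (simp add: cay_pairs[symmetric] mult_ac)
  finally show ?thesis .
qed

lemma form_inner_add_left: "form_inner g k (\<alpha> + \<beta>) \<gamma> = form_inner g k \<alpha> \<gamma> + form_inner g k \<beta> \<gamma>"
  by (simp add: form_inner_def distrib_left distrib_right sum.distrib add_divide_distrib)

lemma form_inner_diff_left: "form_inner g k (\<alpha> - \<beta>) \<gamma> = form_inner g k \<alpha> \<gamma> - form_inner g k \<beta> \<gamma>"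
  by (simp add: form_inner_def right_diff_distrib left_diff_distrib sum_subtractf diff_divide_distrib)

lemma form_inner_scale_left: "form_inner g k (\<lambda>vs. c * \<alpha> vs) \<gamma> = c * form_inner g k \<alpha> \<gamma>"
  unfolding form_inner_def times_divide_eq_right sum_distrib_left
  by (rule arg_cong[where f="\<lambda>x. x / fact k"], rule sum.cong[OF refl], rule sum.cong[OF refl])
    (simp only: mult_ac)

lemma form_inner_zero_left: "form_inner g k 0 \<gamma> = 0"
  by (simp add: form_inner_def)

context spin7_fibre
begin

lemma form_inner_eq:
  assumes "multilin k \<alpha>" "multilin k \<beta>"
  shows "form_inner g k \<alpha> \<beta> = (\<Sum>K | length K = k. \<alpha> (map f K) * \<beta> (map f K)) / fact k"
  unfolding form_inner_def
  by (rule arg_cong[where f="\<lambda>x. x / fact k"], rule multilin_contract[OF _ assms]) (rule contract)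

lemma form_inner_commute:
  assumes "\<alpha> \<in> alt_forms k" "\<beta> \<in> alt_forms k" shows "form_inner g k \<alpha> \<beta> = form_inner g k \<beta> \<alpha>"
  using assms by (simp add: form_inner_eq alt_forms_multilin mult.commute)

lemma form_inner_definite:
  assumes \<alpha>: "\<alpha> \<in> alt_forms k" and z: "form_inner g k \<alpha> \<alpha> = 0" shows "\<alpha> = 0"
proof (rule alt_forms_ext[OF span_f \<alpha> alt_forms_zero])
  fix I :: "8 list" assume I: "length I = k"
  have "(\<Sum>K | length K = k. \<alpha> (map f K) * \<alpha> (map f K)) = 0"
    using z by (simp add: form_inner_eq alt_forms_multilin[OF \<alpha>])
  then have "\<alpha> (map f I) * \<alpha> (map f I) = 0"
    using I by (subst (asm) sum_nonneg_eq_0_iff) auto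
  then show "\<alpha> (map f I) = 0 (map f I)" by simp
qed

text \<open>Positive definiteness makes the orthogonal projection unique, so the definite
  description is evaluated by exhibiting a candidate. The explicit projections in degrees 1 to 4 are
  obtained this way.\<close>

lemma orth_proj_eq:
  assumes W: "\<And>\<gamma>. \<gamma> \<in> W \<Longrightarrow> \<gamma> \<in> alt_forms k" "\<And>\<beta> \<gamma>. \<beta> \<in> W \<Longrightarrow> \<gamma> \<in> W \<Longrightarrow> \<beta> - \<gamma> \<in> W"
    and \<beta>: "\<beta> \<in> W" "\<And>\<gamma>. \<gamma> \<in> W \<Longrightarrow> form_inner g k (\<alpha> - \<beta>) \<gamma> = 0"
  shows "orth_proj g k W \<alpha> = \<beta>"
  unfolding orth_proj_def
proof (rule the_equality)
  fix \<beta>' assume a: "\<beta>' \<in> W \<and> (\<forall>\<gamma>\<in>W. form_inner g k (\<alpha> - \<beta>') \<gamma> = 0)"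
  let ?d = "\<beta>' - \<beta>"
  have d: "?d \<in> W" using a \<beta> W by blast
  have "form_inner g k ?d ?d = form_inner g k (\<alpha> - \<beta>) ?d - form_inner g k (\<alpha> - \<beta>') ?d"
    by (simp only: form_inner_diff_left)
  also have "\<dots> = 0" using a \<beta> d by simp
  finally have "?d = 0" using form_inner_definite[OF W(1)[OF d]] by blast
  then show "\<beta>' = \<beta>" by simp
qed (use \<beta> in blast)

lemma orth_proj_zero:
  assumes W: "\<And>\<gamma>. \<gamma> \<in> W \<Longrightarrow> \<gamma> \<in> alt_forms k" "\<And>\<beta> \<gamma>. \<beta> \<in> W \<Longrightarrow> \<gamma> \<in> W \<Longrightarrow> \<beta> - \<gamma> \<in> W" and "0 \<in> W"
    and "\<And>\<gamma>. \<gamma> \<in> W \<Longrightarrow> form_inner g k \<alpha> \<gamma> = 0"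
  shows "orth_proj g k W \<alpha> = 0"
  by (rule orth_proj_eq[OF W]) (use assms in simp_all)

lemma V_append_alt: "k + length vs = 8 \<Longrightarrow> (\<lambda>us. V (us @ vs)) \<in> alt_forms k"
  by (rule alt_forms_append_right) (use V_alt in simp)

lemma hodge_eq:
  assumes \<beta>: "multilin k \<beta>"
  shows "hodge g V k \<beta> vs = (\<Sum>K | length K = k. \<beta> (map f K) * V (map f K @ vs)) / fact k"
proof (cases "k + length vs = 8")
  case True
  have "multilin k (\<lambda>us. V (us @ vs))" using V_append_alt[OF True] by (rule alt_forms_multilin)
  then show ?thesis unfolding hodge_def
    by (intro arg_cong[where f="\<lambda>x. x / fact k"] multilin_contract[OF _ \<beta>]) (rule contract)
next
  case False
  then have "V (us @ vs) = 0" if "length us = k" for us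
    using that alt_forms_length[OF V_alt, of "us @ vs"] by simp
  then show ?thesis unfolding hodge_def by simp
qed

lemma hodge_alt_forms:
  assumes \<beta>: "multilin k \<beta>" and l: "k + l = 8" shows "hodge g V k \<beta> \<in> alt_forms l"
proof -
  have "hodge g V k \<beta> = (\<lambda>vs. \<Sum>K | length K = k. \<beta> (map f K) / fact k * V (map f K @ vs))"
    by (rule ext) (simp add: hodge_eq[OF \<beta>] sum_divide_distrib)
  also have "\<dots> \<in> alt_forms l"
  proof (intro alt_forms_sum alt_forms_scale alt_forms_append)
    show "V \<in> alt_forms (length (map f K) + l)" if "K \<in> {K. length K = k}" for K
      using that l V_alt by simp
  qed
  finally show ?thesis .
qed

lemma wedge_V_contract:
  assumes len: "k + l + length vs = 8"
  shows "(\<Sum>K | length K = k + l. wedge k l \<alpha> \<beta> (map f K) * V (map f K @ vs))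
    = fact (k + l) / (fact k * fact l) * (\<Sum>I | length I = k. \<Sum>J | length J = l. \<alpha> (map f I) * \<beta> (map f J) * V (map f I @ map f J @ vs))"
proof -
  have "V (map f (map (\<lambda>i. I ! \<sigma> i) [0..<k + l]) @ vs) = of_int (sign \<sigma>) * V (map f I @ vs)"
    if "\<sigma> permutes {..<k + l}" "length I = k + l" for \<sigma> I
    using alt_forms_permute_map[OF V_append_alt[OF len], of \<sigma> I f] that by simp
  from wedge_contract[of k l "\<lambda>K. V (map f K @ vs)" \<alpha> \<beta> f, OF this]
  show ?thesis by simp
qed

lemma hodge_wedge:
  assumes "multilin k \<alpha>" "multilin l \<beta>" and len: "k + l + length vs = 8"
  shows "hodge g V (k + l) (wedge k l \<alpha> \<beta>) vs
    = (\<Sum>I | length I = k. \<Sum>J | length J = l. \<alpha> (map f I) * \<beta> (map f J) * V (map f I @ map f J @ vs)) / (fact k * fact l)"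
  unfolding hodge_eq[OF wedge_multilin[OF assms(1,2)]] wedge_V_contract[OF len] by simp

lemma w_V:
  "length vs = 4 \<Longrightarrow> (\<Sum>I | length I = 4. w (map f I) * V (map f I @ vs)) = 24 * w vs"
proof -
  assume len: "length vs = 4"
  have w: "multilin 4 w" using w_alt by (rule alt_forms_multilin)
  have "hodge g V 4 w = w"
  proof (rule alt_forms_ext[OF span_f hodge_alt_forms[OF w] w_alt])
    fix L :: "8 list" assume L: "length L = 4"
    show "hodge g V 4 w (map f L) = w (map f L)"
      unfolding hodge_eq[OF w] w_f map_append[symmetric] V_f cayley_self_dual[OF L] by (simp add: fact_numeral)
  qed simp
  then have "hodge g V 4 w vs = w vs" by simp
  then show ?thesis unfolding hodge_eq[OF w] by (simp add: fact_numeral)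
qed

lemma hodge_w: "hodge g V 4 w = w"
proof
  fix vs show "hodge g V 4 w vs = w vs"
    unfolding hodge_eq[OF alt_forms_multilin[OF w_alt]]
    using w_V[of vs] alt_forms_length[OF w_alt, of vs] alt_forms_length[OF V_alt]
    by (cases "length vs = 4") (simp_all add: fact_numeral)
qed

lemma w_list: "w [f i, f j, f k, f l] = cay i j k l"
  using w_f[of "[i,j,k,l]"] by (simp add: cay_def)

subsection \<open>2-forms\<close>

lemma alt2_ext:
  assumes "\<alpha> \<in> alt_forms 2" "\<beta> \<in> alt_forms 2" "\<And>i j. \<alpha> [f i, f j] = \<beta> [f i, f j]" shows "\<alpha> = \<beta>"
proof (rule alt_forms_ext[OF span_f assms(1,2)])
  fix I :: "8 list" assume "length I = 2"
  then obtain i j where "I = [i, j]" by (auto simp: numeral_2_eq_2 length_Suc_conv)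
  then show "\<alpha> (map f I) = \<beta> (map f I)" using assms(3) by simp
qed

lemma alt2_swap: "\<alpha> \<in> alt_forms 2 \<Longrightarrow> \<alpha> [v, u] = - \<alpha> [u, v]"
  using alt_forms_swap[of \<alpha> 2 "[]" v u "[]"] by simp

lemma inner2:
  assumes "\<alpha> \<in> alt_forms 2" "\<beta> \<in> alt_forms 2"
  shows "form_inner g 2 \<alpha> \<beta> = (\<Sum>i\<in>UNIV. \<Sum>j\<in>UNIV. \<alpha> [f i, f j] * \<beta> [f i, f j]) / 2"
  by (simp add: form_inner_eq assms alt_forms_multilin sum_lists_2)

abbreviation P2 :: "form8 \<Rightarrow> form8" where "P2 \<beta> \<equiv> hodge g V 6 (wedge 4 2 w \<beta>)"

lemma P2_alt_forms: assumes "\<beta> \<in> alt_forms 2" shows "P2 \<beta> \<in> alt_forms 2"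
  using hodge_alt_forms[OF wedge_multilin[OF alt_forms_multilin[OF w_alt] alt_forms_multilin[OF assms]], of 2] by simp

text \<open>Self-duality of \<open>w\<close> removes the volume form: summing over the four
  arguments of \<open>w\<close> gives 24 w(..., u, v), to be divided by 4! 2! = 48.\<close>

lemma P2_list:
  assumes \<beta>: "\<beta> \<in> alt_forms 2"
  shows "P2 \<beta> [u, v] = (\<Sum>i\<in>UNIV. \<Sum>j\<in>UNIV. \<beta> [f i, f j] * w [f i, f j, u, v]) / 2"
proof -
  have "P2 \<beta> [u, v] = (\<Sum>I | length I = 4. \<Sum>J | length J = 2. w (map f I) * \<beta> (map f J) * V (map f I @ map f J @ [u, v])) / 48"
    using hodge_wedge[OF alt_forms_multilin[OF w_alt] alt_forms_multilin[OF \<beta>], of "[u, v]"] by (simp add: fact_numeral)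
  also have "(\<Sum>I | length I = 4. \<Sum>J | length J = 2. w (map f I) * \<beta> (map f J) * V (map f I @ map f J @ [u, v]))
     = (\<Sum>J | length J = 2. \<beta> (map f J) * (\<Sum>I | length I = 4. w (map f I) * V (map f I @ map f J @ [u, v])))"
    unfolding sum_distrib_left by (subst sum.swap) (simp add: mult_ac)
  also have "\<dots> = (\<Sum>J | length J = 2. \<beta> (map f J) * (24 * w (map f J @ [u, v])))"
    by (intro sum.cong refl) (simp add: w_V)
  finally show ?thesis unfolding sum_lists_2 by (simp add: sum_distrib_left sum_divide_distrib)
qed

lemma P2_f:
  assumes \<beta>: "\<beta> \<in> alt_forms 2"
  shows "P2 \<beta> [f i, f j] = cay2 (\<lambda>k l. \<beta> [f k, f l]) i j"
  unfolding P2_list[OF \<beta>] w_list cay2_def cay_pairs[of _ _ i j] by (simp add: mult.commute)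

lemma L2_7_iff: "\<beta> \<in> L2_7 w \<longleftrightarrow> \<beta> \<in> alt_forms 2 \<and> (\<forall>i j. cay2 (\<lambda>k l. \<beta> [f k, f l]) i j = 3 * \<beta> [f i, f j])"
proof -
  have "P2 \<beta> = (\<lambda>vs. 3 * \<beta> vs) \<longleftrightarrow> (\<forall>i j. P2 \<beta> [f i, f j] = 3 * \<beta> [f i, f j])" if b: "\<beta> \<in> alt_forms 2"
    using alt2_ext[OF P2_alt_forms[OF b] alt_forms_scale[OF b, of 3]] by metis
  then show ?thesis unfolding L2_7_def g_eq[symmetric] V_eq[symmetric] using P2_f by auto
qed

lemma L2_21_iff: "\<beta> \<in> L2_21 w \<longleftrightarrow> \<beta> \<in> alt_forms 2 \<and> (\<forall>i j. cay2 (\<lambda>k l. \<beta> [f k, f l]) i j = - \<beta> [f i, f j])"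
proof -
  have "P2 \<beta> = - \<beta> \<longleftrightarrow> (\<forall>i j. P2 \<beta> [f i, f j] = - \<beta> [f i, f j])" if b: "\<beta> \<in> alt_forms 2"
    using alt2_ext[OF P2_alt_forms[OF b] alt_forms_uminus[OF b]] by (metis uminus_apply)
  then show ?thesis unfolding L2_21_def g_eq[symmetric] V_eq[symmetric] using P2_f by auto
qed

text \<open>The operator \<open>P2\<close> has eigenvalues 3 and -1, so the projection onto the
  eigenvalue 3 is (P + 1) / (3 + 1), and the complementary one is (3 - P) / 4.\<close>

lemma proj_2_7:
  assumes \<alpha>: "\<alpha> \<in> alt_forms 2"
  shows "orth_proj g 2 (L2_7 w) \<alpha> = (\<lambda>vs. 1/4 * (\<alpha> vs + P2 \<alpha> vs))"
proof (rule orth_proj_eq)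
  let ?a = "\<lambda>k l. \<alpha> [f k, f l]"
  have a: "?a l k = - ?a k l" for k l by (rule alt2_swap[OF \<alpha>])
  show "\<gamma> \<in> alt_forms 2" if "\<gamma> \<in> L2_7 w" for \<gamma> using that L2_7_iff by blast
  show "\<beta> - \<gamma> \<in> L2_7 w" if "\<beta> \<in> L2_7 w" "\<gamma> \<in> L2_7 w" for \<beta> \<gamma>
    using that unfolding L2_7_iff
    by (auto intro!: alt_forms_diff simp: right_diff_distrib cay2_def sum_subtractf diff_divide_distrib)
  have "(\<lambda>vs. 1/4 * (\<alpha> vs + P2 \<alpha> vs)) \<in> alt_forms 2"
    using alt_forms_scale[OF alt_forms_add[OF \<alpha> P2_alt_forms[OF \<alpha>]], of "1/4"] by simp
  then show "(\<lambda>vs. 1/4 * (\<alpha> vs + P2 \<alpha> vs)) \<in> L2_7 w"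
    unfolding L2_7_iff P2_f[OF \<alpha>] cay2_scale cay2_add cay2_cay2[of ?a, OF a] by (simp add: algebra_simps)
  fix \<gamma> assume "\<gamma> \<in> L2_7 w"
  then have \<gamma>: "\<gamma> \<in> alt_forms 2" and c: "\<And>i j. cay2 (\<lambda>k l. \<gamma> [f k, f l]) i j = 3 * \<gamma> [f i, f j]"
    unfolding L2_7_iff by auto
  let ?c = "\<lambda>k l. \<gamma> [f k, f l]"
  \<comment> \<open>Since \<open>cay2\<close> is self-adjoint, it can be moved onto \<gamma>, where
    it is multiplication by 3.\<close>
  have "form_inner g 2 (P2 \<alpha>) \<gamma> = 3 * form_inner g 2 \<alpha> \<gamma>"
    unfolding inner2[OF P2_alt_forms[OF \<alpha>] \<gamma>] inner2[OF \<alpha> \<gamma>] P2_f[OF \<alpha>] cay2_adjoint c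
    by (simp add: sum_distrib_left mult_ac)
  moreover have "\<alpha> - (\<lambda>vs. 1/4 * (\<alpha> vs + P2 \<alpha> vs)) = (\<lambda>vs. 1/4 * ((\<lambda>vs. 3 * \<alpha> vs) - P2 \<alpha>) vs)"
    by (rule ext) (simp add: algebra_simps)
  ultimately show "form_inner g 2 (\<alpha> - (\<lambda>vs. 1/4 * (\<alpha> vs + P2 \<alpha> vs))) \<gamma> = 0"
    by (simp only: form_inner_scale_left form_inner_diff_left) simp
qed

lemma proj_2_21:
  assumes \<alpha>: "\<alpha> \<in> alt_forms 2"
  shows "orth_proj g 2 (L2_21 w) \<alpha> = (\<lambda>vs. 1/4 * (3 * \<alpha> vs + - P2 \<alpha> vs))"
proof (rule orth_proj_eq)
  let ?a = "\<lambda>k l. \<alpha> [f k, f l]"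
  have a: "?a l k = - ?a k l" for k l by (rule alt2_swap[OF \<alpha>])
  show "\<gamma> \<in> alt_forms 2" if "\<gamma> \<in> L2_21 w" for \<gamma> using that L2_21_iff by blast
  show "\<beta> - \<gamma> \<in> L2_21 w" if "\<beta> \<in> L2_21 w" "\<gamma> \<in> L2_21 w" for \<beta> \<gamma>
    using that unfolding L2_21_iff
    by (auto intro!: alt_forms_diff simp: right_diff_distrib cay2_def sum_subtractf diff_divide_distrib)
  have "(\<lambda>vs. 1/4 * (3 * \<alpha> vs + - P2 \<alpha> vs)) \<in> alt_forms 2"
    using alt_forms_scale[OF alt_forms_add[OF alt_forms_scale[OF \<alpha>, of 3] alt_forms_uminus[OF P2_alt_forms[OF \<alpha>]]], of "1/4"]
    by simp
  moreover have "cay2 (\<lambda>k l. - cay2 ?a k l) i j = - cay2 (cay2 ?a) i j" for i j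
    using cay2_scale[of "-1" "cay2 ?a"] by simp
  ultimately show "(\<lambda>vs. 1/4 * (3 * \<alpha> vs + - P2 \<alpha> vs)) \<in> L2_21 w"
    unfolding L2_21_iff P2_f[OF \<alpha>] cay2_scale cay2_add using cay2_cay2[of ?a, OF a] by (simp add: algebra_simps)
  fix \<gamma> assume "\<gamma> \<in> L2_21 w"
  then have \<gamma>: "\<gamma> \<in> alt_forms 2" and c: "\<And>i j. cay2 (\<lambda>k l. \<gamma> [f k, f l]) i j = - \<gamma> [f i, f j]"
    unfolding L2_21_iff by auto
  have "form_inner g 2 (P2 \<alpha>) \<gamma> = - form_inner g 2 \<alpha> \<gamma>"
    unfolding inner2[OF P2_alt_forms[OF \<alpha>] \<gamma>] inner2[OF \<alpha> \<gamma>] P2_f[OF \<alpha>] cay2_adjoint c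
    by (simp add: sum_negf)
  moreover have "\<alpha> - (\<lambda>vs. 1/4 * (3 * \<alpha> vs + - P2 \<alpha> vs)) = (\<lambda>vs. 1/4 * (\<alpha> + P2 \<alpha>) vs)"
    by (rule ext) (simp add: algebra_simps)
  ultimately show "form_inner g 2 (\<alpha> - (\<lambda>vs. 1/4 * (3 * \<alpha> vs + - P2 \<alpha> vs))) \<gamma> = 0"
    by (simp only: form_inner_scale_left form_inner_add_left) simp
qed

subsection \<open>3-forms\<close>

lemma interior_w_alt_forms: "interior_product X w \<in> alt_forms 3"
  by (rule interior_alt_forms) (use w_alt in simp)

lemma interior_w_sum:
  "interior_product (\<Sum>a\<in>S. c a *\<^sub>R v a) w vs = (\<Sum>a\<in>S. c a * w (v a # vs))"
proof (cases "length vs = 3")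
  case True
  have l: "linear (\<lambda>v. w (v # vs))" by (rule multilin_hd[of 3]) (use alt_forms_multilin[OF w_alt] True in simp_all)
  show ?thesis by (simp only: interior_product_def linear_sum[OF l] linear_cmul[OF l] real_scaleR_def)
next
  case False then show ?thesis by (simp add: interior_product_def alt_forms_length[OF w_alt])
qed

lemma frame_expansion: "v = (\<Sum>a\<in>UNIV. g (f a) v *\<^sub>R f a)"
proof -
  have "linear (\<lambda>v. \<Sum>a\<in>UNIV. g (f a) v *\<^sub>R f a)"
    by (intro linear_compose_sum ballI) (auto simp: linear_iff linear_add[OF g_lin] linear_cmul[OF g_lin] algebra_simps)
  moreover have "(\<Sum>a\<in>UNIV. g (f a) (f b) *\<^sub>R f a) = f b" for b
  proof -
    have "g (f a) (f b) *\<^sub>R f a = (if a = b then f a else 0)" for a by (simp add: g_f)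
    then show ?thesis by simp
  qed
  then have "id x = (\<Sum>a\<in>UNIV. g (f a) x *\<^sub>R f a)" if "x \<in> range f" for x using that by force
  ultimately show ?thesis
    using linear_eq_on_span[OF linear_id, of "\<lambda>v. \<Sum>a\<in>UNIV. g (f a) v *\<^sub>R f a" "range f" v] span_f by simp
qed

lemma interior_inner:
  assumes "\<gamma> \<in> alt_forms 3"
  shows "form_inner g 3 \<gamma> (interior_product X w) = (\<Sum>a\<in>UNIV. g (f a) X * (\<Sum>I | length I = 3. \<gamma> (map f I) * w (f a # map f I))) / 6"
proof -
  have "interior_product X w vs = (\<Sum>a\<in>UNIV. g (f a) X * w (f a # vs))" for vs
    by (subst frame_expansion[of X]) (rule interior_w_sum)
  then have "form_inner g 3 \<gamma> (interior_product X w) = (\<Sum>I | length I = 3. \<Sum>a\<in>UNIV. g (f a) X * (\<gamma> (map f I) * w (f a # map f I))) / 6"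
    by (simp add: form_inner_eq alt_forms_multilin assms interior_w_alt_forms sum_distrib_left mult_ac fact_numeral)
  then show ?thesis by (subst (asm) sum.swap) (simp add: sum_distrib_left)
qed

lemma V_cycle: "V (X @ Y @ Z) = (-1) ^ (length X * length Y) * V (Y @ X @ Z)"
  using alt_forms_move_block[OF V_alt, of "[]" X Y Z] by simp

text \<open>Exchanging three arguments with four costs no sign, after which self-duality of
  \<open>w\<close> contracts the volume form away. The minus sign comes from moving \<open>v\<close>
  past the three arguments of \<gamma>.\<close>

lemma wedge_3_4:
  assumes \<gamma>: "\<gamma> \<in> alt_forms 3"
  shows "(\<Sum>I | length I = 3. \<Sum>J | length J = 4. \<gamma> (map f I) * w (map f J) * V (map f I @ map f J @ [v]))
    = - 24 * (\<Sum>I | length I = 3. \<gamma> (map f I) * w (v # map f I))"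
proof -
  have "(\<Sum>J | length J = 4. w (map f J) * V (map f I @ map f J @ [v])) = - 24 * w (v # map f I)"
    if I: "length I = 3" for I :: "8 list"
  proof -
    have "(\<Sum>J | length J = 4. w (map f J) * V (map f I @ map f J @ [v])) = (\<Sum>J | length J = 4. w (map f J) * V (map f J @ map f I @ [v]))"
      using V_cycle[of "map f I" _ "[v]"] I by (intro sum.cong refl) simp
    also have "\<dots> = 24 * w (map f I @ [v])" by (rule w_V) (simp add: I)
    also have "w (map f I @ [v]) = - w (v # map f I)"
      using alt_forms_move[OF w_alt, of "[]" "map f I" v "[]"] I by simp
    finally show ?thesis by simp
  qed
  then have "(\<Sum>I | length I = 3. \<gamma> (map f I) * (\<Sum>J | length J = 4. w (map f J) * V (map f I @ map f J @ [v])))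
    = (\<Sum>I | length I = 3. \<gamma> (map f I) * (- 24 * w (v # map f I)))"
    by (intro sum.cong refl) auto
  then show ?thesis by (simp add: sum_distrib_left mult_ac)
qed

text \<open>Identifies the type, defined by \<gamma> \<and> \<Phi> = 0, with the orthogonal
  complement of the contractions of \<Phi> with vectors: the 7-form \<gamma> \<and> \<Phi> is
  determined by its contractions with the volume form, and these are the pairings on the
  right.\<close>

lemma L3_48_iff:
  "\<gamma> \<in> L3_48 w \<longleftrightarrow> \<gamma> \<in> alt_forms 3 \<and> (\<forall>a. (\<Sum>I | length I = 3. \<gamma> (map f I) * w (f a # map f I)) = 0)"
proof -
  have "wedge 3 4 \<gamma> w = 0 \<longleftrightarrow> (\<forall>a. (\<Sum>I | length I = 3. \<gamma> (map f I) * w (f a # map f I)) = 0)" if \<gamma>: "\<gamma> \<in> alt_forms 3"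
  proof
    assume z: "wedge 3 4 \<gamma> w = 0"
    show "\<forall>a. (\<Sum>I | length I = 3. \<gamma> (map f I) * w (f a # map f I)) = 0"
    proof
      fix a
      have "(\<Sum>I | length I = 3. \<Sum>J | length J = 4. \<gamma> (map f I) * w (map f J) * V (map f I @ map f J @ [f a])) = 0"
        using wedge_V_contract[of 3 4 "[f a]" \<gamma> w] z by simp
      then show "(\<Sum>I | length I = 3. \<gamma> (map f I) * w (f a # map f I)) = 0" unfolding wedge_3_4[OF \<gamma>] by simp
    qed
  next
    assume z: "\<forall>a. (\<Sum>I | length I = 3. \<gamma> (map f I) * w (f a # map f I)) = 0"
    show "wedge 3 4 \<gamma> w = 0"
    proof (rule alt_forms_complement_zero[OF span_f])
      show "wedge 3 4 \<gamma> w \<in> alt_forms 7"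
        using wedge_alt_forms[OF alt_forms_multilin[OF \<gamma>] alt_forms_multilin[OF w_alt]] by simp
      show "V \<in> alt_forms (length top8)" using V_alt by (simp only: top8)
      show "V (map f top8) \<noteq> 0" unfolding V_f ecov_self[OF top8(1)] by simp
      fix L :: "8 list" assume "7 + length L = length top8"
      then have "length L = 1" unfolding top8 by simp
      then obtain a where L: "L = [a]" by (auto simp: length_Suc_conv)
      show "(\<Sum>I | length I = 7. wedge 3 4 \<gamma> w (map f I) * V (map f (I @ L))) = 0"
        using wedge_V_contract[of 3 4 "[f a]" \<gamma> w] wedge_3_4[OF \<gamma>, of "f a"] z unfolding L by simp
    qed (rule top8)+
  qed
  then show ?thesis unfolding L3_48_def by auto
qed

lemma interior_w_diff: "interior_product X w - interior_product Y w = interior_product (X - Y) w"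
proof
  fix vs
  show "(interior_product X w - interior_product Y w) vs = interior_product (X - Y) w vs"
    using interior_w_sum[of "\<lambda>a. if a = 0 then 1 else -1" "\<lambda>a. if a = 0 then X else Y" "{0, 1::nat}" vs]
    by (simp add: interior_product_def)
qed

text \<open>The vector whose contraction with \<open>w\<close> is the part of type 8. The
  contractions of \<open>w\<close> with the frame vectors are orthogonal of squared length 42 / 3! =
  7, hence the divisor.\<close>

definition vec3 :: "form8 \<Rightarrow> vec8" where
  "vec3 \<gamma> = (\<Sum>a\<in>UNIV. (form_inner g 3 \<gamma> (interior_product (f a) w) / 7) *\<^sub>R f a)"

lemma inner_f_w:
  assumes "\<gamma> \<in> alt_forms 3"
  shows "form_inner g 3 \<gamma> (interior_product (f a) w) = (\<Sum>I | length I = 3. \<gamma> (map f I) * w (f a # map f I)) / 6"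
  unfolding form_inner_eq[OF alt_forms_multilin[OF assms] alt_forms_multilin[OF interior_w_alt_forms]]
  by (simp add: interior_product_def fact_numeral)

lemma vec3_interior:
  "(\<Sum>I | length I = 3. interior_product (vec3 \<gamma>) w (map f I) * w (f a # map f I)) = 6 * form_inner g 3 \<gamma> (interior_product (f a) w)"
proof -
  let ?c = "\<lambda>a. form_inner g 3 \<gamma> (interior_product (f a) w) / 7"
  have 1: "(\<Sum>I | length I = 3. w (f b # map f I) * w (f a # map f I)) = (if b = a then 42 else 0)" for b
    using cay_cay3[of b a] by (simp add: sum_lists_3 w_list)
  have "(\<Sum>I | length I = 3. interior_product (vec3 \<gamma>) w (map f I) * w (f a # map f I))
    = (\<Sum>b\<in>UNIV. ?c b * (\<Sum>I | length I = 3. w (f b # map f I) * w (f a # map f I)))"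
    unfolding vec3_def interior_w_sum sum_distrib_left sum_distrib_right
    by (subst sum.swap) (simp add: mult_ac)
  also have "\<dots> = (\<Sum>b\<in>UNIV. ?c b * (if b = a then 42 else 0))"
    unfolding 1 ..
  also have "\<dots> = (\<Sum>b\<in>UNIV. if b = a then ?c b * 42 else 0)" by (intro sum.cong refl) simp
  finally show ?thesis by simp
qed

lemma L3_48_interior_inner:
  assumes "\<gamma> \<in> L3_48 w" shows "form_inner g 3 \<gamma> (interior_product X w) = 0"
proof -
  from assms have \<gamma>: "\<gamma> \<in> alt_forms 3" and "\<And>a. (\<Sum>I | length I = 3. \<gamma> (map f I) * w (f a # map f I)) = 0"
    unfolding L3_48_iff by auto
  then show ?thesis unfolding interior_inner[OF \<gamma>] by simp
qed

lemma vec3_residual: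
  assumes \<gamma>: "\<gamma> \<in> alt_forms 3" shows "\<gamma> - interior_product (vec3 \<gamma>) w \<in> L3_48 w"
proof -
  have "(\<Sum>I | length I = 3. (\<gamma> - interior_product (vec3 \<gamma>) w) (map f I) * w (f a # map f I)) = 0" for a
    using vec3_interior[of \<gamma> a] inner_f_w[OF \<gamma>, of a] by (simp add: left_diff_distrib sum_subtractf)
  then show ?thesis unfolding L3_48_iff using alt_forms_diff[OF \<gamma> interior_w_alt_forms] by blast
qed

lemma proj_3_8:
  assumes \<gamma>: "\<gamma> \<in> alt_forms 3" shows "orth_proj g 3 (L3_8 w) \<gamma> = interior_product (vec3 \<gamma>) w"
  by (rule orth_proj_eq)
    (auto simp: L3_8_def interior_w_alt_forms interior_w_diff L3_48_interior_inner[OF vec3_residual[OF \<gamma>]])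

lemma L3_48_diff: "\<beta> \<in> L3_48 w \<Longrightarrow> \<gamma> \<in> L3_48 w \<Longrightarrow> \<beta> - \<gamma> \<in> L3_48 w"
  unfolding L3_48_iff by (auto intro: alt_forms_diff simp: left_diff_distrib sum_subtractf)

lemma L3_48_zero: "0 \<in> L3_48 w"
  unfolding L3_48_iff by (simp add: alt_forms_zero)

lemma proj_3_48:
  assumes \<gamma>: "\<gamma> \<in> alt_forms 3" shows "orth_proj g 3 (L3_48 w) \<gamma> = \<gamma> - interior_product (vec3 \<gamma>) w"
proof (rule orth_proj_eq)
  fix \<beta> assume b: "\<beta> \<in> L3_48 w"
  have "form_inner g 3 (\<gamma> - (\<gamma> - interior_product (vec3 \<gamma>) w)) \<beta> = form_inner g 3 \<beta> (interior_product (vec3 \<gamma>) w)"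
    using form_inner_commute[OF interior_w_alt_forms, of \<beta>] b by (simp add: L3_48_iff)
  then show "form_inner g 3 (\<gamma> - (\<gamma> - interior_product (vec3 \<gamma>) w)) \<beta> = 0"
    using L3_48_interior_inner[OF b] by simp
qed (use vec3_residual[OF \<gamma>] L3_48_diff in \<open>auto simp: L3_48_iff\<close>)

text \<open>Recovers the vector from the form by a formula instead of a choice; this lets the vector
  depend differentiably on the point.\<close>

lemma L3_8_eq: assumes "\<gamma> \<in> L3_8 w" shows "\<gamma> = interior_product (vec3 \<gamma>) w"
proof -
  have "\<gamma> \<in> alt_forms 3" using assms interior_w_alt_forms by (auto simp: L3_8_def)
  then have "orth_proj g 3 (L3_8 w) \<gamma> = interior_product (vec3 \<gamma>) w" by (rule proj_3_8)
  moreover have "orth_proj g 3 (L3_8 w) \<gamma> = \<gamma>"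
    by (rule orth_proj_eq) (use assms in \<open>auto simp: L3_8_def interior_w_alt_forms interior_w_diff form_inner_zero_left\<close>)
  ultimately show ?thesis by simp
qed

end

lemma form_inner_add_right: "form_inner g k \<gamma> (\<alpha> + \<beta>) = form_inner g k \<gamma> \<alpha> + form_inner g k \<gamma> \<beta>"
  by (simp add: form_inner_def distrib_left sum.distrib add_divide_distrib)

lemma multilin_update_sum:
  assumes "multilin (length vs) \<alpha>" "s < length vs"
  shows "\<alpha> (vs[s := \<Sum>p\<in>S. c p *\<^sub>R v p]) = (\<Sum>p\<in>S. c p * \<alpha> (vs[s := v p]))"
proof -
  have l: "linear (\<lambda>x. \<alpha> (take s vs @ x # drop (Suc s) vs))"
    by (rule multilinD[OF assms(1)]) (use assms(2) in simp)
  show ?thesis using assms(2)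
    by (simp only: upd_conv_take_nth_drop linear_sum[OF l] linear_cmul[OF l] real_scaleR_def)
qed

lemma alt_forms_insert:
  assumes "\<alpha> \<in> alt_forms k" "s \<le> length M"
  shows "\<alpha> (map f (take s M @ a # drop s M)) = (-1) ^ s * \<alpha> (f a # map f M)"
proof -
  have "\<alpha> (map f (take s M @ a # drop s M)) = (-1) ^ s * \<alpha> (f a # (map f (take s M) @ map f (drop s M)))"
    using alt_forms_move[OF assms(1), of "[]" "map f (take s M)" "f a" "map f (drop s M)"] assms(2) by simp
  also have "map f (take s M) @ map f (drop s M) = map f M" by (metis append_take_drop_id map_append)
  finally show ?thesis .
qed

lemma act_sum: "act B (\<lambda>vs. \<Sum>i\<in>S. c i * \<alpha> i vs) vs = (\<Sum>i\<in>S. c i * act B (\<alpha> i) vs)"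
  unfolding act_def sum_distrib_left by (rule sum.swap)

context spin7_fibre
begin

section \<open>The action of gl(8) on 4-forms, the Hodge star, and the types in degree 4\<close>

subsection \<open>Endomorphisms given by matrices in the frame\<close>

definition endo :: "(8 \<Rightarrow> 8 \<Rightarrow> real) \<Rightarrow> vec8 \<Rightarrow> vec8" where
  "endo b v = (\<Sum>i\<in>UNIV. \<Sum>p\<in>UNIV. (g (f i) v * b i p) *\<^sub>R f p)"

lemma endo_linear: "linear (endo b)"
  unfolding endo_def
  by (intro linear_compose_sum ballI) (auto simp: linear_iff linear_add[OF g_lin] linear_cmul[OF g_lin] algebra_simps)

lemma endo_f: "endo b (f j) = (\<Sum>p\<in>UNIV. b j p *\<^sub>R f p)"
proof -
  have "endo b (f j) = (\<Sum>i\<in>UNIV. if i = j then \<Sum>p\<in>UNIV. b i p *\<^sub>R f p else 0)"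
    unfolding endo_def by (intro sum.cong refl) (simp add: g_f)
  then show ?thesis by simp
qed

lemma raise_second_eq:
  assumes \<beta>: "\<beta> \<in> alt_forms 2" shows "raise_second g \<beta> = endo (\<lambda>i p. \<beta> [f i, f p])"
proof
  fix v
  have l1: "linear (\<lambda>u. \<beta> [u, x])" for x
    using multilinD[OF alt_forms_multilin[OF \<beta>], of "[]" "[x]"] by simp
  have l2: "linear (\<lambda>u. \<beta> [x, u])" for x
    using multilinD[OF alt_forms_multilin[OF \<beta>], of "[x]" "[]"] by simp
  have "raise_second g \<beta> v = (\<Sum>k\<in>UNIV. \<beta> [v, f k] *\<^sub>R f k)"
  proof (subst vec_eq_iff, intro allI)
    fix p :: 8
    have "linear (\<lambda>u::vec8. u $ p)" by (simp add: linear_iff)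
    from contract[OF l2 this, of v]
    have "(\<Sum>i\<in>UNIV. \<Sum>j\<in>UNIV. inverse_metric g i j * \<beta> [v, e8 i] * e8 j $ p) = (\<Sum>k\<in>UNIV. \<beta> [v, f k] * f k $ p)" .
    moreover have "(\<Sum>j\<in>UNIV. inverse_metric g i j * \<beta> [v, e8 i] * e8 j $ p) = \<beta> [v, e8 i] * inverse_metric g i p" for i
    proof -
      have "(\<Sum>j\<in>UNIV. inverse_metric g i j * \<beta> [v, e8 i] * e8 j $ p)
          = (\<Sum>j\<in>UNIV. if j = p then inverse_metric g i j * \<beta> [v, e8 i] else 0)"
        by (intro sum.cong refl) (simp add: axis_nth_if)
      then show ?thesis by simp
    qed
    ultimately show "raise_second g \<beta> v $ p = (\<Sum>k\<in>UNIV. \<beta> [v, f k] *\<^sub>R f k) $ p"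
      by (simp add: raise_second_def)
  qed
  also have "\<beta> [v, f k] = (\<Sum>i\<in>UNIV. g (f i) v * \<beta> [f i, f k])" for k
    by (subst frame_expansion[of v]) (simp only: linear_sum[OF l1] linear_cmul[OF l1] real_scaleR_def)
  then have "(\<Sum>k\<in>UNIV. \<beta> [v, f k] *\<^sub>R f k) = endo (\<lambda>i p. \<beta> [f i, f p]) v"
    unfolding endo_def by (subst sum.swap) (simp add: scaleR_sum_left)
  finally show "raise_second g \<beta> v = endo (\<lambda>i p. \<beta> [f i, f p]) v" .
qed

lemma diamond_eq: "\<beta> \<in> alt_forms 2 \<Longrightarrow> diamond g \<beta> \<omega> = act (endo (\<lambda>i p. \<beta> [f i, f p])) \<omega>"
  by (simp add: diamond_def act_def raise_second_eq)

lemma act_f: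
  assumes "multilin (length I) \<alpha>"
  shows "act (endo b) \<alpha> (map f I) = (\<Sum>s<length I. \<Sum>p\<in>UNIV. b (I ! s) p * \<alpha> (map f (I[s := p])))"
  unfolding act_def using assms
  by (simp add: endo_f multilin_update_sum map_update)

text \<open>Interchanging the entry in slot s with the summation index p moves the endomorphism to
  the other factor and transposes its matrix. \<open>F\<close> is a function of index lists, to be
  used for \<open>V\<close> with its remaining arguments fixed.\<close>

lemma act_contract:
  assumes \<alpha>: "multilin k \<alpha>"
  shows "(\<Sum>I | length I = k. act (endo b) \<alpha> (map f I) * F I)
    = (\<Sum>I | length I = k. \<alpha> (map f I) * (\<Sum>s<k. \<Sum>p\<in>UNIV. b p (I ! s) * F (I[s := p])))"
proof -
  have *: "(\<Sum>I | length I = k. \<Sum>p\<in>UNIV. b (I ! s) p * \<alpha> (map f (I[s := p])) * F I)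
    = (\<Sum>I | length I = k. \<Sum>p\<in>UNIV. \<alpha> (map f I) * (b p (I ! s) * F (I[s := p])))" if s: "s < k" for s
  proof -
    obtain m where m: "k = Suc m" "s \<le> m" using s by (cases k) auto
    let ?ins = "\<lambda>a M. take s M @ a # drop s M"
    have i: "?ins a M ! s = a" "(?ins a M)[s := p] = ?ins p M" if "length M = m" for a p and M :: "8 list"
      using that m by (simp_all add: nth_append list_update_append)
    have "(\<Sum>I | length I = k. \<Sum>p\<in>UNIV. b (I ! s) p * \<alpha> (map f (I[s := p])) * F I)
      = (\<Sum>a\<in>UNIV. \<Sum>M | length M = m. \<Sum>p\<in>UNIV. b a p * \<alpha> (map f (?ins p M)) * F (?ins a M))"
      unfolding m(1) sum_lists_insert[OF m(2)] by (intro sum.cong refl) (simp only: i mem_Collect_eq)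
    also have "\<dots> = (\<Sum>M | length M = m. \<Sum>a\<in>UNIV. \<Sum>p\<in>UNIV. b a p * \<alpha> (map f (?ins p M)) * F (?ins a M))"
      by (rule sum.swap)
    also have "\<dots> = (\<Sum>M | length M = m. \<Sum>p\<in>UNIV. \<Sum>a\<in>UNIV. b a p * \<alpha> (map f (?ins p M)) * F (?ins a M))"
      by (intro sum.cong refl sum.swap)
    also have "\<dots> = (\<Sum>p\<in>UNIV. \<Sum>M | length M = m. \<Sum>a\<in>UNIV. b a p * \<alpha> (map f (?ins p M)) * F (?ins a M))"
      by (rule sum.swap)
    also have "\<dots> = (\<Sum>I | length I = k. \<Sum>p\<in>UNIV. \<alpha> (map f I) * (b p (I ! s) * F (I[s := p])))"
      unfolding m(1) sum_lists_insert[OF m(2)]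
      by (intro sum.cong refl) (simp only: i mem_Collect_eq, simp only: mult_ac)
    finally show ?thesis .
  qed
  have "(\<Sum>I | length I = k. act (endo b) \<alpha> (map f I) * F I)
    = (\<Sum>I | length I = k. \<Sum>s<k. \<Sum>p\<in>UNIV. b (I ! s) p * \<alpha> (map f (I[s := p])) * F I)"
    by (intro sum.cong refl) (simp add: act_f \<alpha> sum_distrib_right)
  also have "\<dots> = (\<Sum>s<k. \<Sum>I | length I = k. \<Sum>p\<in>UNIV. b (I ! s) p * \<alpha> (map f (I[s := p])) * F I)"
    by (rule sum.swap)
  also have "\<dots> = (\<Sum>s<k. \<Sum>I | length I = k. \<Sum>p\<in>UNIV. \<alpha> (map f I) * (b p (I ! s) * F (I[s := p])))"
    by (intro sum.cong refl *) simp
  also have "\<dots> = (\<Sum>I | length I = k. \<Sum>s<k. \<Sum>p\<in>UNIV. \<alpha> (map f I) * (b p (I ! s) * F (I[s := p])))"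
    by (rule sum.swap)
  finally show ?thesis by (simp add: sum_distrib_left)
qed

lemma act_add: "\<alpha> \<in> alt_forms k \<Longrightarrow> act (endo (\<lambda>i p. a i p + b i p)) \<alpha> = act (endo a) \<alpha> + act (endo b) \<alpha>"
  by (rule alt_forms_ext[OF span_f])
    (auto intro!: act_alt_forms endo_linear alt_forms_add simp: act_f alt_forms_multilin distrib_right sum.distrib)

lemma act_scale: "\<alpha> \<in> alt_forms k \<Longrightarrow> act (endo (\<lambda>i p. c * b i p)) \<alpha> = (\<lambda>vs. c * act (endo b) \<alpha> vs)"
  by (rule alt_forms_ext[OF span_f])
    (auto intro!: act_alt_forms endo_linear alt_forms_scale simp: act_f alt_forms_multilin sum_distrib_left mult.assoc)

abbreviation tr :: "(8 \<Rightarrow> 8 \<Rightarrow> real) \<Rightarrow> real" where "tr b \<equiv> \<Sum>i\<in>UNIV. b i i"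

text \<open>Replacing one vector of the full frame by a different frame vector produces a
  repetition, so only the diagonal entries of \<open>b\<close> contribute on the frame; in top
  degree that value decides.\<close>

lemma act_V: "act (endo b) V = (\<lambda>vs. tr b * V vs)"
proof -
  let ?T = "act (endo b) V - (\<lambda>vs. tr b * V vs)"
  have V8: "V \<in> alt_forms (length top8)" using V_alt by (simp only: top8)
  have up: "V (map f (top8[s := p])) = (if p = top8 ! s then V (map f top8) else 0)" if s: "s < length top8" for s p
  proof (cases "p = top8 ! s")
    case False
    have "\<not> distinct (top8[s := p])"
    proof
      assume d: "distinct (top8[s := p])"
      obtain t where t: "t < length top8" "top8 ! t = p"
        using top8(2) by (metis UNIV_I in_set_conv_nth)
      then have "t \<noteq> s" using False by auto
      then have "top8[s := p] ! t = top8[s := p] ! s" using t s by (simp only: nth_list_update_neq nth_list_update_eq)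
      then show False using d t(1) s \<open>t \<noteq> s\<close> nth_eq_iff_index_eq[OF d, of t s] by (simp only: length_list_update)
    qed
    then have "V (map f (top8[s := p])) = 0" by (rule alt_forms_not_distinct[OF V_alt])
    then show ?thesis using False by (simp only: if_False)
  qed (simp only: list_update_id if_True refl)
  have "act (endo b) V (map f top8) = (\<Sum>s<length top8. \<Sum>p\<in>UNIV. b (top8 ! s) p * (if p = top8 ! s then V (map f top8) else 0))"
    unfolding act_f[OF alt_forms_multilin[OF V8]] by (intro sum.cong refl) (simp only: up lessThan_iff)
  also have "\<dots> = (\<Sum>s<length top8. b (top8 ! s) (top8 ! s) * V (map f top8))"
  proof (rule sum.cong[OF refl])
    fix s
    have "(\<Sum>p\<in>UNIV. b x p * (if p = x then c else 0)) = b x x * c" for x and c :: real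
    proof -
      have "(\<Sum>p\<in>UNIV. b x p * (if p = x then c else 0)) = (\<Sum>p\<in>UNIV. if p = x then b x p * c else 0)"
        by (intro sum.cong refl) simp
      then show ?thesis by simp
    qed
    then show "(\<Sum>p\<in>UNIV. b (top8 ! s) p * (if p = top8 ! s then V (map f top8) else 0)) = b (top8 ! s) (top8 ! s) * V (map f top8)" .
  qed
  also have "\<dots> = (\<Sum>i\<in>UNIV. b i i * V (map f top8))"
    by (rule sum.reindex_bij_betw[where g = "\<lambda>i. b i i * V (map f top8)"])
      (rule bij_betw_nth[OF top8(1) refl top8(2)[symmetric]])
  finally have "?T (map f top8) = 0" by (simp only: fun_diff_def sum_distrib_right diff_self)
  moreover have "?T \<in> alt_forms (length top8)"
    by (intro alt_forms_diff act_alt_forms endo_linear alt_forms_scale V8)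
  ultimately have "?T = 0" by (intro alt_forms_top_zero[OF span_f _ top8(1,2)])
  then show ?thesis by simp
qed

subsection \<open>The Hodge star on 4-forms\<close>

abbreviation star4 :: "form8 \<Rightarrow> form8" where "star4 \<eta> \<equiv> hodge g V 4 \<eta>"

lemma star4_alt_forms: "\<eta> \<in> alt_forms 4 \<Longrightarrow> star4 \<eta> \<in> alt_forms 4"
  by (rule hodge_alt_forms) (auto intro: alt_forms_multilin)

lemma star4_eq: "\<eta> \<in> alt_forms 4 \<Longrightarrow> (\<Sum>I | length I = 4. \<eta> (map f I) * V (map f I @ vs)) = 24 * star4 \<eta> vs"
  by (simp add: hodge_eq alt_forms_multilin fact_numeral)

text \<open>\<open>act_contract\<close> moves the transpose of b onto the first four arguments of
  \<open>V\<close>. Acting on all eight it is the trace, so on the first four it is the trace minus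
  the action on the last four. Consequently the star commutes with skew b and anticommutes with
  symmetric traceless b on forms.\<close>

lemma star4_act:
  assumes \<eta>: "\<eta> \<in> alt_forms 4"
  shows "star4 (act (endo b) \<eta>) = (\<lambda>vs. tr b * star4 \<eta> vs) - act (endo (\<lambda>i p. b p i)) (star4 \<eta>)"
proof (rule alt_forms_ext[OF span_f])
  let ?B = "endo (\<lambda>i p. b p i)"
  have \<eta>': "act (endo b) \<eta> \<in> alt_forms 4" by (rule act_alt_forms[OF endo_linear \<eta>])
  then show "star4 (act (endo b) \<eta>) \<in> alt_forms 4" by (rule star4_alt_forms)
  show "(\<lambda>vs. tr b * star4 \<eta> vs) - act ?B (star4 \<eta>) \<in> alt_forms 4"
    by (intro alt_forms_diff act_alt_forms endo_linear alt_forms_scale star4_alt_forms \<eta>)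
  fix L :: "8 list" assume L: "length L = 4"
  let ?vs = "map f L"
  have "(\<Sum>I | length I = 4. act (endo b) \<eta> (map f I) * V (map f I @ ?vs))
    = (\<Sum>I | length I = 4. \<eta> (map f I) * act ?B (\<lambda>us. V (us @ ?vs)) (map f I))"
    unfolding act_contract[OF alt_forms_multilin[OF \<eta>]]
  proof (rule sum.cong[OF refl])
    fix I :: "8 list" assume "I \<in> {I. length I = 4}"
    then have I: "length I = 4" by simp
    have "multilin (length I) (\<lambda>us. V (us @ ?vs))" by (rule alt_forms_multilin[OF V_append_alt]) (simp add: I L)
    from act_f[OF this, of "\<lambda>i p. b p i"]
    show "\<eta> (map f I) * (\<Sum>s<4. \<Sum>p\<in>UNIV. b p (I ! s) * V (map f (I[s := p]) @ ?vs))
      = \<eta> (map f I) * act ?B (\<lambda>us. V (us @ ?vs)) (map f I)" by (simp only: I)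
  qed
  also have "\<dots> = (\<Sum>I | length I = 4. \<eta> (map f I) * (tr b * V (map f I @ ?vs) - act ?B (\<lambda>ws. V (map f I @ ws)) ?vs))"
  proof (intro sum.cong refl)
    fix I :: "8 list"
    have "tr b * V (map f I @ ?vs) = act ?B V (map f I @ ?vs)" unfolding act_V ..
    then show "\<eta> (map f I) * act ?B (\<lambda>us. V (us @ ?vs)) (map f I)
      = \<eta> (map f I) * (tr b * V (map f I @ ?vs) - act ?B (\<lambda>ws. V (map f I @ ws)) ?vs)"
      unfolding act_append by simp
  qed
  also have "\<dots> = tr b * (\<Sum>I | length I = 4. \<eta> (map f I) * V (map f I @ ?vs))
      - act ?B (\<lambda>ws. \<Sum>I | length I = 4. \<eta> (map f I) * V (map f I @ ws)) ?vs"
    unfolding act_sum by (simp add: right_diff_distrib sum_subtractf sum_distrib_left mult.left_commute)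
  also have "(\<lambda>ws. \<Sum>I | length I = 4. \<eta> (map f I) * V (map f I @ ws)) = (\<lambda>ws. 24 * star4 \<eta> ws)"
    using star4_eq[OF \<eta>] by blast
  also have "act ?B (\<lambda>ws. 24 * star4 \<eta> ws) ?vs = 24 * act ?B (star4 \<eta>) ?vs"
    by (simp add: act_def sum_distrib_left)
  finally show "star4 (act (endo b) \<eta>) ?vs = ((\<lambda>vs. tr b * star4 \<eta> vs) - act ?B (star4 \<eta>)) ?vs"
    unfolding star4_eq[OF \<eta>] star4_eq[OF \<eta>'] by simp
qed

lemma star4_star4:
  assumes \<eta>: "\<eta> \<in> alt_forms 4" shows "star4 (star4 \<eta>) = \<eta>"
proof (rule alt_forms_ext[OF span_f star4_alt_forms[OF star4_alt_forms[OF \<eta>]] \<eta>])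
  fix L :: "8 list" assume L: "length L = 4"
  show "star4 (star4 \<eta>) (map f L) = \<eta> (map f L)"
  proof (cases "distinct L")
    case False
    then show ?thesis
      using alt_forms_not_distinct[OF star4_alt_forms[OF star4_alt_forms[OF \<eta>]] False, of f]
        alt_forms_not_distinct[OF \<eta> False, of f] by simp
  next
    case True
    \<comment> \<open>576 = 24 * 24, one factor 4! from \<open>star4_eq\<close> for each
      star.\<close>
    have "576 * star4 (star4 \<eta>) (map f L) = 24 * (\<Sum>J | length J = 4. star4 \<eta> (map f J) * V (map f J @ map f L))"
      unfolding star4_eq[OF star4_alt_forms[OF \<eta>]] by simp
    also have "\<dots> = (\<Sum>J | length J = 4. (\<Sum>I | length I = 4. \<eta> (map f I) * V (map f I @ map f J)) * V (map f J @ map f L))"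
      unfolding star4_eq[OF \<eta>] by (simp add: sum_distrib_left mult.assoc)
    also have "\<dots> = (\<Sum>I | length I = 4. \<eta> (map f I) * (\<Sum>J | length J = 4. V (map f I @ map f J) * V (map f J @ map f L)))"
      unfolding sum_distrib_left sum_distrib_right by (subst sum.swap) (simp only: mult.assoc)
    also have "\<dots> = (\<Sum>I | length I = 4. \<eta> (map f I) * (24 * ecov L (map e8 I)))"
      unfolding map_append[symmetric] V_f by (intro sum.cong refl) (simp only: eps_eps[OF L True] mem_Collect_eq)
    also have "\<dots> = 24 * (\<Sum>I | length I = length L. ecov L (map e8 I) * \<eta> (map f I))"
      by (simp add: sum_distrib_left mult_ac L)
    also have "(\<Sum>I | length I = length L. ecov L (map e8 I) * \<eta> (map f I)) = fact (length L) * \<eta> (map f L)"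
    proof (rule ecov_contract)
      fix \<sigma> and I :: "8 list" assume "\<sigma> permutes {..<length L}" "length I = length L"
      then show "\<eta> (map f (map (\<lambda>i. I ! \<sigma> i) [0..<length L])) = of_int (sign \<sigma>) * \<eta> (map f I)"
        using alt_forms_permute_map[OF \<eta>, of \<sigma> I f] by simp
    qed
    finally show ?thesis by (simp add: L fact_numeral)
  qed
qed

lemma inner4: "\<alpha> \<in> alt_forms 4 \<Longrightarrow> \<beta> \<in> alt_forms 4 \<Longrightarrow>
    form_inner g 4 \<alpha> \<beta> = (\<Sum>K | length K = 4. \<alpha> (map f K) * \<beta> (map f K)) / 24"
  by (simp add: form_inner_eq alt_forms_multilin fact_numeral)

lemma star4_adjoint:
  assumes \<alpha>: "\<alpha> \<in> alt_forms 4" and \<beta>: "\<beta> \<in> alt_forms 4"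
  shows "form_inner g 4 (star4 \<alpha>) \<beta> = form_inner g 4 \<alpha> (star4 \<beta>)"
proof -
  have "24 * (\<Sum>J | length J = 4. star4 \<alpha> (map f J) * \<beta> (map f J))
     = (\<Sum>J | length J = 4. (\<Sum>I | length I = 4. \<alpha> (map f I) * V (map f I @ map f J)) * \<beta> (map f J))"
    unfolding star4_eq[OF \<alpha>] by (simp add: sum_distrib_left mult.assoc)
  also have "\<dots> = (\<Sum>I | length I = 4. \<alpha> (map f I) * (\<Sum>J | length J = 4. \<beta> (map f J) * V (map f I @ map f J)))"
    unfolding sum_distrib_left sum_distrib_right by (subst sum.swap) (simp only: mult_ac)
  also have "\<dots> = (\<Sum>I | length I = 4. \<alpha> (map f I) * (\<Sum>J | length J = 4. \<beta> (map f J) * V (map f J @ map f I)))"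
  proof (intro sum.cong refl arg_cong2[where f="(*)"])
    fix I J :: "8 list" assume "I \<in> {I. length I = 4}" "J \<in> {J. length J = 4}"
    then show "V (map f I @ map f J) = V (map f J @ map f I)"
      using V_cycle[of "map f I" "map f J" "[]"] by simp
  qed
  also have "\<dots> = 24 * (\<Sum>I | length I = 4. \<alpha> (map f I) * star4 \<beta> (map f I))"
    unfolding star4_eq[OF \<beta>] by (simp add: sum_distrib_left mult_ac)
  finally show ?thesis unfolding inner4[OF star4_alt_forms[OF \<alpha>] \<beta>] inner4[OF \<alpha> star4_alt_forms[OF \<beta>]] by simp
qed

lemma inner_sd_asd:
  assumes \<alpha>: "\<alpha> \<in> alt_forms 4" "star4 \<alpha> = \<alpha>" and \<beta>: "\<beta> \<in> alt_forms 4" "star4 \<beta> = - \<beta>"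
  shows "form_inner g 4 \<alpha> \<beta> = 0" "form_inner g 4 \<beta> \<alpha> = 0"
proof -
  have "form_inner g 4 \<beta> \<alpha> = form_inner g 4 (star4 \<beta>) \<alpha>" using star4_adjoint[OF \<beta>(1) \<alpha>(1)] \<alpha>(2) by simp
  also have "\<dots> = - form_inner g 4 \<beta> \<alpha>" unfolding \<beta>(2)
    using form_inner_scale_left[of g 4 "-1" \<beta> \<alpha>] by (simp add: fun_Compl_def)
  finally show "form_inner g 4 \<beta> \<alpha> = 0" by simp
  then show "form_inner g 4 \<alpha> \<beta> = 0" using form_inner_commute[OF \<alpha>(1) \<beta>(1)] by simp
qed

subsection \<open>The orbit directions\<close>

text \<open>Up to the factor 1/6, the gradient of the linear function that sends a matrix b to the
  inner product of b.w with \<eta>; see \<open>inner_act_w\<close>. It records how \<eta> pairs with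
  the tangent directions of the gl(8)-orbit of \<open>w\<close>.\<close>

definition H :: "form8 \<Rightarrow> 8 \<Rightarrow> 8 \<Rightarrow> real" where
  "H \<eta> i p = (\<Sum>M | length M = 3. \<eta> (f i # map f M) * w (f p # map f M))"

lemma act_w_alt: "act (endo b) w \<in> alt_forms 4"
  by (rule act_alt_forms[OF endo_linear w_alt])

text \<open>Moving slot s to the front in both \<open>w\<close> and \<eta> gives the sign twice, so
  the four slots contribute equally and 4 / 4! leaves 1/6.\<close>

lemma inner_act_w:
  assumes \<eta>: "\<eta> \<in> alt_forms 4"
  shows "form_inner g 4 (act (endo b) w) \<eta> = (\<Sum>i\<in>UNIV. \<Sum>p\<in>UNIV. b i p * H \<eta> i p) / 6"
proof -
  have *: "(\<Sum>I | length I = 4. (\<Sum>p\<in>UNIV. b (I ! s) p * w (map f (I[s := p]))) * \<eta> (map f I))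
     = (\<Sum>i\<in>UNIV. \<Sum>p\<in>UNIV. b i p * H \<eta> i p)" if s: "s < 4" for s
  proof -
    have s3: "s \<le> 3" using s by simp
    let ?ins = "\<lambda>a M. take s M @ a # drop s M"
    have i: "(\<Sum>p\<in>UNIV. b (?ins a M ! s) p * w (map f ((?ins a M)[s := p]))) * \<eta> (map f (?ins a M))
        = (\<Sum>p\<in>UNIV. b a p * (\<eta> (f a # map f M) * w (f p # map f M)))" if "length M = 3" for a and M :: "8 list"
    proof -
      have "?ins a M ! s = a" "(?ins a M)[s := p] = ?ins p M" for p
        using that s3 by (simp_all add: nth_append list_update_append)
      moreover have "w (map f (?ins p M)) = (-1) ^ s * w (f p # map f M)"
         "\<eta> (map f (?ins p M)) = (-1) ^ s * \<eta> (f p # map f M)" for p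
        using alt_forms_insert[OF w_alt, of s M f p] alt_forms_insert[OF \<eta>, of s M f p] that s3 by simp_all
      ultimately show ?thesis
        by (simp only: sum_distrib_right) (simp add: mult_ac power_mult_distrib[symmetric])
    qed
    have "(4::nat) = Suc 3" by simp
    then have "(\<Sum>I | length I = 4. (\<Sum>p\<in>UNIV. b (I ! s) p * w (map f (I[s := p]))) * \<eta> (map f I))
       = (\<Sum>a\<in>UNIV. \<Sum>M | length M = 3. \<Sum>p\<in>UNIV. b a p * (\<eta> (f a # map f M) * w (f p # map f M)))"
      by (simp only: sum_lists_insert[OF s3]) (intro sum.cong refl i, simp)
    also have "\<dots> = (\<Sum>a\<in>UNIV. \<Sum>p\<in>UNIV. b a p * H \<eta> a p)"
      unfolding H_def sum_distrib_left by (intro sum.cong refl sum.swap)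
    finally show ?thesis .
  qed
  have "(\<Sum>I | length I = 4. act (endo b) w (map f I) * \<eta> (map f I))
     = (\<Sum>I | length I = 4. \<Sum>s<4. (\<Sum>p\<in>UNIV. b (I ! s) p * w (map f (I[s := p]))) * \<eta> (map f I))"
    by (intro sum.cong refl) (simp add: act_f alt_forms_multilin[OF w_alt] sum_distrib_right del: sum.lessThan_Suc)
  also have "\<dots> = (\<Sum>s<4. (\<Sum>I | length I = 4. (\<Sum>p\<in>UNIV. b (I ! s) p * w (map f (I[s := p]))) * \<eta> (map f I)))"
    by (rule sum.swap)
  also have "\<dots> = (\<Sum>s<(4::nat). \<Sum>i\<in>UNIV. \<Sum>p\<in>UNIV. b i p * H \<eta> i p)"
    by (intro sum.cong refl *) simp
  finally show ?thesis unfolding inner4[OF act_w_alt \<eta>] by simp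
qed

lemma H_w: "H w i p = (if i = p then 42 else 0)"
  using cay_cay3[of i p] by (simp add: H_def sum_lists_3 w_list)

lemma inner_act_w_w: "form_inner g 4 (act (endo b) w) w = 7 * tr b"
proof -
  have "(\<Sum>p\<in>UNIV. b i p * (if i = p then 42 else 0)) = 42 * b i i" for i
  proof -
    have "(\<Sum>p\<in>UNIV. b i p * (if i = p then 42 else 0)) = (\<Sum>p\<in>UNIV. if i = p then b i p * 42 else 0)"
      by (intro sum.cong refl) simp
    then show ?thesis by simp
  qed
  then show ?thesis unfolding inner_act_w[OF w_alt] H_w by (simp add: sum_distrib_left[symmetric])
qed

lemma inner_w_w: "form_inner g 4 w w = 14"
proof -
  have "(\<Sum>K | length K = 4. w (map f K) * w (map f K)) = 336"
    using cay_cay4 by (simp add: numeral_eq_Suc sum_lists_Suc w_list)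
  then show ?thesis unfolding inner4[OF w_alt w_alt] by simp
qed

lemma act_w_list:
  "act (endo b) w [f i, f j, f k, f l]
    = (\<Sum>q\<in>UNIV. b i q * cay q j k l) + (\<Sum>q\<in>UNIV. b j q * cay i q k l)
    + (\<Sum>q\<in>UNIV. b k q * cay i j q l) + (\<Sum>q\<in>UNIV. b l q * cay i j k q)"
proof -
  have "multilin (length [i,j,k,l]) w" using alt_forms_multilin[OF w_alt] by (simp add: eval_nat_numeral)
  from act_f[OF this, of b] show ?thesis by (simp add: eval_nat_numeral w_list)
qed

text \<open>The first slot contributes 42 b by \<open>cay_cay3\<close>, each of the other three
  contributes 8 P b - 6 b by \<open>cay_cay\<close>, with P = \<open>cay2\<close>; the total is 24
  (b + P b). Thus the eigenvalue -1 is annihilated and the eigenvalue 3 is scaled by 96.\<close>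

lemma H_act_w:
  assumes b: "\<And>i p. b p i = - b i p"
  shows "H (act (endo b) w) i p = 24 * (b i p + cay2 b i p)"
proof -
  \<comment> \<open>The common contribution of slots 2, 3 and 4; the last two are brought to the
    shape of the second by the antisymmetry of \<open>cay\<close>.\<close>
  define K where "K = (\<Sum>j\<in>UNIV. \<Sum>q\<in>UNIV. b j q * (4 * cay i q p j + 6 * dl2 i q p j))"
  have t1: "(\<Sum>j\<in>UNIV. \<Sum>k\<in>UNIV. \<Sum>l\<in>UNIV. (\<Sum>q\<in>UNIV. b i q * cay q j k l) * cay p j k l) = 42 * b i p"
  proof -
    have "(\<Sum>j\<in>UNIV. \<Sum>k\<in>UNIV. \<Sum>l\<in>UNIV. (\<Sum>q\<in>UNIV. b i q * cay q j k l) * cay p j k l)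
      = (\<Sum>j\<in>UNIV. \<Sum>k\<in>UNIV. \<Sum>l\<in>UNIV. \<Sum>q\<in>UNIV. b i q * (cay q j k l * cay p j k l))"
      by (simp only: sum_distrib_right mult.assoc)
    also have "\<dots> = (\<Sum>j\<in>UNIV. \<Sum>q\<in>UNIV. \<Sum>k\<in>UNIV. \<Sum>l\<in>UNIV. b i q * (cay q j k l * cay p j k l))"
      by (rule sum.cong[OF refl], subst sum.swap[of _ UNIV UNIV], rule sum.cong[OF refl], subst sum.swap[of _ UNIV UNIV], simp)
    also have "\<dots> = (\<Sum>q\<in>UNIV. \<Sum>j\<in>UNIV. \<Sum>k\<in>UNIV. \<Sum>l\<in>UNIV. b i q * (cay q j k l * cay p j k l))"
      by (rule sum.swap)
    also have "\<dots> = (\<Sum>q\<in>UNIV. b i q * (if q = p then 42 else 0))"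
      unfolding sum_distrib_left[symmetric] cay_cay3 ..
    also have "\<dots> = (\<Sum>q\<in>UNIV. if q = p then b i q * 42 else 0)" by (intro sum.cong refl) simp
    finally show ?thesis by simp
  qed
  have pull: "(\<Sum>k\<in>UNIV. \<Sum>l\<in>UNIV. (\<Sum>q\<in>UNIV. b j q * X q k l) * Y k l)
      = (\<Sum>q\<in>UNIV. b j q * (\<Sum>k\<in>UNIV. \<Sum>l\<in>UNIV. X q k l * Y k l))" for j and X :: "8 \<Rightarrow> 8 \<Rightarrow> 8 \<Rightarrow> real" and Y
  proof -
    have "(\<Sum>k\<in>UNIV. \<Sum>l\<in>UNIV. (\<Sum>q\<in>UNIV. b j q * X q k l) * Y k l) = (\<Sum>k\<in>UNIV. \<Sum>l\<in>UNIV. \<Sum>q\<in>UNIV. b j q * (X q k l * Y k l))"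
      by (simp only: sum_distrib_right mult.assoc)
    also have "\<dots> = (\<Sum>k\<in>UNIV. \<Sum>q\<in>UNIV. \<Sum>l\<in>UNIV. b j q * (X q k l * Y k l))"
      by (intro sum.cong refl sum.swap)
    also have "\<dots> = (\<Sum>q\<in>UNIV. \<Sum>k\<in>UNIV. \<Sum>l\<in>UNIV. b j q * (X q k l * Y k l))" by (rule sum.swap)
    finally show ?thesis by (simp only: sum_distrib_left)
  qed
  have t2: "(\<Sum>j\<in>UNIV. \<Sum>k\<in>UNIV. \<Sum>l\<in>UNIV. (\<Sum>q\<in>UNIV. b j q * cay i q k l) * cay p j k l) = K"
    unfolding K_def pull cay_cay ..
  have t3: "(\<Sum>j\<in>UNIV. \<Sum>k\<in>UNIV. \<Sum>l\<in>UNIV. (\<Sum>q\<in>UNIV. b k q * cay i j q l) * cay p j k l) = K"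
  proof -
    have e: "(\<Sum>q\<in>UNIV. b k q * cay i j q l) * cay p j k l = (\<Sum>q\<in>UNIV. b k q * cay i q j l) * cay p k j l" for j k l
      by (simp add: cay_swap(2)[of i j _ l] cay_swap(2)[of p j k l] sum_negf)
    have "(\<Sum>j\<in>UNIV. \<Sum>k\<in>UNIV. \<Sum>l\<in>UNIV. (\<Sum>q\<in>UNIV. b k q * cay i j q l) * cay p j k l)
      = (\<Sum>k\<in>UNIV. \<Sum>j\<in>UNIV. \<Sum>l\<in>UNIV. (\<Sum>q\<in>UNIV. b k q * cay i q j l) * cay p k j l)"
      by (rule trans[OF sum.swap], intro sum.cong refl e)
    then show ?thesis unfolding K_def pull cay_cay .
  qed
  have rot: "cay i j k q = cay i q j k" for i j k q
    using cay_swap(3)[of i j k q] cay_swap(2)[of i j q k] by simp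
  have t4: "(\<Sum>j\<in>UNIV. \<Sum>k\<in>UNIV. \<Sum>l\<in>UNIV. (\<Sum>q\<in>UNIV. b l q * cay i j k q) * cay p j k l) = K"
  proof -
    have e: "(\<Sum>q\<in>UNIV. b l q * cay i j k q) * cay p j k l = (\<Sum>q\<in>UNIV. b l q * cay i q j k) * cay p l j k" for j k l
      by (simp only: rot[of i j k] rot[of p j k l])
    have "(\<Sum>j\<in>UNIV. \<Sum>k\<in>UNIV. \<Sum>l\<in>UNIV. (\<Sum>q\<in>UNIV. b l q * cay i j k q) * cay p j k l)
      = (\<Sum>j\<in>UNIV. \<Sum>l\<in>UNIV. \<Sum>k\<in>UNIV. (\<Sum>q\<in>UNIV. b l q * cay i q j k) * cay p l j k)"
      by (rule sum.cong[OF refl], rule trans[OF sum.swap], intro sum.cong refl e)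
    also have "\<dots> = (\<Sum>l\<in>UNIV. \<Sum>j\<in>UNIV. \<Sum>k\<in>UNIV. (\<Sum>q\<in>UNIV. b l q * cay i q j k) * cay p l j k)"
      by (rule sum.swap)
    finally show ?thesis unfolding K_def pull cay_cay .
  qed
  have "K = 4 * (\<Sum>j\<in>UNIV. \<Sum>q\<in>UNIV. cay i p j q * b j q) + 6 * (\<Sum>j\<in>UNIV. \<Sum>q\<in>UNIV. dl2 i q p j * b j q)"
    unfolding K_def sum_distrib_left sum.distrib[symmetric] rot[of i p _ _]
    by (intro sum.cong refl) (simp add: distrib_left)
  also have "(\<Sum>j\<in>UNIV. \<Sum>q\<in>UNIV. cay i p j q * b j q) = 2 * cay2 b i p" by (simp add: cay2_def)
  also have "(\<Sum>j\<in>UNIV. \<Sum>q\<in>UNIV. dl2 i q p j * b j q) = - b i p"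
  proof -
    have "(\<Sum>j\<in>UNIV. \<Sum>q\<in>UNIV. dl2 i q p j * b j q)
      = (\<Sum>j\<in>UNIV. \<Sum>q\<in>UNIV. (if q = j then if i = p then b j q else 0 else 0))
       - (\<Sum>j\<in>UNIV. \<Sum>q\<in>UNIV. (if i = j then 1 else 0) * (if p = q then 1 else 0) * b j q)"
      unfolding sum_subtractf[symmetric] by (intro sum.cong refl) (auto simp: dl2_def)
    also have "(\<Sum>j\<in>UNIV. \<Sum>q\<in>UNIV. (if q = j then if i = p then b j q else 0 else 0)) = 0"
    proof -
      have "b j j = 0" for j using b[of j j] by simp
      then show ?thesis by (cases "i = p") simp_all
    qed
    finally show ?thesis unfolding sum_delta_2 by simp
  qed
  finally have K: "K = 8 * cay2 b i p - 6 * b i p" by simp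
  have "H (act (endo b) w) i p = 42 * b i p + K + K + K"
    unfolding H_def sum_lists_3 list.map act_w_list w_list distrib_right sum.distrib t1 t2 t3 t4 ..
  then show ?thesis unfolding K by simp
qed

end

lemma dl2_skew: "dl2 a b p i = - dl2 a b i p"
  by (simp add: dl2_def conj_commute)

lemma sum_mult_delta: "(\<Sum>i\<in>UNIV. \<Sum>p\<in>(UNIV::8 set). dl2 a b i p * h i p) = h a b - h b a"
proof -
  have "(\<Sum>i\<in>UNIV. \<Sum>p\<in>(UNIV::8 set). dl2 a b i p * h i p)
    = (\<Sum>i\<in>UNIV. \<Sum>p\<in>UNIV. (if a = i then 1 else 0) * (if b = p then 1 else 0) * h i p)
    - (\<Sum>i\<in>UNIV. \<Sum>p\<in>UNIV. (if b = i then 1 else 0) * (if a = p then 1 else 0) * h i p)"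
    unfolding sum_subtractf[symmetric] dl2_delta[symmetric]
    by (intro sum.cong refl) (simp only: left_diff_distrib, simp only: mult_ac)
  then show ?thesis unfolding sum_delta_2 .
qed

context spin7_fibre
begin

definition mat2 :: "(8 \<Rightarrow> 8 \<Rightarrow> real) \<Rightarrow> form8" where
  "mat2 b = (\<lambda>vs. if length vs = 2 then \<Sum>i\<in>UNIV. \<Sum>p\<in>UNIV. b i p * (g (f i) (vs ! 0) * g (f p) (vs ! 1)) else 0)"

lemma mat2_f: "mat2 b [f i, f p] = b i p"
proof -
  have "mat2 b [f i, f p] = (\<Sum>k\<in>UNIV. \<Sum>l\<in>UNIV. (if i = k then 1 else 0) * (if p = l then 1 else 0) * b k l)"
    unfolding mat2_def by (simp add: g_f mult.commute[of "b _ _"] eq_commute[of _ i] eq_commute[of _ p])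
  then show ?thesis unfolding sum_delta_2 .
qed

lemma mat2_alt_forms:
  assumes b: "\<And>i p. b p i = - b i p" shows "mat2 b \<in> alt_forms 2"
proof (rule alt_formsI)
  show "multilin 2 (mat2 b)" unfolding multilin_def
  proof (intro allI impI)
    fix X Y :: "vec8 list" assume "length X + Suc (length Y) = 2"
    then consider y where "X = []" "Y = [y]" | x where "X = [x]" "Y = []"
      by (cases X; cases Y) (auto simp: length_Suc_conv)
    then show "linear (\<lambda>v. mat2 b (X @ v # Y))"
    proof cases
      case 1
      have "linear (\<lambda>v. \<Sum>i\<in>UNIV. \<Sum>p\<in>UNIV. (b i p * g (f p) y) * g (f i) v)"
        by (intro linear_compose_sum ballI linear_scale_real g_lin)
      then show ?thesis using 1 by (simp add: mat2_def mult_ac)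
    next
      case 2
      have "linear (\<lambda>v. \<Sum>i\<in>UNIV. \<Sum>p\<in>UNIV. (b i p * g (f i) x) * g (f p) v)"
        by (intro linear_compose_sum ballI linear_scale_real g_lin)
      then show ?thesis using 2 by (simp add: mat2_def mult_ac)
    qed
  qed
  show "mat2 b (X @ v # v # Y) = 0" if "length X + Suc (Suc (length Y)) = 2" for X v Y
  proof -
    have XY: "X = []" "Y = []" using that by auto
    let ?S = "\<Sum>i\<in>UNIV. \<Sum>p\<in>UNIV. b i p * (g (f i) v * g (f p) v)"
    have "?S = (\<Sum>i\<in>UNIV. \<Sum>p\<in>UNIV. b p i * (g (f p) v * g (f i) v))" by (rule sum.swap)
    also have "\<dots> = - ?S" unfolding sum_negf[symmetric]
    proof (intro sum.cong refl)
      fix i p show "b p i * (g (f p) v * g (f i) v) = - (b i p * (g (f i) v * g (f p) v))"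
        unfolding b[of p i] by (simp add: mult.commute)
    qed
    finally show ?thesis by (simp add: mat2_def XY)
  qed
qed (simp add: mat2_def)

text \<open>Skew matrices in the frame and 2-forms correspond through \<open>mat2\<close>, so the
  type can be parametrised by matrices in the eigenvalue 3 of \<open>cay2\<close>.\<close>

lemma L4_7_iff:
  "\<xi> \<in> L4_7 w \<longleftrightarrow> (\<exists>b. (\<forall>i p. b p i = - b i p) \<and> (\<forall>i p. cay2 b i p = 3 * b i p) \<and> \<xi> = act (endo b) w)"
proof
  assume "\<xi> \<in> L4_7 w"
  then obtain \<beta> where \<beta>: "\<beta> \<in> L2_7 w" and x: "\<xi> = diamond g \<beta> w" unfolding L4_7_def g_eq[symmetric] by auto
  then have a: "\<beta> \<in> alt_forms 2" and c: "\<And>i j. cay2 (\<lambda>k l. \<beta> [f k, f l]) i j = 3 * \<beta> [f i, f j]"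
    unfolding L2_7_iff by auto
  show "\<exists>b. (\<forall>i p. b p i = - b i p) \<and> (\<forall>i p. cay2 b i p = 3 * b i p) \<and> \<xi> = act (endo b) w"
    by (intro exI[of _ "\<lambda>i p. \<beta> [f i, f p]"] conjI allI)
      (rule alt2_swap[OF a], rule c, simp only: x diamond_eq[OF a])
next
  assume "\<exists>b. (\<forall>i p. b p i = - b i p) \<and> (\<forall>i p. cay2 b i p = 3 * b i p) \<and> \<xi> = act (endo b) w"
  then obtain b where b: "\<And>i p. b p i = - b i p" "\<And>i p. cay2 b i p = 3 * b i p" "\<xi> = act (endo b) w" by blast
  have m: "mat2 b \<in> alt_forms 2" by (rule mat2_alt_forms[OF b(1)])
  have "mat2 b \<in> L2_7 w" unfolding L2_7_iff mat2_f using m b(2) by blast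
  moreover have "diamond g (mat2 b) w = \<xi>" unfolding diamond_eq[OF m] mat2_f b(3) ..
  ultimately show "\<xi> \<in> L4_7 w" unfolding L4_7_def g_eq[symmetric] by blast
qed

lemma L4_7I:
  assumes "\<And>i p. b p i = - b i p" "\<And>i p. cay2 b i p = 3 * b i p" shows "act (endo b) w \<in> L4_7 w"
  unfolding L4_7_iff by (intro exI[of _ b] conjI allI assms refl)

lemma L4_7E:
  assumes "\<xi> \<in> L4_7 w"
  obtains b where "\<And>i p. b p i = - b i p" "\<And>i p. cay2 b i p = 3 * b i p" "\<xi> = act (endo b) w"
  using assms unfolding L4_7_iff by blast

lemma L4_7_alt: assumes "\<xi> \<in> L4_7 w" shows "\<xi> \<in> alt_forms 4"
proof (rule L4_7E[OF assms])
  fix b assume x: "\<xi> = act (endo b) w"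
  show ?thesis unfolding x by (rule act_w_alt)
qed

lemma star4_act_skew:
  assumes b: "\<And>i p. b p i = - b i p" shows "star4 (act (endo b) w) = act (endo b) w"
proof -
  have "b i i = 0" for i using b[of i i] by simp
  moreover have "act (endo (\<lambda>i p. b p i)) w = (\<lambda>vs. - act (endo b) w vs)"
  proof -
    have "(\<lambda>i p. b p i) = (\<lambda>i p. (-1) * b i p)"
    proof (intro ext)
      fix i p show "b p i = (-1) * b i p" using b[of p i] by simp
    qed
    then show ?thesis using act_scale[OF w_alt, of "-1" b] by simp
  qed
  ultimately show ?thesis unfolding star4_act[OF w_alt] hodge_w by (simp add: fun_eq_iff)
qed

lemma star4_act_sym:
  assumes b: "\<And>i p. b p i = b i p" and "tr b = 0" shows "star4 (act (endo b) w) = - act (endo b) w"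
  unfolding star4_act[OF w_alt] hodge_w using assms by (simp add: fun_eq_iff)

text \<open>By \<open>H_act_w\<close> the gradient at a matrix of eigenvalue 3 is 24 (1 + 3) a = 96
  a, and 96 / 6 = 16.\<close>

lemma inner_act_act:
  assumes a: "\<And>i p. a p i = - a i p" and c: "\<And>i p. cay2 a i p = 3 * a i p"
  shows "form_inner g 4 (act (endo a) w) (act (endo b) w) = 16 * (\<Sum>i\<in>UNIV. \<Sum>p\<in>UNIV. b i p * a i p)"
proof -
  have "form_inner g 4 (act (endo a) w) (act (endo b) w) = form_inner g 4 (act (endo b) w) (act (endo a) w)"
    by (rule form_inner_commute[OF act_w_alt act_w_alt])
  also have "\<dots> = (\<Sum>i\<in>UNIV. \<Sum>p\<in>UNIV. b i p * (96 * a i p)) / 6"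
    unfolding inner_act_w[OF act_w_alt] H_act_w[of a, OF a] c by simp
  also have "\<dots> = 16 * (\<Sum>i\<in>UNIV. \<Sum>p\<in>UNIV. b i p * a i p)"
    by (simp add: sum_distrib_left sum_divide_distrib mult_ac)
  finally show ?thesis .
qed

text \<open>The infinitesimal invariance of the Cayley form under spin(7). The gradient 24 (a + P a)
  vanishes at eigenvalue -1, so the squared length of a.w is zero.\<close>

lemma act_21_zero:
  assumes a: "\<And>i p. a p i = - a i p" and c: "\<And>i p. cay2 a i p = - a i p"
  shows "act (endo a) w = 0"
proof (rule form_inner_definite[OF act_w_alt])
  show "form_inner g 4 (act (endo a) w) (act (endo a) w) = 0"
    unfolding inner_act_w[OF act_w_alt] H_act_w[of a, OF a] c by simp
qed

subsection \<open>Projections of 4-forms\<close>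

lemma proj_4_1:
  assumes \<eta>: "\<eta> \<in> alt_forms 4"
  shows "orth_proj g 4 (L4_1 w) \<eta> = (\<lambda>vs. form_inner g 4 \<eta> w / 14 * w vs)"
proof (rule orth_proj_eq)
  show "\<gamma> \<in> alt_forms 4" if "\<gamma> \<in> L4_1 w" for \<gamma> using that alt_forms_scale[OF w_alt] by (auto simp: L4_1_def)
  show "\<beta> - \<gamma> \<in> L4_1 w" if bg: "\<beta> \<in> L4_1 w" "\<gamma> \<in> L4_1 w" for \<beta> \<gamma>
  proof -
    obtain x y where "\<beta> = (\<lambda>vs. x * w vs)" "\<gamma> = (\<lambda>vs. y * w vs)" using bg by (auto simp: L4_1_def)
    then have "\<beta> - \<gamma> = (\<lambda>vs. (x - y) * w vs)" by (simp add: fun_eq_iff left_diff_distrib)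
    then show ?thesis by (auto simp: L4_1_def)
  qed
  show "(\<lambda>vs. form_inner g 4 \<eta> w / 14 * w vs) \<in> L4_1 w"
    unfolding L4_1_def by (rule image_eqI[of _ _ "form_inner g 4 \<eta> w / 14"]) (rule refl, rule UNIV_I)
  fix \<gamma> assume "\<gamma> \<in> L4_1 w"
  then obtain h where h: "\<gamma> = (\<lambda>vs. h * w vs)" by (auto simp: L4_1_def)
  let ?\<delta> = "\<eta> - (\<lambda>vs. form_inner g 4 \<eta> w / 14 * w vs)"
  have d: "?\<delta> \<in> alt_forms 4" by (intro alt_forms_diff \<eta> alt_forms_scale w_alt)
  have "form_inner g 4 ?\<delta> w = 0"
    unfolding form_inner_diff_left form_inner_scale_left inner_w_w by simp
  then have "form_inner g 4 w ?\<delta> = 0" using form_inner_commute[OF d w_alt] by simp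
  then have "form_inner g 4 \<gamma> ?\<delta> = 0" unfolding h form_inner_scale_left by simp
  then show "form_inner g 4 ?\<delta> \<gamma> = 0" using form_inner_commute[OF d alt_forms_scale[OF w_alt, of h]] h by simp
qed

lemma L4_35_iff: "\<eta> \<in> L4_35 w \<longleftrightarrow> \<eta> \<in> alt_forms 4 \<and> star4 \<eta> = - \<eta>"
  by (simp add: L4_35_def g_eq V_eq)

lemma hodge_add: "hodge g V k (\<alpha> + \<beta>) = hodge g V k \<alpha> + hodge g V k \<beta>"
  by (rule ext) (simp add: hodge_def distrib_left distrib_right sum.distrib add_divide_distrib)

lemma hodge_diff: "hodge g V k (\<alpha> - \<beta>) = hodge g V k \<alpha> - hodge g V k \<beta>"
  by (rule ext) (simp add: hodge_def right_diff_distrib left_diff_distrib sum_subtractf diff_divide_distrib)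

lemma hodge_scale: "hodge g V k (\<lambda>vs. c * \<alpha> vs) = (\<lambda>vs. c * hodge g V k \<alpha> vs)"
proof
  fix vs
  show "hodge g V k (\<lambda>vs. c * \<alpha> vs) vs = c * hodge g V k \<alpha> vs"
    unfolding hodge_def times_divide_eq_right sum_distrib_left
    by (rule arg_cong[where f="\<lambda>x. x / fact k"], rule sum.cong[OF refl], rule sum.cong[OF refl])
      (simp only: mult_ac)
qed

lemma asd_part:
  assumes \<eta>: "\<eta> \<in> alt_forms 4"
  shows "(\<lambda>vs. 1/2 * (\<eta> - star4 \<eta>) vs) \<in> L4_35 w"
    and "star4 (\<lambda>vs. 1/2 * (\<eta> + star4 \<eta>) vs) = (\<lambda>vs. 1/2 * (\<eta> + star4 \<eta>) vs)"
proof -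
  have "(\<lambda>vs. 1/2 * (\<eta> - star4 \<eta>) vs) \<in> alt_forms 4"
    by (intro alt_forms_scale alt_forms_diff \<eta> star4_alt_forms)
  moreover have "star4 (\<lambda>vs. 1/2 * (\<eta> - star4 \<eta>) vs) = - (\<lambda>vs. 1/2 * (\<eta> - star4 \<eta>) vs)"
    unfolding hodge_scale hodge_diff star4_star4[OF \<eta>] by (rule ext) (simp add: field_simps)
  ultimately show "(\<lambda>vs. 1/2 * (\<eta> - star4 \<eta>) vs) \<in> L4_35 w" unfolding L4_35_iff by blast
  show "star4 (\<lambda>vs. 1/2 * (\<eta> + star4 \<eta>) vs) = (\<lambda>vs. 1/2 * (\<eta> + star4 \<eta>) vs)"
    unfolding hodge_scale hodge_add star4_star4[OF \<eta>] by (rule ext) (simp add: field_simps)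
qed

lemma proj_4_35:
  assumes \<eta>: "\<eta> \<in> alt_forms 4"
  shows "orth_proj g 4 (L4_35 w) \<eta> = (\<lambda>vs. 1/2 * (\<eta> - star4 \<eta>) vs)"
proof (rule orth_proj_eq)
  show "\<beta> - \<gamma> \<in> L4_35 w" if "\<beta> \<in> L4_35 w" "\<gamma> \<in> L4_35 w" for \<beta> \<gamma>
    using that unfolding L4_35_iff hodge_diff by (auto intro: alt_forms_diff)
  show "\<gamma> \<in> alt_forms 4" if "\<gamma> \<in> L4_35 w" for \<gamma> using that L4_35_iff by blast
  show "(\<lambda>vs. 1/2 * (\<eta> - star4 \<eta>) vs) \<in> L4_35 w" by (rule asd_part(1)[OF \<eta>])
  fix \<gamma> assume "\<gamma> \<in> L4_35 w"
  then have \<gamma>: "\<gamma> \<in> alt_forms 4" "star4 \<gamma> = - \<gamma>" unfolding L4_35_iff by auto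
  have e: "\<eta> - (\<lambda>vs. 1/2 * (\<eta> - star4 \<eta>) vs) = (\<lambda>vs. 1/2 * (\<eta> + star4 \<eta>) vs)" by (simp add: fun_eq_iff field_simps)
  have "(\<lambda>vs. 1/2 * (\<eta> + star4 \<eta>) vs) \<in> alt_forms 4"
    by (intro alt_forms_scale alt_forms_add \<eta> star4_alt_forms)
  from inner_sd_asd(1)[OF this asd_part(2)[OF \<eta>] \<gamma>]
  show "form_inner g 4 (\<eta> - (\<lambda>vs. 1/2 * (\<eta> - star4 \<eta>) vs)) \<gamma> = 0" unfolding e .
qed

definition hmat :: "form8 \<Rightarrow> 8 \<Rightarrow> 8 \<Rightarrow> real" where "hmat \<eta> i p = (H \<eta> i p - H \<eta> p i) / 6"

text \<open>The matrix of the type-7 part of \<eta>. For skew b the inner product of b.w with \<eta>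
  is half the pairing of b with \<open>hmat \<eta>\<close>, while that of b.w with a.w is 16 times
  the pairing of b with a. Hence a is the projection (1 + P) / 4 of \<open>hmat \<eta>\<close>
  divided by 32, which gives 1/128.\<close>

definition bmat :: "form8 \<Rightarrow> 8 \<Rightarrow> 8 \<Rightarrow> real" where "bmat \<eta> i p = 1/128 * (hmat \<eta> i p + cay2 (hmat \<eta>) i p)"

lemma hmat_skew: "hmat \<eta> p i = - hmat \<eta> i p"
  by (simp add: hmat_def field_simps)

lemma bmat_skew: "bmat \<eta> p i = - bmat \<eta> i p"
  unfolding bmat_def hmat_skew[of \<eta> p i] cay2_alt[of "hmat \<eta>" p i, OF hmat_skew] by (simp add: field_simps)

lemma cay2_bmat: "cay2 (bmat \<eta>) i p = 3 * bmat \<eta> i p"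
proof -
  have "bmat \<eta> = (\<lambda>i p. 1/128 * (hmat \<eta> i p + cay2 (hmat \<eta>) i p))" by (intro ext) (rule bmat_def)
  then have "cay2 (bmat \<eta>) i p = 1/128 * (cay2 (hmat \<eta>) i p + cay2 (cay2 (hmat \<eta>)) i p)"
    by (simp only: cay2_scale cay2_add)
  then show ?thesis using cay2_cay2[of "hmat \<eta>" i p, OF hmat_skew] by (simp add: bmat_def)
qed

lemma inner_bmat:
  assumes \<eta>: "\<eta> \<in> alt_forms 4" and b: "\<And>i p. b p i = - b i p" and c: "\<And>i p. cay2 b i p = 3 * b i p"
  shows "form_inner g 4 (act (endo (bmat \<eta>)) w) (act (endo b) w) = form_inner g 4 \<eta> (act (endo b) w)"
proof -
  let ?S = "\<lambda>h. \<Sum>i\<in>UNIV. \<Sum>p\<in>UNIV. b i p * h i p"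
  have "?S (cay2 (hmat \<eta>)) = (\<Sum>i\<in>UNIV. \<Sum>p\<in>UNIV. cay2 b i p * hmat \<eta> i p)"
    by (rule cay2_adjoint[symmetric])
  also have "\<dots> = 3 * ?S (hmat \<eta>)" by (simp add: c sum_distrib_left mult_ac)
  finally have h: "?S (cay2 (hmat \<eta>)) = 3 * ?S (hmat \<eta>)" .
  have "?S (bmat \<eta>) = 1/128 * (?S (hmat \<eta>) + ?S (cay2 (hmat \<eta>)))"
    unfolding bmat_def sum_distrib_left sum.distrib[symmetric] by (intro sum.cong refl) (simp add: algebra_simps)
  then have 1: "?S (bmat \<eta>) = ?S (hmat \<eta>) / 32" unfolding h by simp
  have "?S (\<lambda>i p. H \<eta> p i) = - ?S (H \<eta>)"
    unfolding sum_negf[symmetric]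
  proof (rule trans[OF sum.swap], intro sum.cong refl)
    fix i p show "b p i * H \<eta> i p = - (b i p * H \<eta> i p)" unfolding b[of p i] by simp
  qed
  then have "?S (hmat \<eta>) = ?S (H \<eta>) / 3"
    unfolding hmat_def by (simp add: right_diff_distrib sum_subtractf diff_divide_distrib sum_divide_distrib[symmetric])
  then show ?thesis
    using inner_act_act[of "bmat \<eta>" b, OF bmat_skew cay2_bmat] 1 inner_act_w[OF \<eta>, of b]
      form_inner_commute[OF \<eta> act_w_alt] by simp
qed

lemma L4_7_diff: "\<beta> \<in> L4_7 w \<Longrightarrow> \<gamma> \<in> L4_7 w \<Longrightarrow> \<beta> - \<gamma> \<in> L4_7 w"
proof -
  assume "\<beta> \<in> L4_7 w" "\<gamma> \<in> L4_7 w"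
  then obtain a b where a: "\<And>i p. a p i = - a i p" "\<And>i p. cay2 a i p = 3 * a i p" "\<beta> = act (endo a) w"
    and b: "\<And>i p. b p i = - b i p" "\<And>i p. cay2 b i p = 3 * b i p" "\<gamma> = act (endo b) w"
    unfolding L4_7_iff by blast
  let ?c = "\<lambda>i p. a i p + (-1) * b i p"
  have "act (endo ?c) w = \<beta> - \<gamma>"
    unfolding act_add[OF w_alt] act_scale[OF w_alt] a(3) b(3) by (simp add: fun_eq_iff)
  moreover have "act (endo ?c) w \<in> L4_7 w"
  proof (rule L4_7I)
    fix i p
    show "cay2 ?c i p = 3 * ?c i p" unfolding cay2_add cay2_scale a(2) b(2) by simp
    show "?c p i = - ?c i p" using a(1)[of p i] b(1)[of p i] by simp
  qed
  ultimately show ?thesis by simp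
qed

lemma bmat_L4_7: "act (endo (bmat \<eta>)) w \<in> L4_7 w"
  by (rule L4_7I) (rule bmat_skew, rule cay2_bmat)

lemma proj_4_7:
  assumes \<eta>: "\<eta> \<in> alt_forms 4"
  shows "orth_proj g 4 (L4_7 w) \<eta> = act (endo (bmat \<eta>)) w"
proof (rule orth_proj_eq[OF L4_7_alt L4_7_diff bmat_L4_7])
  fix \<gamma> assume "\<gamma> \<in> L4_7 w"
  then obtain b where b: "\<And>i p. b p i = - b i p" "\<And>i p. cay2 b i p = 3 * b i p" "\<gamma> = act (endo b) w"
    unfolding L4_7_iff by blast
  show "form_inner g 4 (\<eta> - act (endo (bmat \<eta>)) w) \<gamma> = 0"
    unfolding form_inner_diff_left b(3) inner_bmat[OF \<eta> b(1,2)] by simp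
qed

lemma L4_27_iff: "\<eta> \<in> L4_27 w \<longleftrightarrow> \<eta> \<in> alt_forms 4 \<and> star4 \<eta> = \<eta> \<and> form_inner g 4 \<eta> w = 0
    \<and> (\<forall>\<xi>\<in>L4_7 w. form_inner g 4 \<eta> \<xi> = 0)"
proof -
  have z: "0 \<in> L4_1 w" "w \<in> L4_1 w" unfolding L4_1_def by (auto simp: fun_eq_iff image_iff intro: exI[of _ 0] exI[of _ 1])
  have z7: "0 \<in> L4_7 w" using L4_7_diff[OF bmat_L4_7 bmat_L4_7] by (metis diff_self)
  have *: "(\<forall>\<zeta>\<in>L4_1 w. \<forall>\<xi>\<in>L4_7 w. form_inner g 4 \<eta> (\<zeta> + \<xi>) = 0)
    \<longleftrightarrow> form_inner g 4 \<eta> w = 0 \<and> (\<forall>\<xi>\<in>L4_7 w. form_inner g 4 \<eta> \<xi> = 0)" if \<eta>: "\<eta> \<in> alt_forms 4"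
  proof (intro iffI conjI ballI)
    assume a: "\<forall>\<zeta>\<in>L4_1 w. \<forall>\<xi>\<in>L4_7 w. form_inner g 4 \<eta> (\<zeta> + \<xi>) = 0"
    show "form_inner g 4 \<eta> w = 0" using a z(2) z7 by force
    show "form_inner g 4 \<eta> \<xi> = 0" if "\<xi> \<in> L4_7 w" for \<xi> using a z(1) that by force
  next
    fix \<zeta> \<xi> assume a: "form_inner g 4 \<eta> w = 0 \<and> (\<forall>\<xi>\<in>L4_7 w. form_inner g 4 \<eta> \<xi> = 0)" and zx: "\<zeta> \<in> L4_1 w" "\<xi> \<in> L4_7 w"
    obtain h where h: "\<zeta> = (\<lambda>vs. h * w vs)" using zx by (auto simp: L4_1_def)
    have "form_inner g 4 \<zeta> \<eta> = 0" unfolding h form_inner_scale_left using a form_inner_commute[OF \<eta> w_alt] by simp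
    then have "form_inner g 4 \<eta> \<zeta> = 0" using form_inner_commute[OF \<eta> alt_forms_scale[OF w_alt, of h]] h by simp
    then show "form_inner g 4 \<eta> (\<zeta> + \<xi>) = 0" unfolding form_inner_add_right using a zx by simp
  qed
  then show ?thesis unfolding L4_27_def g_eq[symmetric] V_eq[symmetric] by blast
qed

text \<open>The residue left by the other three projections, so that the four parts add up to \<eta>
  by construction. What remains to be proved is that the residue has type 27.\<close>

definition p27 :: "form8 \<Rightarrow> form8" where
  "p27 \<eta> = \<eta> - (\<lambda>vs. form_inner g 4 \<eta> w / 14 * w vs) - act (endo (bmat \<eta>)) w - (\<lambda>vs. 1/2 * (\<eta> - star4 \<eta>) vs)"

lemma sd_7: assumes "\<xi> \<in> L4_7 w" shows "star4 \<xi> = \<xi>"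
proof (rule L4_7E[OF assms])
  fix b assume b: "\<And>i p. b p i = - b i p" and x: "\<xi> = act (endo b) w"
  show ?thesis unfolding x by (rule star4_act_skew[OF b])
qed

lemma inner_7_w: assumes "\<xi> \<in> L4_7 w" shows "form_inner g 4 \<xi> w = 0"
proof -
  obtain b where b: "\<And>i p. b p i = - b i p" "\<xi> = act (endo b) w" using assms unfolding L4_7_iff by blast
  have "b i i = 0" for i using b(1)[of i i] by simp
  then show ?thesis unfolding b(2) inner_act_w_w by simp
qed

lemma p27_mem:
  assumes \<eta>: "\<eta> \<in> alt_forms 4" shows "p27 \<eta> \<in> L4_27 w"
proof -
  let ?c = "form_inner g 4 \<eta> w / 14" and ?m = "\<lambda>vs. 1/2 * (\<eta> - star4 \<eta>) vs" and ?p = "\<lambda>vs. 1/2 * (\<eta> + star4 \<eta>) vs"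
  have e: "p27 \<eta> = ?p - (\<lambda>vs. ?c * w vs) - act (endo (bmat \<eta>)) w"
    unfolding p27_def by (simp add: fun_eq_iff field_simps)
  have alt: "p27 \<eta> \<in> alt_forms 4" unfolding p27_def
    by (intro alt_forms_diff alt_forms_scale \<eta> w_alt act_w_alt star4_alt_forms)
  moreover have "star4 (p27 \<eta>) = p27 \<eta>"
    unfolding e hodge_diff asd_part(2)[OF \<eta>] sd_7[OF bmat_L4_7] hodge_scale[of 4 _ w] hodge_w ..
  moreover have m: "?m \<in> alt_forms 4" "star4 ?m = - ?m" using asd_part(1)[OF \<eta>] unfolding L4_35_iff by auto
  have "form_inner g 4 (p27 \<eta>) w = 0"
    unfolding p27_def form_inner_diff_left form_inner_scale_left[of g 4 ?c w] inner_w_w inner_7_w[OF bmat_L4_7]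
      inner_sd_asd(2)[OF w_alt hodge_w m] by simp
  moreover have "form_inner g 4 (p27 \<eta>) \<xi> = 0" if x: "\<xi> \<in> L4_7 w" for \<xi>
  proof -
    have "form_inner g 4 w \<xi> = 0" using inner_7_w[OF x] form_inner_commute[OF w_alt L4_7_alt[OF x]] by simp
    moreover have "form_inner g 4 (act (endo (bmat \<eta>)) w) \<xi> = form_inner g 4 \<eta> \<xi>"
    proof (rule L4_7E[OF x])
      fix b assume b: "\<And>i p. b p i = - b i p" "\<And>i p. cay2 b i p = 3 * b i p" and e: "\<xi> = act (endo b) w"
      show ?thesis unfolding e by (rule inner_bmat[OF \<eta> b])
    qed
    ultimately show ?thesis
      unfolding p27_def form_inner_diff_left form_inner_scale_left[of g 4 ?c w]
        inner_sd_asd(2)[OF L4_7_alt[OF x] sd_7[OF x] m] by simp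
  qed
  ultimately show ?thesis unfolding L4_27_iff by blast
qed

lemma proj_4_27:
  assumes \<eta>: "\<eta> \<in> alt_forms 4" shows "orth_proj g 4 (L4_27 w) \<eta> = p27 \<eta>"
proof (rule orth_proj_eq)
  show "\<gamma> \<in> alt_forms 4" if "\<gamma> \<in> L4_27 w" for \<gamma> using that L4_27_iff by blast
  show "\<beta> - \<gamma> \<in> L4_27 w" if "\<beta> \<in> L4_27 w" "\<gamma> \<in> L4_27 w" for \<beta> \<gamma>
    using that unfolding L4_27_iff hodge_diff form_inner_diff_left by (auto intro: alt_forms_diff)
  show "p27 \<eta> \<in> L4_27 w" by (rule p27_mem[OF \<eta>])
  fix \<gamma> assume g27: "\<gamma> \<in> L4_27 w"
  then have \<gamma>: "\<gamma> \<in> alt_forms 4" "star4 \<gamma> = \<gamma>" "form_inner g 4 \<gamma> w = 0" "\<And>\<xi>. \<xi> \<in> L4_7 w \<Longrightarrow> form_inner g 4 \<gamma> \<xi> = 0"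
    unfolding L4_27_iff by auto
  let ?c = "form_inner g 4 \<eta> w / 14" and ?m = "\<lambda>vs. 1/2 * (\<eta> - star4 \<eta>) vs"
  have e: "\<eta> - p27 \<eta> = (\<lambda>vs. ?c * w vs) + act (endo (bmat \<eta>)) w + ?m"
    unfolding p27_def by (simp add: fun_eq_iff)
  have m: "?m \<in> alt_forms 4" "star4 ?m = - ?m" using asd_part(1)[OF \<eta>] unfolding L4_35_iff by auto
  have "form_inner g 4 w \<gamma> = 0" "form_inner g 4 (act (endo (bmat \<eta>)) w) \<gamma> = 0"
    using \<gamma>(3) \<gamma>(4)[OF bmat_L4_7] form_inner_commute[OF \<gamma>(1) w_alt] form_inner_commute[OF \<gamma>(1) act_w_alt] by simp_all
  then show "form_inner g 4 (\<eta> - p27 \<eta>) \<gamma> = 0"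
    unfolding e form_inner_add_left form_inner_scale_left[of g 4 ?c w] inner_sd_asd(2)[OF \<gamma>(1,2) m] by simp
qed

subsection \<open>The orbit directions are orthogonal to \<open>\<Lambda>\<^sup>4\<^sub>27\<close>\<close>

text \<open>Every b.w is orthogonal to \<eta>. For skew b the spin(7) part of b annihilates
  \<open>w\<close> and the rest is of type 7; for symmetric traceless b the form b.w is
  anti-self-dual. The matrix \<open>H \<eta>\<close> is then shown to be symmetric and traceless
  itself, so it may be paired with itself.\<close>

lemma H_27:
  assumes "\<eta> \<in> L4_27 w" shows "H \<eta> i p = 0"
proof -
  have \<eta>: "\<eta> \<in> alt_forms 4" "star4 \<eta> = \<eta>" "form_inner g 4 \<eta> w = 0" "\<And>\<xi>. \<xi> \<in> L4_7 w \<Longrightarrow> form_inner g 4 \<eta> \<xi> = 0"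
    using assms unfolding L4_27_iff by auto
  let ?L = "\<lambda>b. \<Sum>i\<in>UNIV. \<Sum>p\<in>UNIV. b i p * H \<eta> i p"
  have L: "?L b = 6 * form_inner g 4 (act (endo b) w) \<eta>" for b using inner_act_w[OF \<eta>(1), of b] by simp
  have skew: "?L b = 0" if b: "\<And>i p. b p i = - b i p" for b
  proof -
    \<comment> \<open>The components of \<open>b\<close> for the eigenvalues 3 and -1 of
      \<open>cay2\<close>.\<close>
    let ?a = "\<lambda>i p. 1/4 * (b i p + cay2 b i p)" and ?c = "\<lambda>i p. 1/4 * (3 * b i p + (-1) * cay2 b i p)"
    have cc: "cay2 (cay2 b) i p = 2 * cay2 b i p + 3 * b i p" for i p by (rule cay2_cay2[OF b])
    have sk: "cay2 b p i = - cay2 b i p" for i p by (rule cay2_alt[OF b])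
    have "act (endo ?c) w = 0"
    proof (rule act_21_zero)
      show "?c p i = - ?c i p" for i p using b[of p i] sk[of p i] by (simp add: field_simps)
      show "cay2 ?c i p = - ?c i p" for i p unfolding cay2_scale cay2_add cc by (simp add: field_simps)
    qed
    moreover have a7: "act (endo ?a) w \<in> L4_7 w"
    proof (rule L4_7I)
      show "?a p i = - ?a i p" for i p using b[of p i] sk[of p i] by (simp add: field_simps)
      show "cay2 ?a i p = 3 * ?a i p" for i p unfolding cay2_scale cay2_add cc by (simp add: field_simps)
    qed
    moreover have "act (endo b) w = act (endo ?a) w + act (endo ?c) w"
      unfolding act_add[OF w_alt, symmetric] by (rule arg_cong[where f="\<lambda>b. act (endo b) w"]) (simp add: fun_eq_iff field_simps)
    ultimately have "form_inner g 4 (act (endo b) w) \<eta> = form_inner g 4 \<eta> (act (endo ?a) w)"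
      using form_inner_commute[OF \<eta>(1) act_w_alt] by simp
    then show ?thesis unfolding L using \<eta>(4)[OF a7] by simp
  qed
  have sym: "?L b = 0" if "\<And>i p. b p i = b i p" "tr b = 0" for b
    unfolding L using inner_sd_asd(2)[OF \<eta>(1,2) act_w_alt star4_act_sym[of b, OF that]] by simp
  \<comment> \<open>Testing with elementary skew matrices gives the symmetry of
    \<open>H \<eta>\<close>.\<close>
  have Hs: "H \<eta> p i = H \<eta> i p" for i p
    using skew[of "dl2 i p", OF dl2_skew] sum_mult_delta[of i p "H \<eta>"] by simp
  have "tr (H \<eta>) = (\<Sum>I | length I = 4. \<eta> (map f I) * w (map f I))"
    by (simp add: H_def numeral_eq_Suc sum_lists_Suc)
  also have "\<dots> = 0" using \<eta>(3) inner4[OF \<eta>(1) w_alt] by simp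
  \<comment> \<open>Taking b = \<open>H \<eta>\<close> makes the pairing a sum of squares.\<close>
  finally have "?L (H \<eta>) = 0" using sym[of "H \<eta>"] Hs by blast
  then have "H \<eta> i p * H \<eta> i p = 0"
    by (simp add: sum_nonneg_eq_0_iff sum_nonneg)
  then show ?thesis by simp
qed

section \<open>Which components of a skew-symmetrised derivative vanish at a point\<close>

subsection \<open>Pointwise form of the vanishing components of d\<close>

lemma H_interior:
  "(\<Sum>I | length I = 3. interior_product X w (map f I) * \<eta> (f a # map f I)) = (\<Sum>p\<in>UNIV. g (f p) X * H \<eta> a p)"
proof -
  have "interior_product X w vs = (\<Sum>p\<in>UNIV. g (f p) X * w (f p # vs))" for vs
    by (subst frame_expansion[of X]) (rule interior_w_sum)
  then have "(\<Sum>I | length I = 3. interior_product X w (map f I) * \<eta> (f a # map f I))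
     = (\<Sum>I | length I = 3. \<Sum>p\<in>UNIV. g (f p) X * (\<eta> (f a # map f I) * w (f p # map f I)))"
    by (simp add: sum_distrib_right sum_distrib_left mult_ac)
  also have "\<dots> = (\<Sum>p\<in>UNIV. \<Sum>I | length I = 3. g (f p) X * (\<eta> (f a # map f I) * w (f p # map f I)))"
    by (rule sum.swap)
  finally show ?thesis by (simp add: H_def sum_distrib_left)
qed

lemma skew_3_inner:
  assumes "skew F \<in> alt_forms 4" "\<eta> \<in> alt_forms 4"
  shows "form_inner g 4 (skew F) \<eta> = (\<Sum>a\<in>UNIV. \<Sum>I | length I = 3. F (f a) (map f I) * \<eta> (f a # map f I)) / 6"
  using skew_contract[of \<eta> 3 F f] assms by (simp add: inner4)

lemma skew_48_inner_w:
  assumes "skew F \<in> alt_forms 4" "\<And>u. F u \<in> L3_48 w" shows "form_inner g 4 (skew F) w = 0"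
  using assms(2) unfolding skew_3_inner[OF assms(1) w_alt] L3_48_iff by simp

text \<open>By \<open>skew_contract\<close> the inner product is a sum of pairings of a vector
  contraction of \<open>w\<close> with a vector contraction of \<eta>; these are combinations of
  entries of \<open>H \<eta>\<close>, which is zero.\<close>

lemma skew_8_inner_27:
  assumes "skew F \<in> alt_forms 4" "\<And>u. F u \<in> L3_8 w" "\<eta> \<in> L4_27 w" shows "form_inner g 4 (skew F) \<eta> = 0"
proof -
  have \<eta>: "\<eta> \<in> alt_forms 4" using assms(3) L4_27_iff by blast
  have "(\<Sum>I | length I = 3. F (f a) (map f I) * \<eta> (f a # map f I)) = 0" for a
  proof -
    obtain X where "F (f a) = interior_product X w" using assms(2)[of "f a"] by (auto simp: L3_8_def)
    then show ?thesis using H_interior[of X \<eta> a] H_27[OF assms(3)] by simp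
  qed
  then show ?thesis unfolding skew_3_inner[OF assms(1) \<eta>] by simp
qed

lemma wedge_4_3_contract:
  assumes \<eta>: "\<eta> \<in> alt_forms 4" "star4 \<eta> = \<eta>"
  shows "(\<Sum>I | length I = 4. \<Sum>J | length J = 3. \<eta> (map f I) * interior_product X w (map f J) * V (map f I @ map f J @ [f a]))
     = - 24 * (\<Sum>p\<in>UNIV. g (f p) X * H \<eta> a p)"
proof -
  have 1: "(\<Sum>I | length I = 4. \<eta> (map f I) * V (map f I @ map f J @ [f a])) = - 24 * \<eta> (f a # map f J)"
    if J: "length J = 3" for J
  proof -
    have "(\<Sum>I | length I = 4. \<eta> (map f I) * V (map f I @ (map f J @ [f a]))) = 24 * \<eta> (map f J @ [f a])"
      unfolding star4_eq[OF \<eta>(1)] \<eta>(2) ..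
    also have "\<eta> (map f J @ [f a]) = - \<eta> (f a # map f J)"
      using alt_forms_move[OF \<eta>(1), of "[]" "map f J" "f a" "[]"] J by simp
    finally show ?thesis by simp
  qed
  have "(\<Sum>I | length I = 4. \<Sum>J | length J = 3. \<eta> (map f I) * interior_product X w (map f J) * V (map f I @ map f J @ [f a]))
     = (\<Sum>J | length J = 3. interior_product X w (map f J) * (\<Sum>I | length I = 4. \<eta> (map f I) * V (map f I @ map f J @ [f a])))"
    unfolding sum_distrib_left by (rule trans[OF sum.swap]) (simp only: mult_ac)
  also have "\<dots> = (\<Sum>J | length J = 3. interior_product X w (map f J) * (- 24 * \<eta> (f a # map f J)))"
    by (intro sum.cong refl) (simp only: 1 mem_Collect_eq)
  also have "\<dots> = - 24 * (\<Sum>J | length J = 3. interior_product X w (map f J) * \<eta> (f a # map f J))"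
    by (simp add: sum_distrib_left mult_ac sum_negf)
  finally show ?thesis unfolding H_interior .
qed

text \<open>For self-dual \<eta> the contractions of this 7-form with the volume form are again
  combinations of entries of \<open>H \<eta>\<close>. The equation survives covariant
  differentiation and takes the place of the invariance of \<Lambda>^4_27 in the step from 27 to
  8.\<close>

lemma wedge_27_interior:
  assumes "\<eta> \<in> L4_27 w" shows "wedge 4 3 \<eta> (interior_product X w) = 0"
proof (rule alt_forms_complement_zero[OF span_f])
  have \<eta>: "\<eta> \<in> alt_forms 4" "star4 \<eta> = \<eta>" using assms L4_27_iff by auto
  show "wedge 4 3 \<eta> (interior_product X w) \<in> alt_forms 7"
    using wedge_alt_forms[OF alt_forms_multilin[OF \<eta>(1)] alt_forms_multilin[OF interior_w_alt_forms]] by simp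
  show "V \<in> alt_forms (length top8)" using V_alt by (simp only: top8)
  show "V (map f top8) \<noteq> 0" unfolding V_f ecov_self[OF top8(1)] by simp
  fix L :: "8 list" assume "7 + length L = length top8"
  then have "length L = 1" unfolding top8 by simp
  then obtain a where L: "L = [a]" by (auto simp: length_Suc_conv)
  show "(\<Sum>I | length I = 7. wedge 4 3 \<eta> (interior_product X w) (map f I) * V (map f (I @ L))) = 0"
    using wedge_V_contract[of 4 3 "[f a]" \<eta> "interior_product X w"] wedge_4_3_contract[OF \<eta>, of X a] H_27[OF assms]
    unfolding L by simp
qed (rule top8)+

lemma hodge3_alt: "\<zeta> \<in> alt_forms 3 \<Longrightarrow> hodge g V 3 \<zeta> \<in> alt_forms 5"
  by (rule hodge_alt_forms) (auto intro: alt_forms_multilin)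

text \<open>Both types in degree 5 are stars of 3-forms, so the pairing reduces to a contraction of
  a 4-form and a 3-form with the volume form. The divisor is 4! 3!; exchanging two blocks of four
  arguments costs no sign.\<close>

lemma skew_4_inner:
  assumes F: "skew F \<in> alt_forms 5" and \<zeta>: "\<zeta> \<in> alt_forms 3"
  shows "form_inner g 5 (skew F) (hodge g V 3 \<zeta>)
    = (\<Sum>a\<in>UNIV. \<Sum>I | length I = 4. \<Sum>J | length J = 3. F (f a) (map f I) * \<zeta> (map f J) * V (map f I @ map f J @ [f a])) / 144"
proof -
  have "form_inner g 5 (skew F) (hodge g V 3 \<zeta>)
    = (\<Sum>L | length L = Suc 4. skew F (map f L) * hodge g V 3 \<zeta> (map f L)) / 120"
    unfolding form_inner_eq[OF alt_forms_multilin[OF F] alt_forms_multilin[OF hodge3_alt[OF \<zeta>]]]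
    by (simp add: fact_numeral)
  also have "\<dots> = (\<Sum>a\<in>UNIV. \<Sum>I | length I = 4. F (f a) (map f I) * hodge g V 3 \<zeta> (f a # map f I)) / 24"
    using skew_contract[of "hodge g V 3 \<zeta>" 4 F f] hodge3_alt[OF \<zeta>] by simp
  also have "\<dots> = (\<Sum>a\<in>UNIV. \<Sum>I | length I = 4. \<Sum>J | length J = 3. F (f a) (map f I) * \<zeta> (map f J) * V (map f I @ map f J @ [f a]) / 6) / 24"
  proof (intro arg_cong[where f="\<lambda>x. x / 24"] sum.cong refl)
    fix a and I :: "8 list" assume "I \<in> {I. length I = 4}"
    then have I: "length I = 4" by simp
    have V: "V (map f J @ f a # map f I) = V (map f I @ map f J @ [f a])" if "length J = 3" for J
      using V_cycle[of "map f J @ [f a]" "map f I" "[]"] that I by simp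
    have "hodge g V 3 \<zeta> (f a # map f I) = (\<Sum>J | length J = 3. \<zeta> (map f J) * V (map f J @ f a # map f I)) / 6"
      by (simp add: hodge_eq[OF alt_forms_multilin[OF \<zeta>]] fact_numeral)
    also have "\<dots> = (\<Sum>J | length J = 3. \<zeta> (map f J) * V (map f I @ map f J @ [f a])) / 6"
      by (intro arg_cong[where f="\<lambda>x. x / 6"] sum.cong refl) (simp only: V mem_Collect_eq)
    finally show "F (f a) (map f I) * hodge g V 3 \<zeta> (f a # map f I)
      = (\<Sum>J | length J = 3. F (f a) (map f I) * \<zeta> (map f J) * V (map f I @ map f J @ [f a]) / 6)"
      by (simp add: sum_distrib_left sum_divide_distrib mult_ac)
  qed
  finally show ?thesis by (simp add: sum_divide_distrib[symmetric])
qed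

text \<open>Self-duality of \<open>w\<close> reduces the contraction to the pairing of \<zeta> with
  w(f_a, ...), and this vanishes by the orthogonality form of the type 48.\<close>

lemma skew_1_inner_48:
  assumes F: "skew F \<in> alt_forms 5" "\<And>u. F u \<in> L4_1 w" and z: "\<zeta> \<in> L3_48 w"
  shows "form_inner g 5 (skew F) (hodge g V 3 \<zeta>) = 0"
proof -
  have \<zeta>: "\<zeta> \<in> alt_forms 3" using z L3_48_iff by blast
  have "(\<Sum>I | length I = 4. \<Sum>J | length J = 3. F (f a) (map f I) * \<zeta> (map f J) * V (map f I @ map f J @ [f a])) = 0" for a
  proof -
    obtain h where h: "F (f a) = (\<lambda>vs. h * w vs)" using F(2)[of "f a"] by (auto simp: L4_1_def)
    have 1: "(\<Sum>I | length I = 4. w (map f I) * V (map f I @ map f J @ [f a])) = - 24 * w (f a # map f J)"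
      if J: "length J = 3" for J
    proof -
      have "(\<Sum>I | length I = 4. w (map f I) * V (map f I @ map f J @ [f a])) = 24 * w (map f J @ [f a])"
        by (rule w_V) (simp add: J)
      also have "w (map f J @ [f a]) = - w (f a # map f J)"
        using alt_forms_move[OF w_alt, of "[]" "map f J" "f a" "[]"] J by simp
      finally show ?thesis by simp
    qed
    have "(\<Sum>I | length I = 4. \<Sum>J | length J = 3. F (f a) (map f I) * \<zeta> (map f J) * V (map f I @ map f J @ [f a]))
       = (\<Sum>J | length J = 3. h * \<zeta> (map f J) * (\<Sum>I | length I = 4. w (map f I) * V (map f I @ map f J @ [f a])))"
      unfolding sum_distrib_left h by (rule trans[OF sum.swap]) (simp only: mult_ac)
    also have "\<dots> = (\<Sum>J | length J = 3. h * \<zeta> (map f J) * (- 24 * w (f a # map f J)))"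
      by (intro sum.cong refl) (simp only: 1 mem_Collect_eq)
    also have "\<dots> = - 24 * h * (\<Sum>J | length J = 3. \<zeta> (map f J) * w (f a # map f J))"
      by (simp add: sum_distrib_left mult_ac sum_negf)
    finally show ?thesis using z unfolding L3_48_iff by simp
  qed
  then show ?thesis unfolding skew_4_inner[OF F(1) \<zeta>] by simp
qed

lemma skew_27_inner_8:
  assumes F: "skew F \<in> alt_forms 5" "\<And>u X. wedge 4 3 (F u) (interior_product X w) = 0"
  shows "form_inner g 5 (skew F) (hodge g V 3 (interior_product X w)) = 0"
proof -
  have "(\<Sum>I | length I = 4. \<Sum>J | length J = 3. F (f a) (map f I) * interior_product X w (map f J) * V (map f I @ map f J @ [f a])) = 0" for a
    using wedge_V_contract[of 4 3 "[f a]" "F (f a)" "interior_product X w"] F(2) by simp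
  then show ?thesis unfolding skew_4_inner[OF F(1) interior_w_alt_forms] by simp
qed

end

section \<open>Calculus of form-valued functions on open subsets of \<real>^8\<close>

section \<open>Differentiation of form-valued functions\<close>

subsection \<open>Symmetry of second derivatives\<close>

lemma fd_has_derivative: "f differentiable (at x) \<Longrightarrow> (f has_derivative frechet_derivative f (at x)) (at x)"
  using frechet_derivative_works by blast

lemma fd_line:
  fixes f :: "vec8 \<Rightarrow> real"
  assumes "f differentiable (at (x + s *\<^sub>R u))"
  shows "((\<lambda>s. f (x + s *\<^sub>R u)) has_real_derivative frechet_derivative f (at (x + s *\<^sub>R u)) u) (at s)"
proof -
  have 1: "(f has_derivative frechet_derivative f (at (x + s *\<^sub>R u))) (at (x + s *\<^sub>R u))"
    by (rule fd_has_derivative[OF assms])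
  have 2: "((\<lambda>s. x + s *\<^sub>R u) has_derivative (\<lambda>t. t *\<^sub>R u)) (at s)"
    by (auto intro!: derivative_eq_intros)
  have "((\<lambda>s. f (x + s *\<^sub>R u)) has_derivative (\<lambda>t. frechet_derivative f (at (x + s *\<^sub>R u)) (t *\<^sub>R u))) (at s)"
    using diff_chain_at[OF 2 1] by (simp add: comp_def)
  moreover have "linear (frechet_derivative f (at (x + s *\<^sub>R u)))" by (rule linear_frechet_derivative[OF assms])
  ultimately show ?thesis unfolding has_field_derivative_def
    by (simp add: linear_cmul mult.commute[of _ "frechet_derivative f (at (x + s *\<^sub>R u)) u"])
qed

text \<open>The mean value theorem is applied twice: to the difference of f across v as a function
  of s, then to the first derivative as a function of t.\<close>

lemma second_difference:
  fixes f :: "vec8 \<Rightarrow> real"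
  assumes h: "h > 0"
    and S: "\<And>s t. 0 \<le> s \<Longrightarrow> s \<le> h \<Longrightarrow> 0 \<le> t \<Longrightarrow> t \<le> h \<Longrightarrow> x + s *\<^sub>R u + t *\<^sub>R v \<in> S"
    and f: "\<And>y. y \<in> S \<Longrightarrow> f differentiable (at y)"
    and fu: "\<And>y. y \<in> S \<Longrightarrow> (\<lambda>z. frechet_derivative f (at z) u) differentiable (at y)"
  obtains s t where "0 < s" "s < h" "0 < t" "t < h"
    "f (x + h *\<^sub>R u + h *\<^sub>R v) - f (x + h *\<^sub>R u) - f (x + h *\<^sub>R v) + f x
      = h * (h * frechet_derivative (\<lambda>z. frechet_derivative f (at z) u) (at (x + s *\<^sub>R u + t *\<^sub>R v)) v)"
proof -
  let ?D = "\<lambda>z. frechet_derivative f (at z) u"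
  have d1: "((\<lambda>s. f (x + s *\<^sub>R u + h *\<^sub>R v) - f (x + s *\<^sub>R u)) has_real_derivative
      ?D (x + s *\<^sub>R u + h *\<^sub>R v) - ?D (x + s *\<^sub>R u)) (at s)" if s: "0 \<le> s" "s \<le> h" for s
  proof (rule DERIV_diff)
    have e: "x + r *\<^sub>R u + h *\<^sub>R v = (x + h *\<^sub>R v) + r *\<^sub>R u" for r by (simp add: algebra_simps)
    have "f differentiable (at (x + h *\<^sub>R v + s *\<^sub>R u))" using f[OF S[OF s, of h]] h unfolding e by simp
    then show "((\<lambda>s. f (x + s *\<^sub>R u + h *\<^sub>R v)) has_real_derivative ?D (x + s *\<^sub>R u + h *\<^sub>R v)) (at s)"
      unfolding e by (rule fd_line)
    show "((\<lambda>s. f (x + s *\<^sub>R u)) has_real_derivative ?D (x + s *\<^sub>R u)) (at s)"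
      by (rule fd_line) (use f[OF S[OF s, of 0]] h in simp)
  qed
  from MVT2[OF h, of "\<lambda>s. f (x + s *\<^sub>R u + h *\<^sub>R v) - f (x + s *\<^sub>R u)" "\<lambda>s. ?D (x + s *\<^sub>R u + h *\<^sub>R v) - ?D (x + s *\<^sub>R u)"] d1
  obtain s where s: "0 < s" "s < h"
    and 1: "(f (x + h *\<^sub>R u + h *\<^sub>R v) - f (x + h *\<^sub>R u)) - (f (x + 0 *\<^sub>R u + h *\<^sub>R v) - f (x + 0 *\<^sub>R u))
      = (h - 0) * (?D (x + s *\<^sub>R u + h *\<^sub>R v) - ?D (x + s *\<^sub>R u))" by blast
  have d2: "((\<lambda>t. ?D (x + s *\<^sub>R u + t *\<^sub>R v)) has_real_derivative frechet_derivative ?D (at (x + s *\<^sub>R u + t *\<^sub>R v)) v) (at t)"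
    if t: "0 \<le> t" "t \<le> h" for t
    by (rule fd_line) (use fu[OF S[of s t]] s t in simp)
  from MVT2[OF h, of "\<lambda>t. ?D (x + s *\<^sub>R u + t *\<^sub>R v)" "\<lambda>t. frechet_derivative ?D (at (x + s *\<^sub>R u + t *\<^sub>R v)) v"] d2
  obtain t where t: "0 < t" "t < h"
    and 2: "?D (x + s *\<^sub>R u + h *\<^sub>R v) - ?D (x + s *\<^sub>R u + 0 *\<^sub>R v) = (h - 0) * frechet_derivative ?D (at (x + s *\<^sub>R u + t *\<^sub>R v)) v"
    by blast
  show thesis by (rule that[OF s t]) (use 1 2 in simp)
qed

lemma smooth_on_differentiable: "smooth_on S f \<Longrightarrow> x \<in> S \<Longrightarrow> f differentiable (at x)"
  unfolding smooth_on_def by (metis Ck_on.simps(2))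

lemma smooth_on_frechet: "smooth_on S f \<Longrightarrow> smooth_on S (\<lambda>x. frechet_derivative f (at x) v)"
  unfolding smooth_on_def by (metis Ck_on.simps(2))

lemma smooth_on_continuous: "smooth_on S f \<Longrightarrow> continuous_on S f"
  unfolding smooth_on_def by (metis Ck_on.simps(1))

text \<open>The second difference over a parallelogram is symmetric in u and v and equals h^2 times
  either mixed derivative at some point of the parallelogram. Were the two derivatives at x
  different, a small h would contradict their continuity.\<close>

lemma second_derivative_symmetric:
  fixes f :: "vec8 \<Rightarrow> real"
  assumes f: "smooth_on S f" and S: "open S" "x \<in> S"
  shows "frechet_derivative (\<lambda>z. frechet_derivative f (at z) u) (at x) v
       = frechet_derivative (\<lambda>z. frechet_derivative f (at z) v) (at x) u"
proof (rule ccontr)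
  let ?A = "\<lambda>y. frechet_derivative (\<lambda>z. frechet_derivative f (at z) u) (at y) v"
  let ?B = "\<lambda>y. frechet_derivative (\<lambda>z. frechet_derivative f (at z) v) (at y) u"
  assume ne: "?A x \<noteq> ?B x"
  define e where "e = \<bar>?A x - ?B x\<bar> / 2"
  have e: "e > 0" using ne by (simp add: e_def)
  have "isCont ?A x" "isCont ?B x"
    using smooth_on_continuous[OF smooth_on_frechet[OF smooth_on_frechet[OF f]]] S continuous_on_eq_continuous_at by blast+
  then obtain d1 d2 where d1: "d1 > 0" "\<And>y. dist y x < d1 \<Longrightarrow> dist (?A y) (?A x) < e"
    and d2: "d2 > 0" "\<And>y. dist y x < d2 \<Longrightarrow> dist (?B y) (?B x) < e"
    using e unfolding continuous_at_eps_delta by metis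
  obtain d0 where d0: "d0 > 0" "ball x d0 \<subseteq> S" using S open_contains_ball by blast
  define d where "d = min d0 (min d1 d2)"
  have d: "d > 0" using d0 d1 d2 by (simp add: d_def)
  \<comment> \<open>Small enough for the whole parallelogram to lie within distance d of x; the
    summand 1 keeps the denominator positive if u = v = 0.\<close>
  define h where "h = d / (2 * (norm u + norm v + 1))"
  have n: "norm u + norm v + 1 > 0" by (simp add: add_nonneg_pos)
  have h: "h > 0" using d n by (simp add: h_def)
  have hn: "h * (norm u + norm v) < d"
  proof -
    have "h * (norm u + norm v) < h * (2 * (norm u + norm v + 1))"
      by (rule mult_strict_left_mono[OF _ h]) (simp add: add_nonneg_pos)
    also have "\<dots> = d" using n by (simp add: h_def)
    finally show ?thesis .
  qed
  have near: "dist (x + s *\<^sub>R u + t *\<^sub>R v) x < d" if "0 \<le> s" "s \<le> h" "0 \<le> t" "t \<le> h" for s t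
  proof -
    have "dist (x + s *\<^sub>R u + t *\<^sub>R v) x = norm (s *\<^sub>R u + t *\<^sub>R v)" by (simp add: dist_norm algebra_simps)
    also have "\<dots> \<le> s * norm u + t * norm v" using norm_triangle_ineq[of "s *\<^sub>R u" "t *\<^sub>R v"] that by simp
    also have "\<dots> \<le> h * norm u + h * norm v" using that by (intro add_mono mult_right_mono) auto
    finally show ?thesis using hn by (simp add: distrib_left)
  qed
  have inS: "x + s *\<^sub>R u + t *\<^sub>R v \<in> S" if "0 \<le> s" "s \<le> h" "0 \<le> t" "t \<le> h" for s t
    using near[OF that] d0 by (auto simp: d_def dist_commute)
  have inS': "x + s *\<^sub>R v + t *\<^sub>R u \<in> S" if "0 \<le> s" "s \<le> h" "0 \<le> t" "t \<le> h" for s t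
    using inS[OF that(3,4,1,2)] by (simp add: algebra_simps)
  obtain s t where st: "0 < s" "s < h" "0 < t" "t < h"
    and 1: "f (x + h *\<^sub>R u + h *\<^sub>R v) - f (x + h *\<^sub>R u) - f (x + h *\<^sub>R v) + f x = h * (h * ?A (x + s *\<^sub>R u + t *\<^sub>R v))"
    by (rule second_difference[OF h inS smooth_on_differentiable[OF f] smooth_on_differentiable[OF smooth_on_frechet[OF f]]])
  obtain s' t' where st': "0 < s'" "s' < h" "0 < t'" "t' < h"
    and 2: "f (x + h *\<^sub>R v + h *\<^sub>R u) - f (x + h *\<^sub>R v) - f (x + h *\<^sub>R u) + f x = h * (h * ?B (x + s' *\<^sub>R v + t' *\<^sub>R u))"
    by (rule second_difference[OF h inS' smooth_on_differentiable[OF f] smooth_on_differentiable[OF smooth_on_frechet[OF f]]])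
  have c: "x + h *\<^sub>R v + h *\<^sub>R u = x + h *\<^sub>R u + h *\<^sub>R v" by (simp add: algebra_simps)
  have "h * (h * ?A (x + s *\<^sub>R u + t *\<^sub>R v)) = h * (h * ?B (x + s' *\<^sub>R v + t' *\<^sub>R u))"
    using 1 2 unfolding c by linarith
  then have eq: "?A (x + s *\<^sub>R u + t *\<^sub>R v) = ?B (x + s' *\<^sub>R v + t' *\<^sub>R u)" using h by simp
  have c': "x + s' *\<^sub>R v + t' *\<^sub>R u = x + t' *\<^sub>R u + s' *\<^sub>R v" by (simp add: algebra_simps)
  have tri: False if "\<bar>c - b\<bar> < \<bar>a - b\<bar> / 2" "\<bar>c - a\<bar> < \<bar>a - b\<bar> / 2" for a b c :: real
    using that abs_triangle_ineq[of "a - c" "c - b"] abs_minus_commute[of a c] by simp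
  have "dist (x + s' *\<^sub>R v + t' *\<^sub>R u) x < d" unfolding c' by (rule near) (use st' in simp_all)
  then have "dist (?B (x + s' *\<^sub>R v + t' *\<^sub>R u)) (?B x) < e" using d2(2) by (simp add: d_def)
  moreover have "dist (?A (x + s *\<^sub>R u + t *\<^sub>R v)) (?A x) < e" using d1(2) near[of s t] st by (simp add: d_def)
  ultimately show False unfolding eq e_def dist_real_def by (rule tri)
qed

subsection \<open>Derivatives of real-valued functions\<close>

lemma fd_eqI: "(F has_derivative F') (at y) \<Longrightarrow> frechet_derivative F (at y) = F'"
  using frechet_derivative_at by metis

text \<open>Agreement near y makes the two predicates of having a given derivative coincide. As
  \<open>frechet_derivative\<close> is a choice from this predicate, the equation also holds where
  no derivative exists.\<close>

lemma fd_cong: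
  assumes "open S" "y \<in> S" "\<And>z. z \<in> S \<Longrightarrow> F z = G z"
  shows "frechet_derivative F (at y) = frechet_derivative G (at y)"
proof -
  have "(F has_derivative F') (at y) \<longleftrightarrow> (G has_derivative F') (at y)" for F'
    using has_derivative_transform_within_open[OF _ assms(1,2), of F F' UNIV G]
      has_derivative_transform_within_open[OF _ assms(1,2), of G F' UNIV F] assms(3) by auto
  then show ?thesis unfolding frechet_derivative_def by simp
qed

lemma differentiable_cong:
  assumes "open S" "y \<in> S" "\<And>z. z \<in> S \<Longrightarrow> F z = G z" "G differentiable (at y)"
  shows "F differentiable (at y)"
  using has_derivative_transform_within_open[OF _ assms(1,2), of G _ UNIV F] assms(3,4)
  unfolding differentiable_def by force

lemma fd_add:
  assumes "F differentiable (at y)" "G differentiable (at y)"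
  shows "frechet_derivative (\<lambda>z. F z + G z) (at y) u = frechet_derivative F (at y) u + frechet_derivative G (at y) u"
  using fd_eqI[OF has_derivative_add[OF fd_has_derivative[OF assms(1)] fd_has_derivative[OF assms(2)]]] by simp

lemma fd_sum:
  assumes "\<And>i. i \<in> A \<Longrightarrow> F i differentiable (at y)"
  shows "frechet_derivative (\<lambda>z. \<Sum>i\<in>A. F i z) (at y) u = (\<Sum>i\<in>A. frechet_derivative (F i) (at y) u)"
  using fd_eqI[OF has_derivative_sum[of A F "\<lambda>i. frechet_derivative (F i) (at y)", OF fd_has_derivative[OF assms]]] by simp

lemma fd_mult:
  fixes F G :: "vec8 \<Rightarrow> real"
  assumes "F differentiable (at y)" "G differentiable (at y)"
  shows "frechet_derivative (\<lambda>z. F z * G z) (at y) u = F y * frechet_derivative G (at y) u + frechet_derivative F (at y) u * G y"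
  using fd_eqI[OF has_derivative_mult[OF fd_has_derivative[OF assms(1)] fd_has_derivative[OF assms(2)]]] by simp

lemma fd_scale:
  fixes F :: "vec8 \<Rightarrow> real"
  assumes "F differentiable (at y)"
  shows "frechet_derivative (\<lambda>z. c * F z) (at y) u = c * frechet_derivative F (at y) u"
  using fd_mult[of "\<lambda>_. c" y F u] assms by simp

lemma differentiable_prod_real:
  fixes F :: "'i \<Rightarrow> vec8 \<Rightarrow> real"
  assumes "\<And>i. i \<in> A \<Longrightarrow> F i differentiable (at y)" shows "(\<lambda>z. \<Prod>i\<in>A. F i z) differentiable (at y)"
  using assms by (induction A rule: infinite_finite_induct) (auto intro!: differentiable_mult)

text \<open>A form is a function on lists of arbitrary vectors and carries no norm here, so
  differentiability is required of each evaluation separately.\<close>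

definition fdiff :: "(vec8 \<Rightarrow> form8) \<Rightarrow> vec8 \<Rightarrow> bool" where
  "fdiff \<alpha> y \<longleftrightarrow> (\<forall>vs. (\<lambda>z. \<alpha> z vs) differentiable (at y))"

definition pd :: "(vec8 \<Rightarrow> form8) \<Rightarrow> vec8 \<Rightarrow> vec8 \<Rightarrow> form8" where
  "pd \<alpha> y u = (\<lambda>vs. frechet_derivative (\<lambda>z. \<alpha> z vs) (at y) u)"

definition dform :: "(vec8 \<Rightarrow> form8) \<Rightarrow> vec8 \<Rightarrow> form8" where
  "dform \<alpha> y = skew (pd \<alpha> y)"

lemma fdiffD: "fdiff \<alpha> y \<Longrightarrow> (\<lambda>z. \<alpha> z vs) differentiable (at y)"
  by (simp add: fdiff_def)

lemma pd_linear: "fdiff \<alpha> y \<Longrightarrow> linear (\<lambda>u. pd \<alpha> y u vs)"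
  unfolding pd_def using linear_frechet_derivative[OF fdiffD] by (simp add: eta_contract_eq)

lemma pd_cong:
  assumes "open S" "y \<in> S" "\<And>z. z \<in> S \<Longrightarrow> \<alpha> z = \<beta> z" shows "pd \<alpha> y = pd \<beta> y"
proof (intro ext)
  fix u vs show "pd \<alpha> y u vs = pd \<beta> y u vs"
    unfolding pd_def using fd_cong[OF assms(1,2), of "\<lambda>z. \<alpha> z vs" "\<lambda>z. \<beta> z vs"] assms(3) by simp
qed

lemma dform_cong:
  assumes "open S" "y \<in> S" "\<And>z. z \<in> S \<Longrightarrow> \<alpha> z = \<beta> z" shows "dform \<alpha> y = dform \<beta> y"
proof -
  have "pd \<alpha> y = pd \<beta> y" by (rule pd_cong[OF assms])
  then show ?thesis by (simp only: dform_def)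
qed

lemma fdiff_cong:
  assumes "open S" "y \<in> S" "\<And>z. z \<in> S \<Longrightarrow> \<alpha> z = \<beta> z" "fdiff \<beta> y" shows "fdiff \<alpha> y"
  unfolding fdiff_def
proof
  fix vs show "(\<lambda>z. \<alpha> z vs) differentiable (at y)"
    by (rule differentiable_cong[OF assms(1,2) _ fdiffD[OF assms(4), of vs]]) (simp add: assms(3))
qed

lemma pd_alt_forms:
  assumes S: "open S" "y \<in> S" and alt: "\<And>z. z \<in> S \<Longrightarrow> \<alpha> z \<in> alt_forms k" and d: "fdiff \<alpha> y"
  shows "pd \<alpha> y u \<in> alt_forms k"
proof (rule alt_formsI)
  show "pd \<alpha> y u vs = 0" if "length vs \<noteq> k" for vs
    unfolding pd_def using fd_cong[OF S, of "\<lambda>z. \<alpha> z vs" "\<lambda>z. 0"] alt_forms_length[OF alt that] by simp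
  show "pd \<alpha> y u (X @ v # v # Y) = 0" for X v Y
    unfolding pd_def using fd_cong[OF S, of "\<lambda>z. \<alpha> z (X @ v # v # Y)" "\<lambda>z. 0"] alt_forms_repeat_adj[OF alt] by simp
  show "multilin k (pd \<alpha> y u)" unfolding multilin_def
  proof (intro allI impI linearI)
    fix X Y :: "vec8 list" assume len: "length X + Suc (length Y) = k"
    have l: "linear (\<lambda>v. \<alpha> z (X @ v # Y))" if "z \<in> S" for z
      using multilinD[OF alt_forms_multilin[OF alt[OF that]] len] .
    show "pd \<alpha> y u (X @ (v + v') # Y) = pd \<alpha> y u (X @ v # Y) + pd \<alpha> y u (X @ v' # Y)" for v v'
      unfolding pd_def fd_add[OF fdiffD[OF d] fdiffD[OF d], symmetric]
      using fd_cong[OF S, of "\<lambda>z. \<alpha> z (X @ (v + v') # Y)" "\<lambda>z. \<alpha> z (X @ v # Y) + \<alpha> z (X @ v' # Y)"] linear_add[OF l] by simp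
    show "pd \<alpha> y u (X @ (r *\<^sub>R v) # Y) = r *\<^sub>R pd \<alpha> y u (X @ v # Y)" for r v
      unfolding pd_def real_scaleR_def fd_scale[OF fdiffD[OF d], symmetric]
      using fd_cong[OF S, of "\<lambda>z. \<alpha> z (X @ (r *\<^sub>R v) # Y)" "\<lambda>z. r * \<alpha> z (X @ v # Y)"] linear_cmul[OF l] by simp
  qed
qed

lemma dform_alt_forms:
  assumes "open S" "y \<in> S" "\<And>z. z \<in> S \<Longrightarrow> \<alpha> z \<in> alt_forms k" "fdiff \<alpha> y"
  shows "dform \<alpha> y \<in> alt_forms (Suc k)"
  unfolding dform_def by (rule skew_alt_forms) (rule pd_linear[OF assms(4)], rule pd_alt_forms[OF assms])

lemma skew_add: "skew (\<lambda>u. F u + G u) = skew F + skew G"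
  by (rule ext) (simp add: skew_def distrib_left sum.distrib)

lemma skew_diff: "skew (\<lambda>u. F u - G u) = skew F - skew G"
  by (rule ext) (simp add: skew_def right_diff_distrib sum_subtractf)

lemma dform_add:
  assumes "fdiff \<alpha> y" "fdiff \<beta> y" shows "dform (\<lambda>z. \<alpha> z + \<beta> z) y = dform \<alpha> y + dform \<beta> y"
proof -
  have "pd (\<lambda>z. \<alpha> z + \<beta> z) y = (\<lambda>u. pd \<alpha> y u + pd \<beta> y u)"
    unfolding pd_def by (intro ext) (simp add: fd_add[OF fdiffD[OF assms(1)] fdiffD[OF assms(2)]])
  then show ?thesis unfolding dform_def by (simp only: skew_add)
qed

lemma fdiff_add: "fdiff \<alpha> y \<Longrightarrow> fdiff \<beta> y \<Longrightarrow> fdiff (\<lambda>z. \<alpha> z + \<beta> z) y"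
  by (simp add: fdiff_def)

lemma fdiff_diff: "fdiff \<alpha> y \<Longrightarrow> fdiff \<beta> y \<Longrightarrow> fdiff (\<lambda>z. \<alpha> z - \<beta> z) y"
  by (simp add: fdiff_def)

lemma fdiff_dform:
  assumes "\<And>vs. smooth_on S (\<lambda>z. \<alpha> z vs)" "y \<in> S" shows "fdiff (dform \<alpha>) y"
  unfolding fdiff_def dform_def skew_def pd_def
  by (auto intro!: differentiable_sum differentiable_mult
      smooth_on_differentiable[OF smooth_on_frechet[OF assms(1)] assms(2)])

lemma dform_dform:
  assumes sm: "\<And>vs. smooth_on S (\<lambda>z. \<alpha> z vs)" and S: "open S" "y \<in> S"
  shows "dform (dform \<alpha>) y = 0"
proof -
  let ?S = "\<lambda>u v ws. frechet_derivative (\<lambda>z. frechet_derivative (\<lambda>z. \<alpha> z ws) (at z) v) (at y) u"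
  have "pd (dform \<alpha>) y u = skew (?S u)" for u
  proof
    fix vs :: "vec8 list"
    have d: "(\<lambda>z. frechet_derivative (\<lambda>z. \<alpha> z ws) (at z) v) differentiable (at y)" for v ws
      by (rule smooth_on_differentiable[OF smooth_on_frechet[OF sm] S(2)])
    show "pd (dform \<alpha>) y u vs = skew (?S u) vs"
      unfolding pd_def dform_def skew_def
      by (subst fd_sum) (auto intro!: differentiable_mult d simp: fd_scale[OF d])
  qed
  then have "dform (dform \<alpha>) y = skew (\<lambda>u. skew (?S u))" unfolding dform_def[of "dform \<alpha>"] by (simp add: fun_eq_iff skew_def)
  also have "\<dots> = 0"
    by (rule skew_skew_zero) (rule second_derivative_symmetric[OF sm S])
  finally show ?thesis .
qed

subsection \<open>First-order covariant calculus at a point\<close>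

text \<open>The covariant derivative at the single point \<open>y\<close>: \<open>C\<close> is only
  the value there of the Christoffel symbols, since the connection itself is not
  differentiated.\<close>

definition nab :: "(vec8 \<Rightarrow> vec8 \<Rightarrow> vec8) \<Rightarrow> (vec8 \<Rightarrow> form8) \<Rightarrow> vec8 \<Rightarrow> vec8 \<Rightarrow> form8" where
  "nab C \<alpha> y u = pd \<alpha> y u - act (C u) (\<alpha> y)"

lemma dform_nab:
  assumes "\<alpha> y \<in> alt_forms k" "\<And>u v. C u v = C v u" shows "dform \<alpha> y = skew (nab C \<alpha> y)"
proof -
  have "skew (nab C \<alpha> y) = skew (pd \<alpha> y) - skew (\<lambda>u. act (C u) (\<alpha> y))"
    unfolding nab_def by (rule skew_diff)
  then show ?thesis unfolding dform_def skew_act_zero[of "\<alpha> y" k C, OF assms] by simp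
qed

lemma wedge_diff_left: "wedge k l (\<alpha> - \<alpha>') \<beta> = wedge k l \<alpha> \<beta> - wedge k l \<alpha>' \<beta>"
  by (rule ext) (simp add: wedge_def left_diff_distrib right_diff_distrib sum_subtractf diff_divide_distrib)

lemma wedge_diff_right: "wedge k l \<alpha> (\<beta> - \<beta>') = wedge k l \<alpha> \<beta> - wedge k l \<alpha> \<beta>'"
  by (rule ext) (simp add: wedge_def right_diff_distrib sum_subtractf diff_divide_distrib)

lemma wedge_zero_right: "wedge k l \<alpha> 0 = 0"
  by (rule ext) (simp add: wedge_def)

lemma pd_wedge:
  assumes "fdiff \<alpha> y" "fdiff \<beta> y"
  shows "pd (\<lambda>z. wedge k l (\<alpha> z) (\<beta> z)) y u = wedge k l (pd \<alpha> y u) (\<beta> y) + wedge k l (\<alpha> y) (pd \<beta> y u)"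
proof
  fix vs :: "vec8 list"
  let ?a = "\<lambda>\<sigma>. map (\<lambda>i. vs ! \<sigma> i) [0..<k]" and ?b = "\<lambda>\<sigma>. map (\<lambda>i. vs ! \<sigma> i) [k..<k + l]"
  show "pd (\<lambda>z. wedge k l (\<alpha> z) (\<beta> z)) y u vs = (wedge k l (pd \<alpha> y u) (\<beta> y) + wedge k l (\<alpha> y) (pd \<beta> y u)) vs"
  proof (cases "length vs = k + l")
    case True
    let ?t = "\<lambda>\<sigma> z. of_int (sign \<sigma>) / (fact k * fact l) * (\<alpha> z (?a \<sigma>) * \<beta> z (?b \<sigma>))"
    have "wedge k l (\<alpha> z) (\<beta> z) vs = (\<Sum>\<sigma> | \<sigma> permutes {..<k + l}. ?t \<sigma> z)" for z
      using True by (simp add: wedge_def sum_divide_distrib mult.assoc)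
    then have "pd (\<lambda>z. wedge k l (\<alpha> z) (\<beta> z)) y u vs = (\<Sum>\<sigma> | \<sigma> permutes {..<k + l}. frechet_derivative (?t \<sigma>) (at y) u)"
      unfolding pd_def by (simp only:) (rule fd_sum, intro differentiable_mult differentiable_const fdiffD assms)
    also have "\<dots> = (\<Sum>\<sigma> | \<sigma> permutes {..<k + l}. of_int (sign \<sigma>) / (fact k * fact l) *
        (\<alpha> y (?a \<sigma>) * pd \<beta> y u (?b \<sigma>) + pd \<alpha> y u (?a \<sigma>) * \<beta> y (?b \<sigma>)))"
      unfolding pd_def by (intro sum.cong refl)
        (simp only: fd_scale[OF differentiable_mult[OF fdiffD[OF assms(1)] fdiffD[OF assms(2)]]] fd_mult[OF fdiffD[OF assms(1)] fdiffD[OF assms(2)]])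
    also have "\<dots> = (wedge k l (pd \<alpha> y u) (\<beta> y) + wedge k l (\<alpha> y) (pd \<beta> y u)) vs"
      using True by (simp add: wedge_def sum_divide_distrib sum.distrib[symmetric] add_divide_distrib[symmetric] algebra_simps)
    finally show ?thesis .
  next
    case False
    then show ?thesis by (simp add: pd_def wedge_def)
  qed
qed

text \<open>The Leibniz rule for an equation that holds near y. If one factor is parallel, the
  derivative of the other satisfies the same equation; this is how membership in a type passes to
  the covariant derivative.\<close>

lemma nab_wedge:
  assumes S: "open S" "y \<in> S" and z: "\<And>z. z \<in> S \<Longrightarrow> wedge k l (\<alpha> z) (\<beta> z) = 0" and d: "fdiff \<alpha> y" "fdiff \<beta> y"
  shows "wedge k l (nab C \<alpha> y u) (\<beta> y) + wedge k l (\<alpha> y) (nab C \<beta> y u) = 0"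
proof -
  have "pd (\<lambda>z. wedge k l (\<alpha> z) (\<beta> z)) y u = pd (\<lambda>z. 0) y u"
    using pd_cong[OF S, of "\<lambda>z. wedge k l (\<alpha> z) (\<beta> z)" "\<lambda>z. 0"] z by simp
  also have "\<dots> = 0" by (rule ext) (simp add: pd_def)
  finally have 1: "wedge k l (pd \<alpha> y u) (\<beta> y) + wedge k l (\<alpha> y) (pd \<beta> y u) = 0" using pd_wedge[OF d] by simp
  have "act (C u) 0 = 0" by (rule ext) (simp add: act_def)
  then have 2: "wedge k l (act (C u) (\<alpha> y)) (\<beta> y) + wedge k l (\<alpha> y) (act (C u) (\<beta> y)) = 0"
    using wedge_act[of "C u" k l "\<alpha> y" "\<beta> y"] z[OF S(2)] by simp
  have "wedge k l (nab C \<alpha> y u) (\<beta> y) + wedge k l (\<alpha> y) (nab C \<beta> y u)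
     = (wedge k l (pd \<alpha> y u) (\<beta> y) + wedge k l (\<alpha> y) (pd \<beta> y u))
     - (wedge k l (act (C u) (\<alpha> y)) (\<beta> y) + wedge k l (\<alpha> y) (act (C u) (\<beta> y)))"
    unfolding nab_def wedge_diff_left wedge_diff_right by simp
  then show ?thesis unfolding 1 2 by simp
qed

lemma vec8_expansion: "(v::vec8) = (\<Sum>p\<in>UNIV. v $ p *\<^sub>R e8 p)"
  by (simp add: basis_expansion scalar_mult_eq_scaleR[symmetric])

lemma alt_forms_hd_expand:
  assumes "\<alpha> \<in> alt_forms (Suc k)" shows "\<alpha> (v # ws) = (\<Sum>p\<in>UNIV. v $ p * \<alpha> (e8 p # ws))"
proof (cases "length ws = k")
  case True
  have l: "linear (\<lambda>v. \<alpha> (v # ws))" by (rule multilin_hd[OF alt_forms_multilin[OF assms] True])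
  show ?thesis by (subst vec8_expansion[of v]) (simp only: linear_sum[OF l] linear_cmul[OF l] real_scaleR_def)
next
  case False then show ?thesis using alt_forms_length[OF assms] by simp
qed

text \<open>For parallel \<omega> the derivative of the contraction with X is the contraction with
  the covariant derivative of X. In particular it is again a contraction of \<omega> with a
  vector.\<close>

lemma nab_interior:
  assumes S: "open S" "y \<in> S" and alt: "\<And>z. z \<in> S \<Longrightarrow> \<omega> z \<in> alt_forms (Suc k)" and d: "fdiff \<omega> y"
    and X: "\<And>p. (\<lambda>z. X z $ p) differentiable (at y)" and C: "\<And>u. linear (C u)" and n: "nab C \<omega> y u = 0"
  shows "nab C (\<lambda>z. interior_product (X z) (\<omega> z)) y u
    = interior_product ((\<chi> p. frechet_derivative (\<lambda>z. X z $ p) (at y) u) + C u (X y)) (\<omega> y)"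
proof
  fix ws
  let ?dX = "\<chi> p. frechet_derivative (\<lambda>z. X z $ p) (at y) u"
  have pa: "pd \<omega> y u \<in> alt_forms (Suc k)" by (rule pd_alt_forms[OF S alt d])
  \<comment> \<open>Differentiability is known for evaluations on fixed lists only, so the varying
    vector X z is first expanded in the constant coordinate basis.\<close>
  have "pd (\<lambda>z. interior_product (X z) (\<omega> z)) y u ws = frechet_derivative (\<lambda>z. \<Sum>p\<in>UNIV. X z $ p * \<omega> z (e8 p # ws)) (at y) u"
    unfolding pd_def interior_product_def
    using fd_cong[OF S, of "\<lambda>z. \<omega> z (X z # ws)" "\<lambda>z. \<Sum>p\<in>UNIV. X z $ p * \<omega> z (e8 p # ws)"] alt_forms_hd_expand[OF alt] by simp
  also have "\<dots> = (\<Sum>p\<in>UNIV. X y $ p * pd \<omega> y u (e8 p # ws) + ?dX $ p * \<omega> y (e8 p # ws))"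
    unfolding pd_def by (subst fd_sum) (auto intro!: differentiable_mult X fdiffD[OF d] simp: fd_mult[OF X fdiffD[OF d]])
  also have "\<dots> = pd \<omega> y u (X y # ws) + \<omega> y (?dX # ws)"
    unfolding alt_forms_hd_expand[OF pa, of "X y"] alt_forms_hd_expand[OF alt[OF S(2)], of ?dX] by (simp add: sum.distrib)
  also have "pd \<omega> y u = act (C u) (\<omega> y)" using n by (simp add: nab_def)
  also have "act (C u) (\<omega> y) (X y # ws) = \<omega> y (C u (X y) # ws) + act (C u) (interior_product (X y) (\<omega> y)) ws"
    unfolding act_Cons interior_product_def ..
  finally have "nab C (\<lambda>z. interior_product (X z) (\<omega> z)) y u ws = \<omega> y (?dX # ws) + \<omega> y (C u (X y) # ws)"
    by (simp add: nab_def)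
  also have "\<dots> = \<omega> y ((?dX + C u (X y)) # ws)"
    unfolding alt_forms_hd_expand[OF alt[OF S(2)], of "_ + _"] alt_forms_hd_expand[OF alt[OF S(2)], of ?dX]
      alt_forms_hd_expand[OF alt[OF S(2)], of "C u (X y)"] by (simp add: sum.distrib distrib_right)
  finally show "nab C (\<lambda>z. interior_product (X z) (\<omega> z)) y u ws = interior_product (?dX + C u (X y)) (\<omega> y) ws"
    by (simp add: interior_product_def)
qed

lemma nab_scale:
  assumes h: "h differentiable (at y)" and d: "fdiff \<omega> y" and n: "nab C \<omega> y u = 0"
  shows "nab C (\<lambda>z vs. h z * \<omega> z vs) y u = (\<lambda>vs. frechet_derivative h (at y) u * \<omega> y vs)"
proof
  fix vs
  have "pd \<omega> y u = act (C u) (\<omega> y)" using n by (simp add: nab_def)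
  moreover have "pd (\<lambda>z vs. h z * \<omega> z vs) y u vs = h y * pd \<omega> y u vs + frechet_derivative h (at y) u * \<omega> y vs"
    unfolding pd_def by (rule fd_mult[OF h fdiffD[OF d]])
  moreover have "act (C u) (\<lambda>vs. h y * \<omega> y vs) vs = h y * act (C u) (\<omega> y) vs"
    by (simp add: act_def sum_distrib_left)
  ultimately show "nab C (\<lambda>z vs. h z * \<omega> z vs) y u vs = frechet_derivative h (at y) u * \<omega> y vs"
    by (simp add: nab_def)
qed

section \<open>Recovering volume and metric from the 4-form\<close>

section \<open>The metric as a differentiable function of the 4-form\<close>

definition uvmat :: "bilin8 \<Rightarrow> (8 \<Rightarrow> vec8) \<Rightarrow> vec8 \<Rightarrow> vec8 \<Rightarrow> 8 \<Rightarrow> 8 \<Rightarrow> real" where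
  "uvmat g f u v k l = g (f k) u * g (f l) v - g (f l) u * g (f k) v"

lemma uvmat_skew: "uvmat g f u v l k = - uvmat g f u v k l"
  by (simp add: uvmat_def)

text \<open>A quotient of two top-degree forms evaluated on the same list, so that neither metric
  nor orientation enters; numerator and denominator are polynomial in the coefficients of
  \<open>w\<close>.\<close>

definition top_ratio :: "form8 \<Rightarrow> vec8 \<Rightarrow> vec8 \<Rightarrow> vec8 \<Rightarrow> vec8 \<Rightarrow> real" where
  "top_ratio w u v x y = wedge 2 6 (\<lambda>vs. w (u # v # vs)) (wedge 4 2 w (\<lambda>vs. w (x # y # vs))) (map e8 top8)
     / wedge 4 4 w w (map e8 top8)"

text \<open>A formula for \<open>\<langle>u \<and> v, x \<and> y\<rangle>\<close> in terms of the 4-form alone: in a frame, contraction of bivectors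
  with the Cayley form is an endomorphism \<open>P\<close> with \<open>P\<^sup>3 = 7P + 6\<close>, and \<open>top_ratio\<close> computes \<open>P\<^sup>3\<close> up to scale.\<close>

definition gram2 :: "form8 \<Rightarrow> vec8 \<Rightarrow> vec8 \<Rightarrow> vec8 \<Rightarrow> vec8 \<Rightarrow> real" where
  "gram2 w u v x y = (14 * top_ratio w u v x y - 7 * w [u, v, x, y]) / 6"

text \<open>The squared norm of the standard volume form. Being the same number in all fibres, it
  makes the volume a constant multiple of w \<and> w.\<close>

definition vol_const :: real where
  "vol_const = (\<Sum>K | length K = 8. ecov top8 (map e8 K) * ecov top8 (map e8 K)) / fact 8"

context spin7_fibre
begin

lemma parseval: "(\<Sum>i\<in>UNIV. g (f i) u * g (f i) x) = g u x"
proof -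
  have "g u x = g u (\<Sum>a\<in>UNIV. g (f a) x *\<^sub>R f a)" by (subst frame_expansion[of x]) (rule refl)
  also have "\<dots> = (\<Sum>a\<in>UNIV. g (f a) x * g u (f a))"
    by (simp only: linear_sum[OF g_lin] linear_cmul[OF g_lin] real_scaleR_def)
  finally show ?thesis by (simp add: g_sym[of u "f _"] mult.commute)
qed

lemma bilinear_frame:
  assumes "\<And>y. linear (\<lambda>x. h x y)" "\<And>x. linear (h x)"
  shows "h u v = (\<Sum>i\<in>UNIV. \<Sum>j\<in>UNIV. g (f i) u * g (f j) v * (h (f i) (f j) :: real))"
proof -
  have "h u v = h (\<Sum>a\<in>UNIV. g (f a) u *\<^sub>R f a) v" by (subst frame_expansion[of u]) (rule refl)
  also have "\<dots> = (\<Sum>a\<in>UNIV. g (f a) u * h (f a) v)"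
    by (simp only: linear_sum[OF assms(1)] linear_cmul[OF assms(1)] real_scaleR_def)
  also have "h (f a) v = (\<Sum>b\<in>UNIV. g (f b) v * h (f a) (f b))" for a
  proof -
    have "h (f a) v = h (f a) (\<Sum>b\<in>UNIV. g (f b) v *\<^sub>R f b)" by (subst frame_expansion[of v]) (rule refl)
    then show ?thesis by (simp only: linear_sum[OF assms(2)] linear_cmul[OF assms(2)] real_scaleR_def)
  qed
  then have "(\<Sum>a\<in>UNIV. g (f a) u * h (f a) v) = (\<Sum>i\<in>UNIV. \<Sum>j\<in>UNIV. g (f i) u * g (f j) v * h (f i) (f j))"
    by (simp add: sum_distrib_left mult.assoc)
  finally show ?thesis .
qed

lemma w_bilinear: "linear (\<lambda>x. w [x, y, p, q])" "linear (\<lambda>y. w [x, y, p, q])"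
  using multilinD[OF alt_forms_multilin[OF w_alt], of "[]" "[y, p, q]"]
    multilinD[OF alt_forms_multilin[OF w_alt], of "[x]" "[p, q]"] by simp_all

lemma w_pairs: "w [x, y, u, v] = w [u, v, x, y]"
  using alt_forms_move_block[OF w_alt, of "[]" "[x, y]" "[u, v]" "[]"] by simp

lemma inner_uvmat:
  assumes b: "\<And>i j. b j i = - b i j"
  shows "(\<Sum>i\<in>UNIV. \<Sum>j\<in>UNIV. uvmat g f u v i j * b i j) = 2 * (\<Sum>i\<in>UNIV. \<Sum>j\<in>UNIV. g (f i) u * g (f j) v * b i j)"
proof -
  let ?S = "\<Sum>i\<in>UNIV. \<Sum>j\<in>UNIV. g (f i) u * g (f j) v * b i j"
  have "(\<Sum>i\<in>UNIV. \<Sum>j\<in>UNIV. g (f j) u * g (f i) v * b i j) = - ?S"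
    unfolding sum_negf[symmetric]
  proof (rule trans[OF sum.swap], intro sum.cong refl)
    fix i j show "g (f i) u * g (f j) v * b j i = - (g (f i) u * g (f j) v * b i j)" unfolding b[of j i] by simp
  qed
  then show ?thesis by (simp add: uvmat_def left_diff_distrib sum_subtractf)
qed

lemma w_uv: "w [u, v, f i, f j] = cay2 (uvmat g f u v) i j"
proof -
  have c: "cay i j l k = - cay i j k l" for k l by (rule cay_swap(3))
  have "2 * cay2 (uvmat g f u v) i j = (\<Sum>k\<in>UNIV. \<Sum>l\<in>UNIV. uvmat g f u v k l * cay i j k l)"
    by (simp add: cay2_def mult.commute)
  also have "\<dots> = 2 * (\<Sum>k\<in>UNIV. \<Sum>l\<in>UNIV. g (f k) u * g (f l) v * cay i j k l)" by (rule inner_uvmat[OF c])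
  also have "(\<Sum>k\<in>UNIV. \<Sum>l\<in>UNIV. g (f k) u * g (f l) v * cay i j k l) = w [u, v, f i, f j]"
    by (subst bilinear_frame[of "\<lambda>u v. w [u, v, f i, f j]" u v, OF w_bilinear]) (simp only: w_list cay_pairs)
  finally show ?thesis by simp
qed

lemma uv_uv: "(\<Sum>i\<in>UNIV. \<Sum>j\<in>UNIV. uvmat g f u v i j * uvmat g f x y i j) = 2 * (g u x * g v y - g u y * g v x)"
proof -
  have "(\<Sum>i\<in>UNIV. \<Sum>j\<in>UNIV. g (f i) u * g (f j) v * uvmat g f x y i j)
    = (\<Sum>i\<in>UNIV. g (f i) u * g (f i) x) * (\<Sum>j\<in>UNIV. g (f j) v * g (f j) y)
    - (\<Sum>i\<in>UNIV. g (f i) u * g (f i) y) * (\<Sum>j\<in>UNIV. g (f j) v * g (f j) x)"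
    unfolding sum_product sum_subtractf[symmetric] uvmat_def by (intro sum.cong refl) (simp add: algebra_simps)
  then show ?thesis unfolding inner_uvmat[of "uvmat g f x y", OF uvmat_skew] parseval by simp
qed

lemma uv_cay2_uv: "(\<Sum>i\<in>UNIV. \<Sum>j\<in>UNIV. uvmat g f u v i j * cay2 (uvmat g f x y) i j) = 2 * w [u, v, x, y]"
proof -
  have "(\<Sum>i\<in>UNIV. \<Sum>j\<in>UNIV. g (f i) u * g (f j) v * w [x, y, f i, f j]) = w [x, y, u, v]"
    using bilinear_frame[of "\<lambda>u v. w [u, v, x, y]" u v, OF w_bilinear] by (simp only: w_pairs[of x y])
  also have "\<dots> = w [u, v, x, y]" by (rule w_pairs)
  finally have 1: "(\<Sum>i\<in>UNIV. \<Sum>j\<in>UNIV. g (f i) u * g (f j) v * w [x, y, f i, f j]) = w [u, v, x, y]" .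
  have "(\<Sum>i\<in>UNIV. \<Sum>j\<in>UNIV. uvmat g f u v i j * cay2 (uvmat g f x y) i j)
     = 2 * (\<Sum>i\<in>UNIV. \<Sum>j\<in>UNIV. g (f i) u * g (f j) v * cay2 (uvmat g f x y) i j)"
    by (rule inner_uvmat) (rule cay2_alt[OF uvmat_skew])
  then show ?thesis unfolding w_uv[symmetric] 1 .
qed

lemma V_top: "V (map f top8) = 1"
  unfolding V_f by (rule ecov_self[OF top8(1)])

lemma V_alt_top: "V \<in> alt_forms (length top8)"
  using V_alt by (simp only: top8)

lemma top_form: assumes T: "T \<in> alt_forms 8" shows "T = (\<lambda>vs. T (map f top8) * V vs)"
proof -
  let ?D = "T - (\<lambda>vs. T (map f top8) * V vs)"
  have T': "T \<in> alt_forms (length top8)" using T by (simp only: top8)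
  have "?D = 0"
  proof (rule alt_forms_top_zero[OF span_f _ top8(1,2)])
    show "?D \<in> alt_forms (length top8)" by (intro alt_forms_diff T' alt_forms_scale V_alt_top)
    show "?D (map f top8) = 0" by (simp only: fun_diff_def V_top mult_1_right diff_self)
  qed
  then have "?D vs = 0" for vs by (simp only: zero_fun_apply)
  then show ?thesis by (intro ext) (simp only: fun_diff_def eq_iff_diff_eq_0[of "T _" "_ * V _"])
qed

lemma V_e8: "V (map e8 top8) \<noteq> 0"
proof
  assume "V (map e8 top8) = 0"
  then have "V = 0" by (rule alt_forms_top_zero[OF span_e8 V_alt_top top8(1,2)])
  then show False using V_top by simp
qed

text \<open>Two top-degree forms are proportional, with the ratio of their stars as factor; the
  cross-multiplied form avoids a division.\<close>

lemma top_cross: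
  assumes T: "T \<in> alt_forms 8" and T': "T' \<in> alt_forms 8"
  shows "T vs * hodge g V 8 T' [] = T' vs * hodge g V 8 T []"
proof -
  have "hodge g V 8 T [] = T (map f top8) * hodge g V 8 V []"
    by (subst top_form[OF T]) (simp only: hodge_scale)
  moreover have "hodge g V 8 T' [] = T' (map f top8) * hodge g V 8 V []"
    by (subst top_form[OF T']) (simp only: hodge_scale)
  moreover have "T vs = T (map f top8) * V vs" "T' vs = T' (map f top8) * V vs"
    by (subst top_form[OF T], rule refl) (subst top_form[OF T'], rule refl)
  ultimately show ?thesis by simp
qed

lemma w_w_alt: "wedge 4 4 w w \<in> alt_forms 8"
  using wedge_alt_forms[OF alt_forms_multilin[OF w_alt] alt_forms_multilin[OF w_alt]] by simp

lemma hodge_w_w: "hodge g V 8 (wedge 4 4 w w) [] = 14"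
proof -
  have w: "multilin 4 w" by (rule alt_forms_multilin[OF w_alt])
  have "hodge g V 8 (wedge 4 4 w w) [] = (\<Sum>I | length I = 4. \<Sum>J | length J = 4. w (map f I) * w (map f J) * V (map f I @ map f J)) / 576"
    using hodge_wedge[OF w w, of "[]"] by (simp add: fact_numeral)
  also have "(\<Sum>I | length I = 4. \<Sum>J | length J = 4. w (map f I) * w (map f J) * V (map f I @ map f J))
     = (\<Sum>J | length J = 4. w (map f J) * (\<Sum>I | length I = 4. w (map f I) * V (map f I @ map f J)))"
    unfolding sum_distrib_left by (rule trans[OF sum.swap]) (simp only: mult_ac)
  also have "\<dots> = (\<Sum>J | length J = 4. 24 * (w (map f J) * w (map f J)))"
    by (intro sum.cong refl) (simp add: w_V)
  also have "\<dots> = 24 * 336" using inner_w_w inner4[OF w_alt w_alt] by (simp add: sum_distrib_left[symmetric])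
  finally show ?thesis by simp
qed

lemma w_w_e8: "wedge 4 4 w w (map e8 top8) \<noteq> 0"
proof
  assume "wedge 4 4 w w (map e8 top8) = 0"
  then have "V (map e8 top8) * 14 = 0" using top_cross[OF V_alt w_w_alt, of "map e8 top8"] hodge_w_w by simp
  then show False using V_e8 by simp
qed

lemma V_formula: "V vs = vol_const / 14 * wedge 4 4 w w vs"
proof -
  have "hodge g V 8 V [] = vol_const"
    unfolding hodge_eq[OF alt_forms_multilin[OF V_alt]] vol_const_def append_Nil2 V_f ..
  then show ?thesis using top_cross[OF V_alt w_w_alt, of vs] hodge_w_w by simp
qed

lemma w2_alt: "(\<lambda>vs. w (u # v # vs)) \<in> alt_forms 2"
proof -
  have "w \<in> alt_forms (length [u, v] + 2)" using w_alt by (simp add: eval_nat_numeral)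
  from alt_forms_append[OF this] show ?thesis by simp
qed

text \<open>With m = u \<and> v and n = x \<and> y, the contractions of \<open>w\<close> are P m and
  P n, and the wedge product with \<open>w\<close> applies P once more. The numerator of
  \<open>top_ratio\<close> therefore computes the pairing of P m with P^2 n, which is that of m with
  P^3 n = 7 P n + 6 n; the denominator contributes |w|^2 = 14.\<close>

lemma gram2_eq: "gram2 w u v x y = g u x * g v y - g u y * g v x"
proof -
  let ?a = "\<lambda>vs. w (u # v # vs)" and ?b = "\<lambda>vs. w (x # y # vs)"
  let ?\<beta> = "wedge 4 2 w ?b" and ?m = "uvmat g f u v" and ?n = "uvmat g f x y"
  have w: "multilin 4 w" by (rule alt_forms_multilin[OF w_alt])
  have \<beta>: "multilin 6 ?\<beta>" using wedge_multilin[OF w alt_forms_multilin[OF w2_alt]] by simp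
  have T: "wedge 2 6 ?a ?\<beta> \<in> alt_forms 8" using wedge_alt_forms[OF alt_forms_multilin[OF w2_alt] \<beta>] by simp
  have cs: "cay2 ?m j i = - cay2 ?m i j" "cay2 ?n j i = - cay2 ?n i j" for i j
    by (rule cay2_alt[OF uvmat_skew])+
  have Pb: "P2 ?b [f i, f j] = 2 * cay2 ?n i j + 3 * ?n i j" for i j
  proof -
    have "P2 ?b [f i, f j] = cay2 (\<lambda>k l. w [x, y, f k, f l]) i j" by (rule P2_f[OF w2_alt])
    also have "(\<lambda>k l. w [x, y, f k, f l]) = cay2 ?n" by (intro ext) (rule w_uv)
    also have "cay2 (cay2 ?n) i j = 2 * cay2 ?n i j + 3 * ?n i j" by (rule cay2_cay2[OF uvmat_skew])
    finally show ?thesis .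
  qed
  \<comment> \<open>The divisor 1440 is 2! 6!.\<close>
  have "hodge g V 8 (wedge 2 6 ?a ?\<beta>) [] = (\<Sum>I | length I = 2. \<Sum>J | length J = 6. ?a (map f I) * ?\<beta> (map f J) * V (map f I @ map f J)) / 1440"
    using hodge_wedge[OF alt_forms_multilin[OF w2_alt] \<beta>, of "[]" u v] by (simp add: fact_numeral)
  also have "(\<Sum>I | length I = 2. \<Sum>J | length J = 6. ?a (map f I) * ?\<beta> (map f J) * V (map f I @ map f J))
    = (\<Sum>I | length I = 2. ?a (map f I) * (720 * P2 ?b (map f I)))"
  proof (intro sum.cong refl)
    fix I :: "8 list" assume "I \<in> {I. length I = 2}"
    then have I: "length I = 2" by simp
    have V: "V (map f I @ map f J) = V (map f J @ map f I)" if "length J = 6" for J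
      using V_cycle[of "map f I" "map f J" "[]"] I that by simp
    have "(\<Sum>J | length J = 6. ?a (map f I) * ?\<beta> (map f J) * V (map f I @ map f J))
      = (\<Sum>J | length J = 6. ?a (map f I) * (?\<beta> (map f J) * V (map f J @ map f I)))"
      by (intro sum.cong refl) (simp only: V mem_Collect_eq mult.assoc)
    then show "(\<Sum>J | length J = 6. ?a (map f I) * ?\<beta> (map f J) * V (map f I @ map f J)) = ?a (map f I) * (720 * P2 ?b (map f I))"
      by (simp add: hodge_eq[OF \<beta>] fact_numeral sum_distrib_left[symmetric])
  qed
  also have "\<dots> = 720 * (\<Sum>i\<in>UNIV. \<Sum>j\<in>UNIV. cay2 ?m i j * (2 * cay2 ?n i j + 3 * ?n i j))"
    unfolding sum_lists_2 list.map Pb w_uv by (simp add: sum_distrib_left mult_ac)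
  also have "(\<Sum>i\<in>UNIV. \<Sum>j\<in>UNIV. cay2 ?m i j * (2 * cay2 ?n i j + 3 * ?n i j))
    = 2 * (\<Sum>i\<in>UNIV. \<Sum>j\<in>UNIV. cay2 ?m i j * cay2 ?n i j) + 3 * (\<Sum>i\<in>UNIV. \<Sum>j\<in>UNIV. cay2 ?m i j * ?n i j)"
    by (simp add: distrib_left sum.distrib sum_distrib_left mult_ac)
  also have "(\<Sum>i\<in>UNIV. \<Sum>j\<in>UNIV. cay2 ?m i j * cay2 ?n i j) = (\<Sum>i\<in>UNIV. \<Sum>j\<in>UNIV. ?m i j * (2 * cay2 ?n i j + 3 * ?n i j))"
    unfolding cay2_adjoint by (intro sum.cong refl) (simp only: cay2_cay2[of ?n, OF uvmat_skew])
  also have "\<dots> = 2 * (\<Sum>i\<in>UNIV. \<Sum>j\<in>UNIV. ?m i j * cay2 ?n i j) + 3 * (\<Sum>i\<in>UNIV. \<Sum>j\<in>UNIV. ?m i j * ?n i j)"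
    by (simp add: distrib_left sum.distrib sum_distrib_left mult_ac)
  also have "(\<Sum>i\<in>UNIV. \<Sum>j\<in>UNIV. cay2 ?m i j * ?n i j) = (\<Sum>i\<in>UNIV. \<Sum>j\<in>UNIV. ?m i j * cay2 ?n i j)" by (rule cay2_adjoint)
  finally have h: "hodge g V 8 (wedge 2 6 ?a ?\<beta>) [] = 7 * w [u, v, x, y] + 6 * (g u x * g v y - g u y * g v x)"
    unfolding uv_cay2_uv uv_uv by simp
  have "wedge 2 6 ?a ?\<beta> (map e8 top8) * 14 = wedge 4 4 w w (map e8 top8) * (7 * w [u, v, x, y] + 6 * (g u x * g v y - g u y * g v x))"
    using top_cross[OF T w_w_alt, of "map e8 top8"] unfolding h hodge_w_w .
  then have "14 * top_ratio w u v x y = 7 * w [u, v, x, y] + 6 * (g u x * g v y - g u y * g v x)"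
    unfolding top_ratio_def using w_w_e8 by (simp only: field_simps) simp
  then show ?thesis unfolding gram2_def by simp
qed

lemma g_nonneg: "g u u \<ge> 0"
  by (subst parseval[symmetric]) (intro sum_nonneg, simp)

text \<open>Two frame vectors f_a, f_b are used, with a and b different from an index k at which u
  has a nonzero coordinate. The Gram determinant is then |u|^2 - u_a^2 - u_b^2, which is at least
  u_k^2.\<close>

lemma gram_det_pos:
  assumes "u \<noteq> 0"
  obtains v x where "g u u * (g v v * g x x - g v x * g v x) - g u v * (g u v * g x x - g v x * g u x)
    + g u x * (g u v * g v x - g v v * g u x) > 0"
proof -
  have "\<exists>k. g (f k) u \<noteq> 0"
  proof (rule ccontr)
    assume "\<not> ?thesis"
    then have "u = 0" using frame_expansion[of u] by simp
    then show False using assms by simp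
  qed
  then obtain k where k: "g (f k) u \<noteq> 0" ..
  \<comment> \<open>In the cyclic index type these are distinct from \<open>k\<close> and from each
    other.\<close>
  let ?a = "k + 1" and ?b = "k + 2"
  have d: "?a \<noteq> k" "?b \<noteq> k" "?a \<noteq> ?b" by simp_all
  have "(\<Sum>i\<in>{k, ?a, ?b}. g (f i) u * g (f i) u) \<le> (\<Sum>i\<in>UNIV. g (f i) u * g (f i) u)"
    by (intro sum_mono2) auto
  then have "g (f k) u * g (f k) u + (g (f ?a) u * g (f ?a) u + g (f ?b) u * g (f ?b) u) \<le> g u u"
    unfolding parseval using d by (simp del: add_left_cancel add_right_cancel)
  moreover have "g (f k) u * g (f k) u > 0" using k not_real_square_gt_zero by blast
  ultimately have "g u u - g (f ?a) u * g (f ?a) u - g (f ?b) u * g (f ?b) u > 0" by linarith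
  moreover have "g (f ?a) (f ?a) = 1" "g (f ?b) (f ?b) = 1" "g (f ?a) (f ?b) = 0" using d by (simp_all add: g_f)
  moreover have "g u (f ?a) = g (f ?a) u" "g u (f ?b) = g (f ?b) u" by (rule g_sym)+
  ultimately show thesis by (intro that[of "f ?a" "f ?b"]) simp
qed

lemma metric_matrix_inverse:
  fixes M :: "real^8^8" defines "M \<equiv> \<chi> a b. g (e8 a) (e8 b)"
  shows "M ** matrix_inv M = mat 1"
proof -
  have "(M ** matrix_inv M) $ i $ j = mat 1 $ i $ j" for i j
  proof -
    have "(\<Sum>a\<in>UNIV. \<Sum>b\<in>UNIV. inverse_metric g a b * g (e8 i) (e8 a) * e8 b $ j) = (\<Sum>k\<in>UNIV. g (e8 i) (f k) * f k $ j)"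
      by (rule contract[OF g_lin]) (simp add: linear_iff)
    also have "\<dots> = e8 i $ j"
      using arg_cong[OF frame_expansion[of "e8 i"], of "\<lambda>v. v $ j"] unfolding g_sym[of "e8 i" "f _"] by simp
    finally have A: "(\<Sum>a\<in>UNIV. \<Sum>b\<in>UNIV. inverse_metric g a b * g (e8 i) (e8 a) * e8 b $ j) = e8 i $ j" .
    have B: "(\<Sum>b\<in>UNIV. inverse_metric g a b * g (e8 i) (e8 a) * e8 b $ j) = g (e8 i) (e8 a) * inverse_metric g a j" for a
    proof -
      have "(\<Sum>b\<in>UNIV. inverse_metric g a b * g (e8 i) (e8 a) * e8 b $ j)
        = (\<Sum>b\<in>UNIV. if b = j then inverse_metric g a b * g (e8 i) (e8 a) else 0)"
        by (intro sum.cong refl) (simp add: axis_nth_if)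
      then show ?thesis by simp
    qed
    show ?thesis using A unfolding B
      by (simp add: matrix_matrix_mult_def M_def inverse_metric_def mat_def axis_nth_if)
  qed
  then show ?thesis by (simp add: vec_eq_iff)
qed

text \<open>Cramer's rule expresses the inverse metric as a rational function of the metric, so it
  inherits differentiability.\<close>

lemma inverse_metric_cramer:
  fixes M :: "real^8^8" defines "M \<equiv> \<chi> a b. g (e8 a) (e8 b)"
  shows "det M \<noteq> 0" "inverse_metric g i j = det (\<chi> k l. if l = i then e8 j $ k else M $ k $ l) / det M"
proof -
  have MI: "M ** matrix_inv M = mat 1" unfolding M_def by (rule metric_matrix_inverse)
  then have "det M * det (matrix_inv M) = 1" by (metis det_I det_mul)
  then show d: "det M \<noteq> 0" by auto
  have "M *v (matrix_inv M *v e8 j) = e8 j" using MI by (simp add: matrix_vector_mul_assoc)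
  then have "matrix_inv M *v e8 j = (\<chi> k. det (\<chi> i l. if l = k then e8 j $ i else M $ i $ l) / det M)"
    using cramer[OF d] by blast
  moreover have "(matrix_inv M *v e8 j) $ i = matrix_inv M $ i $ j"
    by (simp add: matrix_vector_mul_component inner_axis matrix_vector_mult_basis column_def)
  ultimately show "inverse_metric g i j = det (\<chi> k l. if l = i then e8 j $ k else M $ k $ l) / det M"
    by (simp add: inverse_metric_def M_def)
qed

text \<open>Rewrites the frame formula for \<open>vec3\<close> in coordinates. Only the metric and
  \<open>w\<close> occur on the right, and unlike the frame these depend differentiably on the
  point.\<close>

lemma vec3_nth:
  assumes \<gamma>: "\<gamma> \<in> alt_forms 3"
  shows "vec3 \<gamma> $ p = (\<Sum>b\<in>UNIV. inverse_metric g p b * (form_inner g 3 \<gamma> (interior_product (e8 b) w) / 7))"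
proof -
  have "linear (\<lambda>X. form_inner g 3 \<gamma> (interior_product X w))"
    unfolding interior_inner[OF \<gamma>]
    by (rule linearI) (simp_all add: linear_add[OF g_lin] linear_cmul[OF g_lin] distrib_right sum.distrib sum_distrib_left add_divide_distrib mult.assoc)
  then have l: "linear (\<lambda>X. form_inner g 3 \<gamma> (interior_product X w) / 7)"
    using linear_scale_real[of _ "1/7"] by fastforce
  have "(\<Sum>a\<in>UNIV. \<Sum>b\<in>UNIV. inverse_metric g a b * e8 a $ p * (form_inner g 3 \<gamma> (interior_product (e8 b) w) / 7))
    = (\<Sum>k\<in>UNIV. f k $ p * (form_inner g 3 \<gamma> (interior_product (f k) w) / 7))"
    by (rule contract[OF _ l]) (simp add: linear_iff)
  also have "\<dots> = vec3 \<gamma> $ p" by (simp add: vec3_def mult.commute)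
  also have "(\<Sum>a\<in>UNIV. \<Sum>b\<in>UNIV. inverse_metric g a b * e8 a $ p * (form_inner g 3 \<gamma> (interior_product (e8 b) w) / 7))
    = (\<Sum>a\<in>UNIV. if a = p then \<Sum>b\<in>UNIV. inverse_metric g a b * (form_inner g 3 \<gamma> (interior_product (e8 b) w) / 7) else 0)"
    by (intro sum.cong refl) (simp add: axis_nth_if)
  finally show ?thesis by simp
qed

definition flat2 :: "vec8 \<Rightarrow> vec8 \<Rightarrow> form8" where
  "flat2 u v = (\<lambda>ws. if length ws = 2 then g u (ws ! 0) * g v (ws ! 1) - g u (ws ! 1) * g v (ws ! 0) else 0)"

lemma flat2_eq: "flat2 u v = mat2 (\<lambda>i p. g u (f i) * g v (f p) - g u (f p) * g v (f i))"
proof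
  fix ws
  show "flat2 u v ws = mat2 (\<lambda>i p. g u (f i) * g v (f p) - g u (f p) * g v (f i)) ws"
  proof (cases "length ws = 2")
    case True
    have e: "g x y = (\<Sum>i\<in>UNIV. g x (f i) * g (f i) y)" for x y
      unfolding g_sym[of x "f _"] by (rule parseval[symmetric])
    let ?p = "ws ! 0" and ?q = "ws ! 1"
    have "flat2 u v ws = (\<Sum>i\<in>UNIV. g u (f i) * g (f i) ?p) * (\<Sum>j\<in>UNIV. g v (f j) * g (f j) ?q)
        - (\<Sum>j\<in>UNIV. g u (f j) * g (f j) ?q) * (\<Sum>i\<in>UNIV. g v (f i) * g (f i) ?p)"
      unfolding flat2_def e[symmetric] using True by simp
    also have "(\<Sum>j\<in>UNIV. g u (f j) * g (f j) ?q) * (\<Sum>i\<in>UNIV. g v (f i) * g (f i) ?p)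
      = (\<Sum>i\<in>UNIV. g v (f i) * g (f i) ?p) * (\<Sum>j\<in>UNIV. g u (f j) * g (f j) ?q)" by (rule mult.commute)
    finally show ?thesis unfolding mat2_def sum_product sum_subtractf[symmetric] using True
      by (simp add: algebra_simps)
  qed (simp add: flat2_def mat2_def)
qed

text \<open>A frame-free expression of the skew gradient: its value on two vectors is the pairing of
  \<eta> with the orbit direction given by the 2-form dual to their bivector. The factor 1/6 in
  \<open>hmat\<close> is chosen to make this exact.\<close>

lemma hform_eq:
  assumes \<eta>: "\<eta> \<in> alt_forms 4"
  shows "mat2 (hmat \<eta>) = (\<lambda>vs. if length vs = 2 then form_inner g 4 (diamond g (flat2 (vs ! 0) (vs ! 1)) w) \<eta> else 0)"
proof
  fix vs
  show "mat2 (hmat \<eta>) vs = (if length vs = 2 then form_inner g 4 (diamond g (flat2 (vs ! 0) (vs ! 1)) w) \<eta> else 0)"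
  proof (cases "length vs = 2")
    case True
    let ?u = "vs ! 0" and ?v = "vs ! 1"
    let ?b = "\<lambda>i p. g ?u (f i) * g ?v (f p) - g ?u (f p) * g ?v (f i)"
    have "?b p i = - ?b i p" for i p by simp
    then have "flat2 ?u ?v \<in> alt_forms 2" unfolding flat2_eq by (intro mat2_alt_forms)
    from diamond_eq[OF this, of w] have "diamond g (flat2 ?u ?v) w = act (endo ?b) w"
      unfolding flat2_eq mat2_f .
    then have "form_inner g 4 (diamond g (flat2 ?u ?v) w) \<eta> = (\<Sum>i\<in>UNIV. \<Sum>p\<in>UNIV. ?b i p * H \<eta> i p) / 6"
      by (simp only: inner_act_w[OF \<eta>])
    also have "(\<Sum>i\<in>UNIV. \<Sum>p\<in>UNIV. ?b i p * H \<eta> i p) = (\<Sum>i\<in>UNIV. \<Sum>p\<in>UNIV. g ?u (f i) * g ?v (f p) * H \<eta> i p)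
       - (\<Sum>i\<in>UNIV. \<Sum>p\<in>UNIV. g ?u (f p) * g ?v (f i) * H \<eta> i p)"
      by (simp add: left_diff_distrib sum_subtractf)
    also have "(\<Sum>i\<in>UNIV. \<Sum>p\<in>UNIV. g ?u (f p) * g ?v (f i) * H \<eta> i p) = (\<Sum>i\<in>UNIV. \<Sum>p\<in>UNIV. g ?u (f i) * g ?v (f p) * H \<eta> p i)"
      by (rule sum.swap)
    finally show ?thesis using True
      by (simp add: mat2_def hmat_def g_sym[of "f _"] sum_subtractf[symmetric] sum_divide_distrib right_diff_distrib mult_ac diff_divide_distrib)
  qed (simp add: mat2_def)
qed

lemma proj_4_7_diamond:
  assumes \<eta>: "\<eta> \<in> alt_forms 4"
  shows "act (endo (bmat \<eta>)) w = diamond g (\<lambda>vs. 1/128 * (mat2 (hmat \<eta>) vs + P2 (mat2 (hmat \<eta>)) vs)) w"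
proof -
  have h: "mat2 (hmat \<eta>) \<in> alt_forms 2" by (rule mat2_alt_forms[OF hmat_skew])
  have b: "(\<lambda>vs. 1/128 * (mat2 (hmat \<eta>) vs + P2 (mat2 (hmat \<eta>)) vs)) \<in> alt_forms 2"
    using alt_forms_scale[OF alt_forms_add[OF h P2_alt_forms[OF h]], of "1/128"] by simp
  have "(\<lambda>i p. 1/128 * (mat2 (hmat \<eta>) [f i, f p] + P2 (mat2 (hmat \<eta>)) [f i, f p])) = bmat \<eta>"
    unfolding P2_f[OF h] mat2_f by (intro ext) (simp add: bmat_def)
  then show ?thesis unfolding diamond_eq[OF b] by simp
qed

end

lemma det_differentiable:
  fixes A :: "vec8 \<Rightarrow> real^8^8"
  assumes "\<And>i j. (\<lambda>z. A z $ i $ j) differentiable (at y)" shows "(\<lambda>z. det (A z)) differentiable (at y)"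
  unfolding det_def by (auto intro!: differentiable_sum differentiable_mult differentiable_prod_real assms)

lemma differentiable_if_const:
  "(b \<Longrightarrow> F differentiable (at y)) \<Longrightarrow> (\<not> b \<Longrightarrow> G differentiable (at y)) \<Longrightarrow> (\<lambda>z. if b then F z else G z) differentiable (at y)"
  by (cases b) simp_all

lemma fdiff_wedge:
  assumes "fdiff \<alpha> y" "fdiff \<beta> y" shows "fdiff (\<lambda>z. wedge k l (\<alpha> z) (\<beta> z)) y"
  unfolding fdiff_def wedge_def
  by (auto intro!: differentiable_if_const differentiable_divide differentiable_sum differentiable_mult
      fdiffD[OF assms(1)] fdiffD[OF assms(2)] simp: finite_permutations)

lemma sqrt_differentiable:
  fixes h :: "vec8 \<Rightarrow> real"
  assumes "h differentiable (at y)" "h y > 0" shows "(\<lambda>z. sqrt (h z)) differentiable (at y)"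
  using has_derivative_real_sqrt[OF assms(2) fd_has_derivative[OF assms(1)]] unfolding differentiable_def by blast

lemma positive_nbhd:
  fixes Q :: "vec8 \<Rightarrow> real"
  assumes "Q differentiable (at y)" "Q y > 0"
  obtains d where "d > 0" "\<And>z. z \<in> ball y d \<Longrightarrow> Q z > 0"
proof -
  have "isCont Q y" by (rule differentiable_imp_continuous_within[OF assms(1)])
  then obtain d where d: "d > 0" "\<And>z. dist z y < d \<Longrightarrow> dist (Q z) (Q y) < Q y"
    using assms(2) unfolding continuous_at_eps_delta by blast
  have "Q z > 0" if "z \<in> ball y d" for z
    using d(2)[of z] that by (simp add: dist_commute dist_real_def abs_if split: if_splits)
  then show thesis using that d(1) by blast
qed

context spin7_fibre
begin

lemma g_pos: assumes "u \<noteq> 0" shows "g u u > 0"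
proof (rule ccontr)
  assume "\<not> g u u > 0"
  then have "(\<Sum>i\<in>UNIV. g (f i) u * g (f i) u) = 0" using g_nonneg[of u] unfolding parseval by simp
  then have "g (f i) u = 0" for i by (subst (asm) sum_nonneg_eq_0_iff) auto
  then have "u = 0" using frame_expansion[of u] by simp
  then show False using assms by simp
qed

lemma interior_w_add: "interior_product (X + Y) w = interior_product X w + interior_product Y w"
  using interior_w_diff[of "X + Y" Y] by (simp add: fun_eq_iff algebra_simps)

lemma vec3_add: "vec3 (\<alpha> + \<beta>) = vec3 \<alpha> + vec3 \<beta>"
  unfolding vec3_def form_inner_add_left by (simp add: add_divide_distrib scaleR_add_left sum.distrib)

lemma H_add: "H (\<alpha> + \<beta>) i p = H \<alpha> i p + H \<beta> i p"
  by (simp add: H_def distrib_right sum.distrib)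

lemma bmat_add: "bmat (\<alpha> + \<beta>) = (\<lambda>i p. bmat \<alpha> i p + bmat \<beta> i p)"
proof -
  have "hmat (\<alpha> + \<beta>) = (\<lambda>i p. hmat \<alpha> i p + hmat \<beta> i p)"
    by (intro ext) (simp add: hmat_def H_add field_simps)
  then show ?thesis by (intro ext) (simp add: bmat_def cay2_add field_simps)
qed

section \<open>Projections in degree 5, and additivity of all projections\<close>

lemma form_inner_5_sum:
  assumes "\<alpha> \<in> alt_forms 5" "\<beta> \<in> alt_forms 5"
  shows "120 * form_inner g 5 \<alpha> \<beta> = (\<Sum>(a,b,c,d,e)\<in>UNIV. \<alpha> [f a, f b, f c, f d, f e] * \<beta> [f a, f b, f c, f d, f e])"
proof -
  have "120 * form_inner g 5 \<alpha> \<beta> = (\<Sum>K | length K = 5. \<alpha> (map f K) * \<beta> (map f K))"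
    by (simp add: form_inner_eq alt_forms_multilin assms fact_numeral)
  also have "\<dots> = (\<Sum>a\<in>UNIV. \<Sum>b\<in>UNIV. \<Sum>c\<in>UNIV. \<Sum>d\<in>UNIV. \<Sum>e\<in>UNIV.
      \<alpha> [f a, f b, f c, f d, f e] * \<beta> [f a, f b, f c, f d, f e])"
    by (simp add: numeral_eq_Suc sum_lists_Suc)
  also have "\<dots> = (\<Sum>(a,b,c,d,e)\<in>UNIV. \<alpha> [f a, f b, f c, f d, f e] * \<beta> [f a, f b, f c, f d, f e])"
    by (simp add: sum.cartesian_product case_prod_beta)
  finally show ?thesis .
qed

text \<open>In degree 5 no formula for the projection is computed. Coordinates in the frame embed
  5-forms into a Euclidean space, scaling the inner product by 5! = 120, and the decomposition along
  a subspace is taken there.\<close>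

lemma orth_proj_5_exists:
  assumes \<alpha>: "\<alpha> \<in> alt_forms 5" and W: "\<And>\<gamma>. \<gamma> \<in> W \<Longrightarrow> \<gamma> \<in> alt_forms 5" "0 \<in> W"
    "\<And>\<beta> \<gamma>. \<beta> \<in> W \<Longrightarrow> \<gamma> \<in> W \<Longrightarrow> \<beta> + \<gamma> \<in> W" "\<And>c \<gamma>. \<gamma> \<in> W \<Longrightarrow> (\<lambda>vs. c * \<gamma> vs) \<in> W"
  obtains \<beta> where "\<beta> \<in> W" "\<And>\<gamma>. \<gamma> \<in> W \<Longrightarrow> form_inner g 5 (\<alpha> - \<beta>) \<gamma> = 0"
proof -
  define \<Psi> :: "form8 \<Rightarrow> real^(8 \<times> 8 \<times> 8 \<times> 8 \<times> 8)" where
    "\<Psi> \<alpha> = (\<chi> t. case t of (a,b,c,d,e) \<Rightarrow> \<alpha> [f a, f b, f c, f d, f e])" for \<alpha>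
  have inner: "\<Psi> \<alpha> \<bullet> \<Psi> \<beta> = 120 * form_inner g 5 \<alpha> \<beta>" if "\<alpha> \<in> alt_forms 5" "\<beta> \<in> alt_forms 5" for \<alpha> \<beta>
    unfolding form_inner_5_sum[OF that] inner_vec_def \<Psi>_def by (simp add: case_prod_beta)
  have sub: "subspace (\<Psi> ` W)"
  proof (rule subspaceI)
    have "\<Psi> 0 = 0" by (simp add: \<Psi>_def vec_eq_iff case_prod_beta)
    then show "0 \<in> \<Psi> ` W" using W(2) by (metis image_eqI)
    fix x y assume "x \<in> \<Psi> ` W" "y \<in> \<Psi> ` W"
    then obtain \<beta> \<gamma> where b: "\<beta> \<in> W" "\<gamma> \<in> W" "x = \<Psi> \<beta>" "y = \<Psi> \<gamma>" by auto
    have "x + y = \<Psi> (\<beta> + \<gamma>)" unfolding b by (simp add: \<Psi>_def vec_eq_iff case_prod_beta)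
    then show "x + y \<in> \<Psi> ` W" using W(3)[OF b(1,2)] by blast
  next
    fix c x assume "x \<in> \<Psi> ` W"
    then obtain \<beta> where b: "\<beta> \<in> W" "x = \<Psi> \<beta>" by auto
    have "c *\<^sub>R x = \<Psi> (\<lambda>vs. c * \<beta> vs)" unfolding b by (simp add: \<Psi>_def vec_eq_iff case_prod_beta)
    then show "c *\<^sub>R x \<in> \<Psi> ` W" using W(4)[OF b(1)] by blast
  qed
  obtain p q where p: "p \<in> span (\<Psi> ` W)" and q: "\<And>x. x \<in> span (\<Psi> ` W) \<Longrightarrow> orthogonal q x" and e: "\<Psi> \<alpha> = p + q"
    using orthogonal_subspace_decomp_exists[of "\<Psi> ` W" "\<Psi> \<alpha>"] by metis
  have "span (\<Psi> ` W) = \<Psi> ` W" using sub by (simp add: span_eq_iff)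
  then have "p \<in> \<Psi> ` W" using p by (simp only:)
  then obtain \<beta> where \<beta>: "\<beta> \<in> W" "p = \<Psi> \<beta>" by blast
  have "form_inner g 5 (\<alpha> - \<beta>) \<gamma> = 0" if \<gamma>: "\<gamma> \<in> W" for \<gamma>
  proof -
    have "\<Psi> (\<alpha> - \<beta>) = \<Psi> \<alpha> - \<Psi> \<beta>" by (simp add: \<Psi>_def vec_eq_iff case_prod_beta)
    then have "\<Psi> (\<alpha> - \<beta>) = q" using e \<beta> by simp
    moreover have "orthogonal q (\<Psi> \<gamma>)" using q[OF span_base] \<gamma> by blast
    ultimately have "\<Psi> (\<alpha> - \<beta>) \<bullet> \<Psi> \<gamma> = 0" by (simp add: orthogonal_def)
    then show ?thesis using inner[OF alt_forms_diff[OF \<alpha> W(1)[OF \<beta>(1)]] W(1)[OF \<gamma>]] by simp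
  qed
  then show thesis using that \<beta>(1) by blast
qed

lemma orth_proj_5_add:
  assumes \<alpha>: "\<alpha> \<in> alt_forms 5" "\<alpha>' \<in> alt_forms 5" and W: "\<And>\<gamma>. \<gamma> \<in> W \<Longrightarrow> \<gamma> \<in> alt_forms 5" "0 \<in> W"
    "\<And>\<beta> \<gamma>. \<beta> \<in> W \<Longrightarrow> \<gamma> \<in> W \<Longrightarrow> \<beta> + \<gamma> \<in> W" "\<And>c \<gamma>. \<gamma> \<in> W \<Longrightarrow> (\<lambda>vs. c * \<gamma> vs) \<in> W"
  shows "orth_proj g 5 W (\<alpha> + \<alpha>') = orth_proj g 5 W \<alpha> + orth_proj g 5 W \<alpha>'"
proof -
  have diff: "\<beta> - \<gamma> \<in> W" if "\<beta> \<in> W" "\<gamma> \<in> W" for \<beta> \<gamma>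
  proof -
    have "\<beta> - \<gamma> = \<beta> + (\<lambda>vs. (-1) * \<gamma> vs)" by (simp add: fun_eq_iff)
    then show ?thesis using W(3)[OF that(1) W(4)[OF that(2), of "-1"]] by (simp only:)
  qed
  obtain \<beta> where b: "\<beta> \<in> W" "\<And>\<gamma>. \<gamma> \<in> W \<Longrightarrow> form_inner g 5 (\<alpha> - \<beta>) \<gamma> = 0"
    by (rule orth_proj_5_exists[OF \<alpha>(1) W]) blast+
  obtain \<beta>' where b': "\<beta>' \<in> W" "\<And>\<gamma>. \<gamma> \<in> W \<Longrightarrow> form_inner g 5 (\<alpha>' - \<beta>') \<gamma> = 0"
    by (rule orth_proj_5_exists[OF \<alpha>(2) W]) blast+
  have "orth_proj g 5 W \<alpha> = \<beta>" by (rule orth_proj_eq[OF W(1) diff b])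
  moreover have "orth_proj g 5 W \<alpha>' = \<beta>'" by (rule orth_proj_eq[OF W(1) diff b'])
  moreover have "orth_proj g 5 W (\<alpha> + \<alpha>') = \<beta> + \<beta>'"
  proof (rule orth_proj_eq[OF W(1) diff])
    show "\<beta> + \<beta>' \<in> W" by (rule W(3)[OF b(1) b'(1)])
    fix \<gamma> assume g: "\<gamma> \<in> W"
    have "\<alpha> + \<alpha>' - (\<beta> + \<beta>') = (\<alpha> - \<beta>) + (\<alpha>' - \<beta>')" by simp
    then show "form_inner g 5 (\<alpha> + \<alpha>' - (\<beta> + \<beta>')) \<gamma> = 0"
      using b(2)[OF g] b'(2)[OF g] by (simp only: form_inner_add_left)
  qed
  ultimately show ?thesis by simp
qed

lemma L3_48_zero_add_scale:
  "\<beta> \<in> L3_48 w \<Longrightarrow> \<gamma> \<in> L3_48 w \<Longrightarrow> \<beta> + \<gamma> \<in> L3_48 w" "\<gamma> \<in> L3_48 w \<Longrightarrow> (\<lambda>vs. c * \<gamma> vs) \<in> L3_48 w"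
  unfolding L3_48_iff
  by (auto intro!: alt_forms_add alt_forms_scale simp: distrib_right sum.distrib mult.assoc sum_distrib_left[symmetric])

lemma L3_8_closed:
  "0 \<in> L3_8 w" "\<beta> \<in> L3_8 w \<Longrightarrow> \<gamma> \<in> L3_8 w \<Longrightarrow> \<beta> + \<gamma> \<in> L3_8 w" "\<gamma> \<in> L3_8 w \<Longrightarrow> (\<lambda>vs. c * \<gamma> vs) \<in> L3_8 w"
proof -
  show z: "0 \<in> L3_8 w" using interior_w_diff[of 0 0] unfolding L3_8_def by (auto intro: image_eqI[of _ _ 0])
  show "\<beta> + \<gamma> \<in> L3_8 w" if bg: "\<beta> \<in> L3_8 w" "\<gamma> \<in> L3_8 w"
  proof -
    obtain X Y where "\<beta> = interior_product X w" "\<gamma> = interior_product Y w" using bg by (auto simp: L3_8_def)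
    then have "\<beta> + \<gamma> = interior_product (X + Y) w" by (simp only: interior_w_add)
    then show ?thesis unfolding L3_8_def by (rule range_eqI)
  qed
  show "(\<lambda>vs. c * \<gamma> vs) \<in> L3_8 w" if g: "\<gamma> \<in> L3_8 w"
  proof -
    obtain X where "\<gamma> = interior_product X w" using g by (auto simp: L3_8_def)
    moreover have "(\<lambda>vs. c * interior_product X w vs) = interior_product (c *\<^sub>R X) w"
      by (rule ext) (use interior_w_sum[of "\<lambda>_. c" "\<lambda>_. X" "{0::nat}"] in \<open>simp add: interior_product_def\<close>)
    ultimately show ?thesis unfolding L3_8_def by auto
  qed
qed

lemma star3_closed:
  assumes U: "\<And>\<gamma>. \<gamma> \<in> U \<Longrightarrow> \<gamma> \<in> alt_forms 3" "0 \<in> U" "\<And>\<beta> \<gamma>. \<beta> \<in> U \<Longrightarrow> \<gamma> \<in> U \<Longrightarrow> \<beta> + \<gamma> \<in> U"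
    "\<And>c \<gamma>. \<gamma> \<in> U \<Longrightarrow> (\<lambda>vs. c * \<gamma> vs) \<in> U"
  defines "W \<equiv> hodge g V 3 ` U"
  shows "\<And>\<gamma>. \<gamma> \<in> W \<Longrightarrow> \<gamma> \<in> alt_forms 5" "0 \<in> W" "\<And>\<beta> \<gamma>. \<beta> \<in> W \<Longrightarrow> \<gamma> \<in> W \<Longrightarrow> \<beta> + \<gamma> \<in> W"
    "\<And>c \<gamma>. \<gamma> \<in> W \<Longrightarrow> (\<lambda>vs. c * \<gamma> vs) \<in> W"
proof -
  show "\<gamma> \<in> alt_forms 5" if "\<gamma> \<in> W" for \<gamma> using that hodge3_alt U(1) unfolding W_def by auto
  have "hodge g V 3 0 = 0" by (rule ext) (simp add: hodge_def)
  then show "0 \<in> W" using U(2) unfolding W_def by (metis image_eqI)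
  show "\<beta> + \<gamma> \<in> W" if bg: "\<beta> \<in> W" "\<gamma> \<in> W" for \<beta> \<gamma>
  proof -
    obtain b c where "b \<in> U" "c \<in> U" "\<beta> = hodge g V 3 b" "\<gamma> = hodge g V 3 c" using bg unfolding W_def by auto
    then show ?thesis using U(3)[of b c] hodge_add[of 3 b c] unfolding W_def by (metis image_eqI)
  qed
  show "(\<lambda>vs. c * \<gamma> vs) \<in> W" if g: "\<gamma> \<in> W" for c \<gamma>
  proof -
    obtain b where "b \<in> U" "\<gamma> = hodge g V 3 b" using g unfolding W_def by auto
    then show ?thesis using U(4)[of b c] hodge_scale[of 3 c b] unfolding W_def by (metis image_eqI)
  qed
qed

lemma W5_8: "type_space w 5 8 = hodge g V 3 ` L3_8 w" "type_space w 5 48 = hodge g V 3 ` L3_48 w"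
  by (simp_all add: type_space_def g_eq V_eq)

lemma L3_alt: "\<gamma> \<in> L3_8 w \<Longrightarrow> \<gamma> \<in> alt_forms 3" "\<gamma> \<in> L3_48 w \<Longrightarrow> \<gamma> \<in> alt_forms 3"
  using interior_w_alt_forms by (auto simp: L3_8_def L3_48_def)

lemmas W5_8_closed = star3_closed[OF L3_alt(1) L3_8_closed]
lemmas W5_48_closed = star3_closed[OF L3_alt(2) L3_48_zero L3_48_zero_add_scale]

text \<open>Since \<open>orth_proj\<close> is a definite description, additivity rests on existence:
  explicit formulas provide it in degrees 3 and 4, the Euclidean embedding in degree 5.\<close>

lemma type_proj_add:
  assumes kq: "(k, q) \<in> {(3,8), (3,48), (4,1), (4,7), (4,27), (4,35), (5,8), (5,48)}"
    and \<alpha>: "\<alpha> \<in> alt_forms k" and \<beta>: "\<beta> \<in> alt_forms k"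
  shows "orth_proj g k (type_space w k q) (\<alpha> + \<beta>) = orth_proj g k (type_space w k q) \<alpha> + orth_proj g k (type_space w k q) \<beta>"
proof -
  have a4: "\<alpha> + \<beta> \<in> alt_forms k" by (rule alt_forms_add[OF \<alpha> \<beta>])
  have p27: "p27 (\<alpha> + \<beta>) = p27 \<alpha> + p27 \<beta>" if "k = 4"
    unfolding p27_def bmat_add act_add[OF w_alt] form_inner_add_left hodge_add by (simp add: fun_eq_iff field_simps)
  consider "(k, q) = (3,8)" | "(k, q) = (3,48)" | "(k, q) = (4,1)" | "(k, q) = (4,7)" | "(k, q) = (4,27)"
    | "(k, q) = (4,35)" | "(k, q) = (5,8)" | "(k, q) = (5,48)" using kq by auto
  then show ?thesis
  proof cases
    case 1
    then have k: "k = 3" "q = 8" by auto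
    show ?thesis using \<alpha> \<beta> a4 unfolding k by (simp add: type_space_def proj_3_8 vec3_add interior_w_add)
  next
    case 2
    then have k: "k = 3" "q = 48" by auto
    show ?thesis using \<alpha> \<beta> a4 unfolding k by (simp add: type_space_def proj_3_48 vec3_add interior_w_add)
  next
    case 3
    then have k: "k = 4" "q = 1" by auto
    show ?thesis using \<alpha> \<beta> a4 unfolding k
      by (simp add: type_space_def proj_4_1 form_inner_add_left fun_eq_iff field_simps)
  next
    case 4
    then have k: "k = 4" "q = 7" by auto
    show ?thesis using \<alpha> \<beta> a4 unfolding k by (simp add: type_space_def proj_4_7 bmat_add act_add[OF w_alt])
  next
    case 5
    then have k: "k = 4" "q = 27" by auto
    show ?thesis using \<alpha> \<beta> a4 p27 unfolding k by (simp add: type_space_def proj_4_27)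
  next
    case 6
    then have k: "k = 4" "q = 35" by auto
    show ?thesis using \<alpha> \<beta> a4 unfolding k
      by (simp add: type_space_def proj_4_35 hodge_add fun_eq_iff field_simps)
  next
    case 7
    then have k: "k = 5" "q = 8" by auto
    show ?thesis unfolding k W5_8 by (rule orth_proj_5_add[OF \<alpha>[unfolded k] \<beta>[unfolded k] W5_8_closed])
  next
    case 8
    then have k: "k = 5" "q = 48" by auto
    show ?thesis unfolding k W5_8 by (rule orth_proj_5_add[OF \<alpha>[unfolded k] \<beta>[unfolded k] W5_48_closed])
  qed
qed

end

text \<open>For the symmetric matrix with rows (a, d, e), (d, b, h), (e, h, c), the left side is a 2
  x 2 minor of its second compound and the right side is a times its determinant.\<close>

lemma jacobi_minor:
  fixes a b c d e h :: real
  shows "(a * b - d * d) * (a * c - e * e) - (a * h - e * d) * (a * h - e * d)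
    = a * (a * (b * c - h * h) - d * (d * c - h * e) + e * (d * h - b * e))"
  by (simp add: algebra_simps)

text \<open>The determinant of the second compound of the same 3 x 3 matrix is the square of its
  determinant.\<close>

lemma compound_det:
  fixes a b c d e h :: real
  shows "(a * b - d * d) * ((a * c - e * e) * (b * c - h * h) - (d * c - e * h) * (d * c - e * h))
    - (a * h - e * d) * ((a * h - e * d) * (b * c - h * h) - (d * c - e * h) * (d * h - e * b))
    + (d * h - e * b) * ((a * h - e * d) * (d * c - e * h) - (a * c - e * e) * (d * h - e * b))
    = (a * (b * c - h * h) - d * (d * c - h * e) + e * (d * h - b * e))
    * (a * (b * c - h * h) - d * (d * c - h * e) + e * (d * h - b * e))"
  by (simp add: algebra_simps)

section \<open>One chart: differentiability of the metric, vanishing components of d, and the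
  second-order identities\<close>

section \<open>Torsion-free structures on an open subset of \<open>\<real>\<^sup>8\<close>\<close>

text \<open>The coordinate expression of a structure in a single chart. Fields are families of local
  expressions and all operators are applied chart by chart, so the identities can be proved
  here.\<close>

locale spin7_domain =
  fixes S :: "vec8 set" and \<Phi> :: "vec8 \<Rightarrow> form8"
  assumes S: "open S" and adm: "\<And>z. z \<in> S \<Longrightarrow> admissible (\<Phi> z)"
    and sm: "\<And>vs. smooth_on S (\<lambda>z. \<Phi> z vs)"
    and tf: "\<And>y u. y \<in> S \<Longrightarrow> cov_deriv (\<lambda>z. induced_metric (\<Phi> z)) \<Phi> y u = 0"
begin

abbreviation G :: "vec8 \<Rightarrow> bilin8" where "G z \<equiv> induced_metric (\<Phi> z)"
abbreviation Vol :: "vec8 \<Rightarrow> form8" where "Vol z \<equiv> induced_vol (\<Phi> z)"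

lemma fibreE: assumes "z \<in> S" obtains f where "spin7_fibre f (G z) (Vol z) (\<Phi> z)"
  using admissible_fibre[OF adm[OF assms]] by blast

lemma \<Phi>_alt: assumes "z \<in> S" shows "\<Phi> z \<in> alt_forms 4"
proof -
  obtain f where "spin7_fibre f (G z) (Vol z) (\<Phi> z)" by (rule fibreE[OF assms])
  then interpret spin7_fibre f "G z" "Vol z" "\<Phi> z" .
  show ?thesis by (rule w_alt)
qed

lemma \<Phi>_diff: "y \<in> S \<Longrightarrow> fdiff \<Phi> y"
  unfolding fdiff_def using smooth_on_differentiable[OF sm] by blast

lemma G_bilinear: assumes "z \<in> S" shows "G z u v = G z v u" "linear (G z u)"
proof -
  obtain f where "spin7_fibre f (G z) (Vol z) (\<Phi> z)" by (rule fibreE[OF assms])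
  then interpret spin7_fibre f "G z" "Vol z" "\<Phi> z" .
  show "G z u v = G z v u" by (rule g_sym)
  show "linear (G z u)" by (rule g_lin)
qed

lemma \<Phi>_\<Phi>_top: assumes "z \<in> S" shows "wedge 4 4 (\<Phi> z) (\<Phi> z) (map e8 top8) \<noteq> 0"
proof -
  obtain f where "spin7_fibre f (G z) (Vol z) (\<Phi> z)" by (rule fibreE[OF assms])
  then interpret spin7_fibre f "G z" "Vol z" "\<Phi> z" .
  show ?thesis by (rule w_w_e8)
qed

lemma gram2_G: assumes "z \<in> S" shows "gram2 (\<Phi> z) u v x t = G z u x * G z v t - G z u t * G z v x"
proof -
  obtain f where "spin7_fibre f (G z) (Vol z) (\<Phi> z)" by (rule fibreE[OF assms])
  then interpret spin7_fibre f "G z" "Vol z" "\<Phi> z" .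
  show ?thesis by (rule gram2_eq)
qed

lemma gram2_differentiable:
  assumes y: "y \<in> S" shows "(\<lambda>z. gram2 (\<Phi> z) u v x t) differentiable (at y)"
proof -
  note d = \<Phi>_diff[OF y]
  have i: "fdiff (\<lambda>z vs. \<Phi> z (a # b # vs)) y" for a b by (simp add: fdiff_def fdiffD[OF d])
  have "(\<lambda>z. wedge 2 6 (\<lambda>vs. \<Phi> z (u # v # vs)) (wedge 4 2 (\<Phi> z) (\<lambda>vs. \<Phi> z (x # t # vs))) (map e8 top8)) differentiable (at y)"
    by (rule fdiffD[OF fdiff_wedge[OF i fdiff_wedge[OF d i]]])
  moreover have "(\<lambda>z. wedge 4 4 (\<Phi> z) (\<Phi> z) (map e8 top8)) differentiable (at y)"
    by (rule fdiffD[OF fdiff_wedge[OF d d]])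
  ultimately show ?thesis
    unfolding gram2_def top_ratio_def
    by (intro differentiable_divide differentiable_diff differentiable_mult differentiable_const fdiffD[OF d] \<Phi>_\<Phi>_top[OF y]) simp_all
qed

text \<open>With \<open>Q = D\<^sup>2\<close> the second compound of a \<open>3 \<times> 3\<close> Gram matrix of determinant \<open>D\<close>, a \<open>2 \<times> 2\<close> minor \<open>F\<close> of
  that compound is \<open>g(u, u) D\<close> by Jacobi's identity, so \<open>g(u, u)\<close> is recovered as \<open>sqrt (F\<^sup>2 / Q)\<close>.\<close>

lemma G_diag_differentiable:
  assumes y: "y \<in> S" shows "(\<lambda>z. G z u u) differentiable (at y)"
proof (cases "u = 0")
  \<comment> \<open>The square root is not differentiable at 0, so the zero vector is treated
    separately.\<close>
  case True
  have "G z u u = 0" if "z \<in> S" for z using linear_0[OF G_bilinear(2)[OF that]] True by simp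
  then show ?thesis by (rule differentiable_cong[OF S y _ differentiable_const])
next
  case False
  obtain f where "spin7_fibre f (G y) (Vol y) (\<Phi> y)" by (rule fibreE[OF y])
  then interpret spin7_fibre f "G y" "Vol y" "\<Phi> y" .
  define Dt where "Dt z v x = G z u u * (G z v v * G z x x - G z v x * G z v x) - G z u v * (G z u v * G z x x - G z v x * G z u x)
    + G z u x * (G z u v * G z v x - G z v v * G z u x)" for z v x
  \<comment> \<open>These vectors are chosen at \<open>y\<close> and kept fixed while the point
    varies; the positivity of \<open>Q\<close> at \<open>y\<close> then persists on a ball.\<close>
  obtain v x where vx: "Dt y v x > 0" using gram_det_pos[OF False] unfolding Dt_def by metis
  define F where "F z = gram2 (\<Phi> z) u v u v * gram2 (\<Phi> z) u x u x - gram2 (\<Phi> z) u v u x * gram2 (\<Phi> z) u v u x" for z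
  define Q where "Q z = gram2 (\<Phi> z) u v u v * (gram2 (\<Phi> z) u x u x * gram2 (\<Phi> z) v x v x - gram2 (\<Phi> z) u x v x * gram2 (\<Phi> z) u x v x)
    - gram2 (\<Phi> z) u v u x * (gram2 (\<Phi> z) u v u x * gram2 (\<Phi> z) v x v x - gram2 (\<Phi> z) u x v x * gram2 (\<Phi> z) u v v x)
    + gram2 (\<Phi> z) u v v x * (gram2 (\<Phi> z) u v u x * gram2 (\<Phi> z) u x v x - gram2 (\<Phi> z) u x u x * gram2 (\<Phi> z) u v v x)" for z
  have FD: "F z = G z u u * Dt z v x" and QD: "Q z = Dt z v x * Dt z v x" if z: "z \<in> S" for z
  proof -
    have s: "G z v u = G z u v" "G z x u = G z u x" "G z x v = G z v x" by (rule G_bilinear(1)[OF z])+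
    show "F z = G z u u * Dt z v x" unfolding F_def Dt_def gram2_G[OF z] s by (rule jacobi_minor)
    show "Q z = Dt z v x * Dt z v x" unfolding Q_def Dt_def gram2_G[OF z] s by (rule compound_det)
  qed
  have dF: "F differentiable (at y)" and dQ: "Q differentiable (at y)"
    unfolding F_def[abs_def] Q_def[abs_def]
    by (intro differentiable_diff differentiable_add differentiable_mult gram2_differentiable[OF y])+
  have Qy: "Q y > 0" unfolding QD[OF y] using vx by simp
  obtain r where r: "r > 0" "\<And>z. z \<in> ball y r \<Longrightarrow> Q z > 0" using positive_nbhd[OF dQ Qy] by blast
  let ?h = "\<lambda>z. F z * F z / Q z"
  have h: "?h z = G z u u * G z u u" if "z \<in> S" "Q z > 0" for z
  proof -
    have "Dt z v x \<noteq> 0" using that(2) unfolding QD[OF that(1)] by auto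
    then show ?thesis unfolding FD[OF that(1)] QD[OF that(1)] by simp
  qed
  have "?h differentiable (at y)" using dF dQ Qy by (intro differentiable_divide differentiable_mult) auto
  moreover have "?h y > 0" unfolding h[OF y Qy] using g_pos[OF False] by simp
  ultimately have d: "(\<lambda>z. sqrt (?h z)) differentiable (at y)" by (rule sqrt_differentiable)
  have eq: "G z u u = sqrt (?h z)" if "z \<in> S \<inter> ball y r" for z
  proof -
    have z: "z \<in> S" "Q z > 0" using that r(2) by auto
    obtain f' where "spin7_fibre f' (G z) (Vol z) (\<Phi> z)" by (rule fibreE[OF z(1)])
    then have "G z u u \<ge> 0" by (rule spin7_fibre.g_nonneg)
    then show ?thesis unfolding h[OF z] by simp
  qed
  show ?thesis by (rule differentiable_cong[of "S \<inter> ball y r", OF _ _ eq d]) (use S y r(1) in auto)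
qed

lemma G_differentiable:
  assumes y: "y \<in> S" shows "(\<lambda>z. G z u v) differentiable (at y)"
proof (rule differentiable_cong[OF S y])
  show "(\<lambda>z. (G z (u + v) (u + v) - G z u u - G z v v) / 2) differentiable (at y)"
    by (intro differentiable_divide differentiable_diff G_diag_differentiable[OF y] differentiable_const) simp
  fix z assume z: "z \<in> S"
  have "G z (u + v) (u + v) = G z (u + v) u + G z (u + v) v" by (rule linear_add[OF G_bilinear(2)[OF z]])
  also have "G z (u + v) u = G z u (u + v)" by (rule G_bilinear(1)[OF z])
  also have "\<dots> = G z u u + G z u v" by (rule linear_add[OF G_bilinear(2)[OF z]])
  also have "G z (u + v) v = G z v (u + v)" by (rule G_bilinear(1)[OF z])
  also have "\<dots> = G z v u + G z v v" by (rule linear_add[OF G_bilinear(2)[OF z]])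
  also have "G z v u = G z u v" by (rule G_bilinear(1)[OF z])
  finally show "G z u v = (G z (u + v) (u + v) - G z u u - G z v v) / 2" by simp
qed

lemma inverse_metric_differentiable:
  assumes y: "y \<in> S" shows "(\<lambda>z. inverse_metric (G z) i j) differentiable (at y)"
proof (rule differentiable_cong[OF S y])
  let ?M = "\<lambda>z. (\<chi> a b. G z (e8 a) (e8 b)) :: real^8^8"
  let ?N = "\<lambda>z. (\<chi> k l. if l = i then e8 j $ k else ?M z $ k $ l) :: real^8^8"
  have dM: "det (?M y) \<noteq> 0"
  proof -
    obtain f where "spin7_fibre f (G y) (Vol y) (\<Phi> y)" by (rule fibreE[OF y])
    then show ?thesis by (rule spin7_fibre.inverse_metric_cramer(1))
  qed
  show "(\<lambda>z. det (?N z) / det (?M z)) differentiable (at y)"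
    by (intro differentiable_divide det_differentiable dM)
      (simp_all add: differentiable_if_const G_differentiable[OF y])
  fix z assume "z \<in> S"
  then obtain f where "spin7_fibre f (G z) (Vol z) (\<Phi> z)" by (rule fibreE)
  then show "inverse_metric (G z) i j = det (?N z) / det (?M z)" by (rule spin7_fibre.inverse_metric_cramer(2))
qed

lemma Vol_differentiable: assumes y: "y \<in> S" shows "fdiff Vol y"
proof (rule fdiff_cong[OF S y])
  show "fdiff (\<lambda>z vs. vol_const / 14 * wedge 4 4 (\<Phi> z) (\<Phi> z) vs) y"
    unfolding fdiff_def by (intro allI differentiable_mult differentiable_const fdiffD[OF fdiff_wedge] \<Phi>_diff[OF y])
  fix z assume "z \<in> S"
  then obtain f where f: "spin7_fibre f (G z) (Vol z) (\<Phi> z)" by (rule fibreE)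
  show "Vol z = (\<lambda>vs. vol_const / 14 * wedge 4 4 (\<Phi> z) (\<Phi> z) vs)"
    by (rule ext) (rule spin7_fibre.V_formula[OF f])
qed

lemma form_inner_differentiable:
  assumes y: "y \<in> S" and "fdiff \<alpha> y" "fdiff \<beta> y"
  shows "(\<lambda>z. form_inner (G z) k (\<alpha> z) (\<beta> z)) differentiable (at y)"
  unfolding form_inner_def
  by (intro differentiable_divide differentiable_sum differentiable_mult differentiable_prod_real ballI
      inverse_metric_differentiable[OF y] fdiffD[OF assms(2)] fdiffD[OF assms(3)]) auto

lemma hodge_differentiable:
  assumes y: "y \<in> S" and "fdiff \<alpha> y" shows "fdiff (\<lambda>z. hodge (G z) (Vol z) k (\<alpha> z)) y"
  unfolding hodge_def fdiff_def
  by (intro allI differentiable_divide differentiable_sum differentiable_mult differentiable_prod_real ballI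
      inverse_metric_differentiable[OF y] fdiffD[OF assms(2)] fdiffD[OF Vol_differentiable[OF y]]) auto

text \<open>The endomorphism varies with the point, so its values are expanded in the constant
  basis, after which only evaluations on fixed lists are differentiated.\<close>

lemma diamond_differentiable:
  assumes y: "y \<in> S" and "fdiff \<beta> y" shows "fdiff (\<lambda>z. diamond (G z) (\<beta> z) (\<Phi> z)) y"
proof (rule fdiff_cong[OF S y])
  let ?r = "\<lambda>z v p. \<Sum>q\<in>UNIV. \<beta> z [v, e8 q] * inverse_metric (G z) q p"
  show "fdiff (\<lambda>z vs. \<Sum>j<length vs. \<Sum>p\<in>UNIV. ?r z (vs ! j) p * \<Phi> z (vs[j := e8 p])) y"
    unfolding fdiff_def
    by (intro allI differentiable_sum differentiable_mult ballI inverse_metric_differentiable[OF y]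
       fdiffD[OF assms(2)] fdiffD[OF \<Phi>_diff[OF y]]) auto
  fix z assume "z \<in> S"
  then have a: "\<Phi> z \<in> alt_forms 4" by (rule \<Phi>_alt)
  show "diamond (G z) (\<beta> z) (\<Phi> z) = (\<lambda>vs. \<Sum>j<length vs. \<Sum>p\<in>UNIV. ?r z (vs ! j) p * \<Phi> z (vs[j := e8 p]))"
  proof
    fix vs
    show "diamond (G z) (\<beta> z) (\<Phi> z) vs = (\<Sum>j<length vs. \<Sum>p\<in>UNIV. ?r z (vs ! j) p * \<Phi> z (vs[j := e8 p]))"
      unfolding diamond_def
    proof (rule sum.cong[OF refl])
      fix j assume j: "j \<in> {..<length vs}"
      have e: "raise_second (G z) (\<beta> z) v = (\<Sum>p\<in>UNIV. ?r z v p *\<^sub>R e8 p)" for v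
        by (subst vec8_expansion) (simp add: raise_second_def)
      show "\<Phi> z (vs[j := raise_second (G z) (\<beta> z) (vs ! j)]) = (\<Sum>p\<in>UNIV. ?r z (vs ! j) p * \<Phi> z (vs[j := e8 p]))"
      proof (cases "length vs = 4")
        case True
        then show ?thesis unfolding e using multilin_update_sum[of vs "\<Phi> z" j] alt_forms_multilin[OF a] j by simp
      next
        case False
        then show ?thesis by (simp add: alt_forms_length[OF a])
      qed
    qed
  qed
qed

subsection \<open>The projections preserve differentiability\<close>

abbreviation pr :: "nat \<Rightarrow> nat \<Rightarrow> vec8 \<Rightarrow> form8 \<Rightarrow> form8" where
  "pr k q z \<alpha> \<equiv> orth_proj (G z) k (type_space (\<Phi> z) k q) \<alpha>"

definition vecf :: "vec8 \<Rightarrow> form8 \<Rightarrow> vec8" where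
  "vecf z \<gamma> = (\<chi> p. \<Sum>b\<in>UNIV. inverse_metric (G z) p b * (form_inner (G z) 3 \<gamma> (interior_product (e8 b) (\<Phi> z)) / 7))"

text \<open>Here and in \<open>pr_3\<close> and \<open>pr_4\<close> an adapted frame is used inside
  the proof only. The formulas involve just the metric, the volume form and the 4-form, whence the
  projections of differentiable forms are differentiable.\<close>

lemma pr_2:
  assumes "z \<in> S" "\<alpha> \<in> alt_forms 2"
  shows "pr 2 7 z \<alpha> = (\<lambda>vs. 1/4 * (\<alpha> vs + hodge (G z) (Vol z) 6 (wedge 4 2 (\<Phi> z) \<alpha>) vs))"
    "pr 2 21 z \<alpha> = (\<lambda>vs. 1/4 * (3 * \<alpha> vs + - hodge (G z) (Vol z) 6 (wedge 4 2 (\<Phi> z) \<alpha>) vs))"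
    "pr 2 7 z \<alpha> + pr 2 21 z \<alpha> = \<alpha>"
proof -
  obtain f where "spin7_fibre f (G z) (Vol z) (\<Phi> z)" by (rule fibreE[OF assms(1)])
  then interpret spin7_fibre f "G z" "Vol z" "\<Phi> z" .
  show 1: "pr 2 7 z \<alpha> = (\<lambda>vs. 1/4 * (\<alpha> vs + hodge (G z) (Vol z) 6 (wedge 4 2 (\<Phi> z) \<alpha>) vs))"
    using proj_2_7[OF assms(2)] by (simp add: type_space_def)
  show 2: "pr 2 21 z \<alpha> = (\<lambda>vs. 1/4 * (3 * \<alpha> vs + - hodge (G z) (Vol z) 6 (wedge 4 2 (\<Phi> z) \<alpha>) vs))"
    using proj_2_21[OF assms(2)] by (simp add: type_space_def)
  show "pr 2 7 z \<alpha> + pr 2 21 z \<alpha> = \<alpha>" unfolding 1 2 by (simp add: fun_eq_iff field_simps)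
qed

lemma pr_3:
  assumes "z \<in> S" "\<gamma> \<in> alt_forms 3"
  shows "pr 3 8 z \<gamma> = interior_product (vecf z \<gamma>) (\<Phi> z)" "pr 3 48 z \<gamma> = \<gamma> - interior_product (vecf z \<gamma>) (\<Phi> z)"
    "pr 3 8 z \<gamma> \<in> L3_8 (\<Phi> z)" "pr 3 48 z \<gamma> \<in> L3_48 (\<Phi> z)"
    "\<gamma> \<in> L3_8 (\<Phi> z) \<Longrightarrow> \<gamma> = interior_product (vecf z \<gamma>) (\<Phi> z)"
proof -
  obtain f where "spin7_fibre f (G z) (Vol z) (\<Phi> z)" by (rule fibreE[OF assms(1)])
  then interpret spin7_fibre f "G z" "Vol z" "\<Phi> z" .
  have v: "vec3 \<gamma> = vecf z \<gamma>" unfolding vec_eq_iff vec3_nth[OF assms(2)] vecf_def by simp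
  show 1: "pr 3 8 z \<gamma> = interior_product (vecf z \<gamma>) (\<Phi> z)"
    using proj_3_8[OF assms(2)] unfolding v by (simp add: type_space_def)
  show 2: "pr 3 48 z \<gamma> = \<gamma> - interior_product (vecf z \<gamma>) (\<Phi> z)"
    using proj_3_48[OF assms(2)] unfolding v by (simp add: type_space_def)
  show "pr 3 8 z \<gamma> \<in> L3_8 (\<Phi> z)" unfolding 1 by (simp add: L3_8_def)
  show "pr 3 48 z \<gamma> \<in> L3_48 (\<Phi> z)" unfolding 2 using vec3_residual[OF assms(2)] unfolding v .
  show "\<gamma> \<in> L3_8 (\<Phi> z) \<Longrightarrow> \<gamma> = interior_product (vecf z \<gamma>) (\<Phi> z)" using L3_8_eq[of \<gamma>] unfolding v .
qed

definition flatf :: "vec8 \<Rightarrow> vec8 \<Rightarrow> vec8 \<Rightarrow> form8" where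
  "flatf z u v = (\<lambda>ws. if length ws = 2 then G z u (ws ! 0) * G z v (ws ! 1) - G z u (ws ! 1) * G z v (ws ! 0) else 0)"

definition hform :: "vec8 \<Rightarrow> form8 \<Rightarrow> form8" where
  "hform z \<eta> = (\<lambda>vs. if length vs = 2 then form_inner (G z) 4 (diamond (G z) (flatf z (vs ! 0) (vs ! 1)) (\<Phi> z)) \<eta> else 0)"

lemma pr_4:
  assumes "z \<in> S" "\<eta> \<in> alt_forms 4"
  shows "pr 4 1 z \<eta> = (\<lambda>vs. form_inner (G z) 4 \<eta> (\<Phi> z) / 14 * \<Phi> z vs)"
    "pr 4 7 z \<eta> = diamond (G z) (\<lambda>vs. 1/128 * (hform z \<eta> vs + hodge (G z) (Vol z) 6 (wedge 4 2 (\<Phi> z) (hform z \<eta>)) vs)) (\<Phi> z)"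
    "pr 4 35 z \<eta> = (\<lambda>vs. 1/2 * (\<eta> vs - hodge (G z) (Vol z) 4 \<eta> vs))"
    "pr 4 27 z \<eta> = \<eta> - pr 4 1 z \<eta> - pr 4 7 z \<eta> - pr 4 35 z \<eta>"
    "pr 4 27 z \<eta> \<in> L4_27 (\<Phi> z)"
proof -
  obtain f where fib: "spin7_fibre f (G z) (Vol z) (\<Phi> z)" by (rule fibreE[OF assms(1)])
  then interpret spin7_fibre f "G z" "Vol z" "\<Phi> z" .
  have flat: "flatf z = flat2" by (intro ext) (simp add: flatf_def flat2_def)
  have h: "mat2 (hmat \<eta>) = hform z \<eta>" unfolding hform_eq[OF assms(2)] hform_def flat ..
  show 1: "pr 4 1 z \<eta> = (\<lambda>vs. form_inner (G z) 4 \<eta> (\<Phi> z) / 14 * \<Phi> z vs)"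
    using proj_4_1[OF assms(2)] by (simp add: type_space_def)
  have 7: "pr 4 7 z \<eta> = act (endo (bmat \<eta>)) (\<Phi> z)"
    using proj_4_7[OF assms(2)] by (simp add: type_space_def)
  show "pr 4 7 z \<eta> = diamond (G z) (\<lambda>vs. 1/128 * (hform z \<eta> vs + hodge (G z) (Vol z) 6 (wedge 4 2 (\<Phi> z) (hform z \<eta>)) vs)) (\<Phi> z)"
    unfolding 7 proj_4_7_diamond[OF assms(2)] h ..
  show 35: "pr 4 35 z \<eta> = (\<lambda>vs. 1/2 * (\<eta> vs - hodge (G z) (Vol z) 4 \<eta> vs))"
    using proj_4_35[OF assms(2)] by (simp add: type_space_def)
  have 27: "pr 4 27 z \<eta> = p27 \<eta>" using proj_4_27[OF assms(2)] by (simp add: type_space_def)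
  show "pr 4 27 z \<eta> = \<eta> - pr 4 1 z \<eta> - pr 4 7 z \<eta> - pr 4 35 z \<eta>"
    unfolding 27 p27_def 1 7 35 by simp
  show "pr 4 27 z \<eta> \<in> L4_27 (\<Phi> z)" unfolding 27 by (rule p27_mem[OF assms(2)])
qed

lemma fdiff_pr_2:
  assumes y: "y \<in> S" and a: "\<And>z. z \<in> S \<Longrightarrow> \<alpha> z \<in> alt_forms 2" and d: "fdiff \<alpha> y"
  shows "fdiff (\<lambda>z. pr 2 7 z (\<alpha> z)) y" "fdiff (\<lambda>z. pr 2 21 z (\<alpha> z)) y"
proof -
  have h: "fdiff (\<lambda>z. hodge (G z) (Vol z) 6 (wedge 4 2 (\<Phi> z) (\<alpha> z))) y"
    by (rule hodge_differentiable[OF y fdiff_wedge[OF \<Phi>_diff[OF y] d]])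
  have "fdiff (\<lambda>z vs. 1/4 * (\<alpha> z vs + hodge (G z) (Vol z) 6 (wedge 4 2 (\<Phi> z) (\<alpha> z)) vs)) y"
    unfolding fdiff_def by (intro allI differentiable_mult differentiable_add differentiable_const fdiffD[OF d] fdiffD[OF h])
  then show "fdiff (\<lambda>z. pr 2 7 z (\<alpha> z)) y" by (rule fdiff_cong[OF S y pr_2(1)[OF _ a], rotated 2])
  have "fdiff (\<lambda>z vs. 1/4 * (3 * \<alpha> z vs + - hodge (G z) (Vol z) 6 (wedge 4 2 (\<Phi> z) (\<alpha> z)) vs)) y"
    unfolding fdiff_def by (intro allI differentiable_mult differentiable_add differentiable_minus differentiable_const fdiffD[OF d] fdiffD[OF h])
  then show "fdiff (\<lambda>z. pr 2 21 z (\<alpha> z)) y" by (rule fdiff_cong[OF S y pr_2(2)[OF _ a], rotated 2])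
qed

lemma vecf_differentiable:
  assumes y: "y \<in> S" and d: "fdiff \<gamma> y" shows "(\<lambda>z. vecf z (\<gamma> z) $ p) differentiable (at y)"
proof -
  have "fdiff (\<lambda>z. interior_product (e8 b) (\<Phi> z)) y" for b
    unfolding interior_product_def fdiff_def by (intro allI fdiffD[OF \<Phi>_diff[OF y]])
  note i = form_inner_differentiable[OF y d this]
  show ?thesis unfolding vecf_def vec_lambda_beta
    by (intro differentiable_sum differentiable_mult differentiable_divide differentiable_const ballI i
        inverse_metric_differentiable[OF y]) auto
qed

lemma fdiff_pr_3:
  assumes y: "y \<in> S" and a: "\<And>z. z \<in> S \<Longrightarrow> \<gamma> z \<in> alt_forms 3" and d: "fdiff \<gamma> y"
  shows "fdiff (\<lambda>z. pr 3 8 z (\<gamma> z)) y" "fdiff (\<lambda>z. pr 3 48 z (\<gamma> z)) y"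
proof -
  have i: "fdiff (\<lambda>z. interior_product (vecf z (\<gamma> z)) (\<Phi> z)) y"
  proof (rule fdiff_cong[OF S y])
    show "fdiff (\<lambda>z ws. \<Sum>p\<in>UNIV. vecf z (\<gamma> z) $ p * \<Phi> z (e8 p # ws)) y"
      unfolding fdiff_def
      by (intro allI differentiable_sum differentiable_mult ballI vecf_differentiable[OF y d] fdiffD[OF \<Phi>_diff[OF y]]) auto
    fix z assume "z \<in> S"
    then have a: "\<Phi> z \<in> alt_forms (Suc 3)" using \<Phi>_alt by simp
    show "interior_product (vecf z (\<gamma> z)) (\<Phi> z) = (\<lambda>ws. \<Sum>p\<in>UNIV. vecf z (\<gamma> z) $ p * \<Phi> z (e8 p # ws))"
      unfolding interior_product_def by (rule ext) (rule alt_forms_hd_expand[OF a])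
  qed
  then show "fdiff (\<lambda>z. pr 3 8 z (\<gamma> z)) y" by (rule fdiff_cong[OF S y pr_3(1)[OF _ a], rotated 2])
  show "fdiff (\<lambda>z. pr 3 48 z (\<gamma> z)) y"
    by (rule fdiff_cong[OF S y pr_3(2)[OF _ a] fdiff_diff[OF d i]])
qed

lemma fdiff_pr_4:
  assumes y: "y \<in> S" and a: "\<And>z. z \<in> S \<Longrightarrow> \<eta> z \<in> alt_forms 4" and d: "fdiff \<eta> y"
  shows "fdiff (\<lambda>z. pr 4 1 z (\<eta> z)) y" "fdiff (\<lambda>z. pr 4 7 z (\<eta> z)) y"
    "fdiff (\<lambda>z. pr 4 35 z (\<eta> z)) y" "fdiff (\<lambda>z. pr 4 27 z (\<eta> z)) y"
proof -
  have "fdiff (\<lambda>z vs. form_inner (G z) 4 (\<eta> z) (\<Phi> z) / 14 * \<Phi> z vs) y"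
    unfolding fdiff_def
    by (intro allI differentiable_mult differentiable_divide differentiable_const
        form_inner_differentiable[OF y d \<Phi>_diff[OF y]] fdiffD[OF \<Phi>_diff[OF y]]) simp
  then show 1: "fdiff (\<lambda>z. pr 4 1 z (\<eta> z)) y" by (rule fdiff_cong[OF S y pr_4(1)[OF _ a], rotated 2])
  have fl: "fdiff (\<lambda>z. flatf z u v) y" for u v
    unfolding fdiff_def flatf_def
    by (intro allI differentiable_if_const differentiable_diff differentiable_mult G_differentiable[OF y] differentiable_const)
  have h: "fdiff (\<lambda>z. hform z (\<eta> z)) y"
    unfolding fdiff_def hform_def
    by (intro allI differentiable_if_const form_inner_differentiable[OF y] diamond_differentiable[OF y] fl d differentiable_const)
  have P: "fdiff (\<lambda>z. hodge (G z) (Vol z) 6 (wedge 4 2 (\<Phi> z) (hform z (\<eta> z)))) y"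
    by (rule hodge_differentiable[OF y fdiff_wedge[OF \<Phi>_diff[OF y] h]])
  have "fdiff (\<lambda>z vs. 1/128 * (hform z (\<eta> z) vs + hodge (G z) (Vol z) 6 (wedge 4 2 (\<Phi> z) (hform z (\<eta> z))) vs)) y"
    unfolding fdiff_def by (intro allI differentiable_mult differentiable_add differentiable_const fdiffD[OF h] fdiffD[OF P])
  from diamond_differentiable[OF y this]
  show 7: "fdiff (\<lambda>z. pr 4 7 z (\<eta> z)) y" by (rule fdiff_cong[OF S y pr_4(2)[OF _ a], rotated 2])
  have "fdiff (\<lambda>z vs. 1/2 * (\<eta> z vs - hodge (G z) (Vol z) 4 (\<eta> z) vs)) y"
    unfolding fdiff_def by (intro allI differentiable_mult differentiable_diff differentiable_const fdiffD[OF d]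
      fdiffD[OF hodge_differentiable[OF y d]])
  then show 35: "fdiff (\<lambda>z. pr 4 35 z (\<eta> z)) y" by (rule fdiff_cong[OF S y pr_4(3)[OF _ a], rotated 2])
  show "fdiff (\<lambda>z. pr 4 27 z (\<eta> z)) y"
    by (rule fdiff_cong[OF S y pr_4(4)[OF _ a] fdiff_diff[OF fdiff_diff[OF fdiff_diff[OF d 1] 7] 35]])
qed

end

context spin7_fibre
begin

lemma orth_proj_5_zero:
  assumes W: "\<And>\<gamma>. \<gamma> \<in> W \<Longrightarrow> \<gamma> \<in> alt_forms 5" "0 \<in> W"
    "\<And>\<beta> \<gamma>. \<beta> \<in> W \<Longrightarrow> \<gamma> \<in> W \<Longrightarrow> \<beta> + \<gamma> \<in> W" "\<And>c \<gamma>. \<gamma> \<in> W \<Longrightarrow> (\<lambda>vs. c * \<gamma> vs) \<in> W"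
    and z: "\<And>\<gamma>. \<gamma> \<in> W \<Longrightarrow> form_inner g 5 \<alpha> \<gamma> = 0"
  shows "orth_proj g 5 W \<alpha> = 0"
proof (rule orth_proj_zero[OF W(1) _ W(2) z])
  fix \<beta> \<gamma> assume b: "\<beta> \<in> W" and c: "\<gamma> \<in> W"
  have "\<beta> - \<gamma> = \<beta> + (\<lambda>vs. (-1) * \<gamma> vs)" by (simp add: fun_eq_iff)
  then show "\<beta> - \<gamma> \<in> W" using W(3)[OF b W(4)[OF c, of "-1"]] by (simp only:)
qed

lemma proj_4_27_zero:
  assumes "\<And>\<gamma>. \<gamma> \<in> L4_27 w \<Longrightarrow> form_inner g 4 \<eta> \<gamma> = 0" shows "orth_proj g 4 (L4_27 w) \<eta> = 0"
proof (rule orth_proj_zero[OF _ _ _ assms])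
  show "\<gamma> \<in> alt_forms 4" if "\<gamma> \<in> L4_27 w" for \<gamma> using that L4_27_iff by blast
  show "\<beta> - \<gamma> \<in> L4_27 w" if "\<beta> \<in> L4_27 w" "\<gamma> \<in> L4_27 w" for \<beta> \<gamma>
    using that unfolding L4_27_iff hodge_diff form_inner_diff_left by (auto intro: alt_forms_diff)
  have "star4 0 = 0" by (rule ext) (simp add: hodge_def)
  then show "0 \<in> L4_27 w" unfolding L4_27_iff by (simp add: alt_forms_zero form_inner_zero_left)
qed

lemma type_proj_zero:
  assumes "(k, q) \<in> {(3,8), (3,48), (4,1), (4,7), (4,27), (4,35), (5,8), (5,48)}"
  shows "orth_proj g k (type_space w k q) 0 = 0"
  using type_proj_add[OF assms alt_forms_zero alt_forms_zero] by (simp only: add_0_left add_cancel_left_left add_cancel_left_right add_cancel_right_left add_cancel_right_right)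

lemma proj_2_zero: "orth_proj g 2 (L2_7 w) 0 = 0" "orth_proj g 2 (L2_21 w) 0 = 0"
proof -
  have P: "P2 0 = 0" unfolding wedge_zero_right by (rule ext) (simp add: hodge_def)
  show "orth_proj g 2 (L2_7 w) 0 = 0" unfolding proj_2_7[OF alt_forms_zero] P by (simp add: fun_eq_iff)
  show "orth_proj g 2 (L2_21 w) 0 = 0" unfolding proj_2_21[OF alt_forms_zero] P by (simp add: fun_eq_iff)
qed

lemma proj_1_8: assumes "\<alpha> \<in> alt_forms 1" shows "orth_proj g 1 (type_space w 1 8) \<alpha> = \<alpha>"
  by (rule orth_proj_eq) (auto simp: type_space_def assms[unfolded One_nat_def] alt_forms_diff form_inner_zero_left)

end

context spin7_domain
begin

subsection \<open>The Levi-Civita connection in coordinates\<close>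

lemma dG_linear:
  assumes y: "y \<in> S"
  shows "linear (\<lambda>u. frechet_derivative (\<lambda>z. G z v x) (at y) u)"
    and "linear (\<lambda>v. frechet_derivative (\<lambda>z. G z x v) (at y) u)"
proof -
  show "linear (\<lambda>u. frechet_derivative (\<lambda>z. G z v x) (at y) u)"
    using linear_frechet_derivative[OF G_differentiable[OF y, of v x]] by (simp only: eta_contract_eq)
  note d = G_differentiable[OF y]
  show "linear (\<lambda>v. frechet_derivative (\<lambda>z. G z x v) (at y) u)"
  proof (rule linearI)
    fix v v'
    have "frechet_derivative (\<lambda>z. G z x (v + v')) (at y) u = frechet_derivative (\<lambda>z. G z x v + G z x v') (at y) u"
      using fd_cong[OF S y, of "\<lambda>z. G z x (v + v')" "\<lambda>z. G z x v + G z x v'"] linear_add[OF G_bilinear(2)] by simp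
    then show "frechet_derivative (\<lambda>z. G z x (v + v')) (at y) u
        = frechet_derivative (\<lambda>z. G z x v) (at y) u + frechet_derivative (\<lambda>z. G z x v') (at y) u"
      unfolding fd_add[OF d d] .
  next
    fix c v
    have "frechet_derivative (\<lambda>z. G z x (c *\<^sub>R v)) (at y) u = frechet_derivative (\<lambda>z. c * G z x v) (at y) u"
      using fd_cong[OF S y, of "\<lambda>z. G z x (c *\<^sub>R v)" "\<lambda>z. c * G z x v"] linear_cmul[OF G_bilinear(2)] by simp
    then show "frechet_derivative (\<lambda>z. G z x (c *\<^sub>R v)) (at y) u = c *\<^sub>R frechet_derivative (\<lambda>z. G z x v) (at y) u"
      unfolding fd_scale[OF d] by simp
  qed
qed

lemma dG_commute:
  assumes y: "y \<in> S" shows "frechet_derivative (\<lambda>z. G z u v) (at y) = frechet_derivative (\<lambda>z. G z v u) (at y)"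
  by (rule fd_cong[OF S y]) (rule G_bilinear(1))

lemma christoffel_commute: assumes y: "y \<in> S" shows "christoffel G y u v = christoffel G y v u"
  unfolding christoffel_def dG_commute[OF y, of u v] by (simp only: add.commute)

lemma christoffel_linear: assumes y: "y \<in> S" shows "linear (christoffel G y u)"
proof (rule linearI)
  note l = dG_linear(1)[OF y] dG_linear(2)[OF y]
  have c: "frechet_derivative (\<lambda>z. G z v (e8 m)) (at y) x = frechet_derivative (\<lambda>z. G z (e8 m) v) (at y) x" for v m x
    unfolding dG_commute[OF y, of v] ..
  show "christoffel G y u (v + v') = christoffel G y u v + christoffel G y u v'" for v v'
    unfolding christoffel_def vec_eq_iff c
    by (simp add: linear_add[OF l(1)] linear_add[OF l(2)] ring_distribs sum.distrib sum_subtractf add_divide_distrib diff_divide_distrib)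
  show "christoffel G y u (r *\<^sub>R v) = r *\<^sub>R christoffel G y u v" for r v
    unfolding christoffel_def vec_eq_iff c
    by (simp add: linear_cmul[OF l(1)] linear_cmul[OF l(2)] ring_distribs sum.distrib sum_subtractf sum_distrib_left mult_ac add_divide_distrib diff_divide_distrib)
qed

abbreviation nabla :: "(vec8 \<Rightarrow> form8) \<Rightarrow> vec8 \<Rightarrow> vec8 \<Rightarrow> form8" where
  "nabla \<alpha> y \<equiv> nab (christoffel G y) \<alpha> y"

lemma nab_\<Phi>: assumes "y \<in> S" shows "nabla \<Phi> y u = 0"
  using tf[OF assms, of u] by (simp add: nab_def pd_def act_def cov_deriv_def fun_eq_iff)

lemma dform_eq_nab: "y \<in> S \<Longrightarrow> \<alpha> y \<in> alt_forms k \<Longrightarrow> dform \<alpha> y = skew (nabla \<alpha> y)"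
  by (rule dform_nab) (auto intro: christoffel_commute)

lemma nab_alt_forms:
  assumes y: "y \<in> S" and a: "\<And>z. z \<in> S \<Longrightarrow> \<alpha> z \<in> alt_forms k" and d: "fdiff \<alpha> y"
  shows "nabla \<alpha> y u \<in> alt_forms k"
  unfolding nab_def by (rule alt_forms_diff[OF pd_alt_forms[OF S y a d] act_alt_forms[OF christoffel_linear[OF y] a[OF y]]])

lemma nab_cong:
  assumes y: "y \<in> S" and e: "\<And>z. z \<in> S \<Longrightarrow> \<alpha> z = \<beta> z" shows "nabla \<alpha> y = nabla \<beta> y"
proof -
  have "pd \<alpha> y = pd \<beta> y" by (rule pd_cong[OF S y e])
  then show ?thesis by (intro ext) (simp only: nab_def e[OF y])
qed

subsection \<open>Vanishing components of the exterior derivative\<close>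

text \<open>As \<Phi> is parallel, differentiating \<alpha> \<and> \<Phi> = 0 shows that the
  covariant derivative of \<alpha> stays in type 48. Such forms are orthogonal to all contractions
  of \<Phi>, which are all that the component along \<Phi> involves.\<close>

lemma d_48_1:
  assumes y: "y \<in> S" and a: "\<And>z. z \<in> S \<Longrightarrow> \<alpha> z \<in> L3_48 (\<Phi> z)" and d: "fdiff \<alpha> y"
  shows "pr 4 1 y (dform \<alpha> y) = 0"
proof -
  obtain f where "spin7_fibre f (G y) (Vol y) (\<Phi> y)" by (rule fibreE[OF y])
  then interpret spin7_fibre f "G y" "Vol y" "\<Phi> y" .
  have alt: "\<alpha> z \<in> alt_forms 3" if "z \<in> S" for z using a[OF that] by (simp add: L3_48_def)
  have dalt: "dform \<alpha> y \<in> alt_forms 4" using dform_alt_forms[OF S y alt d] by simp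
  have n: "nabla \<alpha> y u \<in> L3_48 (\<Phi> y)" for u
  proof -
    have "wedge 3 4 (nabla \<alpha> y u) (\<Phi> y) + wedge 3 4 (\<alpha> y) (nabla \<Phi> y u) = 0"
      by (rule nab_wedge[OF S y _ d \<Phi>_diff[OF y]]) (use a in \<open>simp add: L3_48_def\<close>)
    then show ?thesis using nab_alt_forms[OF y alt d] by (simp add: nab_\<Phi>[OF y] wedge_zero_right L3_48_def)
  qed
  have "form_inner (G y) 4 (dform \<alpha> y) (\<Phi> y) = 0"
    using skew_48_inner_w[of "nabla \<alpha> y", OF _ n] dalt unfolding dform_eq_nab[of y \<alpha>, OF y alt[OF y]] by blast
  then show ?thesis unfolding pr_4(1)[OF y dalt] by (simp add: fun_eq_iff)
qed

text \<open>The covariant derivative of a vector contraction of the parallel form \<Phi> is again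
  one, so the pointwise statement \<open>skew_8_inner_27\<close> applies.\<close>

lemma d_8_27:
  assumes y: "y \<in> S" and a: "\<And>z. z \<in> S \<Longrightarrow> \<alpha> z \<in> L3_8 (\<Phi> z)" and d: "fdiff \<alpha> y"
  shows "pr 4 27 y (dform \<alpha> y) = 0"
proof -
  obtain f where "spin7_fibre f (G y) (Vol y) (\<Phi> y)" by (rule fibreE[OF y])
  then interpret spin7_fibre f "G y" "Vol y" "\<Phi> y" .
  have i: "interior_product X (\<Phi> z) \<in> alt_forms 3" if zS: "z \<in> S" for X z
  proof -
    obtain f' where "spin7_fibre f' (G z) (Vol z) (\<Phi> z)" by (rule fibreE[OF zS])
    then show ?thesis by (rule spin7_fibre.interior_w_alt_forms)
  qed
  have alt: "\<alpha> z \<in> alt_forms 3" if "z \<in> S" for z using a[OF that] i[OF that] by (auto simp: L3_8_def)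
  have dalt: "dform \<alpha> y \<in> alt_forms 4" using dform_alt_forms[OF S y alt d] by simp
  have n: "nabla \<alpha> y u \<in> L3_8 (\<Phi> y)" for u
  proof -
    \<comment> \<open>The vector field is \<open>vecf\<close>, a differentiable function of the
      form; a vector chosen separately at each point could not be differentiated.\<close>
    have "nabla \<alpha> y = nabla (\<lambda>z. interior_product (vecf z (\<alpha> z)) (\<Phi> z)) y"
      by (rule nab_cong[OF y]) (rule pr_3(5)[OF _ alt a])
    then have "nabla \<alpha> y u = nabla (\<lambda>z. interior_product (vecf z (\<alpha> z)) (\<Phi> z)) y u" by (simp only:)
    also have "\<dots> = interior_product ((\<chi> p. frechet_derivative (\<lambda>z. vecf z (\<alpha> z) $ p) (at y) u) + christoffel G y u (vecf y (\<alpha> y))) (\<Phi> y)"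
      by (rule nab_interior[of S y \<Phi> 3, OF S y _ \<Phi>_diff[OF y] vecf_differentiable[OF y d] christoffel_linear[OF y] nab_\<Phi>[OF y]])
        (use \<Phi>_alt in simp)
    finally show ?thesis by (simp add: L3_8_def)
  qed
  have "form_inner (G y) 4 (dform \<alpha> y) \<gamma> = 0" if "\<gamma> \<in> L4_27 (\<Phi> y)" for \<gamma>
    using skew_8_inner_27[of "nabla \<alpha> y", OF _ n that] dalt unfolding dform_eq_nab[of y \<alpha>, OF y alt[OF y]] by blast
  from proj_4_27_zero[OF this] show ?thesis by (simp add: type_space_def)
qed

text \<open>Stated for the type-1 part of a given 4-form, since its coefficient is then the inner
  product with \<Phi> over 14, which is differentiable. The covariant derivative only hits the
  coefficient.\<close>

lemma d_1_48:
  assumes y: "y \<in> S" and a: "\<And>z. z \<in> S \<Longrightarrow> \<eta> z \<in> alt_forms 4" and d: "fdiff \<eta> y"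
  shows "pr 5 48 y (dform (\<lambda>z. pr 4 1 z (\<eta> z)) y) = 0"
proof -
  obtain f where "spin7_fibre f (G y) (Vol y) (\<Phi> y)" by (rule fibreE[OF y])
  then interpret spin7_fibre f "G y" "Vol y" "\<Phi> y" .
  let ?\<alpha> = "\<lambda>z vs. form_inner (G z) 4 (\<eta> z) (\<Phi> z) / 14 * \<Phi> z vs"
  have e: "pr 4 1 z (\<eta> z) = ?\<alpha> z" if "z \<in> S" for z by (rule pr_4(1)[OF that a[OF that]])
  have alt: "?\<alpha> z \<in> alt_forms 4" if "z \<in> S" for z using alt_forms_scale[OF \<Phi>_alt[OF that]] .
  have dh: "(\<lambda>z. form_inner (G z) 4 (\<eta> z) (\<Phi> z) / 14) differentiable (at y)"
    by (intro differentiable_divide differentiable_const form_inner_differentiable[OF y d \<Phi>_diff[OF y]]) simp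
  have fd: "fdiff ?\<alpha> y" unfolding fdiff_def by (intro allI differentiable_mult dh fdiffD[OF \<Phi>_diff[OF y]])
  have dalt: "dform ?\<alpha> y \<in> alt_forms 5" using dform_alt_forms[OF S y alt fd] by simp
  have n: "nabla ?\<alpha> y u \<in> L4_1 (\<Phi> y)" for u
    unfolding nab_scale[OF dh \<Phi>_diff[OF y] nab_\<Phi>[OF y]] L4_1_def by blast
  have sk: "dform ?\<alpha> y = skew (nabla ?\<alpha> y)" by (rule dform_eq_nab[of y ?\<alpha>, OF y alt[OF y]])
  have "form_inner (G y) 5 (dform ?\<alpha> y) (hodge (G y) (Vol y) 3 \<zeta>) = 0" if "\<zeta> \<in> L3_48 (\<Phi> y)" for \<zeta>
    unfolding sk by (rule skew_1_inner_48[OF dalt[unfolded sk] n that])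
  then have "orth_proj (G y) 5 (hodge (G y) (Vol y) 3 ` L3_48 (\<Phi> y)) (dform ?\<alpha> y) = 0"
    by (intro orth_proj_5_zero[OF W5_48_closed]) auto
  moreover have "dform (\<lambda>z. pr 4 1 z (\<eta> z)) y = dform ?\<alpha> y" by (rule dform_cong[OF S y e])
  ultimately show ?thesis unfolding W5_8 by (simp only:)
qed

text \<open>The invariance used here is that of the equations \<alpha> \<and> (X-contraction of
  \<Phi>) = 0 for all X, not that of the type itself; they suffice for the pairing with stars of
  type-8 forms.\<close>

lemma d_27_8:
  assumes y: "y \<in> S" and a: "\<And>z. z \<in> S \<Longrightarrow> \<alpha> z \<in> L4_27 (\<Phi> z)" and d: "fdiff \<alpha> y"
  shows "pr 5 8 y (dform \<alpha> y) = 0"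
proof -
  obtain f where "spin7_fibre f (G y) (Vol y) (\<Phi> y)" by (rule fibreE[OF y])
  then interpret spin7_fibre f "G y" "Vol y" "\<Phi> y" .
  have alt: "\<alpha> z \<in> alt_forms 4" if "z \<in> S" for z using a[OF that] by (simp add: L4_27_def)
  have w0: "wedge 4 3 (\<alpha> z) (interior_product X (\<Phi> z)) = 0" if zS: "z \<in> S" for z X
  proof -
    obtain f' where "spin7_fibre f' (G z) (Vol z) (\<Phi> z)" by (rule fibreE[OF zS])
    then show ?thesis by (rule spin7_fibre.wedge_27_interior) (rule a[OF zS])
  qed
  have dalt: "dform \<alpha> y \<in> alt_forms 5" using dform_alt_forms[OF S y alt d] by simp
  have n: "wedge 4 3 (nabla \<alpha> y u) (interior_product X (\<Phi> y)) = 0" for u X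
  proof -
    have di: "fdiff (\<lambda>z. interior_product X (\<Phi> z)) y"
      unfolding interior_product_def fdiff_def by (intro allI fdiffD[OF \<Phi>_diff[OF y]])
    \<comment> \<open>The constant coordinate vector X is not parallel, but the derivative of its
      contraction is a contraction with another vector, so the second summand vanishes by the same
      equation.\<close>
    have "wedge 4 3 (nabla \<alpha> y u) (interior_product X (\<Phi> y)) + wedge 4 3 (\<alpha> y) (nabla (\<lambda>z. interior_product X (\<Phi> z)) y u) = 0"
      by (rule nab_wedge[OF S y w0 d di])
    moreover have "nabla (\<lambda>z. interior_product X (\<Phi> z)) y u
      = interior_product ((\<chi> p. frechet_derivative (\<lambda>z. X $ p) (at y) u) + christoffel G y u X) (\<Phi> y)"
      by (rule nab_interior[of S y \<Phi> 3, OF S y _ \<Phi>_diff[OF y] _ christoffel_linear[OF y] nab_\<Phi>[OF y]])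
        (use \<Phi>_alt in simp_all)
    ultimately show ?thesis by (simp add: w0[OF y])
  qed
  have sk: "dform \<alpha> y = skew (nabla \<alpha> y)" by (rule dform_eq_nab[of y \<alpha>, OF y alt[OF y]])
  have "form_inner (G y) 5 (dform \<alpha> y) \<gamma> = 0" if \<gamma>: "\<gamma> \<in> hodge (G y) (Vol y) 3 ` L3_8 (\<Phi> y)" for \<gamma>
  proof -
    obtain X where "\<gamma> = hodge (G y) (Vol y) 3 (interior_product X (\<Phi> y))" using \<gamma> by (auto simp: L3_8_def)
    then show ?thesis unfolding sk using skew_27_inner_8[OF dalt[unfolded sk] n] by simp
  qed
  then have "orth_proj (G y) 5 (hodge (G y) (Vol y) 3 ` L3_8 (\<Phi> y)) (dform \<alpha> y) = 0"
    by (intro orth_proj_5_zero[OF W5_8_closed]) auto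
  then show ?thesis unfolding W5_8 .
qed

subsection \<open>Second-order identities\<close>

lemma pr_alt_forms:
  assumes "z \<in> S" "\<alpha> \<in> alt_forms k" "(k, q) \<in> {(2,7), (2,21), (3,8), (3,48), (4,1), (4,7), (4,27), (4,35)}"
  shows "pr k q z \<alpha> \<in> alt_forms k"
proof -
  obtain f where "spin7_fibre f (G z) (Vol z) (\<Phi> z)" by (rule fibreE[OF assms(1)])
  then interpret spin7_fibre f "G z" "Vol z" "\<Phi> z" .
  consider "k = 2" "q = 7" | "k = 2" "q = 21" | "k = 3" "q = 8 \<or> q = 48" | "k = 4" "q = 1" | "k = 4" "q = 7" | "k = 4" "q = 27"
    | "k = 4" "q = 35" using assms(3) by auto
  then show ?thesis
  proof cases
    case 1
    then have a: "\<alpha> \<in> alt_forms 2" using assms(2) by simp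
    show ?thesis unfolding 1 pr_2(1)[OF assms(1) a]
      using alt_forms_scale[OF alt_forms_add[OF a P2_alt_forms[OF a]], of "1/4"] by simp
  next
    case 2
    then have a: "\<alpha> \<in> alt_forms 2" using assms(2) by simp
    show ?thesis unfolding 2 pr_2(2)[OF assms(1) a]
      using alt_forms_scale[OF alt_forms_add[OF alt_forms_scale[OF a, of 3] alt_forms_uminus[OF P2_alt_forms[OF a]]], of "1/4"] by simp
  next
    case 3
    then have a: "\<alpha> \<in> alt_forms 3" using assms(2) by simp
    show ?thesis using pr_3(3,4)[OF assms(1) a] L3_alt 3 by auto
  next
    case 4
    then have a: "\<alpha> \<in> alt_forms 4" using assms(2) by simp
    show ?thesis unfolding 4 pr_4(1)[OF assms(1) a] by (rule alt_forms_scale[OF w_alt])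
  next
    case 5
    then have a: "\<alpha> \<in> alt_forms 4" using assms(2) by simp
    have "pr 4 7 z \<alpha> = act (endo (bmat \<alpha>)) (\<Phi> z)" using proj_4_7[OF a] by (simp add: type_space_def)
    then show ?thesis unfolding 5 using L4_7_alt[OF bmat_L4_7] by (simp only:)
  next
    case 6
    then have a: "\<alpha> \<in> alt_forms 4" using assms(2) by simp
    show ?thesis using pr_4(5)[OF assms(1) a] unfolding 6 L4_27_def by simp
  next
    case 7
    then have a: "\<alpha> \<in> alt_forms 4" using assms(2) by simp
    show ?thesis unfolding 7 pr_4(3)[OF assms(1) a]
      using alt_forms_scale[OF alt_forms_diff[OF a star4_alt_forms[OF a]], of "1/2"] by simp
  qed
qed

lemma pr_zero:
  assumes "y \<in> S" "(k, q) \<in> {(3,8), (3,48), (4,1), (4,7), (4,27), (4,35), (5,8), (5,48)}" shows "pr k q y 0 = 0"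
proof -
  obtain f where "spin7_fibre f (G y) (Vol y) (\<Phi> y)" by (rule fibreE[OF assms(1)])
  then show ?thesis by (rule spin7_fibre.type_proj_zero) (rule assms(2))
qed

lemma pr_dform_add:
  assumes y: "y \<in> S" and kq: "(Suc k, q) \<in> {(3,8), (3,48), (4,1), (4,7), (4,27), (4,35), (5,8), (5,48)}"
    and a: "\<And>z. z \<in> S \<Longrightarrow> \<alpha> z \<in> alt_forms k" "\<And>z. z \<in> S \<Longrightarrow> \<beta> z \<in> alt_forms k"
    and d: "fdiff \<alpha> y" "fdiff \<beta> y"
  shows "pr (Suc k) q y (dform (\<lambda>z. \<alpha> z + \<beta> z) y) = pr (Suc k) q y (dform \<alpha> y) + pr (Suc k) q y (dform \<beta> y)"
proof -
  obtain f where "spin7_fibre f (G y) (Vol y) (\<Phi> y)" by (rule fibreE[OF y])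
  then interpret spin7_fibre f "G y" "Vol y" "\<Phi> y" .
  show ?thesis unfolding dform_add[OF d]
    by (rule type_proj_add[OF kq dform_alt_forms[OF S y a(1) d(1)] dform_alt_forms[OF S y a(2) d(2)]])
qed

text \<open>Used with \<eta> an exterior derivative and \<alpha>, \<beta> its parts of complementary
  types: the identity is the projection of d \<eta> = 0.\<close>

lemma pr_d_split2:
  assumes y: "y \<in> S" and kq: "(Suc k, q) \<in> {(3,8), (3,48), (4,1), (4,7), (4,27), (4,35), (5,8), (5,48)}"
    and a: "\<And>z. z \<in> S \<Longrightarrow> \<alpha> z \<in> alt_forms k" "\<And>z. z \<in> S \<Longrightarrow> \<beta> z \<in> alt_forms k"
    and d: "fdiff \<alpha> y" "fdiff \<beta> y"
    and e: "\<And>z. z \<in> S \<Longrightarrow> \<alpha> z + \<beta> z = \<eta> z" and z: "dform \<eta> y = 0"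
  shows "pr (Suc k) q y (dform \<alpha> y) + pr (Suc k) q y (dform \<beta> y) = 0"
proof -
  have "dform (\<lambda>z. \<alpha> z + \<beta> z) y = 0" using dform_cong[of S y "\<lambda>z. \<alpha> z + \<beta> z" \<eta>, OF S y e] z by (simp only:)
  then show ?thesis using pr_dform_add[OF y kq a d] pr_zero[OF y kq] by (simp only:)
qed

lemma pr_d_split4:
  assumes y: "y \<in> S" and q: "q \<in> {8, 48}" and \<eta>: "\<And>z. z \<in> S \<Longrightarrow> \<eta> z \<in> alt_forms 4" "fdiff \<eta> y" "dform \<eta> y = 0"
  shows "pr 5 q y (dform (\<lambda>z. pr 4 1 z (\<eta> z)) y) + pr 5 q y (dform (\<lambda>z. pr 4 7 z (\<eta> z)) y)
    + pr 5 q y (dform (\<lambda>z. pr 4 27 z (\<eta> z)) y) + pr 5 q y (dform (\<lambda>z. pr 4 35 z (\<eta> z)) y) = 0"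
proof -
  note f = fdiff_pr_4[OF y \<eta>(1,2)]
  let ?A = "\<lambda>z. pr 4 1 z (\<eta> z)" and ?B = "\<lambda>z. pr 4 7 z (\<eta> z)" and ?C = "\<lambda>z. pr 4 27 z (\<eta> z)" and ?E = "\<lambda>z. pr 4 35 z (\<eta> z)"
  have p: "pr 4 p z (\<eta> z) \<in> alt_forms 4" if "z \<in> S" "p \<in> {1, 7, 27, 35}" for p z
    by (rule pr_alt_forms[OF that(1) \<eta>(1)[OF that(1)]]) (use that(2) in auto)
  have a: "?A z \<in> alt_forms 4" "?B z \<in> alt_forms 4" "?C z \<in> alt_forms 4" "?E z \<in> alt_forms 4" if "z \<in> S" for z
    by (rule p[OF that], simp)+
  have q': "(Suc 4, q) \<in> {(3,8), (3,48), (4,1), (4,7), (4,27), (4,35), (5,8), (5,48)}" using q by auto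
  have ab: "?A z + ?B z \<in> alt_forms 4" and abc: "?A z + ?B z + ?C z \<in> alt_forms 4" if "z \<in> S" for z
    by (intro alt_forms_add a[OF that])+
  have "pr (Suc 4) q y (dform (\<lambda>z. ?A z + ?B z + ?C z) y) + pr (Suc 4) q y (dform ?E y) = 0"
  proof (rule pr_d_split2[OF y q' abc a(4) fdiff_add[OF fdiff_add[OF f(1,2)] f(4)] f(3) _ \<eta>(3)])
    show "?A z + ?B z + ?C z + ?E z = \<eta> z" if "z \<in> S" for z unfolding pr_4(4)[OF that \<eta>(1)[OF that]] by simp
  qed
  moreover have "pr (Suc 4) q y (dform (\<lambda>z. ?A z + ?B z + ?C z) y)
      = pr (Suc 4) q y (dform (\<lambda>z. ?A z + ?B z) y) + pr (Suc 4) q y (dform ?C y)"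
    by (rule pr_dform_add[OF y q' ab a(3) fdiff_add[OF f(1,2)] f(4)])
  moreover have "pr (Suc 4) q y (dform (\<lambda>z. ?A z + ?B z) y) = pr (Suc 4) q y (dform ?A y) + pr (Suc 4) q y (dform ?B y)"
    by (rule pr_dform_add[OF y q' a(1,2) f(1,2)])
  ultimately have "pr (Suc 4) q y (dform ?A y) + pr (Suc 4) q y (dform ?B y) + pr (Suc 4) q y (dform ?C y) + pr (Suc 4) q y (dform ?E y) = 0"
    by (simp only:)
  then show ?thesis by simp
qed

end

context spin7_domain
begin

lemma dform_smooth:
  assumes "\<And>vs. smooth_on S (\<lambda>z. \<alpha> z vs)" "\<forall>z\<in>S. \<alpha> z \<in> alt_forms k" and y: "y \<in> S"
  shows "dform \<alpha> y \<in> alt_forms (Suc k)" "fdiff (dform \<alpha>) y" "dform (dform \<alpha>) y = 0"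
proof -
  have d: "fdiff \<alpha> y" unfolding fdiff_def using smooth_on_differentiable[OF assms(1) y] by blast
  show "dform \<alpha> y \<in> alt_forms (Suc k)" by (rule dform_alt_forms[OF S y _ d]) (use assms(2) in blast)
  show "fdiff (dform \<alpha>) y" by (rule fdiff_dform[OF assms(1) y])
  show "dform (dform \<alpha>) y = 0" by (rule dform_dform[OF assms(1) S y])
qed

lemma dform_zero_on: assumes y: "y \<in> S" and "\<And>z. z \<in> S \<Longrightarrow> \<alpha> z = 0" shows "dform \<alpha> y = 0"
proof -
  have "dform \<alpha> y = dform (\<lambda>z. 0) y" by (rule dform_cong[OF S y assms(2)])
  also have "\<dots> = 0" by (rule ext) (simp add: dform_def skew_def pd_def)
  finally show ?thesis .
qed

lemma second_order_0:
  assumes sm: "\<And>vs. smooth_on S (\<lambda>z. \<alpha> z vs)" and a: "\<And>z. z \<in> S \<Longrightarrow> \<alpha> z \<in> alt_forms 0" and y: "y \<in> S"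
  shows "pr 2 7 y (dform (\<lambda>z. pr 1 8 z (dform \<alpha> z)) y) = 0" "pr 2 21 y (dform (\<lambda>z. pr 1 8 z (dform \<alpha> z)) y) = 0"
proof -
  have a': "\<forall>z\<in>S. \<alpha> z \<in> alt_forms 0" using a by blast
  have "pr 1 8 z (dform \<alpha> z) = dform \<alpha> z" if zS: "z \<in> S" for z
  proof -
    obtain f where "spin7_fibre f (G z) (Vol z) (\<Phi> z)" by (rule fibreE[OF zS])
    then show ?thesis by (rule spin7_fibre.proj_1_8) (use dform_smooth(1)[OF sm a' zS] in simp)
  qed
  then have "dform (\<lambda>z. pr 1 8 z (dform \<alpha> z)) y = dform (dform \<alpha>) y" by (rule dform_cong[OF S y])
  also have "\<dots> = 0" by (rule dform_smooth(3)[OF sm a' y])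
  finally have z: "dform (\<lambda>z. pr 1 8 z (dform \<alpha> z)) y = 0" .
  obtain f where "spin7_fibre f (G y) (Vol y) (\<Phi> y)" by (rule fibreE[OF y])
  from spin7_fibre.proj_2_zero[OF this]
  show "pr 2 7 y (dform (\<lambda>z. pr 1 8 z (dform \<alpha> z)) y) = 0" "pr 2 21 y (dform (\<lambda>z. pr 1 8 z (dform \<alpha> z)) y) = 0"
    unfolding z by (simp_all add: type_space_def)
qed

lemma second_order_1:
  assumes sm: "\<And>vs. smooth_on S (\<lambda>z. \<alpha> z vs)" and a: "\<And>z. z \<in> S \<Longrightarrow> \<alpha> z \<in> alt_forms 1" and y: "y \<in> S"
    and q: "q \<in> {8, 48}"
  shows "pr 3 q y (dform (\<lambda>z. pr 2 7 z (dform \<alpha> z)) y) + pr 3 q y (dform (\<lambda>z. pr 2 21 z (dform \<alpha> z)) y) = 0"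
proof -
  have a': "\<forall>z\<in>S. \<alpha> z \<in> alt_forms 1" using a by blast
  note d = dform_smooth[OF sm a']
  have alt: "dform \<alpha> z \<in> alt_forms 2" if "z \<in> S" for z using d(1)[OF that] by (simp add: numeral_2_eq_2)
  have "pr (Suc 2) q y (dform (\<lambda>z. pr 2 7 z (dform \<alpha> z)) y) + pr (Suc 2) q y (dform (\<lambda>z. pr 2 21 z (dform \<alpha> z)) y) = 0"
    by (rule pr_d_split2[OF y _ pr_alt_forms[OF _ alt] pr_alt_forms[OF _ alt] fdiff_pr_2[OF y alt d(2)[OF y]] pr_2(3)[OF _ alt] d(3)[OF y]])
      (use q in auto)
  then show ?thesis by simp
qed

text \<open>For arbitrary 2-forms, so that one lemma serves both source types 7 and 21.\<close>

lemma second_order_2: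
  assumes sm: "\<And>vs. smooth_on S (\<lambda>z. \<alpha> z vs)" and a: "\<And>z. z \<in> S \<Longrightarrow> \<alpha> z \<in> alt_forms 2" and y: "y \<in> S"
  shows "pr 4 1 y (dform (\<lambda>z. pr 3 8 z (dform \<alpha> z)) y) = 0" "pr 4 27 y (dform (\<lambda>z. pr 3 48 z (dform \<alpha> z)) y) = 0"
    "q \<in> {7, 35} \<Longrightarrow> pr 4 q y (dform (\<lambda>z. pr 3 8 z (dform \<alpha> z)) y) + pr 4 q y (dform (\<lambda>z. pr 3 48 z (dform \<alpha> z)) y) = 0"
proof -
  have a': "\<forall>z\<in>S. \<alpha> z \<in> alt_forms 2" using a by blast
  note d = dform_smooth[OF sm a']
  have alt: "dform \<alpha> z \<in> alt_forms 3" if "z \<in> S" for z using d(1)[OF that] by simp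
  note f = fdiff_pr_3[OF y alt d(2)[OF y]]
  have s: "pr 4 q y (dform (\<lambda>z. pr 3 8 z (dform \<alpha> z)) y) + pr 4 q y (dform (\<lambda>z. pr 3 48 z (dform \<alpha> z)) y) = 0"
    if q: "q \<in> {1, 7, 27, 35}" for q
  proof -
    have "pr (Suc 3) q y (dform (\<lambda>z. pr 3 8 z (dform \<alpha> z)) y) + pr (Suc 3) q y (dform (\<lambda>z. pr 3 48 z (dform \<alpha> z)) y) = 0"
    proof (rule pr_d_split2[OF y _ pr_alt_forms[OF _ alt] pr_alt_forms[OF _ alt] f _ d(3)[OF y]])
      show "pr 3 8 z (dform \<alpha> z) + pr 3 48 z (dform \<alpha> z) = dform \<alpha> z" if "z \<in> S" for z
        unfolding pr_3(1,2)[OF that alt[OF that]] by simp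
    qed (use q in auto)
    then show ?thesis by simp
  qed
  \<comment> \<open>The splitting identity for the targets 1 and 27 loses one of its two summands,
    since d has no component from 48 to 1 or from 8 to 27; the other summand then vanishes
    too.\<close>
  have 1: "pr 4 1 y (dform (\<lambda>z. pr 3 48 z (dform \<alpha> z)) y) = 0" by (rule d_48_1[OF y pr_3(4)[OF _ alt] f(2)])
  have 27: "pr 4 27 y (dform (\<lambda>z. pr 3 8 z (dform \<alpha> z)) y) = 0" by (rule d_8_27[OF y pr_3(3)[OF _ alt] f(1)])
  show "pr 4 1 y (dform (\<lambda>z. pr 3 8 z (dform \<alpha> z)) y) = 0" using s[of 1] 1 by simp
  show "pr 4 27 y (dform (\<lambda>z. pr 3 48 z (dform \<alpha> z)) y) = 0" using s[of 27] 27 by simp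
  show "q \<in> {7, 35} \<Longrightarrow> pr 4 q y (dform (\<lambda>z. pr 3 8 z (dform \<alpha> z)) y) + pr 4 q y (dform (\<lambda>z. pr 3 48 z (dform \<alpha> z)) y) = 0"
    using s[of q] by blast
qed

text \<open>The projected identity has four summands, through the types 1, 7, 27 and 35. The first
  derivative kills 27 for source 8 and 1 for source 48; the second derivative kills 1 to 48 and 27
  to 8 for either source. The four identities are what is left.\<close>

lemma second_order_3:
  assumes sm: "\<And>vs. smooth_on S (\<lambda>z. \<alpha> z vs)" and a: "\<And>z. z \<in> S \<Longrightarrow> \<alpha> z \<in> alt_forms 3" and y: "y \<in> S"
  defines "P \<equiv> \<lambda>p q. pr 5 q y (dform (\<lambda>z. pr 4 p z (dform \<alpha> z)) y)"
  shows "(\<And>z. z \<in> S \<Longrightarrow> \<alpha> z \<in> L3_8 (\<Phi> z)) \<Longrightarrow> P 1 8 + P 7 8 + P 35 8 = 0"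
    "(\<And>z. z \<in> S \<Longrightarrow> \<alpha> z \<in> L3_8 (\<Phi> z)) \<Longrightarrow> P 7 48 + P 35 48 = 0"
    "(\<And>z. z \<in> S \<Longrightarrow> \<alpha> z \<in> L3_48 (\<Phi> z)) \<Longrightarrow> P 7 8 + P 35 8 = 0"
    "(\<And>z. z \<in> S \<Longrightarrow> \<alpha> z \<in> L3_48 (\<Phi> z)) \<Longrightarrow> P 7 48 + P 27 48 + P 35 48 = 0"
proof -
  have a': "\<forall>z\<in>S. \<alpha> z \<in> alt_forms 3" using a by blast
  note d = dform_smooth[OF sm a']
  have alt: "dform \<alpha> z \<in> alt_forms 4" if "z \<in> S" for z using d(1)[OF that] by simp
  have f: "fdiff \<alpha> z" if "z \<in> S" for z unfolding fdiff_def using smooth_on_differentiable[OF sm that] by blast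
  have s: "P 1 q + P 7 q + P 27 q + P 35 q = 0" if "q \<in> {8, 48}" for q
    unfolding P_def by (rule pr_d_split4[OF y that alt d(2)[OF y] d(3)[OF y]])
  \<comment> \<open>The inner component has to vanish on the whole domain, as it is differentiated
    before being projected.\<close>
  have zero: "P p q = 0" if z: "\<And>z. z \<in> S \<Longrightarrow> pr 4 p z (dform \<alpha> z) = 0" and q: "q \<in> {8, 48}" for p q
  proof -
    have 5: "(5, q) \<in> {(3,8), (3,48), (4,1), (4,7), (4,27), (4,35), (5,8), (5,48)}" using q by auto
    have "dform (\<lambda>z. pr 4 p z (dform \<alpha> z)) y = 0" by (rule dform_zero_on[OF y z])
    then show ?thesis unfolding P_def using pr_zero[OF y 5] by (simp only:)
  qed
  have 148: "P 1 48 = 0" unfolding P_def by (rule d_1_48[OF y alt d(2)[OF y]])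
  have 278: "P 27 8 = 0" unfolding P_def by (rule d_27_8[OF y pr_4(5)[OF _ alt] fdiff_pr_4(4)[OF y alt d(2)[OF y]]])
  {
    assume t: "\<And>z. z \<in> S \<Longrightarrow> \<alpha> z \<in> L3_8 (\<Phi> z)"
    have z: "P 27 q = 0" if "q \<in> {8, 48}" for q by (rule zero[OF d_8_27[OF _ t f] that])
    show "P 1 8 + P 7 8 + P 35 8 = 0" using s[of 8] z[of 8] by simp
    show "P 7 48 + P 35 48 = 0" using s[of 48] z[of 48] 148 by simp
  next
    assume t: "\<And>z. z \<in> S \<Longrightarrow> \<alpha> z \<in> L3_48 (\<Phi> z)"
    have z: "P 1 q = 0" if "q \<in> {8, 48}" for q by (rule zero[OF d_48_1[OF _ t f] that])
    show "P 7 8 + P 35 8 = 0" using s[of 8] z[of 8] 278 by simp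
    show "P 7 48 + P 27 48 + P 35 48 = 0" using s[of 48] z[of 48] by simp
  }
qed

end

section \<open>From single charts to fields on the manifold\<close>

section \<open>The identities on a manifold\<close>

lemma D_eq:
  "D \<A> \<Phi> k q \<alpha> c y = (if c \<in> \<A> \<and> y \<in> chart_image c
     then orth_proj (induced_metric (\<Phi> c y)) (Suc k) (type_space (\<Phi> c y) (Suc k) q) (dform (\<alpha> c) y) else 0)"
proof -
  have "ext_deriv \<A> \<alpha> c y = dform (\<alpha> c) y" if "c \<in> \<A>" "y \<in> chart_image c"
    unfolding ext_deriv_def on_charts_def dform_def skew_def pd_def del_def using that by simp
  then show ?thesis unfolding D_def type_proj_def on_charts_def by simp
qed

text \<open>The inner field is extended by 0 off the chart image. As the image is open, the
  derivative at a point of it only sees the projected values.\<close>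

lemma D_D_eq:
  assumes "c \<in> \<A>" "open (chart_image c)" "y \<in> chart_image c"
  shows "D \<A> \<Phi> k' q' (D \<A> \<Phi> k q \<alpha>) c y = orth_proj (induced_metric (\<Phi> c y)) (Suc k') (type_space (\<Phi> c y) (Suc k') q')
    (dform (\<lambda>z. orth_proj (induced_metric (\<Phi> c z)) (Suc k) (type_space (\<Phi> c z) (Suc k) q) (dform (\<alpha> c) z)) y)"
proof -
  have "dform (D \<A> \<Phi> k q \<alpha> c) y
    = dform (\<lambda>z. orth_proj (induced_metric (\<Phi> c z)) (Suc k) (type_space (\<Phi> c z) (Suc k) q) (dform (\<alpha> c) z)) y"
    by (rule dform_cong[OF assms(2,3)]) (simp add: D_eq assms(1))
  then show ?thesis unfolding D_eq[of \<A> \<Phi> k'] using assms by simp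
qed

lemma form_field_add:
  fixes F F' :: "'a form_field" shows "(F + F') c y = F c y + F' c y"
  by simp

lemma form_field_zeroI:
  fixes F :: "'a form_field"
  assumes "\<And>c y. \<not> (c \<in> \<A> \<and> y \<in> chart_image c) \<Longrightarrow> F c y = 0"
    "\<And>c y. c \<in> \<A> \<Longrightarrow> y \<in> chart_image c \<Longrightarrow> F c y = 0" shows "F = 0"
proof (intro ext)
  fix c y vs
  have "F c y = 0" using assms by blast
  then show "F c y vs = 0 c y vs" by simp
qed

theorem mainTheorem4:
  fixes M :: "'a topology" and \<A> :: "'a chart set" and \<Phi> :: "'a form_field"
  assumes "smooth_manifold8 M \<A>"
    and "spin7_structure \<A> \<Phi>"
    and "torsion_free \<A> \<Phi>"
  shows "
    (\<forall>f\<in>Omega \<A> \<Phi> 0 1.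
       D \<A> \<Phi> 1 7 (D \<A> \<Phi> 0 8 f) = 0 \<and>
       D \<A> \<Phi> 1 21 (D \<A> \<Phi> 0 8 f) = 0) \<and>
    (\<forall>\<alpha>\<in>Omega \<A> \<Phi> 1 8.
       D \<A> \<Phi> 2 8 (D \<A> \<Phi> 1 7 \<alpha>) + D \<A> \<Phi> 2 8 (D \<A> \<Phi> 1 21 \<alpha>) = 0 \<and>
       D \<A> \<Phi> 2 48 (D \<A> \<Phi> 1 7 \<alpha>) + D \<A> \<Phi> 2 48 (D \<A> \<Phi> 1 21 \<alpha>) = 0) \<and>
    (\<forall>\<beta>\<in>Omega \<A> \<Phi> 2 7.
       D \<A> \<Phi> 3 1 (D \<A> \<Phi> 2 8 \<beta>) = 0 \<and>
       D \<A> \<Phi> 3 7 (D \<A> \<Phi> 2 8 \<beta>) + D \<A> \<Phi> 3 7 (D \<A> \<Phi> 2 48 \<beta>) = 0 \<and>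
       D \<A> \<Phi> 3 27 (D \<A> \<Phi> 2 48 \<beta>) = 0 \<and>
       D \<A> \<Phi> 3 35 (D \<A> \<Phi> 2 8 \<beta>) + D \<A> \<Phi> 3 35 (D \<A> \<Phi> 2 48 \<beta>) = 0) \<and>
    (\<forall>\<beta>\<in>Omega \<A> \<Phi> 2 21.
       D \<A> \<Phi> 3 1 (D \<A> \<Phi> 2 8 \<beta>) = 0 \<and>
       D \<A> \<Phi> 3 7 (D \<A> \<Phi> 2 8 \<beta>) + D \<A> \<Phi> 3 7 (D \<A> \<Phi> 2 48 \<beta>) = 0 \<and>
       D \<A> \<Phi> 3 27 (D \<A> \<Phi> 2 48 \<beta>) = 0 \<and>
       D \<A> \<Phi> 3 35 (D \<A> \<Phi> 2 8 \<beta>) + D \<A> \<Phi> 3 35 (D \<A> \<Phi> 2 48 \<beta>) = 0) \<and>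
    (\<forall>\<gamma>\<in>Omega \<A> \<Phi> 3 8.
       D \<A> \<Phi> 4 8 (D \<A> \<Phi> 3 1 \<gamma>) + D \<A> \<Phi> 4 8 (D \<A> \<Phi> 3 7 \<gamma>) + D \<A> \<Phi> 4 8 (D \<A> \<Phi> 3 35 \<gamma>) = 0 \<and>
       D \<A> \<Phi> 4 48 (D \<A> \<Phi> 3 7 \<gamma>) + D \<A> \<Phi> 4 48 (D \<A> \<Phi> 3 35 \<gamma>) = 0) \<and>
    (\<forall>\<gamma>\<in>Omega \<A> \<Phi> 3 48.
       D \<A> \<Phi> 4 8 (D \<A> \<Phi> 3 7 \<gamma>) + D \<A> \<Phi> 4 8 (D \<A> \<Phi> 3 35 \<gamma>) = 0 \<and>
       D \<A> \<Phi> 4 48 (D \<A> \<Phi> 3 7 \<gamma>) + D \<A> \<Phi> 4 48 (D \<A> \<Phi> 3 27 \<gamma>) + D \<A> \<Phi> 4 48 (D \<A> \<Phi> 3 35 \<gamma>) = 0)"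
proof -
  have op: "open (chart_image c)" if "c \<in> \<A>" for c
    using assms(1) that by (auto simp: smooth_manifold8_def)
  have dom: "spin7_domain (chart_image c) (\<Phi> c)" if c: "c \<in> \<A>" for c
  proof (rule spin7_domain.intro)
    show "open (chart_image c)" by (rule op[OF c])
    show "admissible (\<Phi> c z)" if "z \<in> chart_image c" for z using assms(2) c that by (auto simp: spin7_structure_def)
    show "smooth_on (chart_image c) (\<lambda>z. \<Phi> c z vs)" for vs
      using assms(2) c by (auto simp: spin7_structure_def smooth_forms_def)
    show "cov_deriv (\<lambda>z. induced_metric (\<Phi> c z)) (\<Phi> c) y u = 0" if "y \<in> chart_image c" for y u
      using assms(3) c that by (auto simp: torsion_free_def)
  qed
  have sm: "smooth_on (chart_image c) (\<lambda>z. \<alpha> c z vs)" and alt: "\<And>z. z \<in> chart_image c \<Longrightarrow> \<alpha> c z \<in> alt_forms k"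
    and ty: "\<And>z. z \<in> chart_image c \<Longrightarrow> \<alpha> c z \<in> type_space (\<Phi> c z) k p"
    if "\<alpha> \<in> Omega \<A> \<Phi> k p" "c \<in> \<A>" for \<alpha> k p c vs
    using that by (auto simp: Omega_def smooth_forms_def)
  have t38: "\<alpha> c z \<in> L3_8 (\<Phi> c z)" if "\<alpha> \<in> Omega \<A> \<Phi> 3 8" "c \<in> \<A>" "z \<in> chart_image c" for \<alpha> c z
    using ty[OF that] by (simp add: type_space_def)
  have t348: "\<alpha> c z \<in> L3_48 (\<Phi> c z)" if "\<alpha> \<in> Omega \<A> \<Phi> 3 48" "c \<in> \<A>" "z \<in> chart_image c" for \<alpha> c z
    using ty[OF that] by (simp add: type_space_def)
  note DD = D_D_eq[OF _ op]
  have num: "Suc 0 = 1" "Suc 1 = 2" "Suc 2 = 3" "Suc 3 = 4" "Suc 4 = 5" by simp_all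
  note zeroI = form_field_zeroI[of \<A>]
  have o0: "D \<A> \<Phi> 1 7 (D \<A> \<Phi> 0 8 f) = 0" "D \<A> \<Phi> 1 21 (D \<A> \<Phi> 0 8 f) = 0" if f: "f \<in> Omega \<A> \<Phi> 0 1" for f
  proof -
    show "D \<A> \<Phi> 1 7 (D \<A> \<Phi> 0 8 f) = 0"
    proof (rule zeroI)
      fix c y assume c: "c \<in> \<A>" "y \<in> chart_image c"
      show "D \<A> \<Phi> 1 7 (D \<A> \<Phi> 0 8 f) c y = 0" unfolding DD[OF c(1,1,2)] num
        by (rule spin7_domain.second_order_0(1)[OF dom[OF c(1)] sm[OF f c(1)] alt[OF f c(1)] c(2)])
    qed (auto simp: D_eq)
    show "D \<A> \<Phi> 1 21 (D \<A> \<Phi> 0 8 f) = 0"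
    proof (rule zeroI)
      fix c y assume c: "c \<in> \<A>" "y \<in> chart_image c"
      show "D \<A> \<Phi> 1 21 (D \<A> \<Phi> 0 8 f) c y = 0" unfolding DD[OF c(1,1,2)] num
        by (rule spin7_domain.second_order_0(2)[OF dom[OF c(1)] sm[OF f c(1)] alt[OF f c(1)] c(2)])
    qed (auto simp: D_eq)
  qed
  have o1: "D \<A> \<Phi> 2 q (D \<A> \<Phi> 1 7 \<alpha>) + D \<A> \<Phi> 2 q (D \<A> \<Phi> 1 21 \<alpha>) = 0"
    if a: "\<alpha> \<in> Omega \<A> \<Phi> 1 8" and q: "q \<in> {8, 48}" for \<alpha> q
  proof (rule zeroI)
    fix c y assume c: "c \<in> \<A>" "y \<in> chart_image c"
    show "(D \<A> \<Phi> 2 q (D \<A> \<Phi> 1 7 \<alpha>) + D \<A> \<Phi> 2 q (D \<A> \<Phi> 1 21 \<alpha>)) c y = 0"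
      unfolding form_field_add DD[OF c(1,1,2)] num
      by (rule spin7_domain.second_order_1[OF dom[OF c(1)] sm[OF a c(1)] alt[OF a c(1)] c(2) q])
  qed (auto simp: D_eq)
  \<comment> \<open>The source type \<open>p\<close> is left free, so that both blocks of the
    statement in degree 2 follow.\<close>
  have o2: "D \<A> \<Phi> 3 1 (D \<A> \<Phi> 2 8 \<beta>) = 0" "D \<A> \<Phi> 3 27 (D \<A> \<Phi> 2 48 \<beta>) = 0"
    "\<And>q. q \<in> {7, 35} \<Longrightarrow> D \<A> \<Phi> 3 q (D \<A> \<Phi> 2 8 \<beta>) + D \<A> \<Phi> 3 q (D \<A> \<Phi> 2 48 \<beta>) = 0"
    if b: "\<beta> \<in> Omega \<A> \<Phi> 2 p" for \<beta> p
  proof -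
    show "D \<A> \<Phi> 3 1 (D \<A> \<Phi> 2 8 \<beta>) = 0"
    proof (rule zeroI)
      fix c y assume c: "c \<in> \<A>" "y \<in> chart_image c"
      show "D \<A> \<Phi> 3 1 (D \<A> \<Phi> 2 8 \<beta>) c y = 0" unfolding DD[OF c(1,1,2)] num
        by (rule spin7_domain.second_order_2(1)[OF dom[OF c(1)] sm[OF b c(1)] alt[OF b c(1)] c(2)])
    qed (auto simp: D_eq)
    show "D \<A> \<Phi> 3 27 (D \<A> \<Phi> 2 48 \<beta>) = 0"
    proof (rule zeroI)
      fix c y assume c: "c \<in> \<A>" "y \<in> chart_image c"
      show "D \<A> \<Phi> 3 27 (D \<A> \<Phi> 2 48 \<beta>) c y = 0" unfolding DD[OF c(1,1,2)] num
        by (rule spin7_domain.second_order_2(2)[OF dom[OF c(1)] sm[OF b c(1)] alt[OF b c(1)] c(2)])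
    qed (auto simp: D_eq)
    fix q :: nat assume q: "q \<in> {7, 35}"
    show "D \<A> \<Phi> 3 q (D \<A> \<Phi> 2 8 \<beta>) + D \<A> \<Phi> 3 q (D \<A> \<Phi> 2 48 \<beta>) = 0"
    proof (rule zeroI)
      fix c y assume c: "c \<in> \<A>" "y \<in> chart_image c"
      show "(D \<A> \<Phi> 3 q (D \<A> \<Phi> 2 8 \<beta>) + D \<A> \<Phi> 3 q (D \<A> \<Phi> 2 48 \<beta>)) c y = 0"
        unfolding form_field_add DD[OF c(1,1,2)] num
        by (rule spin7_domain.second_order_2(3)[OF dom[OF c(1)] sm[OF b c(1)] alt[OF b c(1)] c(2) q])
    qed (auto simp: D_eq)
  qed
  have o38: "D \<A> \<Phi> 4 8 (D \<A> \<Phi> 3 1 \<gamma>) + D \<A> \<Phi> 4 8 (D \<A> \<Phi> 3 7 \<gamma>) + D \<A> \<Phi> 4 8 (D \<A> \<Phi> 3 35 \<gamma>) = 0"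
    "D \<A> \<Phi> 4 48 (D \<A> \<Phi> 3 7 \<gamma>) + D \<A> \<Phi> 4 48 (D \<A> \<Phi> 3 35 \<gamma>) = 0"
    if g: "\<gamma> \<in> Omega \<A> \<Phi> 3 8" for \<gamma>
  proof -
    show "D \<A> \<Phi> 4 8 (D \<A> \<Phi> 3 1 \<gamma>) + D \<A> \<Phi> 4 8 (D \<A> \<Phi> 3 7 \<gamma>) + D \<A> \<Phi> 4 8 (D \<A> \<Phi> 3 35 \<gamma>) = 0"
    proof (rule zeroI)
      fix c y assume c: "c \<in> \<A>" "y \<in> chart_image c"
      show "(D \<A> \<Phi> 4 8 (D \<A> \<Phi> 3 1 \<gamma>) + D \<A> \<Phi> 4 8 (D \<A> \<Phi> 3 7 \<gamma>) + D \<A> \<Phi> 4 8 (D \<A> \<Phi> 3 35 \<gamma>)) c y = 0"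
        unfolding form_field_add DD[OF c(1,1,2)] num
        by (rule spin7_domain.second_order_3(1)[OF dom[OF c(1)] sm[OF g c(1)] alt[OF g c(1)] c(2) t38[OF g c(1)]])
    qed (auto simp: D_eq)
    show "D \<A> \<Phi> 4 48 (D \<A> \<Phi> 3 7 \<gamma>) + D \<A> \<Phi> 4 48 (D \<A> \<Phi> 3 35 \<gamma>) = 0"
    proof (rule zeroI)
      fix c y assume c: "c \<in> \<A>" "y \<in> chart_image c"
      show "(D \<A> \<Phi> 4 48 (D \<A> \<Phi> 3 7 \<gamma>) + D \<A> \<Phi> 4 48 (D \<A> \<Phi> 3 35 \<gamma>)) c y = 0"
        unfolding form_field_add DD[OF c(1,1,2)] num
        by (rule spin7_domain.second_order_3(2)[OF dom[OF c(1)] sm[OF g c(1)] alt[OF g c(1)] c(2) t38[OF g c(1)]])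
    qed (auto simp: D_eq)
  qed
  have o348: "D \<A> \<Phi> 4 8 (D \<A> \<Phi> 3 7 \<gamma>) + D \<A> \<Phi> 4 8 (D \<A> \<Phi> 3 35 \<gamma>) = 0"
    "D \<A> \<Phi> 4 48 (D \<A> \<Phi> 3 7 \<gamma>) + D \<A> \<Phi> 4 48 (D \<A> \<Phi> 3 27 \<gamma>) + D \<A> \<Phi> 4 48 (D \<A> \<Phi> 3 35 \<gamma>) = 0"
    if g: "\<gamma> \<in> Omega \<A> \<Phi> 3 48" for \<gamma>
  proof -
    show "D \<A> \<Phi> 4 8 (D \<A> \<Phi> 3 7 \<gamma>) + D \<A> \<Phi> 4 8 (D \<A> \<Phi> 3 35 \<gamma>) = 0"
    proof (rule zeroI)
      fix c y assume c: "c \<in> \<A>" "y \<in> chart_image c"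
      show "(D \<A> \<Phi> 4 8 (D \<A> \<Phi> 3 7 \<gamma>) + D \<A> \<Phi> 4 8 (D \<A> \<Phi> 3 35 \<gamma>)) c y = 0"
        unfolding form_field_add DD[OF c(1,1,2)] num
        by (rule spin7_domain.second_order_3(3)[OF dom[OF c(1)] sm[OF g c(1)] alt[OF g c(1)] c(2) t348[OF g c(1)]])
    qed (auto simp: D_eq)
    show "D \<A> \<Phi> 4 48 (D \<A> \<Phi> 3 7 \<gamma>) + D \<A> \<Phi> 4 48 (D \<A> \<Phi> 3 27 \<gamma>) + D \<A> \<Phi> 4 48 (D \<A> \<Phi> 3 35 \<gamma>) = 0"
    proof (rule zeroI)
      fix c y assume c: "c \<in> \<A>" "y \<in> chart_image c"
      show "(D \<A> \<Phi> 4 48 (D \<A> \<Phi> 3 7 \<gamma>) + D \<A> \<Phi> 4 48 (D \<A> \<Phi> 3 27 \<gamma>) + D \<A> \<Phi> 4 48 (D \<A> \<Phi> 3 35 \<gamma>)) c y = 0"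
        unfolding form_field_add DD[OF c(1,1,2)] num
        by (rule spin7_domain.second_order_3(4)[OF dom[OF c(1)] sm[OF g c(1)] alt[OF g c(1)] c(2) t348[OF g c(1)]])
    qed (auto simp: D_eq)
  qed
  show ?thesis
    using o0 o1[of _ 8] o1[of _ 48] o2 o38 o348 by simp
qed

end
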